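(* Let $p_1,p_2,q_1,q_2,p,q\in(0,\infty]$, $\tau\in[0,1]$, and let $m,m_1,m_2\in\mathscr{P}(\mathbb{R}^{2d})$. Write $\mathcal{I}m_2(z)=m_2(-z)$ and $m_J(z)=m(Jz)=m(z_2,-z_1)$ for $z=(z_1,z_2)\in\mathbb{R}^{2d}$. Then $$W_\tau:\mathcal{M}^{p_1,q_1}_{m_1}(\mathbb{R}^d)\times\mathcal{M}^{p_2,q_2}_{m_2}(\mathbb{R}^d)\longrightarrow M^{p,q}_{1\otimes m}(\mathbb{R}^{2d})$$ if and only if there is a constant $C>0$ such that for all sequences $\vec a=(a_{k_1,k_2})_{k_1,k_2\in\mathbb{Z}^d}$, $\vec b=(b_{k_1,k_2})_{k_1,k_2\in\mathbb{Z}^d}$, $$\big\|(a_{k_1,k_2}b_{n_1-k_1,n_2-k_2})\big\|_{l^{p,q}_{1\otimes m_J}}\le C\,\|\vec a\|_{l^{p_1,q_1}_{m_1}(\mathbb{Z}^{2d})}\|\vec b\|_{l^{p_2,q_2}_{\mathcal{I}m_2}(\mathbb{Z}^{2d})},$$ where the norm on the left is the $l^{p}$ quasi-norm over $k=(k_1,k_2)\in\mathbb{Z}^{2d}$ (inner) followed by the $l^q$ quasi-norm over $n=(n_1,n_2)\in\mathbb{Z}^{2d}$ (outer) with weight $m_J(n)$. In particular, for $p<\infty$ this is equivalent to $$l^{p_1/p,q_1/p}_{m_1^p}(\mathbb{Z}^{2d})\ast l^{p_2/p,q_2/p}_{\mathcal{I}m_2^p}(\mathbb{Z}^{2d})\subset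 l^{q/p,q/p}_{m_J^p}(\mathbb{Z}^{2d}).$$
   Context: $\tau$-Wigner distribution: for $f_1,f_2\in L^2(\mathbb{R}^d)$, $W_\tau(f_1,f_2)(x,\xi)=\int_{\mathbb{R}^d}f_1(x+\tau t)\overline{f_2(x-(1-\tau)t)}e^{-2\pi i\xi\cdot t}\,dt$. Weights: a function $v$ is submultiplicative if $v(z+w)\le v(z)v(w)$; $m$ is $v$-moderate if $m(z+w)\le Cv(z)m(w)$ for all $z,w$. $\mathscr{P}(\mathbb{R}^{n})$ is the set of non-negative (measurable) functions on $\mathbb{R}^n$ that are $v$-moderate for some submultiplicative $v$ of polynomial growth. Modulation spaces: for $f\in\mathcal{S}'(\mathbb{R}^n)$ and a fixed nonzero $\phi\in\mathcal{S}(\mathbb{R}^n)$, $V_\phi f(x,\xi)=\langle f,M_\xi T_x\phi\rangle$ with $T_xg(t)=g(t-x)$, $M_\xi g(t)=e^{2\pi it\cdot\xi}g(t)$. For $0<p,q\le\infty$ and $m\in\mathscr{P}(\mathbb{R}^{2n})$, $M^{p,q}_m(\mathbb{R}^n)$ is the set of $f\in\mathcal{S}'(\mathbb{R}^n)$ with $\|f\|_{M^{p,q}_m}=\big(\int(\int|V_\phi f(x,\xi)|^pm(x,\xi)^pdx)^{q/p}d\xi\big)^{1/q}<\infty$ (usual modification if $p$ or $q$ is $\infty$; different $\phi$ give equivalent quasi-norms). $\mathcal{M}^{p,q}_m(\mathbb{R}^n)$ is the closure of $\mathcal{S}(\mathbb{R}^n)$ in $M^{p,q}_m(\mathbb{R}^n)$.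 For $m$ on $\mathbb{R}^{2d}$, $(1\otimes m)(z,\zeta)=m(\zeta)$ for $z,\zeta\in\mathbb{R}^{2d}$. Boundedness notation: $W_\tau:\mathcal{M}^{p_1,q_1}_{m_1}\times\mathcal{M}^{p_2,q_2}_{m_2}\to X$ means there is $C>0$ with $\|W_\tau(f_1,f_2)\|_X\le C\|f_1\|_{M^{p_1,q_1}_{m_1}}\|f_2\|_{M^{p_2,q_2}_{m_2}}$ for all $f_1,f_2\in\mathcal{S}(\mathbb{R}^d)$. Discrete spaces: $\|\vec a\|_{l^{p,q}_m(\mathbb{Z}^{2d})}=\big(\sum_{n\in\mathbb{Z}^d}(\sum_{k\in\mathbb{Z}^d}|a_{k,n}|^pm(k,n)^p)^{q/p}\big)^{1/q}$ (usual modifications). An inclusion $X\ast Y\subset Z$ of sequence spaces means that there is $C>0$ with $\|\vec a\ast\vec b\|_Z\le C\|\vec a\|_X\|\vec b\|_Y$ for all $\vec a\in X,\vec b\in Y$, where $(\vec a\ast\vec b)_n=\sum_ka_kb_{n-k}$ (the series converging absolutely). $J=\begin{pmatrix}0&I\\-I&0\end{pmatrix}$, so $J(z_1,z_2)=(z_2,-z_1)$. *)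

theory Defs
  imports "HOL-Analysis.Analysis"
begin

section \<open>Mixed Lebesgue quasi-norms\<close>

definition ennreal_powr :: "ennreal \<Rightarrow> real \<Rightarrow> ennreal" where
  "ennreal_powr x r = (if x = \<infinity> then \<infinity> else ennreal (enn2real x powr r))"

text \<open>
  For \<open>p = \<infinity>\<close> this is the essential supremum of \<open>F\<close>; over a counting measure it is the
  supremum.  It is written with an almost-everywhere bound, so that no Borel measurability
  of \<open>F\<close> is needed: weights are only Lebesgue measurable.  Likewise, for Lebesgue measurable
  \<open>F\<close> the integral over \<^const>\<open>lborel\<close> agrees with the one over \<^const>\<open>lebesgue\<close>.
\<close>

definition Lp_qnorm :: "ennreal \<Rightarrow> 'x measure \<Rightarrow> ('x \<Rightarrow> ennreal) \<Rightarrow> ennreal" where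
  "Lp_qnorm p M F =
     (if p = \<infinity> then Inf {c. AE x in M. F x \<le> c}
      else ennreal_powr (\<integral>\<^sup>+x. ennreal_powr (F x) (enn2real p) \<partial>M) (1 / enn2real p))"

definition mixed_qnorm ::
  "ennreal \<Rightarrow> ennreal \<Rightarrow> 'x measure \<Rightarrow> 'y measure \<Rightarrow> ('x \<times> 'y \<Rightarrow> ennreal) \<Rightarrow> ennreal" where
  "mixed_qnorm p q M N F = Lp_qnorm q N (\<lambda>y. Lp_qnorm p M (\<lambda>x. F (x, y)))"


section \<open>Schwartz functions and tempered distributions\<close>

fun partial_derivs :: "'a::euclidean_space list \<Rightarrow> ('a \<Rightarrow> complex) \<Rightarrow> 'a \<Rightarrow> complex" where
  "partial_derivs [] f = f"
| "partial_derivs (b # bs) f = (\<lambda>x. frechet_derivative (partial_derivs bs f) (at x) b)"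

definition schwartz :: "('a::euclidean_space \<Rightarrow> complex) set" where
  "schwartz = {f. \<forall>bs. set bs \<subseteq> Basis \<longrightarrow>
     (\<forall>x. partial_derivs bs f differentiable (at x)) \<and>
     (\<forall>k::nat. bounded (range (\<lambda>x. norm x ^ k * norm (partial_derivs bs f x))))}"

definition schwartz_seminorm :: "nat \<Rightarrow> 'a::euclidean_space list \<Rightarrow> ('a \<Rightarrow> complex) \<Rightarrow> real" where
  "schwartz_seminorm k bs f = (SUP x. norm x ^ k * norm (partial_derivs bs f x))"

text \<open>A distribution is a functional of which only the values on \<^term>\<open>schwartz\<close> matter.\<close>

definition tempered_distributions :: "(('a::euclidean_space \<Rightarrow> complex) \<Rightarrow> complex) set" where
  "tempered_distributions = {u.
     (\<forall>f\<in>schwartz. \<forall>g\<in>schwartz. u (\<lambda>x. f x + g x) = u f + u g) \<and>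
     (\<forall>c. \<forall>f\<in>schwartz. u (\<lambda>x. c * f x) = c * u f) \<and>
     (\<exists>(C::real) (N::nat). \<forall>f\<in>schwartz. norm (u f) \<le>
        C * (\<Sum>k\<le>N. \<Sum>bs | set bs \<subseteq> Basis \<and> length bs \<le> N. schwartz_seminorm k bs f))}"

definition distribution_of :: "('a::euclidean_space \<Rightarrow> complex) \<Rightarrow> ('a \<Rightarrow> complex) \<Rightarrow> complex" where
  "distribution_of f = (\<lambda>g. \<integral>x. f x * g x \<partial>lborel)"


section \<open>Modulation spaces\<close>

definition translate :: "'a::euclidean_space \<Rightarrow> ('a \<Rightarrow> complex) \<Rightarrow> 'a \<Rightarrow> complex" where
  "translate x g = (\<lambda>t. g (t - x))"

definition modulate :: "'a::euclidean_space \<Rightarrow> ('a \<Rightarrow> complex) \<Rightarrow> 'a \<Rightarrow> complex" where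
  "modulate \<xi> g = (\<lambda>t. cis (2 * pi * (t \<bullet> \<xi>)) * g t)"

text \<open>
  The bracket \<open>\<langle>f, g\<rangle>\<close> extends the \<open>L\<^sup>2\<close> inner product, hence is conjugate-linear in \<open>g\<close>:
  it is the linear functional \<open>f\<close> at the conjugate of \<open>g\<close>.
\<close>

definition STFT ::
  "('a::euclidean_space \<Rightarrow> complex) \<Rightarrow> (('a \<Rightarrow> complex) \<Rightarrow> complex) \<Rightarrow> 'a \<times> 'a \<Rightarrow> complex" where
  "STFT \<phi> f = (\<lambda>(x, \<xi>). f (\<lambda>t. cnj (modulate \<xi> (translate x \<phi>) t)))"

definition modulation_qnorm ::
  "('a::euclidean_space \<Rightarrow> complex) \<Rightarrow> ennreal \<Rightarrow> ennreal \<Rightarrow> ('a \<times> 'a \<Rightarrow> real) \<Rightarrow>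
   (('a \<Rightarrow> complex) \<Rightarrow> complex) \<Rightarrow> ennreal" where
  "modulation_qnorm \<phi> p q m f =
     mixed_qnorm p q lborel lborel (\<lambda>z. ennreal (norm (STFT \<phi> f z) * m z))"

definition modulation_space ::
  "('a::euclidean_space \<Rightarrow> complex) \<Rightarrow> ennreal \<Rightarrow> ennreal \<Rightarrow> ('a \<times> 'a \<Rightarrow> real) \<Rightarrow>
   (('a \<Rightarrow> complex) \<Rightarrow> complex) set" where
  "modulation_space \<phi> p q m =
     {f \<in> tempered_distributions. modulation_qnorm \<phi> p q m f < \<infinity>}"


section \<open>Weights\<close>

definition submultiplicative :: "('a::real_normed_vector \<Rightarrow> real) \<Rightarrow> bool" where
  "submultiplicative v \<longleftrightarrow> (\<forall>z. 0 \<le> v z) \<and> (\<forall>z w. v (z + w) \<le> v z * v w)"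

definition polynomial_growth :: "('a::real_normed_vector \<Rightarrow> real) \<Rightarrow> bool" where
  "polynomial_growth v \<longleftrightarrow> (\<exists>(C::real) (N::nat). \<forall>z. v z \<le> C * (1 + norm z) ^ N)"

definition moderate :: "('a::real_normed_vector \<Rightarrow> real) \<Rightarrow> ('a \<Rightarrow> real) \<Rightarrow> bool" where
  "moderate v m \<longleftrightarrow> (\<exists>C>0. \<forall>z w. m (z + w) \<le> C * v z * m w)"

definition weights :: "('a::euclidean_space \<Rightarrow> real) set" where
  "weights = {m. (\<forall>z. 0 \<le> m z) \<and> m \<in> borel_measurable lebesgue \<and>
     (\<exists>v. submultiplicative v \<and> polynomial_growth v \<and> moderate v m)}"

definition one_tensor :: "('y \<Rightarrow> real) \<Rightarrow> 'x \<times> 'y \<Rightarrow> real" where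
  "one_tensor m = (\<lambda>(z, \<zeta>). m \<zeta>)"

definition reflect_weight :: "('a::ab_group_add \<Rightarrow> real) \<Rightarrow> 'a \<Rightarrow> real" where
  "reflect_weight m = (\<lambda>z. m (- z))"

definition J_weight :: "('a::ab_group_add \<times> 'a \<Rightarrow> real) \<Rightarrow> 'a \<times> 'a \<Rightarrow> real" where
  "J_weight m = (\<lambda>(z1, z2). m (z2, - z1))"


section \<open>The Wigner distribution\<close>

definition tau_wigner ::
  "real \<Rightarrow> ('a::euclidean_space \<Rightarrow> complex) \<Rightarrow> ('a \<Rightarrow> complex) \<Rightarrow> 'a \<times> 'a \<Rightarrow> complex" where
  "tau_wigner \<tau> f1 f2 = (\<lambda>(x, \<xi>). \<integral>t. f1 (x + \<tau> *\<^sub>R t) * cnj (f2 (x - (1 - \<tau>) *\<^sub>R t))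
                             * cis (- (2 * pi * (\<xi> \<bullet> t))) \<partial>lborel)"

text \<open>
  Boundedness from the product of the closures of the Schwartz space in the two source spaces
  is, by convention, the estimate on Schwartz functions.
\<close>

definition tau_wigner_bounded ::
  "('a::euclidean_space \<Rightarrow> complex) \<Rightarrow> ('a \<times> 'a \<Rightarrow> complex) \<Rightarrow> real \<Rightarrow>
   ennreal \<Rightarrow> ennreal \<Rightarrow> ('a \<times> 'a \<Rightarrow> real) \<Rightarrow> ennreal \<Rightarrow> ennreal \<Rightarrow> ('a \<times> 'a \<Rightarrow> real) \<Rightarrow>
   ennreal \<Rightarrow> ennreal \<Rightarrow> (('a \<times> 'a) \<times> ('a \<times> 'a) \<Rightarrow> real) \<Rightarrow> bool" where
  "tau_wigner_bounded \<phi> \<Phi> \<tau> p1 q1 m1 p2 q2 m2 p q m \<longleftrightarrow>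
     (\<exists>C::real. 0 < C \<and> (\<forall>f1\<in>schwartz. \<forall>f2\<in>schwartz.
        distribution_of (tau_wigner \<tau> f1 f2) \<in> modulation_space \<Phi> p q m \<and>
        modulation_qnorm \<Phi> p q m (distribution_of (tau_wigner \<tau> f1 f2))
          \<le> ennreal C * modulation_qnorm \<phi> p1 q1 m1 (distribution_of f1)
                      * modulation_qnorm \<phi> p2 q2 m2 (distribution_of f2)))"


section \<open>Discrete spaces\<close>

text \<open>The inclusion of \<open>\<int>\<^sup>2\<^sup>d\<close> into \<open>\<real>\<^sup>2\<^sup>d\<close>; weights are restricted along it.\<close>

definition lattice_point :: "(int ^ 'd) \<times> (int ^ 'd) \<Rightarrow> (real ^ 'd) \<times> (real ^ 'd)" where
  "lattice_point = (\<lambda>(k, n). (\<chi> i. of_int (k $ i), \<chi> i. of_int (n $ i)))"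

definition seq_qnorm ::
  "ennreal \<Rightarrow> ennreal \<Rightarrow> ('k \<times> 'n \<Rightarrow> real) \<Rightarrow> ('k \<times> 'n \<Rightarrow> complex) \<Rightarrow> ennreal" where
  "seq_qnorm p q w a =
     mixed_qnorm p q (count_space UNIV) (count_space UNIV) (\<lambda>j. ennreal (norm (a j) * w j))"

definition seq_space ::
  "ennreal \<Rightarrow> ennreal \<Rightarrow> ('k \<times> 'n \<Rightarrow> real) \<Rightarrow> ('k \<times> 'n \<Rightarrow> complex) set" where
  "seq_space p q w = {a. seq_qnorm p q w a < \<infinity>}"

definition convolution_inclusion ::
  "ennreal \<Rightarrow> ennreal \<Rightarrow> ('k::ab_group_add \<times> 'n::ab_group_add \<Rightarrow> real) \<Rightarrow>
   ennreal \<Rightarrow> ennreal \<Rightarrow> ('k \<times> 'n \<Rightarrow> real) \<Rightarrow>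
   ennreal \<Rightarrow> ennreal \<Rightarrow> ('k \<times> 'n \<Rightarrow> real) \<Rightarrow> bool" where
  "convolution_inclusion p1 q1 w1 p2 q2 w2 p q w \<longleftrightarrow>
     (\<exists>C::real. 0 < C \<and> (\<forall>a\<in>seq_space p1 q1 w1. \<forall>b\<in>seq_space p2 q2 w2.
        (\<forall>n. (\<lambda>k. norm (a k * b (n - k))) summable_on UNIV) \<and>
        seq_qnorm p q w (\<lambda>n. \<Sum>\<^sub>\<infinity>k. a k * b (n - k))
          \<le> ennreal C * seq_qnorm p1 q1 w1 a * seq_qnorm p2 q2 w2 b))"

end

(*
  The short-time Fourier transform of W_tau(f, g) with window W_tau(phi, phi) factorises: up to a
  constant its modulus at (z, zeta) is |V f(z + A zeta)| |V g(z + A zeta + J zeta)|, where V is the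
  transform with window phi and A zeta = (-tau zeta_2, (1 - tau) zeta_1).  Since (z, zeta) ->
  (z + A zeta, -J zeta) is a composition of a shear and a rotation, sampling on the lattice turns the
  mixed norm of the left side into the mixed norm of (a_k b_{n-k}).

  Lattice estimate => boundedness: replace V f and V g by their Peetre maximal functions, which are
  comparable on unit cubes and have equivalent norms for all exponents, also below 1.

  Boundedness => lattice estimate: on a sufficiently sparse finite subset of the lattice the Gram
  matrix of the time-frequency shifts of phi is a small perturbation of a multiple of the identity, so
  there are Schwartz functions f, g whose transforms take the prescribed values a_k, b_k there, with
  norms controlled by those of a and b.  Splitting the lattice into finitely many sparse cosets and
  exhausting it by finite sets removes the restriction.

  For finite p, taking p-th powers turns the lattice estimate into the convolution inclusion.
*)
theory Submission
  imports Defs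
begin


section \<open>Quasi-norms, Minkowski's inequality and weighted convolution\<close>

section \<open>Powers of extended nonnegative reals\<close>

text \<open>The obstacle is the range of exponents below 1, where the triangle inequality and
  duality fail and convolution with an integrable kernel is no longer bounded. Every continuous
  estimate is therefore routed through one exponent r with 0 < r \<le> min(p, q): in r-th powers the
  mixed quasi-norm obeys Minkowski's inequality, and, for r \<le> 1, the reproducing formula makes
  |V f| dominated by its own L^r averages at polynomial scale. Polynomial kernels are the common
  currency, since weights grow at most polynomially while transforms of Schwartz functions decay
  faster than any power.

  The windows of the statement are arbitrary, whereas the factorisation belongs to one particular
  window; the maximal functions bridge this too, because for them a change of window costs only a
  pointwise constant. They also carry a value prescribed at one point over the whole surrounding
  cell, so both implications use them.

  In the last equivalence the weight m must not vanish identically: for m = 0 the lattice estimate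
  is empty, but the inclusion still demands absolute convergence. By moderateness m is then positive
  everywhere.\<close>

lemma ennreal_powr_ennreal: "0 \<le> x \<Longrightarrow> ennreal_powr (ennreal x) r = ennreal (x powr r)"
  by (simp add: ennreal_powr_def)

lemma ennreal_powr_top [simp]: "ennreal_powr top r = top"
  by (simp add: ennreal_powr_def)

lemma ennreal_powr_0 [simp]: "ennreal_powr 0 r = 0"
  by (simp add: ennreal_powr_def)

lemma ennreal_powr_one [simp]: "ennreal_powr x 1 = x"
  by (cases x) (auto simp: ennreal_powr_ennreal)

lemma ennreal_powr_eq_top_iff [simp]: "ennreal_powr x r = top \<longleftrightarrow> x = top"
  by (cases x) (auto simp: ennreal_powr_ennreal)

lemma ennreal_powr_eq_0_iff [simp]: "ennreal_powr x r = 0 \<longleftrightarrow> x = 0"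
  by (cases x) (auto simp: ennreal_powr_ennreal)

lemma ennreal_powr_mono: "x \<le> y \<Longrightarrow> 0 < r \<Longrightarrow> ennreal_powr x r \<le> ennreal_powr y r"
  by (cases x; cases y) (auto simp: ennreal_powr_ennreal top_unique intro!: ennreal_leI powr_mono2)

lemma ennreal_powr_mult:
  "0 < r \<Longrightarrow> ennreal_powr (x * y) r = ennreal_powr x r * ennreal_powr y r"
  by (cases x; cases y; cases "x = 0"; cases "y = 0")
     (auto simp: ennreal_powr_ennreal powr_mult ennreal_mult_top ennreal_top_mult
        simp flip: ennreal_mult)

lemma ennreal_powr_powr: "ennreal_powr (ennreal_powr x r) s = ennreal_powr x (r * s)"
  by (cases x) (auto simp: ennreal_powr_ennreal powr_powr)

lemma ennreal_powr_add:
  "x \<noteq> top \<Longrightarrow> ennreal_powr x (r + s) = ennreal_powr x r * ennreal_powr x s"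
  by (cases x) (auto simp: ennreal_powr_ennreal powr_add simp flip: ennreal_mult)

lemma ennreal_powr_inverse:
  "r \<noteq> 0 \<Longrightarrow> ennreal_powr (ennreal_powr x r) (1 / r) = x"
  "r \<noteq> 0 \<Longrightarrow> ennreal_powr (ennreal_powr x (1 / r)) r = x"
  by (simp_all add: ennreal_powr_powr)

lemma ennreal_powr_le_iff: "0 < r \<Longrightarrow> ennreal_powr x r \<le> ennreal_powr y r \<longleftrightarrow> x \<le> y"
  using ennreal_powr_mono[of x y r] ennreal_powr_mono[of "ennreal_powr x r" "ennreal_powr y r" "1/r"]
  by (auto simp: ennreal_powr_inverse)

lemma ennreal_powr_le_swap: "0 < r \<Longrightarrow> ennreal_powr x (1 / r) \<le> y \<longleftrightarrow> x \<le> ennreal_powr y r"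
  using ennreal_powr_le_iff[of r "ennreal_powr x (1 / r)" y] by (simp add: ennreal_powr_inverse)

lemma ennreal_powr_SUP:
  assumes "0 < r"
  shows "ennreal_powr (SUP i\<in>I. f i) r = (SUP i\<in>I. ennreal_powr (f i) r)"
proof (rule antisym)
  have "(SUP i\<in>I. f i) \<le> ennreal_powr (SUP i\<in>I. ennreal_powr (f i) r) (1 / r)"
  proof (rule SUP_least)
    fix i assume "i \<in> I"
    then have "ennreal_powr (f i) r \<le> (SUP i\<in>I. ennreal_powr (f i) r)" by (rule SUP_upper)
    from ennreal_powr_mono[OF this, of "1 / r"] assms
    show "f i \<le> ennreal_powr (SUP i\<in>I. ennreal_powr (f i) r) (1 / r)"
      by (simp add: ennreal_powr_inverse)
  qed
  from ennreal_powr_mono[OF this assms] assms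
  show "ennreal_powr (SUP i\<in>I. f i) r \<le> (SUP i\<in>I. ennreal_powr (f i) r)"
    by (simp add: ennreal_powr_inverse)
  show "(SUP i\<in>I. ennreal_powr (f i) r) \<le> ennreal_powr (SUP i\<in>I. f i) r"
    by (intro SUP_least ennreal_powr_mono SUP_upper assms)
qed

lemma borel_measurable_ennreal_powr [measurable]:
  assumes [measurable]: "f \<in> borel_measurable M"
  shows "(\<lambda>x. ennreal_powr (f x) r) \<in> borel_measurable M"
  unfolding ennreal_powr_def by measurable


section \<open>Lebesgue quasi-norms\<close>

text \<open>The integral is a supremum over simple minorants, and scaling a minorant of f gives a
  minorant of c f. No measurability enters, which matters because weights need not be Borel.\<close>

lemma nn_integral_cmult_le:
  "c * (\<integral>\<^sup>+x. f x \<partial>M) \<le> (\<integral>\<^sup>+x. c * f x \<partial>M)"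
proof -
  have "c * (\<integral>\<^sup>+x. f x \<partial>M) = (SUP g\<in>{g. simple_function M g \<and> g \<le> f}. c * integral\<^sup>S M g)"
    unfolding nn_integral_def by (simp add: SUP_mult_left_ennreal)
  also have "\<dots> \<le> (\<integral>\<^sup>+x. c * f x \<partial>M)"
  proof (rule SUP_least)
    fix g assume g: "g \<in> {g. simple_function M g \<and> g \<le> f}"
    then have "c * integral\<^sup>S M g = integral\<^sup>S M (\<lambda>x. c * g x)"
      by (simp add: simple_integral_mult)
    also have "\<dots> = (\<integral>\<^sup>+x. c * g x \<partial>M)"
      using g by (intro nn_integral_eq_simple_integral[symmetric]) auto
    also have "\<dots> \<le> (\<integral>\<^sup>+x. c * f x \<partial>M)"
      using g by (intro nn_integral_mono) (auto simp: le_fun_def intro: mult_left_mono)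
    finally show "c * integral\<^sup>S M g \<le> (\<integral>\<^sup>+x. c * f x \<partial>M)" .
  qed
  finally show ?thesis .
qed

text \<open>The reverse inequality is the previous one for the factor 1/c, so c must be positive and
  finite.\<close>

lemma nn_integral_cmult_finite:
  fixes c :: real
  assumes "0 < c"
  shows "(\<integral>\<^sup>+x. ennreal c * f x \<partial>M) = ennreal c * (\<integral>\<^sup>+x. f x \<partial>M)"
proof (rule antisym)
  have c: "ennreal (1 / c) * (ennreal c * y) = y" "ennreal c * (ennreal (1 / c) * y) = y" for y
    using assms by (simp_all add: mult.assoc[symmetric] flip: ennreal_mult)
  have "ennreal (1 / c) * (\<integral>\<^sup>+x. ennreal c * f x \<partial>M) \<le> (\<integral>\<^sup>+x. f x \<partial>M)"
    using nn_integral_cmult_le[of "ennreal (1 / c)" M "\<lambda>x. ennreal c * f x"] by (simp add: c)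
  from mult_left_mono[OF this, of "ennreal c"]
  show "(\<integral>\<^sup>+x. ennreal c * f x \<partial>M) \<le> ennreal c * (\<integral>\<^sup>+x. f x \<partial>M)"
    by (simp add: c)
qed (rule nn_integral_cmult_le)

lemma enn2real_pos: "0 < p \<Longrightarrow> p \<noteq> top \<Longrightarrow> 0 < enn2real p"
  by (simp add: enn2real_positive_iff less_top)

lemma Lp_qnorm_mono_AE:
  assumes "AE x in M. F x \<le> G x" "0 < p"
  shows "Lp_qnorm p M F \<le> Lp_qnorm p M G"
proof (cases "p = top")
  case True
  have "{c. AE x in M. G x \<le> c} \<subseteq> {c. AE x in M. F x \<le> c}"
    using assms(1) by (auto elim: eventually_mono[OF eventually_conj] intro: order_trans)
  then show ?thesis using True by (simp add: Lp_qnorm_def Inf_superset_mono)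
next
  case False
  then show ?thesis using assms enn2real_pos[of p]
    by (auto simp: Lp_qnorm_def intro!: ennreal_powr_mono nn_integral_mono_AE elim!: eventually_mono)
qed

lemma Lp_qnorm_mono: "(\<And>x. F x \<le> G x) \<Longrightarrow> 0 < p \<Longrightarrow> Lp_qnorm p M F \<le> Lp_qnorm p M G"
  by (simp add: Lp_qnorm_mono_AE)

text \<open>At exponent infinity: scaling by a positive finite c is an order automorphism of
  [0, \<infinity>], so it maps the essential bounds of F onto those of c F and commutes with
  infima.\<close>

lemma Lp_qnorm_cmult:
  fixes c :: real
  assumes "0 < c" "0 < p"
  shows "Lp_qnorm p M (\<lambda>x. ennreal c * F x) = ennreal c * Lp_qnorm p M F"
proof (cases "p = top")
  case True
  have inv: "ennreal c * (ennreal (1 / c) * y) = y" "ennreal (1 / c) * (ennreal c * y) = y" for y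
    using assms by (simp_all add: mult.assoc[symmetric] flip: ennreal_mult)
  have c: "ennreal c * F x \<le> ennreal c * d \<longleftrightarrow> F x \<le> d" for x d
    using mult_left_mono[of "ennreal c * F x" "ennreal c * d" "ennreal (1 / c)"]
    by (auto simp: inv intro: mult_left_mono)
  have "{d. AE x in M. ennreal c * F x \<le> d} = (\<lambda>d. ennreal c * d) ` {d. AE x in M. F x \<le> d}"
  proof safe
    fix d assume *: "AE x in M. ennreal c * F x \<le> d"
    have "AE x in M. F x \<le> ennreal (1 / c) * d"
      using * by (subst (asm) inv[of d, symmetric]) (simp add: c)
    then show "d \<in> (\<lambda>d. ennreal c * d) ` {d. AE x in M. F x \<le> d}"
      by (intro image_eqI[where x = "ennreal (1 / c) * d"]) (auto simp: inv)
  qed (auto simp: c)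
  moreover have "Inf ((\<lambda>d. ennreal c * d) ` {d. AE x in M. F x \<le> d})
      = ennreal c * Inf {d. AE x in M. F x \<le> d}"
  proof (rule antisym)
    have "ennreal (1 / c) * Inf ((\<lambda>d. ennreal c * d) ` {d. AE x in M. F x \<le> d})
      \<le> Inf {d. AE x in M. F x \<le> d}"
    proof (rule Inf_greatest)
      fix d assume "d \<in> {d. AE x in M. F x \<le> d}"
      then have "Inf ((\<lambda>d. ennreal c * d) ` {d. AE x in M. F x \<le> d}) \<le> ennreal c * d"
        by (intro Inf_lower imageI)
      from mult_left_mono[OF this, of "ennreal (1 / c)"]
      show "ennreal (1 / c) * Inf ((\<lambda>d. ennreal c * d) ` {d. AE x in M. F x \<le> d}) \<le> d"
        using inv[of d] by (simp add: ac_simps)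
    qed
    from mult_left_mono[OF this, of "ennreal c"]
    show "Inf ((\<lambda>d. ennreal c * d) ` {d. AE x in M. F x \<le> d})
      \<le> ennreal c * Inf {d. AE x in M. F x \<le> d}" by (simp add: inv)
  qed (auto intro!: Inf_greatest mult_left_mono Inf_lower)
  ultimately show ?thesis using True by (simp add: Lp_qnorm_def)
next
  case False
  note P = enn2real_pos[OF assms(2) False]
  have "(\<integral>\<^sup>+x. ennreal_powr (ennreal c * F x) (enn2real p) \<partial>M)
     = ennreal (c powr enn2real p) * (\<integral>\<^sup>+x. ennreal_powr (F x) (enn2real p) \<partial>M)"
    using assms P by (subst nn_integral_cmult_finite[symmetric])
      (auto simp: ennreal_powr_mult ennreal_powr_ennreal)
  then show ?thesis using assms P False
    by (simp add: Lp_qnorm_def ennreal_powr_mult ennreal_powr_ennreal powr_powr)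
qed

lemma Lp_qnorm_0 [simp]: "0 < p \<Longrightarrow> Lp_qnorm p M (\<lambda>_. 0) = 0"
  by (auto simp: Lp_qnorm_def bot_ennreal)

lemma mixed_qnorm_mono:
  "(\<And>z. F z \<le> G z) \<Longrightarrow> 0 < p \<Longrightarrow> 0 < q \<Longrightarrow> mixed_qnorm p q M N F \<le> mixed_qnorm p q M N G"
  unfolding mixed_qnorm_def by (intro Lp_qnorm_mono)

lemma mixed_qnorm_cmult:
  fixes c :: real
  shows "0 < c \<Longrightarrow> 0 < p \<Longrightarrow> 0 < q \<Longrightarrow>
    mixed_qnorm p q M N (\<lambda>z. ennreal c * F z) = ennreal c * mixed_qnorm p q M N F"
  unfolding mixed_qnorm_def by (simp add: Lp_qnorm_cmult)

lemma mixed_qnorm_le_cmult: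
  fixes c :: real
  assumes "\<And>z. F z \<le> ennreal c * G z" "0 < c" "0 < p" "0 < q"
  shows "mixed_qnorm p q M N F \<le> ennreal c * mixed_qnorm p q M N G"
  using mixed_qnorm_mono[of F "\<lambda>z. ennreal c * G z" p q M N] assms by (simp add: mixed_qnorm_cmult)

text \<open>The infimum of the essential bounds is attained: a sequence of bounds tends to it, and
  the countably many exceptional null sets have a null union.\<close>

lemma AE_le_Lp_qnorm_top: "AE x in M. F x \<le> Lp_qnorm top M F"
proof -
  let ?A = "{c. AE x in M. F x \<le> c}"
  have "top \<in> ?A" by simp
  then obtain f :: "nat \<Rightarrow> ennreal" where f: "range f \<subseteq> ?A" "Inf ?A = (INF i. f i)"
    using ennreal_Inf_countable_INF[of ?A] by blast
  have "AE x in M. \<forall>i. F x \<le> f i"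
    using f(1) by (subst AE_all_countable) auto
  then show ?thesis
    by eventually_elim (auto simp: Lp_qnorm_def f(2) intro: INF_greatest)
qed

lemma Lp_qnorm_top_le_iff: "Lp_qnorm top M F \<le> c \<longleftrightarrow> (AE x in M. F x \<le> c)"
proof
  assume "Lp_qnorm top M F \<le> c"
  with AE_le_Lp_qnorm_top[of F M] show "AE x in M. F x \<le> c"
    by (auto elim!: eventually_mono)
next
  assume "AE x in M. F x \<le> c" then show "Lp_qnorm top M F \<le> c"
    unfolding Lp_qnorm_def by (auto intro: Inf_lower)
qed

text \<open>Serves translations and rotations, and also the floor map, which carries Lebesgue
  measure to counting measure on the lattice.\<close>

lemma Lp_qnorm_distr:
  assumes [measurable]: "T \<in> measurable M N" "F \<in> borel_measurable N" and N: "distr M N T = N"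
  shows "Lp_qnorm p M (\<lambda>x. F (T x)) = Lp_qnorm p N F"
proof (cases "p = top")
  case True
  have "(AE x in M. F (T x) \<le> c) \<longleftrightarrow> (AE x in N. F x \<le> c)" for c
  proof -
    have "(AE x in distr M N T. F x \<le> c) \<longleftrightarrow> (AE x in M. F (T x) \<le> c)"
      by (rule AE_distr_iff) measurable
    then show ?thesis unfolding N by simp
  qed
  then show ?thesis using True by (simp add: Lp_qnorm_def)
next
  case False
  have "(\<integral>\<^sup>+ x. ennreal_powr (F x) (enn2real p) \<partial>N) =
    (\<integral>\<^sup>+ x. ennreal_powr (F (T x)) (enn2real p) \<partial>M)"
    by (subst N[symmetric]) (simp add: nn_integral_distr)
  then show ?thesis using False by (simp add: Lp_qnorm_def)
qed

text \<open>At exponent infinity the quasi-norm of a section is at most c exactly when the section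
  exceeds c on a null set; the measure of that exceptional set is an integral of an indicator, hence
  measurable in y.\<close>

lemma borel_measurable_Lp_qnorm [measurable]:
  assumes "sigma_finite_measure M" and [measurable]: "F \<in> borel_measurable (N \<Otimes>\<^sub>M M)"
  shows "(\<lambda>y. Lp_qnorm p M (\<lambda>x. F (y, x))) \<in> borel_measurable N"
proof (cases "p = top")
  case True
  interpret M: sigma_finite_measure M by fact
  show ?thesis
  proof (rule borel_measurableI_le)
    fix c
    have sec: "{x \<in> space M. \<not> F (y, x) \<le> c} \<in> sets M" if "y \<in> space N" for y
    proof -
      have [measurable]: "(\<lambda>x. F (y, x)) \<in> borel_measurable M"
        using that assms(2) by (rule measurable_compose_Pair1)
      show ?thesis by measurable
    qed
    have "{y \<in> space N. Lp_qnorm p M (\<lambda>x. F (y, x)) \<le> c}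
       = {y \<in> space N. emeasure M {x \<in> space M. \<not> F (y, x) \<le> c} = 0}"
      unfolding True Lp_qnorm_top_le_iff
      by (intro Collect_cong conj_cong refl) (rule AE_iff_measurable[OF sec refl])
    also have "\<dots> = {y \<in> space N. (\<integral>\<^sup>+x. indicator {z \<in> space (N \<Otimes>\<^sub>M M). \<not> F z \<le> c} (y, x) \<partial>M) = 0}"
    proof (intro Collect_cong conj_cong refl)
      fix y assume y: "y \<in> space N"
      have "(\<integral>\<^sup>+x. indicator {z \<in> space (N \<Otimes>\<^sub>M M). \<not> F z \<le> c} (y, x) \<partial>M)
        = (\<integral>\<^sup>+x. indicator {x \<in> space M. \<not> F (y, x) \<le> c} x \<partial>M)"
        using y by (intro nn_integral_cong) (auto simp: space_pair_measure indicator_def)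
      also have "\<dots> = emeasure M {x \<in> space M. \<not> F (y, x) \<le> c}"
        by (rule nn_integral_indicator[OF sec[OF y]])
      finally show "(emeasure M {x \<in> space M. \<not> F (y, x) \<le> c} = 0) =
        ((\<integral>\<^sup>+x. indicator {z \<in> space (N \<Otimes>\<^sub>M M). \<not> F z \<le> c} (y, x) \<partial>M) = 0)" by simp
    qed
    also have "\<dots> \<in> sets N" by measurable
    finally show "{y \<in> space N. Lp_qnorm p M (\<lambda>x. F (y, x)) \<le> c} \<in> sets N" .
  qed
next
  case False
  interpret M: sigma_finite_measure M by fact
  show ?thesis using False unfolding Lp_qnorm_def by simp
qed


section \<open>Minkowski's inequality\<close>

text \<open>The convex function y^P s^(1-P) of y lies above its tangent at y = c s. After rescaling
  this is Young's inequality with exponents P and P/(P-1).\<close>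

lemma powr_tangent_line:
  fixes c y s P :: real
  assumes "1 \<le> P" "0 \<le> c" "0 \<le> y" "0 < s"
  shows "P * c powr (P - 1) * y \<le> y powr P * s powr (1 - P) + (P - 1) * c powr P * s"
proof (cases "c = 0 \<or> y = 0")
  case False
  then have pos: "0 < c" "0 < y" using assms by auto
  define a where "a = y powr P * s powr (1 - P)"
  define b where "b = c powr P * s"
  have "a powr (1 / P) * b powr (1 - 1 / P) \<le> (1 / P) * a + (1 - 1 / P) * b"
    using assms pos by (intro Youngs_inequality_0) (auto simp: a_def b_def field_simps)
  also have "a powr (1 / P) * b powr (1 - 1 / P) = c powr (P - 1) * y"
  proof -
    have "P * (1 - 1 / P) = P - 1" "(1 - P) * (1 / P) + (1 - 1 / P) = 0"
      using assms by (auto simp: field_simps)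
    have "a powr (1 / P) = y * s powr ((1 - P) * (1 / P))"
      using assms pos unfolding a_def by (simp add: powr_mult powr_powr)
    moreover have "b powr (1 - 1 / P) = c powr (P - 1) * s powr (1 - 1 / P)"
      using assms pos \<open>P * (1 - 1 / P) = P - 1\<close> unfolding b_def by (simp add: powr_mult powr_powr)
    moreover have "s powr ((1 - P) * (1 / P)) * s powr (1 - 1 / P) = 1"
      using assms \<open>(1 - P) * (1 / P) + (1 - 1 / P) = 0\<close>
      by (simp only: powr_add[symmetric]) simp
    ultimately show ?thesis by (simp add: ac_simps)
  qed
  finally have "P * (c powr (P - 1) * y) \<le> P * ((1 / P) * a + (1 - 1 / P) * b)"
    using assms by (intro mult_left_mono) auto
  also have "\<dots> = a + (P - 1) * b" using assms by (simp add: field_simps)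
  finally show ?thesis by (simp add: a_def b_def ac_simps)
qed (use assms in auto)

text \<open>Hoelder's inequality with the auxiliary density s, obtained by integrating the tangent
  inequality with the slope parameter c still free. The value c = 1 already rules out an infinite
  integral of y when the right-hand integral is finite.\<close>

lemma nn_integral_powr_le:
  assumes P: "1 \<le> P" and [measurable]: "y \<in> borel_measurable M" "s \<in> borel_measurable M"
    and s: "\<And>u. 0 < s u" "\<And>u. s u \<noteq> top"
    and T: "0 < (\<integral>\<^sup>+u. s u \<partial>M)" "(\<integral>\<^sup>+u. s u \<partial>M) \<noteq> top"
  shows "ennreal_powr (\<integral>\<^sup>+u. y u \<partial>M) P \<le> ennreal_powr (\<integral>\<^sup>+u. s u \<partial>M) (P - 1) *
    (\<integral>\<^sup>+u. ennreal_powr (y u) P * ennreal_powr (s u) (1 - P) \<partial>M)" (is "_ \<le> _ * ?I")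
proof -
  obtain t where t: "(\<integral>\<^sup>+u. s u \<partial>M) = ennreal t" "0 < t"
    using T by (cases "\<integral>\<^sup>+u. s u \<partial>M") auto
  have pointwise: "ennreal (P * c powr (P - 1)) * y u
     \<le> ennreal_powr (y u) P * ennreal_powr (s u) (1 - P) + ennreal ((P - 1) * c powr P) * s u"
    if "0 \<le> c" for c u
  proof -
    obtain s' where s': "s u = ennreal s'" "0 < s'"
      using s[of u] by (cases "s u") auto
    show ?thesis
    proof (cases "y u")
      case (real y')
      have "ennreal (P * c powr (P - 1)) * y u = ennreal (P * c powr (P - 1) * y')"
        using real P by (simp add: ennreal_mult)
      also have "\<dots> \<le> ennreal (y' powr P * s' powr (1 - P) + (P - 1) * c powr P * s')"
        using powr_tangent_line[of P c y' s'] P that real s' by (intro ennreal_leI) auto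
      also have "\<dots> = ennreal_powr (y u) P * ennreal_powr (s u) (1 - P) + ennreal ((P - 1) * c powr P) * s u"
        using real s' P by (simp add: ennreal_powr_ennreal ennreal_mult ennreal_plus)
      finally show ?thesis .
    next
      case top
      then show ?thesis using s' by (simp add: ennreal_powr_ennreal ennreal_top_mult)
    qed
  qed
  have main: "ennreal (P * c powr (P - 1)) * (\<integral>\<^sup>+u. y u \<partial>M) \<le> ?I + ennreal ((P - 1) * c powr P * t)"
    if "0 \<le> c" for c
  proof -
    have "ennreal (P * c powr (P - 1)) * (\<integral>\<^sup>+u. y u \<partial>M)
        = (\<integral>\<^sup>+u. ennreal (P * c powr (P - 1)) * y u \<partial>M)"
      by (simp add: nn_integral_cmult)
    also have "\<dots> \<le> (\<integral>\<^sup>+u. ennreal_powr (y u) P * ennreal_powr (s u) (1 - P)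
        + ennreal ((P - 1) * c powr P) * s u \<partial>M)"
      by (intro nn_integral_mono pointwise that)
    also have "\<dots> = ?I + ennreal ((P - 1) * c powr P) * ennreal t"
      by (simp add: nn_integral_add nn_integral_cmult t(1))
    finally show ?thesis using P t by (simp add: ennreal_mult)
  qed
  show ?thesis
  proof (cases "?I = top")
    case True
    then show ?thesis using t by (simp add: ennreal_powr_ennreal ennreal_mult_top)
  next
    case False
    then obtain i where i: "?I = ennreal i" "0 \<le> i" by (cases ?I) auto
    have "(\<integral>\<^sup>+u. y u \<partial>M) \<noteq> top"
    proof
      assume "(\<integral>\<^sup>+u. y u \<partial>M) = top"
      with main[of 1] P i show False by (simp add: ennreal_mult_top top_unique flip: ennreal_plus)
    qed
    then obtain Y where Y: "(\<integral>\<^sup>+u. y u \<partial>M) = ennreal Y" "0 \<le> Y" by (cases "\<integral>\<^sup>+u. y u \<partial>M") auto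
    \<comment> \<open>The optimal slope: the ratio of the integral of y to that of s.\<close>
    define c where "c = Y / t"
    have c: "0 \<le> c" using Y t by (simp add: c_def)
    have "P * c powr (P - 1) * Y \<le> i + (P - 1) * c powr P * t"
      using main[OF c] P t Y i by (simp flip: ennreal_mult ennreal_plus)
    moreover have "c powr (P - 1) * Y = c powr P * t"
    proof (cases "Y = 0")
      case False
      then have "c > 0" using Y t by (simp add: c_def)
      then have "c powr P = c powr (P - 1) * c" by (simp add: powr_diff field_simps)
      then show ?thesis using t by (simp add: c_def)
    qed (use P c_def in auto)
    ultimately have "c powr P * t \<le> i" by (simp add: algebra_simps)
    then have "t powr (P - 1) * (c powr P * t) \<le> t powr (P - 1) * i"
      by (intro mult_left_mono) auto
    moreover have "t powr (P - 1) * (c powr P * t) = Y powr P"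
    proof -
      have "t powr (P - 1) * t = t powr P" using t by (simp add: powr_diff)
      moreover have "t powr P * c powr P = Y powr P"
        using t Y by (simp add: c_def flip: powr_mult)
      ultimately show ?thesis by (metis mult.assoc mult.commute)
    qed
    ultimately show ?thesis using Y t i
      by (simp add: ennreal_powr_ennreal flip: ennreal_mult)
  qed
qed

text \<open>Minkowski's integral inequality for the exponent P = p/r \<ge> 1, proved without
  duality. Use Hoelder in u at each x, with the density s(u) equal to the r-th power of the
  quasi-norm of F(u, .); after Fubini the x-integral restores s^P, and s^P s^(1-P) = s integrates to
  the very quantity to be reached.\<close>

lemma Lp_qnorm_Minkowski:
  fixes F :: "'u \<times> 'x \<Rightarrow> ennreal"
  assumes "finite_measure U" "sigma_finite_measure M"
    and F[measurable]: "F \<in> borel_measurable (U \<Otimes>\<^sub>M M)"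
    and r: "0 < r" "ennreal r \<le> p"
  shows "Lp_qnorm p M (\<lambda>x. ennreal_powr (\<integral>\<^sup>+u. ennreal_powr (F (u, x)) r \<partial>U) (1 / r))
    \<le> ennreal_powr (\<integral>\<^sup>+u. ennreal_powr (Lp_qnorm p M (\<lambda>x. F (u, x))) r \<partial>U) (1 / r)"
    (is "Lp_qnorm p M ?G \<le> ennreal_powr ?S (1 / r)")
proof -
  interpret U: finite_measure U by fact
  interpret M: sigma_finite_measure M by fact
  interpret UM: pair_sigma_finite U M ..
  have [measurable]: "(\<lambda>u. Lp_qnorm p M (\<lambda>x. F (u, x))) \<in> borel_measurable U"
    by (intro borel_measurable_Lp_qnorm F assms)
  show ?thesis
  proof (cases "p = top")
    case True
    have "AE u in U. AE x in M. F (u, x) \<le> Lp_qnorm p M (\<lambda>x. F (u, x))"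
      unfolding True by (simp add: AE_le_Lp_qnorm_top)
    then have "AE x in M. AE u in U. F (u, x) \<le> Lp_qnorm p M (\<lambda>x. F (u, x))"
      by (subst (asm) UM.AE_commute) (auto simp: split_beta')
    then have "AE x in M. ?G x \<le> ennreal_powr ?S (1 / r)"
    proof eventually_elim
      case (elim x)
      then show ?case using r
        by (intro ennreal_powr_mono nn_integral_mono_AE) (auto elim!: eventually_mono intro: ennreal_powr_mono)
    qed
    then show ?thesis unfolding True by (subst Lp_qnorm_top_le_iff)
  next
    case False
    define P where "P = enn2real p / r"
    have "0 < p" using r by (metis ennreal_less_zero_iff less_le_trans)
    note p0 = enn2real_pos[OF this False]
    have "r \<le> enn2real p" using r False by (cases p) auto
    then have P: "1 \<le> P" "enn2real p = r * P" using r p0 by (auto simp: P_def)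
    let ?N = "\<lambda>u. Lp_qnorm p M (\<lambda>x. F (u, x))"
    have N: "ennreal_powr (?N u) (r * P) = (\<integral>\<^sup>+x. ennreal_powr (F (u, x)) (r * P) \<partial>M)" for u
      using False p0 by (simp add: Lp_qnorm_def ennreal_powr_inverse P(2)[symmetric])
    have Gp: "ennreal_powr (?G x) (enn2real p) = ennreal_powr (\<integral>\<^sup>+u. ennreal_powr (F (u, x)) r \<partial>U) P" for x
      using r by (simp add: ennreal_powr_powr P(2))
    have "(\<integral>\<^sup>+x. ennreal_powr (\<integral>\<^sup>+u. ennreal_powr (F (u, x)) r \<partial>U) P \<partial>M) \<le> ennreal_powr (?S) P"
    proof (cases "?S = top \<or> emeasure U (space U) = 0")
      case True
      then show ?thesis
      proof
        assume "emeasure U (space U) = 0"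
        then have "AE u in U. False" by (simp add: AE_iff_measurable[OF _ refl])
        then have "(\<integral>\<^sup>+u. f u \<partial>U) = 0" for f :: "'u \<Rightarrow> ennreal"
          by (metis (mono_tags, lifting) eventually_mono nn_integral_0_iff_AE nn_integral_cong_AE nn_integral_const mult_zero_left)
        then show ?thesis by simp
      qed simp
    next
      case nt: False
      have step: "(\<integral>\<^sup>+x. ennreal_powr (\<integral>\<^sup>+u. ennreal_powr (F (u, x)) r \<partial>U) P \<partial>M)
          \<le> ennreal_powr (?S + ennreal e) P" if "0 < e" for e
      proof -
        \<comment> \<open>Spreads the mass e evenly over U, so that the perturbed densities
          integrate to \<open>?S + ennreal e\<close>; e tends to 0 at the end.\<close>
        define d where "d = e / measure U (space U)"
        have mU: "0 < measure U (space U)" using nt by (simp add: U.emeasure_eq_measure less_le)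
        have d: "0 < d" using that mU by (simp add: d_def)
        have fin: "AE u in U. ?N u \<noteq> top"
        proof -
          have "AE u in U. ennreal_powr (?N u) r \<noteq> top"
            using nt nn_integral_PInf_AE[of "\<lambda>u. ennreal_powr (?N u) r" U] by simp
          then show ?thesis by simp
        qed
        \<comment> \<open>Perturbing by d makes the weights strictly positive; the value 1 at infinity is irrelevant.\<close>
        define s where "s u = (if ?N u = top then 1 else ennreal_powr (?N u) r + ennreal d)" for u
        have [measurable]: "s \<in> borel_measurable U" unfolding s_def by measurable
        have "(\<integral>\<^sup>+u. s u \<partial>U) = (\<integral>\<^sup>+u. ennreal_powr (?N u) r + ennreal d \<partial>U)"
          using fin by (intro nn_integral_cong_AE) (auto elim!: eventually_mono simp: s_def)
        also have "\<dots> = ?S + ennreal e"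
          using mU that by (simp add: nn_integral_add d_def U.emeasure_eq_measure flip: ennreal_mult)
        finally have T: "(\<integral>\<^sup>+u. s u \<partial>U) = ?S + ennreal e" .
        have s: "0 < s u" "s u \<noteq> top" for u
          using d by (auto simp: s_def zero_less_iff_neq_zero)
        have "(\<integral>\<^sup>+x. ennreal_powr (\<integral>\<^sup>+u. ennreal_powr (F (u, x)) r \<partial>U) P \<partial>M)
          \<le> (\<integral>\<^sup>+x. ennreal_powr (?S + ennreal e) (P - 1) *
             (\<integral>\<^sup>+u. ennreal_powr (ennreal_powr (F (u, x)) r) P * ennreal_powr (s u) (1 - P) \<partial>U) \<partial>M)"
          using nt that unfolding T[symmetric]
          by (intro nn_integral_mono nn_integral_powr_le P s) (auto simp: T zero_less_iff_neq_zero)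
        also have "\<dots> = ennreal_powr (?S + ennreal e) (P - 1) *
             (\<integral>\<^sup>+x. (\<integral>\<^sup>+u. ennreal_powr (F (u, x)) (r * P) * ennreal_powr (s u) (1 - P) \<partial>U) \<partial>M)"
          by (subst nn_integral_cmult) (auto simp: ennreal_powr_powr)
        also have "(\<integral>\<^sup>+x. (\<integral>\<^sup>+u. ennreal_powr (F (u, x)) (r * P) * ennreal_powr (s u) (1 - P) \<partial>U) \<partial>M)
            = (\<integral>\<^sup>+u. (\<integral>\<^sup>+x. ennreal_powr (F (u, x)) (r * P) * ennreal_powr (s u) (1 - P) \<partial>M) \<partial>U)"
          by (rule UM.Fubini') (simp add: split_beta')
        also have "\<dots> = (\<integral>\<^sup>+u. ennreal_powr (?N u) (r * P) * ennreal_powr (s u) (1 - P) \<partial>U)"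
        proof (intro nn_integral_cong)
          fix u assume "u \<in> space U"
          then have [measurable]: "(\<lambda>x. F (u, x)) \<in> borel_measurable M"
            using F by (rule measurable_compose_Pair1)
          show "(\<integral>\<^sup>+x. ennreal_powr (F (u, x)) (r * P) * ennreal_powr (s u) (1 - P) \<partial>M)
            = ennreal_powr (?N u) (r * P) * ennreal_powr (s u) (1 - P)"
            unfolding N by (rule nn_integral_multc) measurable
        qed
        also have "\<dots> \<le> (\<integral>\<^sup>+u. s u \<partial>U)"
        proof (rule nn_integral_mono_AE)
          show "AE u in U. ennreal_powr (?N u) (r * P) * ennreal_powr (s u) (1 - P) \<le> s u"
            using fin
          proof eventually_elim
            case (elim u)
            have "ennreal_powr (?N u) (r * P) = ennreal_powr (ennreal_powr (?N u) r) P"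
              by (simp add: ennreal_powr_powr)
            also have "\<dots> \<le> ennreal_powr (s u) P"
              using P elim by (intro ennreal_powr_mono) (auto simp: s_def)
            finally have "ennreal_powr (?N u) (r * P) * ennreal_powr (s u) (1 - P)
                \<le> ennreal_powr (s u) P * ennreal_powr (s u) (1 - P)"
              by (intro mult_right_mono) auto
            also have "\<dots> = s u" using ennreal_powr_add[OF s(2), of u P "1 - P"] by simp
            finally show ?case .
          qed
        qed
        also have "\<dots> = ?S + ennreal e" by (rule T)
        finally have "(\<integral>\<^sup>+x. ennreal_powr (\<integral>\<^sup>+u. ennreal_powr (F (u, x)) r \<partial>U) P \<partial>M)
          \<le> ennreal_powr (?S + ennreal e) (P - 1) * (?S + ennreal e)"
          by (simp add: mult_left_mono)
        also have "\<dots> = ennreal_powr (?S + ennreal e) P"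
          using nt ennreal_powr_add[of "?S + ennreal e" "P - 1" 1] by simp
        finally show ?thesis .
      qed
      have P0: "0 < P" using P by simp
      have "ennreal_powr (\<integral>\<^sup>+x. ennreal_powr (\<integral>\<^sup>+u. ennreal_powr (F (u, x)) r \<partial>U) P \<partial>M) (1 / P)
          \<le> ?S"
        by (rule ennreal_le_epsilon) (simp only: ennreal_powr_le_swap[OF P0] step)
      then show ?thesis by (simp only: ennreal_powr_le_swap[OF P0])
    qed
    then have "(\<integral>\<^sup>+x. ennreal_powr (?G x) (enn2real p) \<partial>M) \<le> ennreal_powr ?S P"
      unfolding Gp .
    from ennreal_powr_mono[OF this, of "1 / enn2real p"] p0 r P
    show ?thesis using False by (simp add: Lp_qnorm_def ennreal_powr_powr)
  qed
qed


section \<open>Polynomial decay\<close>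

text \<open>The sign of s is free: for s > 0 this is a kernel, and \<open>decay (- s)\<close> is the
  growth permitted to a weight, so gains and losses are balanced by adding exponents.\<close>

definition decay :: "real \<Rightarrow> 'a::real_normed_vector \<Rightarrow> real" where
  "decay s x = (1 + norm x) powr - s"

lemma one_plus_norm_pos [simp]: "0 < 1 + norm x" "1 + norm x \<noteq> 0"
  by (smt (verit) norm_ge_zero)+

lemma decay_pos [simp]: "0 < decay s x"
  by (simp add: decay_def)

lemma decay_nonneg [simp]: "0 \<le> decay s x" and decay_nonzero [simp]: "decay s x \<noteq> 0"
  using decay_pos[of s x] by linarith+

lemma decay_zero [simp]: "decay s 0 = 1"
  by (simp add: decay_def)

lemma decay_mono: "s \<le> t \<Longrightarrow> decay t x \<le> decay s x"
  by (simp add: decay_def powr_mono)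

lemma decay_le_1: "0 \<le> s \<Longrightarrow> decay s x \<le> 1"
  using decay_mono[of 0 s x] by (simp add: decay_def)

lemma decay_add: "decay (s + t) x = decay s x * decay t x"
  by (simp add: decay_def flip: powr_add)

lemma decay_cancel: "decay (- s) x * decay s x = 1" "decay s x * decay (- s) x = 1"
  by (simp_all add: decay_def flip: powr_add)

lemma decay_minus [simp]: "decay s (- x) = decay s x"
  by (simp add: decay_def)

lemma decay_minus_commute: "decay s (x - y) = decay s (y - x)"
  by (simp add: decay_def norm_minus_commute)

lemma decay_powr: "decay s x powr r = decay (s * r) x"
  by (simp add: decay_def powr_powr)

lemma decay_antimono: "0 \<le> s \<Longrightarrow> norm x \<le> norm y \<Longrightarrow> decay s y \<le> decay s x"
  unfolding decay_def by (intro powr_mono2') auto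

text \<open>Submultiplicativity of 1 + norm, reversed by the negative power.\<close>

lemma decay_triangle: "0 \<le> s \<Longrightarrow> decay s x * decay s y \<le> decay s (x + y)"
proof -
  assume "0 \<le> s"
  have "1 + norm (x + y) \<le> (1 + norm x) * (1 + norm y)"
  proof -
    have "0 \<le> norm x * norm y" by simp
    moreover have "(1 + norm x) * (1 + norm y) = 1 + norm x + norm y + norm x * norm y" by algebra
    ultimately show ?thesis using norm_triangle_ineq[of x y] by linarith
  qed
  then have "((1 + norm x) * (1 + norm y)) powr - s \<le> (1 + norm (x + y)) powr - s"
    using \<open>0 \<le> s\<close> by (intro powr_mono2') auto
  then show ?thesis by (simp add: decay_def powr_mult add_nonneg_nonneg)
qed

lemma decay_triangle_diff: "0 \<le> s \<Longrightarrow> decay s (x - y) * decay s (y - z) \<le> decay s (x - z)"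
  using decay_triangle[of s "x - y" "y - z"] by simp

lemma decay_Pair_le_fst: "0 \<le> s \<Longrightarrow> decay s (x, y) \<le> decay s x"
  by (intro decay_antimono) (auto simp: norm_fst_le norm_Pair intro: real_le_rsqrt)

lemma decay_Pair_le_snd: "0 \<le> s \<Longrightarrow> decay s (x, y) \<le> decay s y"
  by (intro decay_antimono) (auto simp: norm_Pair intro: real_le_rsqrt)

text \<open>Doubling the exponent turns decay in a pair into a product of two kernels, the majorant
  that Fubini requires.\<close>

lemma decay_Pair_le_mult: "0 \<le> s \<Longrightarrow> decay (2 * s) (x, y) \<le> decay s x * decay s y"
proof -
  assume s: "0 \<le> s"
  have "decay (2 * s) (x, y) = decay s (x, y) * decay s (x, y)" by (simp flip: decay_add)
  also have "\<dots> \<le> decay s x * decay s y"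
    using s by (intro mult_mono decay_Pair_le_fst decay_Pair_le_snd) auto
  finally show ?thesis .
qed

lemma borel_measurable_decay [measurable (raw)]:
  assumes "f \<in> borel_measurable M"
  shows "(\<lambda>x. decay s (f x :: 'a::euclidean_space)) \<in> borel_measurable M"
  using assms unfolding decay_def by measurable

lemma nn_integral_inverse_1_plus_square_finite:
  "(\<integral>\<^sup>+(x::real). ennreal (1 / (1 + x\<^sup>2)) \<partial>lborel) < \<infinity>"
proof -
  let ?f = "\<lambda>x::real. ennreal (1 / (1 + x\<^sup>2))"
  have pos: "(\<integral>\<^sup>+x. ?f x * indicator {0..} x \<partial>lborel) = ennreal (pi / 2 - arctan 0)"
    by (rule nn_integral_FTC_atLeast)
       (auto intro!: derivative_eq_intros tendsto_arctan_at_top simp: field_simps)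
  have neg: "(\<integral>\<^sup>+x. ?f x * indicator {..0} x \<partial>lborel) = (\<integral>\<^sup>+x. ?f x * indicator {0..} x \<partial>lborel)"
    by (subst lborel_distr_uminus[symmetric], subst nn_integral_distr)
       (auto intro!: nn_integral_cong simp: indicator_def)
  have "(\<integral>\<^sup>+x. ?f x \<partial>lborel) \<le> (\<integral>\<^sup>+x. ?f x * indicator {0..} x + ?f x * indicator {..0} x \<partial>lborel)"
    by (intro nn_integral_mono) (auto simp: indicator_def)
  also have "\<dots> < \<infinity>" by (simp add: nn_integral_add neg pos)
  finally show ?thesis .
qed

text \<open>The threshold gives two powers of decay to each coordinate, so the kernel lies below a
  tensor product of functions 1/(1 + x^2), whose integrals come from the arctangent.\<close>

lemma nn_integral_decay_finite:
  assumes "real (2 * DIM('a)) \<le> s"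
  shows "(\<integral>\<^sup>+(x::'a::euclidean_space). ennreal (decay s x) \<partial>lborel) < \<infinity>"
proof -
  have le: "decay s x \<le> (\<Prod>b\<in>Basis. 1 / (1 + (x \<bullet> b)\<^sup>2))" for x :: 'a
  proof -
    have "decay s x \<le> decay (2 * DIM('a)) x" using assms by (rule decay_mono)
    also have "\<dots> = (\<Prod>b\<in>(Basis :: 'a set). 1 / (1 + norm x)\<^sup>2)"
    proof -
      have "decay (real (2 * DIM('a))) x = 1 / (1 + norm x) ^ (2 * DIM('a))"
        unfolding decay_def powr_minus_divide by (subst powr_realpow) auto
      then show ?thesis by (simp add: power_mult power_one_over)
    qed
    also have "\<dots> \<le> (\<Prod>b\<in>Basis. 1 / (1 + (x \<bullet> b)\<^sup>2))"
    proof (intro prod_mono conjI)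
      fix b :: 'a assume "b \<in> Basis"
      then have "(x \<bullet> b)\<^sup>2 \<le> (norm x)\<^sup>2" using Basis_le_norm[of b x] by (simp add: abs_le_square_iff[symmetric])
      also have "\<dots> \<le> (1 + norm x)\<^sup>2 - 1" by (simp add: power2_eq_square algebra_simps)
      finally show "1 / (1 + norm x)\<^sup>2 \<le> 1 / (1 + (x \<bullet> b)\<^sup>2)"
        by (intro divide_left_mono) (auto simp: add_pos_nonneg)
    qed simp
    finally show ?thesis .
  qed
  have "(\<integral>\<^sup>+(x::'a). ennreal (decay s x) \<partial>lborel)
      \<le> (\<integral>\<^sup>+(x::'a). (\<Prod>b\<in>Basis. ennreal (1 / (1 + (x \<bullet> b)\<^sup>2))) \<partial>lborel)"
    by (intro nn_integral_mono) (simp add: prod_ennreal ennreal_leI le)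
  also have "\<dots> = (\<Prod>b\<in>(Basis :: 'a set). \<integral>\<^sup>+(x::real). ennreal (1 / (1 + x\<^sup>2)) \<partial>lborel)"
    by (rule nn_integral_lborel_prod) auto
  also have "\<dots> < \<infinity>"
    using nn_integral_inverse_1_plus_square_finite by (simp add: power_less_top_ennreal)
  finally show ?thesis .
qed

lemma integrable_decay:
  assumes "real (2 * DIM('a)) \<le> s"
  shows "integrable lborel (decay s :: 'a::euclidean_space \<Rightarrow> real)"
  using nn_integral_decay_finite[OF assms] by (intro integrableI_nonneg) auto

lemma integrable_bounded_decay:
  fixes f :: "'a::euclidean_space \<Rightarrow> 'b::{banach, second_countable_topology}"
  assumes "f \<in> borel_measurable borel" "\<And>x. norm (f x) \<le> C * decay s x" "real (2 * DIM('a)) \<le> s"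
  shows "integrable lborel f"
  by (rule Bochner_Integration.integrable_bound[of _ "\<lambda>x. C * decay s x"])
     (use assms in \<open>auto intro: integrable_decay order_trans abs_ge_self\<close>)


section \<open>Invariance of Lebesgue measure\<close>

lemma lborel_distr_reflect: "distr lborel borel (\<lambda>u. z - u) = (lborel :: 'a::euclidean_space measure)"
  using lborel_affine[of "-1" z] by (simp add: density_1)

lemma lborel_distr_translate: "distr lborel borel (\<lambda>u. u + z) = (lborel :: 'a::euclidean_space measure)"
  using lborel_distr_plus[of z] by (simp add: add.commute[of _ z])

lemma nn_integral_reflect:
  fixes z :: "'a::euclidean_space"
  assumes "f \<in> borel_measurable borel"
  shows "(\<integral>\<^sup>+u. f (z - u) \<partial>lborel) = (\<integral>\<^sup>+u. f u \<partial>lborel)"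
  using nn_integral_distr[of "\<lambda>u. z - u" lborel borel f] assms by (simp add: lborel_distr_reflect)

lemma integral_reflect:
  fixes z :: "'a::euclidean_space" and f :: "'a \<Rightarrow> 'b::{banach, second_countable_topology}"
  assumes "f \<in> borel_measurable borel"
  shows "(LINT u|lborel. f (z - u)) = (LINT u|lborel. f u)"
  using integral_distr[of "\<lambda>u. z - u" lborel borel f] assms by (simp add: lborel_distr_reflect)

lemma integral_translate:
  fixes z :: "'a::euclidean_space" and f :: "'a \<Rightarrow> 'b::{banach, second_countable_topology}"
  assumes "f \<in> borel_measurable borel"
  shows "(LINT u|lborel. f (u + z)) = (LINT u|lborel. f u)"
  using integral_distr[of "\<lambda>u. u + z" lborel borel f] assms by (simp add: lborel_distr_translate)

lemma Lp_qnorm_translate: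
  fixes c :: "'a::euclidean_space"
  assumes "F \<in> borel_measurable borel"
  shows "Lp_qnorm p lborel (\<lambda>x. F (x - c)) = Lp_qnorm p lborel F"
proof (rule Lp_qnorm_distr)
  have "distr lborel lborel (\<lambda>x. x - c) = distr lborel borel (\<lambda>x. x + (- c))"
    by (rule distr_cong) auto
  then show "distr lborel lborel (\<lambda>x. x - c) = lborel" by (simp only: lborel_distr_translate)
qed (use assms in auto)


section \<open>Convolution in mixed quasi-norms\<close>

text \<open>The bounds by p and q are what Minkowski's inequality asks of r; r \<le> 1 is for the
  splitting F = F^r F^(1-r) in the maximal function argument.\<close>

lemma common_lower_exponent:
  fixes p q :: ennreal
  assumes pq: "0 < p" "0 < q"
  obtains r :: real where "0 < r" "r \<le> 1" "ennreal r \<le> p" "ennreal r \<le> q"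
proof -
  define r where "r = enn2real (min 1 (min p q))"
  have er: "ennreal r = min 1 (min p q)" unfolding r_def by (rule ennreal_enn2real) (simp add: min_less_iff_disj)
  have "0 < r" using pq er by (metis ennreal_0 less_irrefl linorder_not_less min_less_iff_conj ennreal_neg zero_less_one not_gr_zero)
  moreover have "r \<le> 1" using er by (metis ennreal_1 ennreal_le_iff min.cobounded1 zero_le_one)
  moreover have "ennreal r \<le> p" "ennreal r \<le> q" unfolding er by (simp_all add: min_le_iff_disj)
  ultimately show ?thesis by (rule that)
qed

text \<open>Read \<open>\<kappa>\<close> as a finite measure on the shifts u and use Minkowski once
  in each variable. Translation invariance removes the first component of u from the inner
  quasi-norm and then the second from the outer one.\<close>

lemma mixed_qnorm_convolution:
  fixes F \<kappa> :: "'a::euclidean_space \<times> 'b::euclidean_space \<Rightarrow> ennreal"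
  assumes F[measurable]: "F \<in> borel_measurable borel" and \<kappa>[measurable]: "\<kappa> \<in> borel_measurable borel"
    and fin: "(\<integral>\<^sup>+u. \<kappa> u \<partial>lborel) \<noteq> top"
    and r: "0 < r" "ennreal r \<le> p" "ennreal r \<le> q"
  shows "mixed_qnorm p q lborel lborel
      (\<lambda>z. ennreal_powr (\<integral>\<^sup>+u. ennreal_powr (F (z - u)) r * \<kappa> u \<partial>lborel) (1 / r))
    \<le> ennreal_powr (\<integral>\<^sup>+u. \<kappa> u \<partial>lborel) (1 / r) * mixed_qnorm p q lborel lborel F"
proof -
  define U where "U = density lborel \<kappa>"
  have U: "finite_measure U"
    by (rule finite_measureI) (use fin in \<open>simp add: U_def emeasure_density\<close>)
  have sU[measurable_cong]: "sets U = sets borel" by (simp add: U_def)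
  have spU: "space U = UNIV" by (simp add: U_def)
  have intU: "(\<integral>\<^sup>+u. ennreal_powr (f u) r * \<kappa> u \<partial>lborel) = (\<integral>\<^sup>+u. ennreal_powr (f u) r \<partial>U)"
    if "f \<in> borel_measurable borel" for f :: "'a \<times> 'b \<Rightarrow> ennreal"
    using that unfolding U_def by (subst nn_integral_density) (auto simp: mult.commute)
  define g where "g y = Lp_qnorm p lborel (\<lambda>x. F (x, y))" for y
  have [measurable]: "F \<in> borel_measurable (borel \<Otimes>\<^sub>M borel)"
    using F by (simp add: borel_prod)
  have Fswap[measurable]: "(\<lambda>(y, x). F (x, y)) \<in> borel_measurable (borel \<Otimes>\<^sub>M borel)"
    by measurable
  have g[measurable]: "g \<in> borel_measurable borel"
    using borel_measurable_Lp_qnorm[OF sigma_finite_lborel, of "\<lambda>(y, x). F (x, y)" borel p] Fswap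
    unfolding g_def by (simp cong: measurable_cong_sets sets_pair_measure_cong)
  have p0: "0 < p" "0 < q" using r by (auto intro: less_le_trans[of _ "ennreal r"])
  have inner: "Lp_qnorm p lborel (\<lambda>x. ennreal_powr (\<integral>\<^sup>+u. ennreal_powr (F ((x, y) - u)) r * \<kappa> u \<partial>lborel) (1 / r))
     \<le> ennreal_powr (\<integral>\<^sup>+u. ennreal_powr (g (y - snd u)) r \<partial>U) (1 / r)" for y
  proof -
    have "(\<lambda>v. F ((snd v, y) - fst v)) \<in> borel_measurable (borel \<Otimes>\<^sub>M borel)"
      by measurable
    then have m: "(\<lambda>v. F ((snd v, y) - fst v)) \<in> borel_measurable (U \<Otimes>\<^sub>M lborel)"
      by (simp cong: measurable_cong_sets sets_pair_measure_cong add: sU)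
    have "Lp_qnorm p lborel (\<lambda>x. ennreal_powr (\<integral>\<^sup>+u. ennreal_powr (F ((x, y) - u)) r \<partial>U) (1 / r))
      \<le> ennreal_powr (\<integral>\<^sup>+u. ennreal_powr (Lp_qnorm p lborel (\<lambda>x. F ((x, y) - u))) r \<partial>U) (1 / r)"
      using Lp_qnorm_Minkowski[OF U sigma_finite_lborel m r(1,2)] by simp
    also have "(\<lambda>u. Lp_qnorm p lborel (\<lambda>x. F ((x, y) - u))) = (\<lambda>u. g (y - snd u))"
    proof
      fix u :: "'a \<times> 'b"
      have "(\<lambda>x. F (x, y - snd u)) \<in> borel_measurable borel" by measurable
      from Lp_qnorm_translate[OF this, of p "fst u"]
      show "Lp_qnorm p lborel (\<lambda>x. F ((x, y) - u)) = g (y - snd u)"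
        by (simp add: g_def minus_prod_def)
    qed
    finally show ?thesis by (simp add: intU)
  qed
  have "mixed_qnorm p q lborel lborel
      (\<lambda>z. ennreal_powr (\<integral>\<^sup>+u. ennreal_powr (F (z - u)) r * \<kappa> u \<partial>lborel) (1 / r))
    \<le> Lp_qnorm q lborel (\<lambda>y. ennreal_powr (\<integral>\<^sup>+u. ennreal_powr (g (y - snd u)) r \<partial>U) (1 / r))"
    unfolding mixed_qnorm_def by (intro Lp_qnorm_mono inner p0)
  also have "\<dots> \<le> ennreal_powr (\<integral>\<^sup>+u. ennreal_powr (Lp_qnorm q lborel (\<lambda>y. g (y - snd u))) r \<partial>U) (1 / r)"
  proof -
    have [measurable]: "snd \<in> borel_measurable (borel :: ('a \<times> 'b) measure)"
      by (intro borel_measurable_continuous_onI continuous_intros)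
    have "(\<lambda>v. g (snd v - snd (fst v))) \<in> borel_measurable (borel \<Otimes>\<^sub>M borel :: (('a \<times> 'b) \<times> 'b) measure)"
      by measurable
    then have m: "(\<lambda>v. g (snd v - snd (fst v))) \<in> borel_measurable (U \<Otimes>\<^sub>M lborel)"
      by (simp cong: measurable_cong_sets sets_pair_measure_cong add: sU)
    show ?thesis
      using Lp_qnorm_Minkowski[OF U sigma_finite_lborel m r(1,3)] by simp
  qed
  also have "\<dots> = ennreal_powr (\<integral>\<^sup>+u. ennreal_powr (Lp_qnorm q lborel g) r \<partial>U) (1 / r)"
    by (simp add: Lp_qnorm_translate)
  also have "(\<integral>\<^sup>+u. ennreal_powr (Lp_qnorm q lborel g) r \<partial>U)
     = ennreal_powr (Lp_qnorm q lborel g) r * (\<integral>\<^sup>+u. \<kappa> u \<partial>lborel)"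
    by (simp add: U_def emeasure_density)
  also have "ennreal_powr \<dots> (1 / r) = ennreal_powr (\<integral>\<^sup>+u. \<kappa> u \<partial>lborel) (1 / r) * Lp_qnorm q lborel g"
    using r by (simp add: ennreal_powr_mult ennreal_powr_inverse mult.commute)
  finally show ?thesis by (simp add: mixed_qnorm_def g_def[abs_def])
qed

text \<open>Normal form of a weight: the controlling submultiplicative function is replaced by a
  power of 1 + norm, with constant and exponent made explicit for later bookkeeping.\<close>

definition poly_moderate :: "real \<Rightarrow> real \<Rightarrow> ('a::real_normed_vector \<Rightarrow> real) \<Rightarrow> bool" where
  "poly_moderate C s m \<longleftrightarrow> 0 < C \<and> 0 \<le> s \<and> (\<forall>z. 0 \<le> m z) \<and>
     (\<forall>z w. m z \<le> C * decay (- s) (z - w) * m w)"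

lemma poly_moderateD:
  assumes "poly_moderate C s m"
  shows "m z \<le> C * decay (- s) (z - w) * m w" "0 \<le> m z"
  using assms unfolding poly_moderate_def by blast+

text \<open>Moderateness carries the r-th power of the weight under the integral at the price of r s
  powers of decay; the remaining \<open>2 * DIM\<close> powers keep the kernel integrable, which
  explains the bound on \<open>\<sigma>\<close>.\<close>

lemma mixed_qnorm_decay_bound:
  assumes pm: "poly_moderate C s (m :: 'a::euclidean_space \<times> 'b::euclidean_space \<Rightarrow> real)"
    and m[measurable]: "m \<in> borel_measurable borel"
    and r: "0 < r" "ennreal r \<le> p" "ennreal r \<le> q"
    and \<sigma>: "r * s + 2 * DIM('a \<times> 'b) \<le> \<sigma>"
  obtains K where "0 < K" "\<And>F H. F \<in> borel_measurable borel \<Longrightarrow> (\<And>z. 0 \<le> F z) \<Longrightarrow> (\<And>z. 0 \<le> H z) \<Longrightarrow>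
      (\<And>z. ennreal (H z powr r) \<le> (\<integral>\<^sup>+w. ennreal (F w powr r * decay \<sigma> (z - w)) \<partial>lborel)) \<Longrightarrow>
      mixed_qnorm p q lborel lborel (\<lambda>z. ennreal (H z * m z))
      \<le> ennreal K * mixed_qnorm p q lborel lborel (\<lambda>z. ennreal (F z * m z))"
proof -
  define \<kappa> where "\<kappa> = (\<lambda>u::'a \<times> 'b. ennreal (C powr r * decay (\<sigma> - s * r) u))"
  have m0: "0 \<le> m z" for z using pm unfolding poly_moderate_def by blast
  have C: "0 < C" "0 \<le> s" using pm by (auto simp: poly_moderate_def)
  have [measurable]: "\<kappa> \<in> borel_measurable borel" unfolding \<kappa>_def by measurable
  have "(\<integral>\<^sup>+u. \<kappa> u \<partial>lborel) = ennreal (C powr r) * (\<integral>\<^sup>+u. ennreal (decay (\<sigma> - s * r) u) \<partial>(lborel :: ('a \<times> 'b) measure))"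
    unfolding \<kappa>_def by (subst nn_integral_cmult[symmetric]) (auto simp: ennreal_mult)
  also have "\<dots> < top"
    using nn_integral_decay_finite[where 'a = "'a \<times> 'b", of "\<sigma> - s * r"] \<sigma>
    by (auto simp: ennreal_mult_less_top mult.commute)
  finally have fin: "(\<integral>\<^sup>+u. \<kappa> u \<partial>lborel) \<noteq> top" by simp
  define K where "K = enn2real (ennreal_powr (\<integral>\<^sup>+u. \<kappa> u \<partial>lborel) (1 / r)) + 1"
  have K: "0 < K" "ennreal_powr (\<integral>\<^sup>+u. \<kappa> u \<partial>lborel) (1 / r) \<le> ennreal K"
    using fin unfolding K_def
    by (cases "ennreal_powr (\<integral>\<^sup>+u. \<kappa> u \<partial>lborel) (1 / r)"; simp add: add_nonneg_pos ennreal_leI)+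
  show ?thesis
  proof (rule that[OF K(1)])
    fix F H :: "'a \<times> 'b \<Rightarrow> real"
    assume [measurable]: "F \<in> borel_measurable borel" and F: "\<And>z. 0 \<le> F z" and H: "\<And>z. 0 \<le> H z"
      and le: "\<And>z. ennreal (H z powr r) \<le> (\<integral>\<^sup>+w. ennreal (F w powr r * decay \<sigma> (z - w)) \<partial>lborel)"
    define G where "G z = ennreal (F z * m z)" for z
    have [measurable]: "G \<in> borel_measurable borel" unfolding G_def by measurable
    have ptw: "ennreal (H z * m z) \<le> ennreal_powr (\<integral>\<^sup>+u. ennreal_powr (G (z - u)) r * \<kappa> u \<partial>lborel) (1 / r)" for z
    proof -
      have "ennreal_powr (ennreal (H z * m z)) r = ennreal (m z powr r) * ennreal (H z powr r)"
        using H m0 by (simp add: ennreal_powr_ennreal powr_mult mult.commute flip: ennreal_mult)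
      also have "\<dots> \<le> ennreal (m z powr r) * (\<integral>\<^sup>+w. ennreal (F w powr r * decay \<sigma> (z - w)) \<partial>lborel)"
        by (intro mult_left_mono le) auto
      also have "\<dots> = (\<integral>\<^sup>+w. ennreal (m z powr r * (F w powr r * decay \<sigma> (z - w))) \<partial>lborel)"
        by (subst nn_integral_cmult[symmetric]) (auto simp: ennreal_mult)
      also have "\<dots> \<le> (\<integral>\<^sup>+w. ennreal_powr (G w) r * \<kappa> (z - w) \<partial>lborel)"
      proof (intro nn_integral_mono)
        fix w
        have "m z powr r \<le> (C * decay (- s) (z - w) * m w) powr r"
          using pm r m0 by (intro powr_mono2 poly_moderateD less_imp_le) auto
        also have "\<dots> = C powr r * decay (- (s * r)) (z - w) * m w powr r"
          using C m0 by (simp add: powr_mult decay_powr)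
        finally have "m z powr r * (F w powr r * decay \<sigma> (z - w))
          \<le> C powr r * decay (- (s * r)) (z - w) * m w powr r * (F w powr r * decay \<sigma> (z - w))"
          by (intro mult_right_mono) auto
        also have "\<dots> = (F w * m w) powr r * (C powr r * decay (\<sigma> - s * r) (z - w))"
          using F m0 decay_add[of "- (s * r)" \<sigma> "z - w"] by (simp add: powr_mult ac_simps)
        finally show "ennreal (m z powr r * (F w powr r * decay \<sigma> (z - w)))
            \<le> ennreal_powr (G w) r * \<kappa> (z - w)"
          using F m0 by (simp add: G_def \<kappa>_def ennreal_powr_ennreal ennreal_leI flip: ennreal_mult)
      qed
      also have "\<dots> = (\<integral>\<^sup>+u. ennreal_powr (G (z - u)) r * \<kappa> u \<partial>lborel)"
        using nn_integral_reflect[of "\<lambda>w. ennreal_powr (G w) r * \<kappa> (z - w)" z] by simp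
      finally show ?thesis
        using r ennreal_powr_le_swap[of "1 / r" "ennreal (H z * m z)"] by simp
    qed
    have p0: "0 < p" "0 < q" using r by (auto intro: less_le_trans[of _ "ennreal r"])
    have "mixed_qnorm p q lborel lborel (\<lambda>z. ennreal (H z * m z))
       \<le> mixed_qnorm p q lborel lborel (\<lambda>z. ennreal_powr (\<integral>\<^sup>+u. ennreal_powr (G (z - u)) r * \<kappa> u \<partial>lborel) (1 / r))"
      by (intro mixed_qnorm_mono ptw p0)
    also have "\<dots> \<le> ennreal_powr (\<integral>\<^sup>+u. \<kappa> u \<partial>lborel) (1 / r) * mixed_qnorm p q lborel lborel G"
      using fin r by (intro mixed_qnorm_convolution) auto
    also have "\<dots> \<le> ennreal K * mixed_qnorm p q lborel lborel G"
      by (intro mult_right_mono K) auto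
    finally show "mixed_qnorm p q lborel lborel (\<lambda>z. ennreal (H z * m z))
      \<le> ennreal K * mixed_qnorm p q lborel lborel (\<lambda>z. ennreal (F z * m z))" by (simp add: G_def[abs_def])
  qed
qed

text \<open>
  Weights are only Lebesgue measurable, whereas measurability for product measures needs Borel
  functions; a weight is therefore traded for a comparable Borel function, a step function.
\<close>

definition borel_comparable :: "('a::euclidean_space \<Rightarrow> real) \<Rightarrow> bool" where
  "borel_comparable m \<longleftrightarrow> (\<exists>m' c. m' \<in> borel_measurable borel \<and> 0 < c \<and>
     (\<forall>z. m z \<le> c * m' z \<and> m' z \<le> c * m z \<and> 0 \<le> m' z))"

text \<open>The comparable Borel weight is again moderate, with constant \<open>c * C * c\<close>;
  passing to it and back costs a factor c each time.\<close>

lemma mixed_qnorm_decay_bound_weight: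
  fixes m :: "'a::euclidean_space \<times> 'b::euclidean_space \<Rightarrow> real"
  assumes pm: "poly_moderate C s m" and m: "borel_comparable m"
    and r: "0 < r" "ennreal r \<le> p" "ennreal r \<le> q"
    and \<sigma>: "r * s + 2 * DIM('a \<times> 'b) \<le> \<sigma>"
  obtains K where "0 < K" "\<And>F H. F \<in> borel_measurable borel \<Longrightarrow> (\<And>z. 0 \<le> F z) \<Longrightarrow> (\<And>z. 0 \<le> H z) \<Longrightarrow>
      (\<And>z. ennreal (H z powr r) \<le> (\<integral>\<^sup>+w. ennreal (F w powr r * decay \<sigma> (z - w)) \<partial>lborel)) \<Longrightarrow>
      mixed_qnorm p q lborel lborel (\<lambda>z. ennreal (H z * m z))
      \<le> ennreal K * mixed_qnorm p q lborel lborel (\<lambda>z. ennreal (F z * m z))"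
proof -
  obtain m' c where m': "m' \<in> borel_measurable borel" "0 < c"
    and le: "\<And>z. m z \<le> c * m' z" "\<And>z. m' z \<le> c * m z" "\<And>z. 0 \<le> m' z"
    using m unfolding borel_comparable_def by blast
  have C: "0 < C" "0 \<le> s" using pm by (auto simp: poly_moderate_def)
  have "m' z \<le> c * C * c * decay (- s) (z - w) * m' w" for z w
  proof -
    have "m' z \<le> c * m z" by (rule le)
    also have "\<dots> \<le> c * (C * decay (- s) (z - w) * m w)"
    proof (rule mult_left_mono)
      show "m z \<le> C * decay (- s) (z - w) * m w" using pm unfolding poly_moderate_def by blast
    qed (use m' in simp)
    also have "\<dots> \<le> c * (C * decay (- s) (z - w) * (c * m' w))"
      using C m' le by (intro mult_left_mono) auto
    finally show ?thesis by (simp add: ac_simps)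
  qed
  then have pm': "poly_moderate (c * C * c) s m'"
    using C m' le unfolding poly_moderate_def by auto
  from mixed_qnorm_decay_bound[OF pm' m'(1) r \<sigma>] obtain K where K: "0 < K"
    and *: "\<And>F H. F \<in> borel_measurable borel \<Longrightarrow> (\<And>z. 0 \<le> F z) \<Longrightarrow> (\<And>z. 0 \<le> H z) \<Longrightarrow>
      (\<And>z. ennreal (H z powr r) \<le> (\<integral>\<^sup>+w. ennreal (F w powr r * decay \<sigma> (z - w)) \<partial>lborel)) \<Longrightarrow>
      mixed_qnorm p q lborel lborel (\<lambda>z. ennreal (H z * m' z))
      \<le> ennreal K * mixed_qnorm p q lborel lborel (\<lambda>z. ennreal (F z * m' z))" by blast
  have p0: "0 < p" "0 < q" using r by (auto intro: less_le_trans[of _ "ennreal r"])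
  show ?thesis
  proof (rule that[of "c * (K * c)"])
    fix F H :: "'a \<times> 'b \<Rightarrow> real"
    assume F: "F \<in> borel_measurable borel" "\<And>z. 0 \<le> F z" and H: "\<And>z. 0 \<le> H z"
      and b: "\<And>z. ennreal (H z powr r) \<le> (\<integral>\<^sup>+w. ennreal (F w powr r * decay \<sigma> (z - w)) \<partial>lborel)"
    have "mixed_qnorm p q lborel lborel (\<lambda>z. ennreal (H z * m z))
       \<le> ennreal c * mixed_qnorm p q lborel lborel (\<lambda>z. ennreal (H z * m' z))"
    proof (rule mixed_qnorm_le_cmult)
      fix z
      have "H z * m z \<le> c * (H z * m' z)" using mult_left_mono[OF le(1)[of z] H[of z]] by (simp add: ac_simps)
      then show "ennreal (H z * m z) \<le> ennreal c * ennreal (H z * m' z)"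
        using m' H le by (simp add: ennreal_leI flip: ennreal_mult)
    qed (use m' p0 in auto)
    also have "\<dots> \<le> ennreal c * (ennreal K * mixed_qnorm p q lborel lborel (\<lambda>z. ennreal (F z * m' z)))"
      by (intro mult_left_mono * F H b) auto
    also have "\<dots> \<le> ennreal c * (ennreal K * (ennreal c * mixed_qnorm p q lborel lborel (\<lambda>z. ennreal (F z * m z))))"
    proof (intro mult_left_mono mixed_qnorm_le_cmult)
      fix z
      have "F z * m' z \<le> c * (F z * m z)" using mult_left_mono[OF le(2)[of z] F(2)[of z]] by (simp add: ac_simps)
      moreover have "0 \<le> m z" using pm unfolding poly_moderate_def by blast
      ultimately show "ennreal (F z * m' z) \<le> ennreal c * ennreal (F z * m z)"
        using m' F by (simp add: ennreal_leI flip: ennreal_mult)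
    qed (use m' p0 in auto)
    finally show "mixed_qnorm p q lborel lborel (\<lambda>z. ennreal (H z * m z))
      \<le> ennreal (c * (K * c)) * mixed_qnorm p q lborel lborel (\<lambda>z. ennreal (F z * m z))"
      using m' K by (simp add: ennreal_mult mult.assoc)
  qed (use m' K in auto)
qed

lemma weights_poly_moderate:
  assumes "m \<in> weights"
  obtains C s where "poly_moderate C s m"
proof -
  from assms obtain v where m0: "\<And>z. 0 \<le> m z" and v: "submultiplicative v" "polynomial_growth v" "moderate v m"
    unfolding weights_def by blast
  obtain B N where B: "\<And>z. v z \<le> B * (1 + norm z) ^ N"
    using v(2) unfolding polynomial_growth_def by blast
  obtain C where C: "0 < C" "\<And>z w. m (z + w) \<le> C * v z * m w"
    using v(3) unfolding moderate_def by blast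
  have "0 \<le> v 0" using v(1) by (simp add: submultiplicative_def)
  then have B0: "0 \<le> B" using B[of 0] by simp
  \<comment> \<open>B may be zero, whereas the constant in \<open>poly_moderate\<close> has to be
    positive; hence B + 1.\<close>
  have "m z \<le> C * (B + 1) * decay (- real N) (z - w) * m w" for z w
  proof -
    have "m z \<le> C * v (z - w) * m w" using C(2)[of "z - w" w] by simp
    also have "\<dots> \<le> C * ((B + 1) * decay (- real N) (z - w)) * m w"
    proof (intro mult_right_mono mult_left_mono m0)
      have "v (z - w) \<le> B * (1 + norm (z - w)) ^ N" by (rule B)
      also have "\<dots> \<le> (B + 1) * (1 + norm (z - w)) ^ N" by (intro mult_right_mono) auto
      also have "(1 + norm (z - w)) ^ N = decay (- real N) (z - w)"
        unfolding decay_def by (simp add: powr_realpow)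
      finally show "v (z - w) \<le> (B + 1) * decay (- real N) (z - w)" .
    qed (use C in auto)
    finally show ?thesis by (simp add: ac_simps)
  qed
  then have "poly_moderate (C * (B + 1)) (real N) m"
    using C B0 m0 unfolding poly_moderate_def by auto
  then show ?thesis by (rule that)
qed


section \<open>Discretisation by unit cells\<close>

section \<open>Step functions over the lattice\<close>

definition vfloor :: "real ^ 'd \<Rightarrow> int ^ 'd" where
  "vfloor x = (\<chi> i. \<lfloor>x $ i\<rfloor>)"

definition lattice_floor :: "(real ^ 'd) \<times> (real ^ 'd) \<Rightarrow> (int ^ 'd) \<times> (int ^ 'd)" where
  "lattice_floor = map_prod vfloor vfloor"

lemma vfloor_vimage:
  "vfloor -` {k} = {x. \<forall>i. of_int (k $ i) \<le> x $ i \<and> x $ i < of_int (k $ i) + 1}"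
  by (auto simp: vfloor_def vec_eq_iff floor_eq_iff)

text \<open>The half-open cell lies between an open and a closed unit box, both of volume 1.\<close>

lemma emeasure_vfloor_vimage:
  fixes k :: "int ^ 'd"
  shows "vfloor -` {k} \<in> sets borel" "emeasure lborel (vfloor -` {k}) = 1"
proof -
  let ?l = "(\<chi> i. of_int (k $ i)) :: real ^ 'd"
  let ?u = "(\<chi> i. of_int (k $ i) + 1) :: real ^ 'd"
  show *: "vfloor -` {k} \<in> sets borel" unfolding vfloor_vimage by measurable
  have 1: "(?u - ?l) \<bullet> b = 1" "?l \<bullet> b \<le> ?u \<bullet> b" if "b \<in> Basis" for b
    using that by (auto simp: Basis_vec_def inner_axis)
  have "emeasure lborel (box ?l ?u) \<le> emeasure lborel (vfloor -` {k})"
    using * by (intro emeasure_mono) (auto simp: vfloor_vimage mem_box_cart less_imp_le)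
  moreover have "emeasure lborel (box ?l ?u) = 1" by (simp add: 1)
  moreover have "emeasure lborel (vfloor -` {k}) \<le> emeasure lborel (cbox ?l ?u)"
    by (intro emeasure_mono) (auto simp: vfloor_vimage mem_box_cart less_imp_le)
  moreover have "emeasure lborel (cbox ?l ?u) = 1" by (simp add: 1)
  ultimately show "emeasure lborel (vfloor -` {k}) = 1" by (metis antisym)
qed

lemma measurable_vfloor [measurable]: "vfloor \<in> measurable borel (count_space UNIV)"
  by (subst measurable_count_space_eq2_countable) (auto simp: emeasure_vfloor_vimage)

lemma measurable_lattice_floor [measurable]: "lattice_floor \<in> measurable borel (count_space UNIV)"
proof (subst measurable_count_space_eq2_countable, safe)
  fix k n :: "int ^ 'd"
  have "lattice_floor -` {(k, n)} = vfloor -` {k} \<times> vfloor -` {n}"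
    by (auto simp: lattice_floor_def)
  also have "\<dots> \<in> sets (borel \<Otimes>\<^sub>M borel)"
    by (intro pair_measureI emeasure_vfloor_vimage)
  finally show "lattice_floor -` {(k, n)} \<inter> space borel \<in> sets borel"
    by (simp flip: borel_prod)
qed auto

text \<open>Every lattice point has a cell of volume 1. Therefore a discrete quasi-norm equals, with
  no constant, the continuous quasi-norm of a step function.\<close>

lemma distr_vfloor: "distr lborel (count_space UNIV) (vfloor :: real ^ 'd \<Rightarrow> _) = count_space UNIV"
  by (rule measure_eqI_countable[of _ UNIV]) (auto simp: emeasure_distr emeasure_vfloor_vimage)

lemma distr_lattice_floor:
  "distr lborel (count_space UNIV) (lattice_floor :: (real ^ 'd) \<times> (real ^ 'd) \<Rightarrow> _) = count_space UNIV"
proof (rule measure_eqI_countable[of _ UNIV])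
  fix a :: "(int ^ 'd) \<times> (int ^ 'd)"
  obtain k n where a: "a = (k, n)" by (cases a)
  have "emeasure lborel (lattice_floor -` {(k, n)}) = emeasure (lborel \<Otimes>\<^sub>M lborel) (vfloor -` {k} \<times> vfloor -` {n})"
    by (simp add: lborel_prod) (rule arg_cong[where f = "emeasure lborel"], auto simp: lattice_floor_def)
  also have "\<dots> = 1"
    by (subst lborel.emeasure_pair_measure_Times) (auto simp: emeasure_vfloor_vimage)
  finally show "emeasure (distr lborel (count_space UNIV) lattice_floor) {a} = emeasure (count_space UNIV) {a}"
    by (simp add: emeasure_distr a)
qed auto

lemma Lp_qnorm_vfloor:
  "Lp_qnorm p lborel (\<lambda>x. h (vfloor x)) = Lp_qnorm p (count_space UNIV) h"
  by (rule Lp_qnorm_distr) (auto simp: distr_vfloor)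

lemma Lp_qnorm_lattice_floor_comp:
  assumes [measurable]: "T \<in> borel_measurable borel" and T: "distr lborel borel T = lborel"
  shows "Lp_qnorm p lborel (\<lambda>x. h (lattice_floor (T x))) = Lp_qnorm p (count_space UNIV) h"
proof (rule Lp_qnorm_distr)
  have "distr lborel (count_space UNIV) (\<lambda>x. lattice_floor (T x))
      = distr (distr lborel borel T) (count_space UNIV) lattice_floor"
    by (subst distr_distr) (auto simp: comp_def)
  then show "distr lborel (count_space UNIV) (\<lambda>x. lattice_floor (T x)) = count_space UNIV"
    by (simp add: T distr_lattice_floor)
qed auto

lemma mixed_qnorm_lattice_floor:
  "mixed_qnorm p q lborel lborel (\<lambda>z. h (lattice_floor z)) = mixed_qnorm p q (count_space UNIV) (count_space UNIV) h"
proof -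
  have "Lp_qnorm p lborel (\<lambda>x. h (lattice_floor (x, y))) = Lp_qnorm p (count_space UNIV) (\<lambda>k. h (k, vfloor y))" for y
    using Lp_qnorm_vfloor[of p "\<lambda>k. h (k, vfloor y)"] by (simp add: lattice_floor_def)
  then show ?thesis
    unfolding mixed_qnorm_def
    using Lp_qnorm_vfloor[of q "\<lambda>n. Lp_qnorm p (count_space UNIV) (\<lambda>k. h (k, n))"] by simp
qed

text \<open>The quarter turn is the exchange of the two factors followed by a reflection in the
  first one; each preserves the product measure.\<close>

lemma distr_rotate:
  "distr lborel borel (\<lambda>z :: 'a \<times> 'a. (- snd z, fst z)) = (lborel :: ('a::euclidean_space \<times> 'a) measure)"
proof -
  have [measurable]: "fst \<in> borel_measurable (borel :: ('a \<times> 'a) measure)" "snd \<in> borel_measurable (borel :: ('a \<times> 'a) measure)"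
    by (intro borel_measurable_continuous_onI continuous_intros)+
  have neg: "distr lborel borel uminus = (lborel :: 'a measure)"
    using lborel_distr_reflect[of 0] by simp
  have "(lborel :: ('a \<times> 'a) measure) = distr (lborel \<Otimes>\<^sub>M lborel) (lborel \<Otimes>\<^sub>M lborel) (\<lambda>(x, y). (y, x))"
    by (subst lborel_pair.distr_pair_swap[symmetric]) (simp add: lborel_prod)
  also have "\<dots> = distr lborel borel (\<lambda>z :: 'a \<times> 'a. (snd z, fst z))"
    unfolding lborel_prod split_beta' by (rule distr_cong) auto
  finally have swap: "distr lborel borel (\<lambda>z :: 'a \<times> 'a. (snd z, fst z)) = lborel" by simp
  have id: "distr lborel borel (\<lambda>x. x) = (lborel :: 'a measure)"
    by (simp add: distr_id2)
  have "(lborel :: ('a \<times> 'a) measure) = distr (lborel :: 'a measure) borel uminus \<Otimes>\<^sub>M distr (lborel :: 'a measure) borel (\<lambda>x. x)"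
    unfolding neg id by (rule lborel_prod[symmetric])
  also have "\<dots> = distr (lborel \<Otimes>\<^sub>M lborel) (borel \<Otimes>\<^sub>M borel) (\<lambda>(x, y). (- x, y))"
    by (rule pair_measure_distr) (auto simp: id sigma_finite_lborel)
  finally have flip: "distr lborel borel (\<lambda>z :: 'a \<times> 'a. (- fst z, snd z)) = lborel"
    unfolding lborel_prod borel_prod split_beta' by (rule sym)
  have "distr (distr lborel borel (\<lambda>z :: 'a \<times> 'a. (snd z, fst z))) borel (\<lambda>z. (- fst z, snd z))
      = distr lborel borel (\<lambda>z :: 'a \<times> 'a. (- snd z, fst z))"
    by (subst distr_distr) (auto simp: comp_def)
  then show ?thesis unfolding swap flip by (rule sym)
qed

text \<open>Rounding down moves each of the 2d coordinates by at most 1, and the l1 norm dominates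
  the Euclidean one. This bound is the radius \<open>?R\<close> of the later proofs.\<close>

lemma norm_minus_lattice_point:
  fixes z :: "(real ^ 'd) \<times> (real ^ 'd)"
  shows "norm (z - lattice_point (lattice_floor z)) \<le> 2 * real CARD('d)"
proof -
  have *: "norm (x - (\<chi> i. of_int (vfloor x $ i))) \<le> CARD('d)" for x :: "real ^ 'd"
  proof -
    have "norm (x - (\<chi> i. of_int (vfloor x $ i))) \<le> (\<Sum>i\<in>UNIV. \<bar>(x - (\<chi> i. of_int (vfloor x $ i))) $ i\<bar>)"
      by (rule norm_le_l1_cart)
    also have "\<dots> \<le> (\<Sum>i\<in>(UNIV :: 'd set). 1)"
    proof (rule sum_mono)
      fix i show "\<bar>(x - (\<chi> i. of_int (vfloor x $ i))) $ i\<bar> \<le> 1"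
        unfolding vfloor_def using floor_correct[of "x $ i"] by simp linarith
    qed
    finally show ?thesis by simp
  qed
  obtain x y where z: "z = (x, y)" by (cases z)
  have "norm (z - lattice_point (lattice_floor z))
    \<le> norm (x - (\<chi> i. of_int (vfloor x $ i))) + norm (y - (\<chi> i. of_int (vfloor y $ i)))"
    unfolding z lattice_floor_def lattice_point_def by (simp add: norm_Pair) (rule sqrt_sum_squares_le_sum; simp)
  also have "\<dots> \<le> 2 * real CARD('d)" using *[of x] *[of y] by simp
  finally show ?thesis .
qed

lemma lattice_point_diff: "lattice_point (k - n) = lattice_point k - lattice_point n"
  by (auto simp: lattice_point_def vec_eq_iff split_beta')

lemma lattice_point_minus: "lattice_point (- k) = - lattice_point k"
  by (auto simp: lattice_point_def vec_eq_iff split_beta')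

text \<open>A moderate weight oscillates by at most a fixed factor over a cell, so it is comparable
  to its own step function.\<close>

lemma borel_comparable_lattice:
  fixes m :: "(real ^ 'd) \<times> (real ^ 'd) \<Rightarrow> real"
  assumes pm: "poly_moderate C s m"
  shows "\<exists>c>0. \<forall>z. m z \<le> c * m (lattice_point (lattice_floor z)) \<and> m (lattice_point (lattice_floor z)) \<le> c * m z"
proof -
  let ?R = "2 * real CARD('d)"
  have C: "0 < C" "0 \<le> s" using pm by (auto simp: poly_moderate_def)
  have m0: "0 \<le> m z" for z using pm unfolding poly_moderate_def by blast
  have d: "decay (- s) (x :: (real ^ 'd) \<times> (real ^ 'd)) \<le> (1 + ?R) powr s" if "norm x \<le> ?R" for x
    using that C by (simp add: decay_def powr_mono2)
  have close: "m z \<le> C * (1 + ?R) powr s * m w" if "norm (z - w) \<le> ?R" for z w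
  proof -
    have "m z \<le> C * decay (- s) (z - w) * m w" using pm unfolding poly_moderate_def by blast
    also have "\<dots> \<le> C * (1 + ?R) powr s * m w"
      using C m0 d[OF that] by (intro mult_right_mono mult_left_mono) auto
    finally show ?thesis .
  qed
  show ?thesis
  proof (intro exI[of _ "C * (1 + ?R) powr s"] conjI allI close)
    show "0 < C * (1 + ?R) powr s" using C by (simp add: add_pos_nonneg)
  qed (use norm_minus_lattice_point in \<open>auto simp: norm_minus_commute\<close>)
qed

lemma borel_comparable_moderate:
  fixes m :: "(real ^ 'd) \<times> (real ^ 'd) \<Rightarrow> real"
  assumes pm: "poly_moderate C s m"
  shows "borel_comparable m" "borel_comparable (one_tensor m :: 'a::euclidean_space \<times> _ \<Rightarrow> real)"
proof -
  from borel_comparable_lattice[OF pm] obtain c where c: "0 < c"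
    "\<And>z. m z \<le> c * m (lattice_point (lattice_floor z))" "\<And>z. m (lattice_point (lattice_floor z)) \<le> c * m z"
    by blast
  have m0: "0 \<le> m z" for z using pm unfolding poly_moderate_def by blast
  have [measurable]: "(\<lambda>z. m (lattice_point (lattice_floor z))) \<in> borel_measurable borel"
    by (rule measurable_compose[OF measurable_lattice_floor]) simp
  have [measurable]: "snd \<in> borel_measurable (borel :: ('a \<times> ((real ^ 'd) \<times> (real ^ 'd))) measure)"
    by (intro borel_measurable_continuous_onI continuous_intros)
  show "borel_comparable m"
    unfolding borel_comparable_def using c m0
    by (intro exI[of _ "\<lambda>z. m (lattice_point (lattice_floor z))"] exI[of _ c]) auto
  have "(\<lambda>z :: 'a \<times> _. m (lattice_point (lattice_floor (snd z)))) \<in> borel_measurable borel"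
    by measurable
  then show "borel_comparable (one_tensor m :: 'a \<times> _ \<Rightarrow> real)"
    unfolding borel_comparable_def using c m0
    by (intro exI[of _ "\<lambda>z. m (lattice_point (lattice_floor (snd z)))"] exI[of _ c])
       (auto simp: one_tensor_def)
qed

lemma poly_moderate_one_tensor:
  assumes pm: "poly_moderate C s m"
  shows "poly_moderate C s (one_tensor m :: 'a::real_normed_vector \<times> 'b::real_normed_vector \<Rightarrow> real)"
proof -
  have C: "0 < C" "0 \<le> s" using pm by (auto simp: poly_moderate_def)
  have m0: "0 \<le> m z" for z using pm unfolding poly_moderate_def by blast
  have "m (snd z) \<le> C * decay (- s) (z - w) * m (snd w)" for z w :: "'a \<times> 'b"
  proof -
    have "m (snd z) \<le> C * decay (- s) (snd z - snd w) * m (snd w)"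
      using pm unfolding poly_moderate_def by blast
    also have "\<dots> \<le> C * decay (- s) (z - w) * m (snd w)"
    proof (intro mult_right_mono mult_left_mono m0)
      have "norm (snd z - snd w) \<le> norm (z - w)"
        by (metis norm_snd_le prod.collapse snd_diff)
      then show "decay (- s) (snd z - snd w) \<le> decay (- s) (z - w)"
        using C by (simp add: decay_def powr_mono2)
    qed (use C in simp)
    finally show ?thesis .
  qed
  then show ?thesis using C m0 by (simp add: poly_moderate_def one_tensor_def split_beta')
qed


section \<open>Schwartz functions, Fourier transforms and Parseval's identity\<close>

section \<open>Schwartz functions\<close>

abbreviation partial_deriv :: "'a::euclidean_space \<Rightarrow> ('a \<Rightarrow> complex) \<Rightarrow> 'a \<Rightarrow> complex" where
  "partial_deriv b f \<equiv> \<lambda>x. frechet_derivative f (at x) b"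

lemma partial_derivs_append:
  "partial_derivs (bs @ cs) f = partial_derivs bs (partial_derivs cs f)"
  by (induction bs) auto

lemma schwartz_differentiable: "f \<in> schwartz \<Longrightarrow> f differentiable (at x)"
  unfolding schwartz_def using partial_derivs.simps(1) by (metis (mono_tags, lifting) empty_set empty_subsetI mem_Collect_eq)

lemma schwartz_has_derivative:
  "f \<in> schwartz \<Longrightarrow> (f has_derivative frechet_derivative f (at x)) (at x)"
  using schwartz_differentiable frechet_derivative_works by blast

lemma schwartz_partial_deriv:
  assumes "f \<in> schwartz" "b \<in> Basis"
  shows "partial_deriv b f \<in> schwartz"
proof -
  have "partial_derivs bs (partial_deriv b f) = partial_derivs (bs @ [b]) f" for bs
    by (simp add: partial_derivs_append)
  moreover have "set (bs @ [b]) \<subseteq> Basis" if "set bs \<subseteq> Basis" for bs using that assms by simp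
  ultimately show ?thesis using assms(1) unfolding schwartz_def mem_Collect_eq by metis
qed

text \<open>
  Membership in the Schwartz space is proved by coinduction: it suffices to exhibit a family of
  rapidly decreasing functions whose partial derivatives are combinations of family members.
\<close>

inductive_set combinations :: "('a \<Rightarrow> complex) set \<Rightarrow> ('a \<Rightarrow> complex) set"
  for X :: "('a \<Rightarrow> complex) set" where
  base: "f \<in> X \<Longrightarrow> f \<in> combinations X"
| add: "f \<in> combinations X \<Longrightarrow> g \<in> combinations X \<Longrightarrow> (\<lambda>x. f x + g x) \<in> combinations X"
| scale: "f \<in> combinations X \<Longrightarrow> (\<lambda>x. c * f x) \<in> combinations X"

lemma schwartz_coinduct:
  fixes X :: "('a::euclidean_space \<Rightarrow> complex) set"
  assumes bound: "\<And>f k. f \<in> X \<Longrightarrow> \<exists>B. \<forall>x. norm x ^ k * norm (f x) \<le> B"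
    and deriv: "\<And>f. f \<in> X \<Longrightarrow> \<exists>D. (\<forall>x. (f has_derivative D x) (at x)) \<and>
        (\<forall>b\<in>Basis. (\<lambda>x. D x b) \<in> combinations X)"
    and f: "f \<in> combinations X"
  shows "f \<in> schwartz"
proof -
  \<comment> \<open>Rapid decrease and the closure of derivatives pass from the family to its
    combinations; since partial derivatives of combinations are again combinations, both then hold
    at every order.\<close>
  have step: "(\<exists>D. (\<forall>x. (f has_derivative D x) (at x)) \<and> (\<forall>b\<in>Basis. (\<lambda>x. D x b) \<in> combinations X))
    \<and> (\<forall>k. \<exists>B. \<forall>x. norm x ^ k * norm (f x) \<le> B)" if "f \<in> combinations X" for f
    using that
  proof induction
    case (base f)
    then show ?case using deriv bound by blast
  next
    case (add f g)
    then obtain D E where D: "\<And>x. (f has_derivative D x) (at x)" "\<And>b. b \<in> Basis \<Longrightarrow> (\<lambda>x. D x b) \<in> combinations X"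
      and E: "\<And>x. (g has_derivative E x) (at x)" "\<And>b. b \<in> Basis \<Longrightarrow> (\<lambda>x. E x b) \<in> combinations X"
      by blast
    have "\<exists>B. \<forall>x. norm x ^ k * norm (f x + g x) \<le> B" for k
    proof -
      obtain B B' where "\<And>x. norm x ^ k * norm (f x) \<le> B" "\<And>x. norm x ^ k * norm (g x) \<le> B'"
        using add by blast
      then have "norm x ^ k * norm (f x + g x) \<le> B + B'" for x
        using norm_triangle_ineq[of "f x" "g x"]
        by (smt (verit) distrib_left mult_left_mono norm_ge_zero zero_le_power)
      then show ?thesis by blast
    qed
    then show ?case using D E
      by (auto intro!: exI[of _ "\<lambda>x h. D x h + E x h"] derivative_intros combinations.add)
  next
    case (scale f c)
    then obtain D where D: "\<And>x. (f has_derivative D x) (at x)" "\<And>b. b \<in> Basis \<Longrightarrow> (\<lambda>x. D x b) \<in> combinations X"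
      by blast
    have "\<exists>B. \<forall>x. norm x ^ k * norm (c * f x) \<le> B" for k
    proof -
      obtain B where "\<And>x. norm x ^ k * norm (f x) \<le> B" using scale by blast
      then have "norm c * (norm x ^ k * norm (f x)) \<le> norm c * B" for x by (intro mult_left_mono) auto
      then show ?thesis by (intro exI[of _ "norm c * B"]) (simp add: norm_mult ac_simps)
    qed
    then show ?case using D
      by (auto intro!: exI[of _ "\<lambda>x h. c * D x h"] derivative_eq_intros combinations.scale)
  qed
  have partial: "partial_deriv b f \<in> combinations X" if "f \<in> combinations X" "b \<in> Basis" for f b
  proof -
    obtain D where D: "\<And>x. (f has_derivative D x) (at x)" "\<And>b. b \<in> Basis \<Longrightarrow> (\<lambda>x. D x b) \<in> combinations X"
      using step \<open>f \<in> combinations X\<close> by blast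
    have "frechet_derivative f (at x) = D x" for x using frechet_derivative_at[OF D(1)] by simp
    then show ?thesis using D(2)[OF that(2)] by simp
  qed
  have *: "partial_derivs bs f \<in> combinations X" if "set bs \<subseteq> Basis" for bs
    using that by (induction bs) (auto intro: f partial)
  show ?thesis
    unfolding schwartz_def
  proof (intro CollectI allI impI conjI)
    fix bs :: "'a list" assume bs: "set bs \<subseteq> Basis"
    from step[OF *[OF bs]] show "partial_derivs bs f differentiable at x" for x
      unfolding differentiable_def by blast
    fix k :: nat
    from step[OF *[OF bs]] obtain B where "\<And>x. norm x ^ k * norm (partial_derivs bs f x) \<le> B" by blast
    then show "bounded (range (\<lambda>x. norm x ^ k * norm (partial_derivs bs f x)))"
      by (intro boundedI[of _ B]) auto
  qed
qed

lemma decay_imp_power_bound: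
  fixes f :: "'a::real_normed_vector \<Rightarrow> complex"
  assumes "\<And>s. \<exists>C. \<forall>x. norm (f x) \<le> C * decay s x"
  shows "\<exists>B. \<forall>x. norm x ^ k * norm (f x) \<le> B"
proof -
  obtain C where C: "\<And>x. norm (f x) \<le> C * decay (real k) x" using assms by blast
  have "norm x ^ k * norm (f x) \<le> C" for x
  proof -
    have "norm x ^ k * norm (f x) \<le> (1 + norm x) ^ k * (C * decay (real k) x)"
      using C by (intro mult_mono power_mono) auto
    also have "\<dots> = C" unfolding decay_def by (simp add: powr_minus powr_realpow)
    finally show ?thesis .
  qed
  then show ?thesis by blast
qed

text \<open>Only the moments of order 0 and k enter, because (1 + t)^k \<le> 2^k (1 + t^k) for t
  \<ge> 0.\<close>

lemma schwartz_decay: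
  assumes "f \<in> schwartz"
  obtains C where "0 < C" "\<And>x. norm (f x) \<le> C * decay s x"
proof -
  define k where "k = nat \<lceil>s\<rceil>"
  have k: "s \<le> real k" unfolding k_def by linarith
  have "bounded (range (\<lambda>x. norm x ^ j * norm (f x)))" for j
    using assms unfolding schwartz_def by (auto dest!: spec[of _ "[]"])
  then have "\<exists>B. \<forall>x. norm x ^ j * norm (f x) \<le> B" for j
    unfolding bounded_iff by fastforce
  then obtain B where B: "\<And>j x. norm x ^ j * norm (f x) \<le> B j" by metis
  define C where "C = 2 ^ k * (\<bar>B 0\<bar> + \<bar>B k\<bar>) + 1"
  have "norm (f x) \<le> C * decay s x" for x
  proof -
    have "(1 + norm x) ^ k \<le> 2 ^ k * (1 + norm x ^ k)"
    proof (cases "norm x \<le> 1")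
      case True
      then have "(1 + norm x) ^ k \<le> 2 ^ k" by (intro power_mono) auto
      also have "\<dots> \<le> 2 ^ k * (1 + norm x ^ k)" by simp
      finally show ?thesis .
    next
      case False
      then have "(1 + norm x) ^ k \<le> (2 * norm x) ^ k" by (intro power_mono) auto
      also have "\<dots> \<le> 2 ^ k * (1 + norm x ^ k)" by (simp add: power_mult_distrib)
      finally show ?thesis .
    qed
    then have "(1 + norm x) ^ k * norm (f x) \<le> 2 ^ k * (1 + norm x ^ k) * norm (f x)"
      by (intro mult_right_mono) auto
    also have "\<dots> = 2 ^ k * (norm x ^ 0 * norm (f x) + norm x ^ k * norm (f x))" by (simp add: algebra_simps)
    also have "\<dots> \<le> 2 ^ k * (\<bar>B 0\<bar> + \<bar>B k\<bar>)"
      using B[of x 0] B[of x k] by (intro mult_left_mono) (auto simp: abs_le_iff)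
    also have "\<dots> \<le> C" by (simp add: C_def)
    finally have "(1 + norm x) ^ k * norm (f x) \<le> C" .
    then have "norm (f x) \<le> C * decay (real k) x"
      unfolding decay_def by (simp add: powr_minus powr_realpow field_simps)
    also have "\<dots> \<le> C * decay s x" using k by (intro mult_left_mono decay_mono) (auto simp: C_def)
    finally show ?thesis .
  qed
  moreover have "0 < C" by (simp add: C_def add_nonneg_pos)
  ultimately show ?thesis using that by blast
qed

lemma schwartz_power_bound:
  assumes "f \<in> schwartz"
  shows "\<exists>B. \<forall>x. norm x ^ k * norm (f x) \<le> B"
proof (rule decay_imp_power_bound)
  fix s show "\<exists>C. \<forall>x. norm (f x) \<le> C * decay s x" using schwartz_decay[OF assms] by metis
qed

lemma schwartz_continuous: "f \<in> schwartz \<Longrightarrow> continuous_on S f"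
  by (meson continuous_at_imp_continuous_on differentiable_imp_continuous_within schwartz_differentiable)

lemma schwartz_borel_measurable: "f \<in> schwartz \<Longrightarrow> f \<in> borel_measurable borel"
  by (intro borel_measurable_continuous_onI schwartz_continuous)

lemma schwartz_integrable: "f \<in> schwartz \<Longrightarrow> integrable lborel f"
  by (metis integrable_bounded_decay order_refl schwartz_borel_measurable schwartz_decay)

lemma linear_eq_sum_Basis:
  fixes D :: "'a::euclidean_space \<Rightarrow> complex"
  assumes "bounded_linear D"
  shows "D h = (\<Sum>b\<in>Basis. complex_of_real (h \<bullet> b) * D b)"
proof -
  interpret bounded_linear D by fact
  have "D h = D (\<Sum>b\<in>Basis. (h \<bullet> b) *\<^sub>R b)" by (simp add: euclidean_representation)
  also have "\<dots> = (\<Sum>b\<in>Basis. complex_of_real (h \<bullet> b) * D b)"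
    by (simp add: sum scaleR scaleR_conv_of_real)
  finally show ?thesis .
qed

lemma schwartz_derivative_decay:
  assumes "f \<in> schwartz"
  obtains C where "0 < C" "\<And>x h. norm (frechet_derivative f (at x) h) \<le> C * decay s x * norm h"
proof -
  have "\<exists>C. 0 < C \<and> (\<forall>x. norm (partial_deriv b f x) \<le> C * decay s x)" if "b \<in> Basis" for b
    using schwartz_decay[OF schwartz_partial_deriv[OF assms that]] by metis
  then obtain C where C: "\<And>b. b \<in> Basis \<Longrightarrow> 0 < C b"
    "\<And>b x. b \<in> Basis \<Longrightarrow> norm (partial_deriv b f x) \<le> C b * decay s x" by metis
  show ?thesis
  proof (rule that[of "\<Sum>b\<in>Basis. C b"])
    show "0 < (\<Sum>b\<in>Basis. C b)" using C by (intro sum_pos) auto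
    fix x h
    have "frechet_derivative f (at x) h = (\<Sum>b\<in>Basis. complex_of_real (h \<bullet> b) * partial_deriv b f x)"
      by (rule linear_eq_sum_Basis) (rule has_derivative_bounded_linear[OF schwartz_has_derivative[OF assms]])
    also have "norm \<dots> \<le> (\<Sum>b\<in>Basis. norm h * (C b * decay s x))"
    proof (rule sum_norm_le)
      fix b :: 'a assume "b \<in> Basis"
      then show "norm (complex_of_real (h \<bullet> b) * partial_deriv b f x) \<le> norm h * (C b * decay s x)"
        unfolding norm_mult using C(2)[of b x] Basis_le_norm[of b h] by (intro mult_mono) auto
    qed
    also have "\<dots> = (\<Sum>b\<in>Basis. C b) * decay s x * norm h"
      by (simp add: sum_distrib_right sum_distrib_left ac_simps)
    finally show "norm (frechet_derivative f (at x) h) \<le> (\<Sum>b\<in>Basis. C b) * decay s x * norm h" .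
  qed
qed

text \<open>Coinduction with the Schwartz space itself as the family, which is stable under partial
  derivatives; closure under sums and multiples follows.\<close>

lemma combinations_schwartz:
  assumes "f \<in> combinations (schwartz :: ('a::euclidean_space \<Rightarrow> complex) set)"
  shows "f \<in> schwartz"
  using schwartz_power_bound _ assms
proof (rule schwartz_coinduct)
  fix f :: "'a \<Rightarrow> complex" assume f: "f \<in> schwartz"
  then show "\<exists>D. (\<forall>x. (f has_derivative D x) (at x)) \<and> (\<forall>b\<in>Basis. (\<lambda>x. D x b) \<in> combinations schwartz)"
    by (intro exI[of _ "\<lambda>x. frechet_derivative f (at x)"])
       (auto intro!: schwartz_has_derivative combinations.base schwartz_partial_deriv)
qed

lemma schwartz_add:
  "f \<in> schwartz \<Longrightarrow> g \<in> schwartz \<Longrightarrow> (\<lambda>x. f x + g x) \<in> schwartz"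
  by (rule combinations_schwartz) (intro combinations.add combinations.base)

lemma schwartz_scale: "f \<in> schwartz \<Longrightarrow> (\<lambda>x. c * f x) \<in> schwartz"
  by (rule combinations_schwartz) (intro combinations.scale combinations.base)

lemma schwartz_zero: "(\<lambda>_. 0) \<in> schwartz"
  by (rule schwartz_coinduct[of "{\<lambda>_. 0}"])
     (auto intro!: combinations.base exI[of _ "\<lambda>_ _. 0"] exI[of _ 0])

lemma schwartz_sum:
  "(\<And>i. i \<in> I \<Longrightarrow> f i \<in> schwartz) \<Longrightarrow> (\<lambda>x. \<Sum>i\<in>I. f i x) \<in> schwartz"
  by (induction I rule: infinite_finite_induct) (auto intro: schwartz_zero schwartz_add)

lemma schwartz_translate:
  assumes "f \<in> schwartz"
  shows "translate c f \<in> schwartz"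
proof (rule schwartz_coinduct[of "translate c ` schwartz"])
  fix g assume "g \<in> translate c ` schwartz"
  then obtain f where f: "f \<in> schwartz" "g = (\<lambda>x. f (x - c))" by (auto simp: translate_def)
  show "\<exists>B. \<forall>x. norm x ^ k * norm (g x) \<le> B" for k
  proof (rule decay_imp_power_bound)
    fix s :: real
    obtain C where C: "0 < C" "\<And>x. norm (f x) \<le> C * decay \<bar>s\<bar> x" using schwartz_decay[OF f(1)] by metis
    have "norm (g x) \<le> (C / decay \<bar>s\<bar> c) * decay s x" for x
    proof -
      have "norm (g x) * decay \<bar>s\<bar> c \<le> C * decay \<bar>s\<bar> (x - c) * decay \<bar>s\<bar> c"
        using C(2)[of "x - c"] f(2) by (intro mult_right_mono) auto
      also have "\<dots> \<le> C * decay \<bar>s\<bar> x"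
        using decay_triangle[of "\<bar>s\<bar>" "x - c" c] C by (simp add: mult.assoc)
      also have "\<dots> \<le> C * decay s x" using C by (intro mult_left_mono decay_mono) auto
      finally show ?thesis by (simp add: field_simps)
    qed
    then show "\<exists>C. \<forall>x. norm (g x) \<le> C * decay s x" by blast
  qed
  show "\<exists>D. (\<forall>x. (g has_derivative D x) (at x)) \<and> (\<forall>b\<in>Basis. (\<lambda>x. D x b) \<in> combinations (translate c ` schwartz))"
  proof (intro exI[of _ "\<lambda>x. frechet_derivative f (at (x - c))"] conjI allI ballI)
    fix x
    have "((\<lambda>x. f (x - c)) has_derivative (\<lambda>h. frechet_derivative f (at (x - c)) (h - 0))) (at x)"
      by (rule has_derivative_compose[OF _ schwartz_has_derivative[OF f(1)]]) (auto intro!: derivative_eq_intros)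
    then show "(g has_derivative frechet_derivative f (at (x - c))) (at x)" by (simp add: f(2))
  next
    fix b :: 'a assume b: "b \<in> Basis"
    show "(\<lambda>x. frechet_derivative f (at (x - c)) b) \<in> combinations (translate c ` schwartz)"
      by (rule combinations.base, rule image_eqI[OF _ schwartz_partial_deriv[OF f(1) b]])
         (simp add: translate_def)
  qed
qed (use assms in \<open>auto intro: combinations.base\<close>)

lemma has_derivative_cis_inner:
  fixes \<xi> :: "'a::euclidean_space"
  shows "((\<lambda>t. cis (a * (t \<bullet> \<xi>))) has_derivative (\<lambda>h. complex_of_real (a * (h \<bullet> \<xi>)) * (\<i> * cis (a * (x \<bullet> \<xi>))))) (at x)"
proof -
  have "((\<lambda>t. a * (t \<bullet> \<xi>)) has_derivative (\<lambda>h. a * (h \<bullet> \<xi>))) (at x)"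
    by (auto intro!: derivative_eq_intros)
  from has_derivative_cis[OF this] show ?thesis by (simp add: scaleR_conv_of_real)
qed

lemma schwartz_modulate:
  fixes f :: "'a::euclidean_space \<Rightarrow> complex"
  assumes "f \<in> schwartz"
  shows "modulate \<xi> f \<in> schwartz"
proof (rule schwartz_coinduct[of "modulate \<xi> ` schwartz"])
  fix g assume "g \<in> modulate \<xi> ` schwartz"
  then obtain f where f: "f \<in> schwartz" "g = (\<lambda>t. cis (2 * pi * (t \<bullet> \<xi>)) * f t)" by (auto simp: modulate_def)
  show "\<exists>B. \<forall>x. norm x ^ k * norm (g x) \<le> B" for k
    using schwartz_power_bound[OF f(1), of k] by (simp add: f(2) norm_mult)
  let ?D = "\<lambda>x h. cis (2 * pi * (x \<bullet> \<xi>)) * frechet_derivative f (at x) h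
      + complex_of_real (2 * pi * (h \<bullet> \<xi>)) * (\<i> * cis (2 * pi * (x \<bullet> \<xi>))) * f x"
  show "\<exists>D. (\<forall>x. (g has_derivative D x) (at x)) \<and> (\<forall>b\<in>Basis. (\<lambda>x. D x b) \<in> combinations (modulate \<xi> ` schwartz))"
  proof (intro exI[of _ ?D] conjI allI ballI)
    fix x
    show "(g has_derivative ?D x) (at x)" unfolding f(2)
      by (rule has_derivative_mult has_derivative_cis_inner schwartz_has_derivative[OF f(1)])+
  next
    fix b :: 'a assume b: "b \<in> Basis"
    have "(\<lambda>x. modulate \<xi> (partial_deriv b f) x + (complex_of_real (2 * pi * (b \<bullet> \<xi>)) * \<i>) * modulate \<xi> f x)
        \<in> combinations (modulate \<xi> ` schwartz)"
      using schwartz_partial_deriv[OF f(1) b] f(1) by (intro combinations.add combinations.scale combinations.base) auto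
    then show "(\<lambda>x. ?D x b) \<in> combinations (modulate \<xi> ` schwartz)"
      by (simp add: modulate_def ac_simps)
  qed
qed (use assms in \<open>auto intro: combinations.base\<close>)

lemma schwartz_mult_inner:
  fixes f :: "'a::euclidean_space \<Rightarrow> complex"
  assumes "f \<in> schwartz"
  shows "(\<lambda>x. complex_of_real (x \<bullet> c) * f x) \<in> schwartz"
proof -
  let ?M = "\<lambda>f x. complex_of_real (x \<bullet> c) * f x"
  \<comment> \<open>The product rule leaves a term without the linear factor, so the family must
    also contain the Schwartz functions themselves.\<close>
  let ?X = "?M ` schwartz \<union> schwartz"
  show ?thesis
  proof (rule schwartz_coinduct[of ?X])
    fix g assume "g \<in> ?X"
    then consider "g \<in> schwartz" | f where "f \<in> schwartz" "g = ?M f" by blast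
    note g = this
    show "\<exists>B. \<forall>x. norm x ^ k * norm (g x) \<le> B" for k
      using g
    proof cases
      case (2 f)
      obtain B where B: "\<And>x. norm x ^ Suc k * norm (f x) \<le> B" using schwartz_power_bound[OF 2(1)] by blast
      have "norm x ^ k * norm (g x) \<le> norm c * B" for x
      proof -
        have "norm x ^ k * norm (g x) \<le> norm x ^ k * ((norm x * norm c) * norm (f x))"
          unfolding 2 norm_mult by (intro mult_left_mono mult_right_mono) (auto simp: Cauchy_Schwarz_ineq2)
        also have "\<dots> = norm c * (norm x ^ Suc k * norm (f x))" by simp
        also have "\<dots> \<le> norm c * B" using B by (intro mult_left_mono) auto
        finally show ?thesis .
      qed
      then show ?thesis by blast
    qed (rule schwartz_power_bound)
    show "\<exists>D. (\<forall>x. (g has_derivative D x) (at x)) \<and> (\<forall>b\<in>Basis. (\<lambda>x. D x b) \<in> combinations ?X)"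
      using g
    proof cases
      case 1
      then show ?thesis
        by (intro exI[of _ "\<lambda>x. frechet_derivative g (at x)"])
           (auto intro!: schwartz_has_derivative combinations.base schwartz_partial_deriv)
    next
      case (2 f)
      let ?D = "\<lambda>x h. complex_of_real (x \<bullet> c) * frechet_derivative f (at x) h + complex_of_real (h \<bullet> c) * f x"
      show ?thesis
      proof (intro exI[of _ ?D] conjI allI ballI)
        fix x
        have "((\<lambda>x. complex_of_real (x \<bullet> c)) has_derivative (\<lambda>h. complex_of_real (h \<bullet> c))) (at x)"
          by (auto intro!: derivative_eq_intros)
        then show "(g has_derivative ?D x) (at x)" unfolding 2
          by (rule has_derivative_mult[OF _ schwartz_has_derivative[OF 2(1)]])
      next
        fix b :: 'a assume b: "b \<in> Basis"
        show "(\<lambda>x. ?D x b) \<in> combinations ?X"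
          using schwartz_partial_deriv[OF 2(1) b] 2(1)
          by (intro combinations.add combinations.scale combinations.base) auto
      qed
    qed
  qed (use assms in \<open>auto intro: combinations.base\<close>)
qed


text \<open>One statement for all kernels that occur: those of the short-time Fourier transform and
  of the Wigner distribution are f(A z) cnj(g(B z)) with (A, B) an invertible linear change of
  variables. Invertibility bounds norm z by norm (A z) + norm (B z), so decay of the two factors
  becomes decay in z.\<close>

lemma schwartz_tensor:
  fixes f g :: "'a::euclidean_space \<Rightarrow> complex" and \<alpha> \<beta> \<gamma> \<delta> :: real
  assumes fg: "f \<in> schwartz" "g \<in> schwartz" and det: "\<alpha> * \<delta> - \<beta> * \<gamma> \<noteq> 0"
  shows "(\<lambda>z. f (\<alpha> *\<^sub>R fst z + \<beta> *\<^sub>R snd z) * cnj (g (\<gamma> *\<^sub>R fst z + \<delta> *\<^sub>R snd z))) \<in> schwartz"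
proof -
  define A B :: "'a \<times> 'a \<Rightarrow> 'a"
    where "A z = \<alpha> *\<^sub>R fst z + \<beta> *\<^sub>R snd z" and "B z = \<gamma> *\<^sub>R fst z + \<delta> *\<^sub>R snd z" for z
  define T where "T f g = (\<lambda>z. f (A z) * cnj (g (B z)))" for f g :: "'a \<Rightarrow> complex"
  let ?X = "{T f g |f g. f \<in> schwartz \<and> g \<in> schwartz}"
  let ?\<Delta> = "\<bar>\<alpha> * \<delta> - \<beta> * \<gamma>\<bar>"
  define M where "M = (\<bar>\<alpha>\<bar> + \<bar>\<beta>\<bar> + \<bar>\<gamma>\<bar> + \<bar>\<delta>\<bar>) / ?\<Delta>"
  \<comment> \<open>Cramer's rule: both components of z times the determinant are combinations of A
    z and B z.\<close>
  have nz: "norm z \<le> M * (norm (A z) + norm (B z))" for z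
  proof -
    have "(\<alpha> * \<delta> - \<beta> * \<gamma>) *\<^sub>R fst z = \<delta> *\<^sub>R A z - \<beta> *\<^sub>R B z"
      by (simp add: A_def B_def algebra_simps)
    then have "?\<Delta> * norm (fst z) \<le> \<bar>\<delta>\<bar> * norm (A z) + \<bar>\<beta>\<bar> * norm (B z)"
      by (metis norm_scaleR norm_triangle_ineq4)
    moreover have "(\<alpha> * \<delta> - \<beta> * \<gamma>) *\<^sub>R snd z = \<alpha> *\<^sub>R B z - \<gamma> *\<^sub>R A z"
      by (simp add: A_def B_def algebra_simps)
    then have "?\<Delta> * norm (snd z) \<le> \<bar>\<alpha>\<bar> * norm (B z) + \<bar>\<gamma>\<bar> * norm (A z)"
      by (metis norm_scaleR norm_triangle_ineq4)
    moreover have "norm z \<le> norm (fst z) + norm (snd z)"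
      by (cases z) (simp add: norm_Pair sqrt_sum_squares_le_sum)
    then have "?\<Delta> * norm z \<le> ?\<Delta> * norm (fst z) + ?\<Delta> * norm (snd z)"
      by (metis abs_ge_zero distrib_left mult_left_mono)
    moreover have "0 \<le> \<bar>\<alpha>\<bar> * norm (A z)" "0 \<le> \<bar>\<beta>\<bar> * norm (A z)" "0 \<le> \<bar>\<gamma>\<bar> * norm (B z)" "0 \<le> \<bar>\<delta>\<bar> * norm (B z)"
      by auto
    ultimately have "?\<Delta> * norm z \<le> (\<bar>\<alpha>\<bar> + \<bar>\<beta>\<bar> + \<bar>\<gamma>\<bar> + \<bar>\<delta>\<bar>) * (norm (A z) + norm (B z))"
      unfolding distrib_left distrib_right by linarith
    then show ?thesis using det by (simp add: M_def field_simps)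
  qed
  have M0: "0 \<le> M" by (simp add: M_def)
  have dec: "decay s (A z) * decay s (B z) \<le> (1 + M) powr s * decay s z" if "0 \<le> s" for s z
  proof -
    have "1 + norm z \<le> (1 + M) * ((1 + norm (A z)) * (1 + norm (B z)))"
    proof -
      have "0 \<le> norm (A z) * norm (B z)" "0 \<le> M * (norm (A z) * norm (B z))" using M0 by auto
      then show ?thesis using nz[of z] M0 norm_ge_zero[of "A z"] norm_ge_zero[of "B z"]
        unfolding distrib_left distrib_right mult_1_left mult_1_right by linarith
    qed
    then have "((1 + M) * ((1 + norm (A z)) * (1 + norm (B z)))) powr - s \<le> (1 + norm z) powr - s"
      using that by (intro powr_mono2') auto
    then have "(1 + M) powr - s * (decay s (A z) * decay s (B z)) \<le> decay s z"
      using M0 by (simp add: powr_mult decay_def)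
    then show ?thesis using M0 by (simp add: powr_minus field_simps)
  qed
  show ?thesis
  proof (rule schwartz_coinduct[of ?X])
    fix F assume "F \<in> ?X"
    then obtain f g where F: "F = T f g" and fg: "f \<in> schwartz" "g \<in> schwartz" by blast
    show "\<exists>B. \<forall>x. norm x ^ k * norm (F x) \<le> B" for k
    proof (rule decay_imp_power_bound)
      fix s :: real
      obtain C where C: "0 < C" "\<And>x. norm (f x) \<le> C * decay \<bar>s\<bar> x" using schwartz_decay[OF fg(1)] by metis
      obtain C' where C': "0 < C'" "\<And>x. norm (g x) \<le> C' * decay \<bar>s\<bar> x" using schwartz_decay[OF fg(2)] by metis
      have "norm (F z) \<le> C * C' * (1 + M) powr \<bar>s\<bar> * decay s z" for z
      proof -
        have "norm (F z) \<le> (C * decay \<bar>s\<bar> (A z)) * (C' * decay \<bar>s\<bar> (B z))"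
          unfolding F T_def norm_mult complex_mod_cnj using C C' by (intro mult_mono) auto
        also have "\<dots> = C * C' * (decay \<bar>s\<bar> (A z) * decay \<bar>s\<bar> (B z))" by simp
        also have "\<dots> \<le> C * C' * ((1 + M) powr \<bar>s\<bar> * decay \<bar>s\<bar> z)"
          using C C' dec by (intro mult_left_mono) auto
        also have "\<dots> \<le> C * C' * ((1 + M) powr \<bar>s\<bar> * decay s z)"
          using C C' by (intro mult_left_mono decay_mono) auto
        finally show ?thesis by (simp add: ac_simps)
      qed
      then show "\<exists>C. \<forall>x. norm (F x) \<le> C * decay s x" by blast
    qed
    let ?D = "\<lambda>z h. f (A z) * cnj (frechet_derivative g (at (B z)) (B h)) + frechet_derivative f (at (A z)) (A h) * cnj (g (B z))"
    show "\<exists>D. (\<forall>x. (F has_derivative D x) (at x)) \<and> (\<forall>b\<in>Basis. (\<lambda>x. D x b) \<in> combinations ?X)"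
    proof (intro exI[of _ ?D] conjI allI ballI)
      fix z
      have A: "(A has_derivative A) (at z)" unfolding A_def[abs_def] by (auto intro!: derivative_eq_intros)
      have B: "(B has_derivative B) (at z)" unfolding B_def[abs_def] by (auto intro!: derivative_eq_intros)
      show "(F has_derivative ?D z) (at z)" unfolding F T_def
        by (intro has_derivative_mult has_derivative_cnj has_derivative_compose[OF A schwartz_has_derivative[OF fg(1)]]
            has_derivative_compose[OF B schwartz_has_derivative[OF fg(2)]])
    next
      fix b :: "'a \<times> 'a" assume b: "b \<in> Basis"
      have lin: "frechet_derivative f (at x) (c *\<^sub>R u) = complex_of_real c * frechet_derivative f (at x) u"
        if "f \<in> schwartz" for f :: "'a \<Rightarrow> complex" and x u c
        using has_derivative_bounded_linear[OF schwartz_has_derivative[OF that]]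
        by (simp add: bounded_linear.linear linear_scale scaleR_conv_of_real)
      \<comment> \<open>A basis vector of the product lies in one of the two factors, so A and B
        send it to multiples of the same basis vector u. This keeps the derivatives inside the
        family.\<close>
      have "\<exists>u c d. u \<in> Basis \<and> A b = c *\<^sub>R u \<and> B b = d *\<^sub>R u"
        using b unfolding Basis_prod_def A_def B_def by auto
      then obtain u c d where u: "u \<in> Basis" "A b = c *\<^sub>R u" "B b = d *\<^sub>R u" by blast
      have "(\<lambda>z. complex_of_real d * T f (partial_deriv u g) z + complex_of_real c * T (partial_deriv u f) g z) \<in> combinations ?X"
        using schwartz_partial_deriv[OF fg(1) u(1)] schwartz_partial_deriv[OF fg(2) u(1)] fg
        by (intro combinations.add combinations.scale combinations.base) blast+
      then show "(\<lambda>z. ?D z b) \<in> combinations ?X"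
        by (simp add: u(2,3) lin[OF fg(1)] lin[OF fg(2)] T_def ac_simps)
    qed
  next
    show "(\<lambda>z. f (\<alpha> *\<^sub>R fst z + \<beta> *\<^sub>R snd z) * cnj (g (\<gamma> *\<^sub>R fst z + \<delta> *\<^sub>R snd z))) \<in> combinations ?X"
      using fg by (intro combinations.base) (auto simp: T_def A_def B_def)
  qed
qed


section \<open>Partial Fourier transforms\<close>

lemma norm_integral_le:
  fixes f :: "'t \<Rightarrow> 'b::{banach, second_countable_topology}"
  assumes "integrable M f" "integrable M g" "\<And>x. norm (f x) \<le> g x"
  shows "norm (integral\<^sup>L M f) \<le> integral\<^sup>L M g"
  by (rule order_trans[OF integral_norm_bound]) (intro integral_mono integrable_norm assms)

text \<open>By the mean value inequality the normalised remainder is at most 2 g: one g for the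
  increment and one for the derivative. Dominated convergence along sequences then gives the
  limit.\<close>

lemma has_derivative_integral_dominated:
  fixes K :: "'a::euclidean_space \<Rightarrow> 't \<Rightarrow> complex"
  assumes S: "open S" "convex S" "x \<in> S"
    and K: "\<And>y. y \<in> S \<Longrightarrow> integrable M (K y)"
    and D: "\<And>y t. y \<in> S \<Longrightarrow> ((\<lambda>y. K y t) has_derivative D y t) (at y)"
    and bound: "\<And>y t h. y \<in> S \<Longrightarrow> norm (D y t h) \<le> g t * norm h" and g: "integrable M g"
    and meas: "\<And>h. (\<lambda>t. D x t h) \<in> borel_measurable M"
  shows "((\<lambda>y. LINT t|M. K y t) has_derivative (\<lambda>h. LINT t|M. D x t h)) (at x)"
proof -
  have Dint: "integrable M (\<lambda>t. D x t h)" for h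
  proof (rule Bochner_Integration.integrable_bound[of _ "\<lambda>t. g t * norm h"])
    show "AE t in M. norm (D x t h) \<le> norm (g t * norm h)"
      using bound[OF S(3)] by (intro AE_I2) (simp, metis abs_ge_self order_trans)
  qed (use g meas in auto)
  have lin: "linear (D x t)" for t
    using D[OF S(3)] has_derivative_linear by blast
  have bl: "bounded_linear (\<lambda>h. LINT t|M. D x t h)"
  proof (rule bounded_linear_intro[where K = "LINT t|M. g t"])
    fix h k :: 'a and r :: real
    show "(LINT t|M. D x t (h + k)) = (LINT t|M. D x t h) + (LINT t|M. D x t k)"
      by (simp add: linear_add[OF lin] Dint)
    show "(LINT t|M. D x t (r *\<^sub>R h)) = r *\<^sub>R (LINT t|M. D x t h)"
      by (simp add: linear_scale[OF lin])
    have "norm (LINT t|M. D x t h) \<le> (LINT t|M. g t * norm h)"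
      by (rule norm_integral_le) (use Dint g bound[OF S(3)] in auto)
    then show "norm (LINT t|M. D x t h) \<le> norm h * (LINT t|M. g t)"
      by (simp add: mult.commute)
  qed
  have lip: "norm (K y t - K x t) \<le> g t * norm (y - x)" if "y \<in> S" for y t
  proof (rule differentiable_bound[OF S(2) _ _ that S(3)])
    fix u assume u: "u \<in> S"
    show "((\<lambda>y. K y t) has_derivative D u t) (at u within S)"
      using D[OF u] by (rule has_derivative_at_withinI)
    \<comment> \<open>That g t is nonnegative is read off the bound at a basis vector.\<close>
    show "onorm (D u t) \<le> g t"
      using bound[OF u] by (intro onorm_bound) (auto simp: ac_simps intro: order_trans[OF norm_ge_zero] dest: spec[of _ "SOME b. b \<in> Basis"]
        intro!: order_trans[OF norm_ge_zero bound[OF u, of t "SOME b. b \<in> Basis"], simplified])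
  qed
  show ?thesis
    unfolding has_derivative_iff_norm
  proof (intro conjI bl, unfold tendsto_at_iff_sequentially, intro allI impI)
    fix X :: "nat \<Rightarrow> 'a" assume X: "\<forall>i. X i \<in> UNIV - {x}" "X \<longlonglongrightarrow> x"
    have "eventually (\<lambda>i. X i \<in> S) sequentially"
      using X(2) S by (simp add: topological_tendstoD)
    then obtain n where n: "\<And>i. i \<ge> n \<Longrightarrow> X i \<in> S" by (auto simp: eventually_sequentially)
    \<comment> \<open>The sequence is in S only from index n on, hence the shift by n.\<close>
    define Q where "Q i t = inverse (norm (X (i + n) - x)) *\<^sub>R (K (X (i + n)) t - K x t - D x t (X (i + n) - x))" for i t
    have "(\<lambda>i. LINT t|M. Q i t) \<longlonglongrightarrow> (LINT t|M. 0)"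
    proof (rule integral_dominated_convergence[where w = "\<lambda>t. 2 * g t"])
      show "AE t in M. (\<lambda>i. Q i t) \<longlonglongrightarrow> 0"
      proof (rule AE_I2)
        fix t
        have "((\<lambda>y. norm (K y t - K x t - D x t (y - x)) / norm (y - x)) \<longlongrightarrow> 0) (at x)"
          using D[OF S(3), of t] unfolding has_derivative_iff_norm by blast
        then have "(\<lambda>i. norm (K (X i) t - K x t - D x t (X i - x)) / norm (X i - x)) \<longlonglongrightarrow> 0"
          using X unfolding tendsto_at_iff_sequentially comp_def by blast
        from LIMSEQ_ignore_initial_segment[OF this, of n]
        show "(\<lambda>i. Q i t) \<longlonglongrightarrow> 0"
          by (subst tendsto_norm_zero_iff[symmetric]) (simp add: Q_def divide_inverse_commute)
      qed
      show "AE t in M. norm (Q i t) \<le> 2 * g t" for i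
      proof (rule AE_I2)
        fix t
        have "norm (K (X (i + n)) t - K x t - D x t (X (i + n) - x)) \<le> g t * norm (X (i + n) - x) + g t * norm (X (i + n) - x)"
          by (rule norm_triangle_le_diff, rule add_mono) (use lip n bound S in auto)
        moreover have "norm (X (i + n) - x) > 0" using X by auto
        ultimately show "norm (Q i t) \<le> 2 * g t"
          unfolding Q_def norm_scaleR by (simp add: field_simps)
      qed
      show "Q i \<in> borel_measurable M" for i
        unfolding Q_def using K[OF n[of "i + n"]] K[OF S(3)] meas by (auto intro!: borel_measurable_scaleR borel_measurable_diff)
    qed (use g in auto)
    moreover have "(LINT t|M. Q i t) = inverse (norm (X (i + n) - x)) *\<^sub>R
        ((LINT t|M. K (X (i + n)) t) - (LINT t|M. K x t) - (LINT t|M. D x t (X (i + n) - x)))" for i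
      unfolding Q_def using K[OF n[of "i + n"]] K[OF S(3)] Dint by simp
    ultimately have "(\<lambda>i. norm ((LINT t|M. K (X (i + n)) t) - (LINT t|M. K x t) - (LINT t|M. D x t (X (i + n) - x))) / norm (X (i + n) - x)) \<longlonglongrightarrow> 0"
      using tendsto_norm_zero by (fastforce simp: divide_inverse_commute)
    then show "((\<lambda>y. norm ((LINT t|M. K y t) - (LINT t|M. K x t) - (LINT t|M. D x t (y - x))) / norm (y - x)) \<circ> X) \<longlonglongrightarrow> 0"
      unfolding comp_def by (rule LIMSEQ_offset)
  qed
qed

text \<open>Takes the place of integration by parts: the integral of F(t + y) over t does not depend
  on y, so its derivative at y = 0 vanishes. For y in the unit ball the kernel changes by at most
  2^s, which makes the majorant independent of y.\<close>

lemma integral_derivative_eq_0: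
  fixes F :: "'a::euclidean_space \<Rightarrow> complex"
  assumes F: "integrable lborel F" and D: "\<And>t. (F has_derivative D t) (at t)"
    and bound: "\<And>t h. norm (D t h) \<le> C * decay s t * norm h" and s: "real (2 * DIM('a)) \<le> s"
    and meas: "\<And>h. (\<lambda>t. D t h) \<in> borel_measurable borel"
  shows "(LINT t|lborel. D t h) = 0"
proof -
  have Fm: "F \<in> borel_measurable borel" using F by auto
  have "0 \<le> C * decay s (0::'a) * norm (SOME b. b \<in> (Basis :: 'a set))"
    by (rule order_trans[OF norm_ge_zero bound])
  then have C: "0 \<le> C" by (simp add: SOME_Basis)
  have s0: "0 \<le> s" using s by simp
  let ?K = "\<lambda>y t. F (t + y)"
  have "((\<lambda>y. LINT t|lborel. ?K y t) has_derivative (\<lambda>h. LINT t|lborel. D (t + 0) h)) (at 0)"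
  proof (rule has_derivative_integral_dominated[where S = "ball 0 1" and g = "\<lambda>t. C * 2 powr s * decay s t"])
    show "integrable lborel (?K y)" for y
      using F integrable_distr_eq[of "\<lambda>t. t + y" lborel borel F] Fm by (simp add: lborel_distr_translate)
    show "((\<lambda>y. F (t + y)) has_derivative D (t + y)) (at y)" for t y
      by (rule has_derivative_compose[where f = "\<lambda>y. t + y", OF _ D]) (auto intro!: derivative_eq_intros)
    show "norm (D (t + y) h) \<le> C * 2 powr s * decay s t * norm h" if "y \<in> ball 0 1" for y t h
    proof -
      have "decay s (t + y) * decay s y \<le> decay s t" using decay_triangle[OF s0, of "t + y" "- y"] by simp
      moreover have "2 powr - s \<le> decay s y"
        using that s0 unfolding decay_def by (intro powr_mono2') auto
      ultimately have "decay s (t + y) * 2 powr - s \<le> decay s t"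
        by (meson decay_nonneg mult_left_mono order_trans)
      then have "decay s (t + y) \<le> 2 powr s * decay s t" by (simp add: powr_minus field_simps)
      then have "C * decay s (t + y) * norm h \<le> C * (2 powr s * decay s t) * norm h"
        using C by (intro mult_right_mono mult_left_mono) auto
      then show ?thesis using bound[of "t + y" h] by (simp add: ac_simps)
    qed
    show "integrable lborel (\<lambda>t. C * 2 powr s * decay s (t::'a))"
      using integrable_decay[OF s] by simp
  qed (use meas in auto)
  moreover have "(\<lambda>y. LINT t|lborel. ?K y t) = (\<lambda>y. LINT t|lborel. F t)"
    by (simp add: integral_translate[OF Fm])
  ultimately have "(\<lambda>h. LINT t|lborel. D (t + 0) h) = (\<lambda>h. 0)"
    by (metis has_derivative_const has_derivative_unique)
  then show ?thesis by (metis (no_types, lifting) Bochner_Integration.integral_cong add.right_neutral)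
qed

text \<open>Transform in the second variable only. Both the short-time Fourier transform and the
  tau-Wigner distribution arise in this way from a kernel treated by
  \<open>schwartz_tensor\<close>.\<close>

definition partial_fourier :: "('a::euclidean_space \<times> 'b::euclidean_space \<Rightarrow> complex) \<Rightarrow> 'a \<times> 'b \<Rightarrow> complex" where
  "partial_fourier H z = (LINT t|lborel. H (fst z, t) * cis (- (2 * pi * (snd z \<bullet> t))))"

lemma schwartz_section_decay:
  fixes H :: "'a::euclidean_space \<times> 'b::euclidean_space \<Rightarrow> complex"
  assumes "H \<in> schwartz" "0 \<le> s"
  obtains C where "0 < C" "\<And>x t. norm x ^ k * norm (H (x, t)) \<le> C * decay s t"
proof -
  obtain C where C: "0 < C" "\<And>z. norm (H z) \<le> C * decay (real k + s) z" using schwartz_decay[OF assms(1)] by metis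
  show ?thesis
  proof (rule that[OF C(1)])
    fix x t
    have "norm x ^ k * norm (H (x, t)) \<le> (1 + norm (x, t)) ^ k * (C * decay (real k + s) (x, t))"
      using C norm_fst_le[of x t] by (intro mult_mono power_mono) (auto intro: order_trans)
    also have "\<dots> = C * decay s (x, t)"
      unfolding decay_add by (simp add: decay_def powr_minus powr_realpow)
    also have "\<dots> \<le> C * decay s t" using C assms by (intro mult_left_mono decay_Pair_le_snd) auto
    finally show "norm x ^ k * norm (H (x, t)) \<le> C * decay s t" .
  qed
qed

lemma schwartz_section_measurable:
  fixes H :: "'a::euclidean_space \<times> 'b::euclidean_space \<Rightarrow> complex"
  assumes "H \<in> schwartz"
  shows "(\<lambda>t. H (x, t)) \<in> borel_measurable borel"
  by (intro borel_measurable_continuous_onI continuous_on_compose2[OF schwartz_continuous[OF assms]] continuous_intros) auto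

lemma borel_measurable_cis_inner [measurable]: "(\<lambda>t::'b::euclidean_space. cis (- (2 * pi * (\<xi> \<bullet> t)))) \<in> borel_measurable borel"
  by (intro borel_measurable_continuous_onI continuous_intros)

lemma schwartz_section_integrable:
  fixes H :: "'a::euclidean_space \<times> 'b::euclidean_space \<Rightarrow> complex"
  assumes "H \<in> schwartz"
  shows "integrable lborel (\<lambda>t. H (x, t) * cis (- (2 * pi * (\<xi> \<bullet> t))))"
proof -
  obtain C where C: "\<And>x t. norm x ^ 0 * norm (H (x, t)) \<le> C * decay (real (2 * DIM('b))) t"
    by (rule schwartz_section_decay[OF assms, where k = 0 and s = "real (2 * DIM('b))"]) (simp, blast)
  show ?thesis
    by (rule integrable_bounded_decay[OF _ _ order_refl, of _ C])
       (use C[of x] schwartz_section_measurable[OF assms, of x] in \<open>auto simp: norm_mult\<close>)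
qed

lemma norm_cis_mult [simp]: "norm (z * cis a) = norm z" "norm (cis a * z) = norm z"
  by (simp_all add: norm_mult)

lemma norm_phase: "norm (complex_of_real (- (2 * pi * a)) * (\<i> * cis b)) = 2 * pi * \<bar>a\<bar>"
  by (simp add: norm_mult abs_mult)

lemma has_derivative_cis_inner_minus:
  fixes \<xi> :: "'b::euclidean_space"
  shows "((\<lambda>t. cis (- (2 * pi * (\<xi> \<bullet> t)))) has_derivative
     (\<lambda>h. complex_of_real (- (2 * pi * (\<xi> \<bullet> h))) * (\<i> * cis (- (2 * pi * (\<xi> \<bullet> x)))))) (at x)"
  using has_derivative_cis_inner[of "- 2 * pi" \<xi> x] by (simp add: inner_commute)

lemma has_derivative_section:
  fixes H :: "'a::euclidean_space \<times> 'b::euclidean_space \<Rightarrow> complex"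
  assumes H: "H \<in> schwartz"
  shows "((\<lambda>t. H (x, t)) has_derivative (\<lambda>h. frechet_derivative H (at (x, t)) (0, h))) (at t)"
    "((\<lambda>x. H (x, t)) has_derivative (\<lambda>h. frechet_derivative H (at (x, t)) (h, 0))) (at x)"
  by (rule has_derivative_compose[OF _ schwartz_has_derivative[OF H]], auto intro!: derivative_eq_intros)+

text \<open>Integrate the t-derivative of H(x, t) times the phase: the total is zero, and the
  product rule splits it into the two sides.\<close>

lemma partial_fourier_derivative:
  fixes H :: "'a::euclidean_space \<times> 'b::euclidean_space \<Rightarrow> complex"
  assumes H: "H \<in> schwartz" and b: "b \<in> Basis"
  shows "partial_fourier (partial_deriv (0, b) H) z = 2 * pi * \<i> * (snd z \<bullet> b) * partial_fourier H z"
proof -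
  obtain x \<xi> where z: "z = (x, \<xi>)" by (cases z)
  let ?e = "\<lambda>t. cis (- (2 * pi * (\<xi> \<bullet> t)))"
  let ?D = "\<lambda>t h. H (x, t) * (complex_of_real (- (2 * pi * (\<xi> \<bullet> h))) * (\<i> * ?e t))
     + frechet_derivative H (at (x, t)) (0, h) * ?e t"
  define s where "s = real (2 * DIM('b))"
  obtain C1 where C1: "0 < C1" "\<And>z. norm (H z) \<le> C1 * decay s z" using schwartz_decay[OF H] by metis
  obtain C2 where C2: "0 < C2" "\<And>z h. norm (frechet_derivative H (at z) h) \<le> C2 * decay s z * norm h"
    using schwartz_derivative_decay[OF H] by metis
  have b': "(0, b) \<in> (Basis :: ('a \<times> 'b) set)" using b by (auto simp: Basis_prod_def)
  have Fd_sum: "frechet_derivative H (at z) (0, h) = (\<Sum>b\<in>Basis. complex_of_real ((0, h) \<bullet> b) * partial_deriv b H z)" for z h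
    by (rule linear_eq_sum_Basis) (rule has_derivative_bounded_linear[OF schwartz_has_derivative[OF H]])
  have "(LINT t|lborel. ?D t b) = 0"
  proof (rule integral_derivative_eq_0[where F = "\<lambda>t. H (x, t) * ?e t" and D = ?D and h = b and s = s and C = "C1 * (2 * pi * norm \<xi>) + C2"])
    show "integrable lborel (\<lambda>t. H (x, t) * ?e t)" by (rule schwartz_section_integrable[OF H])
    show "((\<lambda>t. H (x, t) * ?e t) has_derivative ?D t) (at t)" for t
      by (rule has_derivative_mult has_derivative_section[OF H] has_derivative_cis_inner_minus)+
    show "norm (?D t h) \<le> (C1 * (2 * pi * norm \<xi>) + C2) * decay s t * norm h" for t h
    proof -
      have d: "decay s (x, t) \<le> decay s t" by (intro decay_Pair_le_snd) (simp add: s_def)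
      have "norm (H (x, t) * (complex_of_real (- (2 * pi * (\<xi> \<bullet> h))) * (\<i> * ?e t)))
          \<le> (C1 * decay s t) * (2 * pi * (norm \<xi> * norm h))"
        unfolding norm_mult[of "H _"] norm_phase
        using order_trans[OF C1(2)[of "(x, t)"] mult_left_mono[OF d, of C1]] C1(1) Cauchy_Schwarz_ineq2[of \<xi> h]
        by (intro mult_mono) auto
      moreover have "norm (frechet_derivative H (at (x, t)) (0, h) * ?e t) \<le> C2 * decay s t * norm h"
        using order_trans[OF C2(2)[of "(x, t)" "(0, h)"]
            mult_right_mono[OF mult_left_mono[OF d, of C2], of "norm (0::'a, h)"]] C2(1) by simp
      ultimately show ?thesis by (intro norm_triangle_le) (simp add: algebra_simps)
    qed
    show "real (2 * DIM('b)) \<le> s" by (simp add: s_def)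
    show "(\<lambda>t. ?D t h) \<in> borel_measurable borel" for h
    proof -
      have [measurable]: "(\<lambda>t. H (x, t)) \<in> borel_measurable borel"
        by (rule schwartz_section_measurable[OF H])
      have [measurable]: "(\<lambda>t. frechet_derivative H (at (x, t)) (0, h)) \<in> borel_measurable borel"
        unfolding Fd_sum
        by (intro borel_measurable_sum borel_measurable_times borel_measurable_const
            schwartz_section_measurable[OF schwartz_partial_deriv[OF H]])
      show ?thesis by measurable
    qed
  qed
  moreover have "integrable lborel (\<lambda>t. H (x, t) * (complex_of_real (- (2 * pi * (\<xi> \<bullet> b))) * (\<i> * ?e t)))"
    using integrable_mult_left[OF schwartz_section_integrable[OF H, of x \<xi>], of "complex_of_real (- (2 * pi * (\<xi> \<bullet> b))) * \<i>"]
    by (simp add: ac_simps)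
  moreover have "integrable lborel (\<lambda>t. frechet_derivative H (at (x, t)) (0, b) * ?e t)"
    using schwartz_section_integrable[OF schwartz_partial_deriv[OF H b']] by simp
  ultimately have "(LINT t|lborel. H (x, t) * (complex_of_real (- (2 * pi * (\<xi> \<bullet> b))) * (\<i> * ?e t)))
      + (LINT t|lborel. frechet_derivative H (at (x, t)) (0, b) * ?e t) = 0" by simp
  moreover have "(LINT t|lborel. H (x, t) * (complex_of_real (- (2 * pi * (\<xi> \<bullet> b))) * (\<i> * ?e t)))
      = (- (2 * pi * \<i> * (\<xi> \<bullet> b))) * (LINT t|lborel. H (x, t) * ?e t)"
    by (subst integral_mult_right_zero[symmetric]) (rule Bochner_Integration.integral_cong, auto)
  ultimately show ?thesis by (simp add: partial_fourier_def z add_eq_0_iff2)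
qed

lemma partial_fourier_bounded:
  fixes H :: "'a::euclidean_space \<times> 'b::euclidean_space \<Rightarrow> complex"
  assumes H: "H \<in> schwartz"
  shows "\<exists>B. \<forall>z. norm (fst z) ^ k * norm (partial_fourier H z) \<le> B"
proof -
  define s where "s = real (2 * DIM('b))"
  obtain C where C: "0 < C" "\<And>x t. norm x ^ k * norm (H (x, t)) \<le> C * decay s t"
    using schwartz_section_decay[OF H, of s k] by (auto simp: s_def)
  have "norm (fst z) ^ k * norm (partial_fourier H z) \<le> (LINT t|lborel. C * decay s (t::'b))" for z
  proof -
    have "norm (fst z) ^ k * norm (partial_fourier H z)
       = norm (LINT t|lborel. norm (fst z) ^ k *\<^sub>R (H (fst z, t) * cis (- (2 * pi * (snd z \<bullet> t)))))"
      by (simp add: partial_fourier_def)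
    also have "\<dots> \<le> (LINT t|lborel. C * decay s (t::'b))"
      by (rule norm_integral_le)
         (use schwartz_section_integrable[OF H] integrable_decay[of s] C in \<open>auto simp: s_def\<close>)
    finally show ?thesis .
  qed
  then show ?thesis by blast
qed

text \<open>Each power of the frequency coordinate is traded for one t-derivative of H, which is
  again Schwartz.\<close>

lemma partial_fourier_inner_bounded:
  fixes H :: "'a::euclidean_space \<times> 'b::euclidean_space \<Rightarrow> complex"
  assumes H: "H \<in> schwartz" and b: "b \<in> Basis"
  shows "\<exists>B. \<forall>z. \<bar>snd z \<bullet> b\<bar> ^ k * norm (partial_fourier H z) \<le> B"
  using H
proof (induction k arbitrary: H)
  case 0
  then show ?case using partial_fourier_bounded[of H 0] by simp
next
  case (Suc k)
  have b': "(0, b) \<in> (Basis :: ('a \<times> 'b) set)" using b by (auto simp: Basis_prod_def)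
  from Suc.IH[OF schwartz_partial_deriv[OF Suc.prems b']]
  obtain B where B: "\<And>z. \<bar>snd z \<bullet> b\<bar> ^ k * norm (partial_fourier (partial_deriv (0, b) H) z) \<le> B" by blast
  have "\<bar>snd z \<bullet> b\<bar> ^ Suc k * norm (partial_fourier H z) \<le> B / (2 * pi)" for z
    using B[of z] by (simp add: partial_fourier_derivative[OF Suc.prems b] norm_mult field_simps)
  then show ?case by blast
qed

lemma power_sum_le:
  fixes f :: "'i \<Rightarrow> real"
  assumes "finite I" "I \<noteq> {}" "\<And>i. i \<in> I \<Longrightarrow> 0 \<le> f i"
  shows "(\<Sum>i\<in>I. f i) ^ k \<le> real (card I) ^ k * (\<Sum>i\<in>I. f i ^ k)"
proof -
  let ?m = "Max (f ` I)"
  have "?m \<in> f ` I" using assms by (intro Max_in) auto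
  then obtain j where j: "j \<in> I" "?m = f j" by auto
  have "(\<Sum>i\<in>I. f i) \<le> real (card I) * f j"
    using assms j by (intro sum_bounded_above) (metis Max_ge finite_imageI imageI)
  then have "(\<Sum>i\<in>I. f i) ^ k \<le> (real (card I) * f j) ^ k"
    using assms by (intro power_mono sum_nonneg) auto
  also have "\<dots> \<le> real (card I) ^ k * (\<Sum>i\<in>I. f i ^ k)"
    unfolding power_mult_distrib using assms j by (intro mult_left_mono member_le_sum) auto
  finally show ?thesis .
qed

text \<open>Decay in x is inherited from H, decay in frequency from the t-derivatives of H. An
  x-derivative acts on H, and a frequency derivative multiplies H by a coordinate of t up to a
  scalar; so the image of the Schwartz space has its derivatives among its own multiples, as
  coinduction requires.\<close>

lemma schwartz_partial_fourier:
  fixes H :: "'a::euclidean_space \<times> 'b::euclidean_space \<Rightarrow> complex"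
  assumes "H \<in> schwartz"
  shows "partial_fourier H \<in> schwartz"
proof (rule schwartz_coinduct[of "partial_fourier ` schwartz"])
  fix W assume "W \<in> partial_fourier ` (schwartz :: ('a \<times> 'b \<Rightarrow> complex) set)"
  then obtain H :: "'a \<times> 'b \<Rightarrow> complex" where H: "H \<in> schwartz" and W: "W = partial_fourier H" by blast
  show "\<exists>B. \<forall>z. norm z ^ k * norm (W z) \<le> B" for k
  proof -
    obtain B where B: "\<And>z. norm (fst z) ^ k * norm (W z) \<le> B"
      using partial_fourier_bounded[OF H] W by blast
    have "\<forall>b. \<exists>B. b \<in> Basis \<longrightarrow> (\<forall>z. \<bar>snd z \<bullet> b\<bar> ^ k * norm (W z) \<le> B)"
      using partial_fourier_inner_bounded[OF H] W by blast
    then obtain B' where B': "\<And>b z. b \<in> Basis \<Longrightarrow> \<bar>snd z \<bullet> b\<bar> ^ k * norm (W z) \<le> B' b" by metis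
    let ?n = "real DIM('b)"
    have "norm z ^ k * norm (W z) \<le> 2 ^ k * (B + ?n ^ k * (\<Sum>b\<in>Basis. B' b))" for z
    proof -
      have "norm z \<le> norm (fst z) + norm (snd z)"
        by (cases z) (simp add: norm_Pair sqrt_sum_squares_le_sum)
      then have "norm z ^ k \<le> (norm (fst z) + norm (snd z)) ^ k" by (intro power_mono) auto
      also have "\<dots> \<le> 2 ^ k * (norm (fst z) ^ k + norm (snd z) ^ k)"
        using power_sum_le[of "UNIV :: bool set" "\<lambda>i. if i then norm (fst z) else norm (snd z)" k]
        by (simp add: UNIV_bool add.commute)
      finally have 1: "norm z ^ k \<le> 2 ^ k * (norm (fst z) ^ k + norm (snd z) ^ k)" .
      have "norm (snd z) ^ k \<le> (\<Sum>b\<in>Basis. \<bar>snd z \<bullet> b\<bar>) ^ k"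
        by (intro power_mono norm_le_l1) auto
      also have "\<dots> \<le> ?n ^ k * (\<Sum>b\<in>Basis. \<bar>snd z \<bullet> b\<bar> ^ k)"
        by (rule power_sum_le) auto
      finally have "norm (snd z) ^ k * norm (W z) \<le> ?n ^ k * (\<Sum>b\<in>Basis. \<bar>snd z \<bullet> b\<bar> ^ k) * norm (W z)"
        by (intro mult_right_mono) auto
      also have "\<dots> = ?n ^ k * (\<Sum>b\<in>Basis. \<bar>snd z \<bullet> b\<bar> ^ k * norm (W z))"
        by (simp add: sum_distrib_right)
      also have "\<dots> \<le> ?n ^ k * (\<Sum>b\<in>Basis. B' b)" by (intro mult_left_mono sum_mono B') auto
      finally have 2: "norm (snd z) ^ k * norm (W z) \<le> ?n ^ k * (\<Sum>b\<in>Basis. B' b)" .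
      have "norm z ^ k * norm (W z) \<le> 2 ^ k * (norm (fst z) ^ k + norm (snd z) ^ k) * norm (W z)"
        using 1 by (intro mult_right_mono) auto
      also have "\<dots> = 2 ^ k * (norm (fst z) ^ k * norm (W z) + norm (snd z) ^ k * norm (W z))"
        by (simp add: algebra_simps)
      also have "\<dots> \<le> 2 ^ k * (B + ?n ^ k * (\<Sum>b\<in>Basis. B' b))"
        using B 2 by (intro mult_left_mono add_mono) auto
      finally show ?thesis .
    qed
    then show ?thesis by blast
  qed
  let ?e = "\<lambda>z t. cis (- (2 * pi * (snd z \<bullet> t)))"
  let ?D = "\<lambda>z t h. H (fst z, t) * (complex_of_real (- (2 * pi * (t \<bullet> snd h))) * (\<i> * ?e z t))
     + frechet_derivative H (at (fst z, t)) (fst h, 0) * ?e z t"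
  define s where "s = real (2 * DIM('b))"
  \<comment> \<open>The extra power in \<open>1 + s\<close> pays for the factor norm t that a
    frequency derivative brings down.\<close>
  obtain C1 where C1: "0 < C1" "\<And>z. norm (H z) \<le> C1 * decay (1 + s) z" using schwartz_decay[OF H] by metis
  obtain C2 where C2: "0 < C2" "\<And>z h. norm (frechet_derivative H (at z) h) \<le> C2 * decay s z * norm h"
    using schwartz_derivative_decay[OF H] by metis
  have Fd_sum: "frechet_derivative H (at z) h = (\<Sum>b\<in>Basis. complex_of_real (h \<bullet> b) * partial_deriv b H z)" for z h
    by (rule linear_eq_sum_Basis) (rule has_derivative_bounded_linear[OF schwartz_has_derivative[OF H]])
  have der: "(W has_derivative (\<lambda>h. LINT t|lborel. ?D z t h)) (at z)" for z
    unfolding W partial_fourier_def[abs_def]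
  proof (rule has_derivative_integral_dominated[where S = UNIV and g = "\<lambda>t. (C1 * (2 * pi) + C2) * decay s t"])
    show "integrable lborel (\<lambda>t. H (fst y, t) * ?e y t)" for y by (rule schwartz_section_integrable[OF H])
    show "((\<lambda>y. H (fst y, t) * ?e y t) has_derivative ?D y t) (at y)" for y t
    proof (rule has_derivative_mult)
      show "((\<lambda>y. H (fst y, t)) has_derivative (\<lambda>h. frechet_derivative H (at (fst y, t)) (fst h, 0))) (at y)"
        by (rule has_derivative_compose[OF _ has_derivative_section(2)[OF H]]) (auto intro!: derivative_eq_intros)
      have "((\<lambda>y. cis (- (2 * pi * (t \<bullet> snd y)))) has_derivative
        (\<lambda>h. complex_of_real (- (2 * pi * (t \<bullet> snd h))) * (\<i> * cis (- (2 * pi * (t \<bullet> snd y)))))) (at y)"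
        by (rule has_derivative_compose[OF _ has_derivative_cis_inner_minus]) (auto intro!: derivative_eq_intros)
      then show "((\<lambda>y. ?e y t) has_derivative (\<lambda>h. complex_of_real (- (2 * pi * (t \<bullet> snd h))) * (\<i> * ?e y t))) (at y)"
        by (simp add: inner_commute)
    qed
    show "norm (?D y t h) \<le> (C1 * (2 * pi) + C2) * decay s t * norm h" for y t h
    proof -
      have s0: "0 \<le> s" by (simp add: s_def)
      have d: "decay s (fst y, t) \<le> decay s t" using s0 by (rule decay_Pair_le_snd)
      have "decay (1 + s) (fst y, t) \<le> decay (1 + s) t" using s0 by (intro decay_Pair_le_snd) auto
      then have "norm (H (fst y, t)) \<le> C1 * decay (1 + s) t"
        using C1(2)[of "(fst y, t)"] C1(1) by (meson less_imp_le mult_left_mono order_trans)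
      then have "norm (H (fst y, t) * (complex_of_real (- (2 * pi * (t \<bullet> snd h))) * (\<i> * ?e y t)))
          \<le> (C1 * decay (1 + s) t) * (2 * pi * (norm t * norm (snd h)))"
        unfolding norm_mult[of "H _"] norm_phase using Cauchy_Schwarz_ineq2[of t "snd h"] C1
        by (intro mult_mono) auto
      also have "\<dots> \<le> (C1 * decay (1 + s) t) * (2 * pi * ((1 + norm t) * norm h))"
        using C1 norm_snd_le[of "snd h" "fst h"] by (intro mult_left_mono mult_mono) auto
      also have "\<dots> = C1 * (2 * pi) * ((1 + norm t) * decay (1 + s) t) * norm h" by (simp add: ac_simps)
      also have "(1 + norm t) * decay (1 + s) t = decay s t"
        unfolding decay_add by (simp add: decay_def powr_minus)
      finally have 1: "norm (H (fst y, t) * (complex_of_real (- (2 * pi * (t \<bullet> snd h))) * (\<i> * ?e y t)))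
        \<le> C1 * (2 * pi) * decay s t * norm h" .
      have "norm (frechet_derivative H (at (fst y, t)) (fst h, 0) * ?e y t) \<le> C2 * decay s (fst y, t) * norm (fst h, 0::'b)"
        using C2(2)[of "(fst y, t)" "(fst h, 0)"] by simp
      also have "\<dots> \<le> C2 * decay s t * norm h"
        using C2(1) d norm_fst_le[of "fst h" "snd h"] by (intro mult_mono mult_left_mono) auto
      finally show ?thesis using 1 by (intro norm_triangle_le) (simp add: algebra_simps)
    qed
    show "integrable lborel (\<lambda>t::'b. (C1 * (2 * pi) + C2) * decay s t)"
      using integrable_decay[of s] by (auto simp: s_def)
    show "(\<lambda>t. ?D z t h) \<in> borel_measurable lborel" for h
    proof -
      have [measurable]: "(\<lambda>t. H (fst z, t)) \<in> borel_measurable borel"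
        by (rule schwartz_section_measurable[OF H])
      have "(\<lambda>t::'b. complex_of_real (- (2 * pi * (t \<bullet> snd h)))) \<in> borel_measurable borel"
        by (intro borel_measurable_continuous_onI continuous_intros)
      moreover have "(\<lambda>t. frechet_derivative H (at (fst z, t)) (fst h, 0)) \<in> borel_measurable borel"
        unfolding Fd_sum[of _ "(fst h, 0)"]
        by (intro borel_measurable_sum borel_measurable_times borel_measurable_const
            schwartz_section_measurable[OF schwartz_partial_deriv[OF H]])
      ultimately show ?thesis
        by (intro borel_measurable_add borel_measurable_times borel_measurable_const)
           (simp_all add: schwartz_section_measurable[OF H] borel_measurable_cis_inner)
    qed
  qed auto
  show "\<exists>D. (\<forall>x. (W has_derivative D x) (at x)) \<and>
      (\<forall>b\<in>Basis. (\<lambda>x. D x b) \<in> combinations (partial_fourier ` (schwartz :: ('a \<times> 'b \<Rightarrow> complex) set)))"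
  proof (intro exI conjI allI ballI, rule der)
    fix b :: "'a \<times> 'b" assume b: "b \<in> Basis"
    then consider u where "u \<in> Basis" "b = (u, 0)" | v where "v \<in> Basis" "b = (0, v)"
      by (auto simp: Basis_prod_def)
    then show "(\<lambda>z. LINT t|lborel. ?D z t b) \<in> combinations (partial_fourier ` schwartz)"
    proof cases
      case (1 u)
      have "(\<lambda>z. LINT t|lborel. ?D z t b) = partial_fourier (partial_deriv b H)"
        by (simp add: 1 partial_fourier_def fun_eq_iff)
      then show ?thesis using schwartz_partial_deriv[OF H b] by (auto intro: combinations.base)
    next
      case (2 v)
      have 0: "frechet_derivative H (at z) 0 = 0" for z
        using has_derivative_bounded_linear[OF schwartz_has_derivative[OF H]]
        by (simp add: bounded_linear.linear linear_0)
      let ?H = "\<lambda>z. complex_of_real (z \<bullet> (0, v)) * H z"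
      have "(\<lambda>z. LINT t|lborel. ?D z t b) = (\<lambda>z. (- (2 * pi * \<i>)) * partial_fourier ?H z)"
        unfolding partial_fourier_def 2 fun_eq_iff
        by (intro allI, subst integral_mult_right_zero[symmetric], rule Bochner_Integration.integral_cong)
           (auto simp: 0[unfolded zero_prod_def])
      then show ?thesis
        by (simp only:) (intro combinations.scale combinations.base imageI schwartz_mult_inner[OF H])
    qed
  qed
qed (use assms in \<open>auto intro: combinations.base\<close>)


section \<open>Fubini and Parseval\<close>

lemma integrable_pair_bound:
  fixes f :: "'a::euclidean_space \<times> 'b::euclidean_space \<Rightarrow> complex"
  assumes f: "f \<in> borel_measurable borel" and g: "integrable lborel g" and h: "integrable lborel h"
    and le: "\<And>x y. norm (f (x, y)) \<le> g x * h y"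
  shows "integrable (lborel \<Otimes>\<^sub>M lborel) f"
proof (rule Bochner_Integration.integrable_bound[of _ "\<lambda>z. g (fst z) * h (snd z)"])
  have [measurable]: "g \<in> borel_measurable borel" "h \<in> borel_measurable borel" using g h by auto
  show "integrable (lborel \<Otimes>\<^sub>M lborel) (\<lambda>z. g (fst z) * h (snd z))"
  proof (rule lborel_pair.Fubini_integrable)
    show "(\<lambda>z. g (fst z) * h (snd z)) \<in> borel_measurable (lborel \<Otimes>\<^sub>M lborel)" by measurable
    have "integrable lborel (\<lambda>x. \<bar>g x\<bar> * (LINT y|lborel. \<bar>h y\<bar>))" using g by auto
    then show "integrable lborel (\<lambda>x. LINT y|lborel. norm (g (fst (x, y)) * h (snd (x, y))))"
      by (simp add: abs_mult)
    show "AE x in lborel. integrable lborel (\<lambda>y. g (fst (x, y)) * h (snd (x, y)))"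
      using h by simp
  qed
  show "f \<in> borel_measurable (lborel \<Otimes>\<^sub>M lborel)" using f by (simp add: lborel_prod)
  show "AE z in lborel \<Otimes>\<^sub>M lborel. norm (f z) \<le> norm (g (fst z) * h (snd z))"
    using le by (intro AE_I2) (auto simp: split_beta' intro: order_trans[OF _ abs_ge_self])
qed

lemma fubini_swap:
  fixes f :: "'a::euclidean_space \<Rightarrow> 'b::euclidean_space \<Rightarrow> complex"
  assumes "(\<lambda>z. f (fst z) (snd z)) \<in> borel_measurable borel" "integrable lborel g" "integrable lborel h"
    "\<And>x y. norm (f x y) \<le> g x * h y"
  shows "(LINT x|lborel. LINT y|lborel. f x y) = (LINT y|lborel. LINT x|lborel. f x y)"
proof -
  have "integrable (lborel \<Otimes>\<^sub>M lborel) (\<lambda>(x, y). f x y)"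
    using integrable_pair_bound[OF assms(1-3)] assms(4) by (simp add: split_beta')
  from lborel_pair.Fubini_integral[OF this] show ?thesis by simp
qed

lemma integral_lborel_prod:
  fixes f :: "'a::euclidean_space \<times> 'b::euclidean_space \<Rightarrow> complex"
  assumes "integrable lborel f"
  shows "(LINT z|lborel. f z) = (LINT x|lborel. LINT y|lborel. f (x, y))"
  using lborel_pair.integral_fst'[of f] assms by (simp add: lborel_prod)

lemma integral_scale:
  fixes f :: "'a::euclidean_space \<Rightarrow> complex"
  assumes "f \<in> borel_measurable borel" "0 < e"
  shows "(LINT x|lborel. f x) = e ^ DIM('a) *\<^sub>R (LINT x|lborel. f (t + e *\<^sub>R x))"
proof -
  have "(LINT x|lborel. f x) = (LINT x|density (distr lborel borel (\<lambda>x. t + e *\<^sub>R x)) (\<lambda>_. \<bar>e\<bar> ^ DIM('a)). f x)"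
    using lborel_affine[of e t] assms by simp
  also have "\<dots> = e ^ DIM('a) *\<^sub>R (LINT x|lborel. f (t + e *\<^sub>R x))"
    using assms by (subst integral_density) (auto simp: integral_distr)
  finally show ?thesis .
qed

definition fourier :: "('a::euclidean_space \<Rightarrow> complex) \<Rightarrow> 'a \<Rightarrow> complex" where
  "fourier F \<xi> = (LINT t|lborel. F t * cis (- (2 * pi * (\<xi> \<bullet> t))))"

lemma partial_fourier_eq: "partial_fourier H (x, \<xi>) = fourier (\<lambda>t. H (x, t)) \<xi>"
  by (simp add: partial_fourier_def fourier_def)

lemma borel_measurable_cis_inner_pair:
  "(\<lambda>z::'a::euclidean_space \<times> 'a. cis (- (2 * pi * (fst z \<bullet> snd z)))) \<in> borel_measurable borel"
  "(\<lambda>z::'a::euclidean_space \<times> 'a. cis (2 * pi * (fst z \<bullet> snd z))) \<in> borel_measurable borel"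
  by (intro borel_measurable_continuous_onI continuous_intros)+

lemma borel_measurable_fst_snd [measurable]:
  "fst \<in> borel_measurable (borel :: ('a::euclidean_space \<times> 'b::euclidean_space) measure)"
  "snd \<in> borel_measurable (borel :: ('a::euclidean_space \<times> 'b::euclidean_space) measure)"
  by (intro borel_measurable_continuous_onI continuous_intros)+

lemma borel_measurable_integral_pair:
  fixes f :: "'a::euclidean_space \<times> 'b::euclidean_space \<Rightarrow> complex"
  assumes "f \<in> borel_measurable borel"
  shows "(\<lambda>x. LINT y|lborel. f (x, y)) \<in> borel_measurable borel"
proof -
  have "(\<lambda>(x, y). f (x, y)) \<in> borel_measurable (borel \<Otimes>\<^sub>M lborel)"
    using assms by (simp add: borel_prod cong: measurable_cong_sets)
      (metis borel_prod measurable_cong_sets sets_lborel sets_pair_measure_cong)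
  then show ?thesis by (rule lborel.borel_measurable_lebesgue_integral)
qed

lemma borel_measurable_fourier:
  assumes [measurable]: "F \<in> borel_measurable borel"
  shows "fourier F \<in> borel_measurable borel"
proof -
  have "(\<lambda>z. F (snd z) * cis (- (2 * pi * (fst z \<bullet> snd z)))) \<in> borel_measurable borel"
    by (intro borel_measurable_times borel_measurable_cis_inner_pair measurable_compose[OF borel_measurable_fst_snd(2) assms])
  from borel_measurable_integral_pair[OF this] show ?thesis by (simp add: fourier_def[abs_def])
qed

text \<open>
  The functions to which the Parseval identity is applied; the exponent makes both the function and
  its transform integrable.
\<close>

definition fourier_nice :: "('a::euclidean_space \<Rightarrow> complex) \<Rightarrow> bool" where
  "fourier_nice F \<longleftrightarrow> continuous_on UNIV F \<and>
     (\<exists>C>0. \<forall>t. norm (F t) \<le> C * decay (2 * DIM('a)) t \<and> norm (fourier F t) \<le> C * decay (2 * DIM('a)) t)"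

lemma fourier_nice_section:
  fixes H :: "'a::euclidean_space \<times> 'b::euclidean_space \<Rightarrow> complex"
  assumes H: "H \<in> schwartz"
  shows "fourier_nice (\<lambda>t. H (x, t))"
proof -
  let ?s = "real (2 * DIM('b))"
  obtain C where C: "0 < C" "\<And>z. norm (H z) \<le> C * decay ?s z" using schwartz_decay[OF H] by metis
  obtain C' where C': "0 < C'" "\<And>z. norm (partial_fourier H z) \<le> C' * decay ?s z"
    using schwartz_decay[OF schwartz_partial_fourier[OF H]] by metis
  have d: "decay ?s (x, t) \<le> decay ?s t" for t by (intro decay_Pair_le_snd) simp
  have "norm (H (x, t)) \<le> (C + C') * decay ?s t" for t
    using C(2)[of "(x, t)"] mult_mono[OF _ d, of C "C + C'" t] C(1) C'(1) by simp
  moreover have "norm (fourier (\<lambda>t. H (x, t)) t) \<le> (C + C') * decay ?s t" for t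
    using C'(2)[of "(x, t)"] mult_mono[OF _ d, of C' "C + C'" t] C(1) C'(1) by (simp add: partial_fourier_eq)
  moreover have "continuous_on UNIV (\<lambda>t. H (x, t))"
    by (intro continuous_on_compose2[OF schwartz_continuous[OF H]] continuous_intros) auto
  ultimately show ?thesis unfolding fourier_nice_def using C(1) C'(1)
    by (intro conjI exI[of _ "C + C'"]) auto
qed

text \<open>The factor \<open>\<Theta> (e *\<^sub>R \<xi>)\<close> makes the exchange of integrals
  legitimate and reappears, after the exchange, as an average of F around t at scale e with density
  \<open>fourier \<Theta>\<close>.\<close>

lemma parseval_regularized:
  fixes F G \<Theta> :: "'a::euclidean_space \<Rightarrow> complex"
  assumes F: "fourier_nice F" and G: "fourier_nice G" and \<Theta>: "fourier_nice \<Theta>" and e: "0 < e"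
  shows "(LINT \<xi>|lborel. fourier F \<xi> * cnj (fourier G \<xi>) * \<Theta> (e *\<^sub>R \<xi>))
    = (LINT t|lborel. cnj (G t) * (LINT u|lborel. F (t + e *\<^sub>R u) * fourier \<Theta> u))"
proof -
  let ?s = "real (2 * DIM('a))"
  obtain CF where CF: "CF > 0" "\<And>t. norm (F t) \<le> CF * decay ?s t" "\<And>t. norm (fourier F t) \<le> CF * decay ?s t"
    using F unfolding fourier_nice_def by blast
  obtain CG where CG: "CG > 0" "\<And>t. norm (G t) \<le> CG * decay ?s t" "\<And>t. norm (fourier G t) \<le> CG * decay ?s t"
    using G unfolding fourier_nice_def by blast
  obtain CT where CT: "CT > 0" "\<And>t. norm (\<Theta> t) \<le> CT * decay ?s t" "\<And>t. norm (fourier \<Theta> t) \<le> CT * decay ?s t"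
    using \<Theta> unfolding fourier_nice_def by blast
  have meas[measurable]: "F \<in> borel_measurable borel" "G \<in> borel_measurable borel" "\<Theta> \<in> borel_measurable borel"
    using F G \<Theta> unfolding fourier_nice_def by (auto intro: borel_measurable_continuous_onI)
  note meas'[measurable] = meas[THEN borel_measurable_fourier] 
  have cism[measurable]: "(\<lambda>z::'a \<times> 'a. cis (2 * pi * (fst z \<bullet> snd z))) \<in> borel_measurable borel"
    by (rule borel_measurable_cis_inner_pair)
  have cism'[measurable]: "(\<lambda>z::'a \<times> 'a. cis (- (2 * pi * (fst z \<bullet> snd z)))) \<in> borel_measurable borel"
    by (rule borel_measurable_cis_inner_pair)
  have [measurable]: "(\<lambda>\<xi>. \<Theta> (e *\<^sub>R \<xi>)) \<in> borel_measurable borel" by measurable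
  have id: "integrable lborel (\<lambda>x::'a. C * decay ?s x)" for C using integrable_decay[where 'a = 'a, of ?s] by simp
  have d1: "decay ?s x \<le> 1" for x :: 'a by (rule decay_le_1) simp
  have T1: "norm (\<Theta> x) \<le> CT" for x using order_trans[OF CT(2) mult_left_mono[OF d1, of CT]] CT(1) by simp
  have i\<Theta>: "integrable lborel (\<lambda>\<xi>. norm (\<Theta> (e *\<^sub>R \<xi>)))"
  proof -
    have "integrable (density (distr lborel borel (\<lambda>x. 0 + e *\<^sub>R x)) (\<lambda>_. \<bar>e\<bar> ^ DIM('a))) (\<lambda>x. norm (\<Theta> x))"
      unfolding lborel_affine[of e 0, OF less_imp_neq[OF e, symmetric], symmetric]
      by (rule integrable_norm) (rule integrable_bounded_decay[of \<Theta>, OF meas(3) CT(2)], simp)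
    then have "integrable lborel (\<lambda>x. \<bar>e\<bar> ^ DIM('a) *\<^sub>R norm (\<Theta> (0 + e *\<^sub>R x)))"
      using e by (subst (asm) integrable_density) (auto simp: integrable_distr_eq)
    then show ?thesis using e by simp
  qed
  \<comment> \<open>The multiplication formula: the transform moves from F to the dilated
    \<open>\<Theta>\<close>, and the substitution s = t + e u undoes the dilation.\<close>
  have inner: "(LINT \<xi>|lborel. fourier F \<xi> * \<Theta> (e *\<^sub>R \<xi>) * cis (2 * pi * (\<xi> \<bullet> t)))
     = (LINT u|lborel. F (t + e *\<^sub>R u) * fourier \<Theta> u)" for t
  proof -
    have "(LINT \<xi>|lborel. fourier F \<xi> * \<Theta> (e *\<^sub>R \<xi>) * cis (2 * pi * (\<xi> \<bullet> t)))
       = (LINT \<xi>|lborel. LINT s|lborel. F s * cis (- (2 * pi * (\<xi> \<bullet> s))) * (\<Theta> (e *\<^sub>R \<xi>) * cis (2 * pi * (\<xi> \<bullet> t))))"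
      by (subst integral_mult_left_zero) (simp only: fourier_def mult.assoc)
    also have "\<dots> = (LINT s|lborel. LINT \<xi>|lborel. F s * cis (- (2 * pi * (\<xi> \<bullet> s))) * (\<Theta> (e *\<^sub>R \<xi>) * cis (2 * pi * (\<xi> \<bullet> t))))"
    proof (rule fubini_swap[OF _ i\<Theta> id[of CF]])
      show "(\<lambda>z. F (snd z) * cis (- (2 * pi * (fst z \<bullet> snd z))) * (\<Theta> (e *\<^sub>R fst z) * cis (2 * pi * (fst z \<bullet> t)))) \<in> borel_measurable borel"
      proof (intro borel_measurable_times cism')
        show "(\<lambda>z::'a \<times> 'a. cis (2 * pi * (fst z \<bullet> t))) \<in> borel_measurable borel"
          by (intro borel_measurable_continuous_onI continuous_intros)
      qed measurable
      show "norm (F s * cis (- (2 * pi * (\<xi> \<bullet> s))) * (\<Theta> (e *\<^sub>R \<xi>) * cis (2 * pi * (\<xi> \<bullet> t))))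
          \<le> norm (\<Theta> (e *\<^sub>R \<xi>)) * (CF * decay ?s s)" for \<xi> s
        using mult_left_mono[OF CF(2)[of s], of "norm (\<Theta> (e *\<^sub>R \<xi>))"] by (simp add: norm_mult mult.commute)
    qed
    also have "\<dots> = (LINT s|lborel. F s * (LINT \<xi>|lborel. \<Theta> (e *\<^sub>R \<xi>) * cis (- (2 * pi * (\<xi> \<bullet> (s - t))))))"
    proof (intro Bochner_Integration.integral_cong refl)
      fix s :: 'a
      have "cis (- (2 * pi * (\<xi> \<bullet> s))) * cis (2 * pi * (\<xi> \<bullet> t)) = cis (- (2 * pi * (\<xi> \<bullet> (s - t))))" for \<xi>
        unfolding cis_mult by (simp add: inner_diff_right algebra_simps)
      then show "(LINT \<xi>|lborel. F s * cis (- (2 * pi * (\<xi> \<bullet> s))) * (\<Theta> (e *\<^sub>R \<xi>) * cis (2 * pi * (\<xi> \<bullet> t))))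
        = F s * (LINT \<xi>|lborel. \<Theta> (e *\<^sub>R \<xi>) * cis (- (2 * pi * (\<xi> \<bullet> (s - t)))))"
        by (subst integral_mult_right_zero[symmetric], intro Bochner_Integration.integral_cong refl)
           (metis (no_types, lifting) mult.assoc mult.left_commute)
    qed
    also have "\<dots> = (e ^ DIM('a)) *\<^sub>R (LINT u|lborel. F (t + e *\<^sub>R u) * (LINT \<xi>|lborel. \<Theta> (e *\<^sub>R \<xi>) * cis (- (2 * pi * (\<xi> \<bullet> (e *\<^sub>R u))))))"
    proof -
      have "(\<lambda>z. \<Theta> (e *\<^sub>R snd z) * cis (- (2 * pi * (snd z \<bullet> (fst z - t))))) \<in> borel_measurable borel"
      proof (rule borel_measurable_times)
        show "(\<lambda>z::'a \<times> 'a. cis (- (2 * pi * (snd z \<bullet> (fst z - t))))) \<in> borel_measurable borel"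
          by (intro borel_measurable_continuous_onI continuous_intros)
      qed measurable
      from borel_measurable_integral_pair[OF this]
      have "(\<lambda>s. F s * (LINT \<xi>|lborel. \<Theta> (e *\<^sub>R \<xi>) * cis (- (2 * pi * (\<xi> \<bullet> (s - t)))))) \<in> borel_measurable borel"
        by simp
      from integral_scale[OF this e, of t] show ?thesis by simp
    qed
    also have "\<dots> = (LINT u|lborel. F (t + e *\<^sub>R u) * ((e ^ DIM('a)) *\<^sub>R (LINT \<xi>|lborel. \<Theta> (e *\<^sub>R \<xi>) * cis (- (2 * pi * (\<xi> \<bullet> (e *\<^sub>R u)))))))"
      by (simp only: mult_scaleR_right integral_scaleR_right)
    also have "\<dots> = (LINT u|lborel. F (t + e *\<^sub>R u) * fourier \<Theta> u)"
    proof -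
      have "(e ^ DIM('a)) *\<^sub>R (LINT \<xi>|lborel. \<Theta> (e *\<^sub>R \<xi>) * cis (- (2 * pi * (\<xi> \<bullet> (e *\<^sub>R u))))) = fourier \<Theta> u" for u
      proof -
        have "(\<lambda>\<xi>. \<Theta> \<xi> * cis (- (2 * pi * (u \<bullet> \<xi>)))) \<in> borel_measurable borel"
          by (intro borel_measurable_times borel_measurable_cis_inner meas)
        from integral_scale[OF this e, where t = 0] show ?thesis
          by (simp add: fourier_def inner_commute)
      qed
      then show ?thesis by (simp only:)
    qed
    finally show ?thesis .
  qed
  have "(LINT \<xi>|lborel. fourier F \<xi> * cnj (fourier G \<xi>) * \<Theta> (e *\<^sub>R \<xi>))
     = (LINT \<xi>|lborel. LINT t|lborel. fourier F \<xi> * \<Theta> (e *\<^sub>R \<xi>) * (cnj (G t) * cis (2 * pi * (\<xi> \<bullet> t))))"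
  proof (intro Bochner_Integration.integral_cong refl)
    fix \<xi> :: 'a
    have "cnj (fourier G \<xi>) = (LINT t|lborel. cnj (G t) * cis (2 * pi * (\<xi> \<bullet> t)))"
      unfolding fourier_def by (simp add: cis_cnj flip: Bochner_Integration.integral_cnj)
    then show "fourier F \<xi> * cnj (fourier G \<xi>) * \<Theta> (e *\<^sub>R \<xi>) = (LINT t|lborel. fourier F \<xi> * \<Theta> (e *\<^sub>R \<xi>) * (cnj (G t) * cis (2 * pi * (\<xi> \<bullet> t))))"
      by simp
  qed
  also have "\<dots> = (LINT t|lborel. LINT \<xi>|lborel. fourier F \<xi> * \<Theta> (e *\<^sub>R \<xi>) * (cnj (G t) * cis (2 * pi * (\<xi> \<bullet> t))))"
  proof (rule fubini_swap[OF _ id[of "CF * CT"] id[of CG]])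
    show "(\<lambda>z. fourier F (fst z) * \<Theta> (e *\<^sub>R fst z) * (cnj (G (snd z)) * cis (2 * pi * (fst z \<bullet> snd z)))) \<in> borel_measurable borel"
    proof (intro borel_measurable_times cism)
      show "(\<lambda>z::'a \<times> 'a. cnj (G (snd z))) \<in> borel_measurable borel"
        by (rule measurable_compose[OF borel_measurable_fst_snd(2)])
           (rule measurable_compose[OF meas(2) borel_measurable_continuous_onI], intro continuous_intros)
    qed measurable
    show "norm (fourier F x * \<Theta> (e *\<^sub>R x) * (cnj (G y) * cis (2 * pi * (x \<bullet> y)))) \<le> CF * CT * decay ?s x * (CG * decay ?s y)" for x y
    proof -
      have "norm (fourier F x) * norm (\<Theta> (e *\<^sub>R x)) * norm (G y) \<le> (CF * decay ?s x) * CT * (CG * decay ?s y)"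
        using CF CG T1 CT(1) by (intro mult_mono) auto
      then show ?thesis by (simp add: norm_mult ac_simps)
    qed
  qed
  also have "\<dots> = (LINT t|lborel. cnj (G t) * (LINT \<xi>|lborel. fourier F \<xi> * \<Theta> (e *\<^sub>R \<xi>) * cis (2 * pi * (\<xi> \<bullet> t))))"
    by (intro Bochner_Integration.integral_cong refl, subst integral_mult_right_zero[symmetric])
       (rule Bochner_Integration.integral_cong, auto)
  finally show ?thesis unfolding inner .
qed

text \<open>Along e = 1/(n+1), \<open>\<Theta> (e *\<^sub>R \<xi>)\<close> tends to
  \<open>\<Theta> 0\<close> and F(t + e u) tends to F(t); the decay contained in
  \<open>fourier_nice\<close> dominates both sides.\<close>

lemma parseval_limit:
  fixes F G \<Theta> :: "'a::euclidean_space \<Rightarrow> complex"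
  assumes F: "fourier_nice F" and G: "fourier_nice G" and \<Theta>: "fourier_nice \<Theta>"
  shows "\<Theta> 0 * (LINT \<xi>|lborel. fourier F \<xi> * cnj (fourier G \<xi>))
    = (LINT u|lborel. fourier \<Theta> u) * (LINT t|lborel. F t * cnj (G t))"
proof -
  let ?s = "real (2 * DIM('a))"
  obtain CF where CF: "CF > 0" "\<And>t. norm (F t) \<le> CF * decay ?s t" "\<And>t. norm (fourier F t) \<le> CF * decay ?s t"
    using F unfolding fourier_nice_def by blast
  obtain CG where CG: "CG > 0" "\<And>t. norm (G t) \<le> CG * decay ?s t" "\<And>t. norm (fourier G t) \<le> CG * decay ?s t"
    using G unfolding fourier_nice_def by blast
  obtain CT where CT: "CT > 0" "\<And>t. norm (\<Theta> t) \<le> CT * decay ?s t" "\<And>t. norm (fourier \<Theta> t) \<le> CT * decay ?s t"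
    using \<Theta> unfolding fourier_nice_def by blast
  have cont: "continuous_on UNIV F" "continuous_on UNIV G" "continuous_on UNIV \<Theta>"
    using F G \<Theta> unfolding fourier_nice_def by auto
  have meas[measurable]: "F \<in> borel_measurable borel" "G \<in> borel_measurable borel" "\<Theta> \<in> borel_measurable borel"
    using cont by (auto intro: borel_measurable_continuous_onI)
  note meas'[measurable] = meas[THEN borel_measurable_fourier]
  have cnjm[measurable]: "(\<lambda>x. cnj (f x)) \<in> borel_measurable borel" if "f \<in> borel_measurable borel" for f :: "'a \<Rightarrow> complex"
    by (rule measurable_compose[OF that borel_measurable_continuous_onI]) (intro continuous_intros)
  have id: "integrable lborel (\<lambda>x::'a. C * decay ?s x)" for C using integrable_decay[where 'a = 'a, of ?s] by simp
  have d1: "decay ?s x \<le> 1" for x :: 'a by (rule decay_le_1) simp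
  have T1: "norm (\<Theta> x) \<le> CT" for x using order_trans[OF CT(2) mult_left_mono[OF d1, of CT]] CT(1) by simp
  have F1: "norm (F x) \<le> CF" for x using order_trans[OF CF(2) mult_left_mono[OF d1, of CF]] CF(1) by simp
  have G1: "norm (fourier G x) \<le> CG" for x using order_trans[OF CG(3) mult_left_mono[OF d1, of CG]] CG(1) by simp
  define e where "e n = inverse (real (Suc n))" for n
  have e: "0 < e n" for n by (simp add: e_def)
  have e0: "e \<longlonglongrightarrow> 0" unfolding e_def by (rule LIMSEQ_inverse_real_of_nat)
  have c0: "(\<lambda>n. f (t + e n *\<^sub>R u)) \<longlonglongrightarrow> f t" if "continuous_on UNIV f" for f :: "'a \<Rightarrow> complex" and t u
  proof -
    have "(\<lambda>n. t + e n *\<^sub>R u) \<longlonglongrightarrow> t + 0 *\<^sub>R u" by (intro tendsto_intros e0)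
    then have "(\<lambda>n. t + e n *\<^sub>R u) \<longlonglongrightarrow> t" by simp
    moreover have "isCont f t" using that by (simp add: continuous_on_eq_continuous_at)
    ultimately show ?thesis by (rule isCont_tendsto_compose[rotated])
  qed
  have lhs: "(\<lambda>n. LINT \<xi>|lborel. fourier F \<xi> * cnj (fourier G \<xi>) * \<Theta> (e n *\<^sub>R \<xi>)) \<longlonglongrightarrow>
      (LINT \<xi>|lborel. fourier F \<xi> * cnj (fourier G \<xi>) * \<Theta> 0)"
  proof (rule integral_dominated_convergence[where w = "\<lambda>\<xi>. CF * CG * CT * decay ?s \<xi>"])
    show "AE x in lborel. (\<lambda>n. fourier F x * cnj (fourier G x) * \<Theta> (e n *\<^sub>R x)) \<longlonglongrightarrow> fourier F x * cnj (fourier G x) * \<Theta> 0"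
      using c0[OF cont(3), of 0] by (intro AE_I2 tendsto_intros) simp
    show "AE x in lborel. norm (fourier F x * cnj (fourier G x) * \<Theta> (e n *\<^sub>R x)) \<le> CF * CG * CT * decay ?s x" for n
    proof (rule AE_I2)
      fix x
      have "norm (fourier F x) * norm (fourier G x) * norm (\<Theta> (e n *\<^sub>R x)) \<le> (CF * decay ?s x) * CG * CT"
        using CF CG G1 T1 CT(1) by (intro mult_mono) auto
      then show "norm (fourier F x * cnj (fourier G x) * \<Theta> (e n *\<^sub>R x)) \<le> CF * CG * CT * decay ?s x"
        by (simp add: norm_mult ac_simps)
    qed
  qed (use id in \<open>auto intro!: borel_measurable_times cnjm meas'\<close>)
  let ?I = "LINT u|lborel. fourier \<Theta> u"
  have int\<Theta>: "integrable lborel (fourier \<Theta>)"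
    by (rule integrable_bounded_decay[OF meas'(3) CT(3)]) simp
  have Jm: "(\<lambda>t. LINT u|lborel. F (t + e n *\<^sub>R u) * fourier \<Theta> u) \<in> borel_measurable borel" for n
  proof -
    have "(\<lambda>z. F (fst z + e n *\<^sub>R snd z) * fourier \<Theta> (snd z)) \<in> borel_measurable borel"
      by measurable
    from borel_measurable_integral_pair[OF this] show ?thesis by simp
  qed
  have J: "(\<lambda>n. LINT u|lborel. F (t + e n *\<^sub>R u) * fourier \<Theta> u) \<longlonglongrightarrow> F t * ?I" for t
  proof -
    have "(\<lambda>n. LINT u|lborel. F (t + e n *\<^sub>R u) * fourier \<Theta> u) \<longlonglongrightarrow> (LINT u|lborel. F t * fourier \<Theta> u)"
    proof (rule integral_dominated_convergence[where w = "\<lambda>u. CF * norm (fourier \<Theta> u)"])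
      show "AE u in lborel. (\<lambda>n. F (t + e n *\<^sub>R u) * fourier \<Theta> u) \<longlonglongrightarrow> F t * fourier \<Theta> u"
        using c0[OF cont(1)] by (intro AE_I2 tendsto_intros) simp
      show "AE u in lborel. norm (F (t + e n *\<^sub>R u) * fourier \<Theta> u) \<le> CF * norm (fourier \<Theta> u)" for n
        using F1 by (intro AE_I2) (simp add: norm_mult mult_right_mono)
    qed (use int\<Theta> in auto)
    then show ?thesis by simp
  qed
  have rhs: "(\<lambda>n. LINT t|lborel. cnj (G t) * (LINT u|lborel. F (t + e n *\<^sub>R u) * fourier \<Theta> u)) \<longlonglongrightarrow>
     (LINT t|lborel. cnj (G t) * (F t * ?I))"
  proof (rule integral_dominated_convergence[where w = "\<lambda>t. (CG * (LINT u|lborel. CF * norm (fourier \<Theta> u))) * decay ?s t"])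
    show "AE t in lborel. (\<lambda>n. cnj (G t) * (LINT u|lborel. F (t + e n *\<^sub>R u) * fourier \<Theta> u)) \<longlonglongrightarrow> cnj (G t) * (F t * ?I)"
      using J by (intro AE_I2 tendsto_intros)
    show "AE t in lborel. norm (cnj (G t) * (LINT u|lborel. F (t + e n *\<^sub>R u) * fourier \<Theta> u)) \<le> (CG * (LINT u|lborel. CF * norm (fourier \<Theta> u))) * decay ?s t" for n
    proof (rule AE_I2)
      fix t
      have "norm (LINT u|lborel. F (t + e n *\<^sub>R u) * fourier \<Theta> u) \<le> (LINT u|lborel. CF * norm (fourier \<Theta> u))"
      proof (rule norm_integral_le)
        show "integrable lborel (\<lambda>u. F (t + e n *\<^sub>R u) * fourier \<Theta> u)"
          by (rule Bochner_Integration.integrable_bound[of _ "\<lambda>u. CF * norm (fourier \<Theta> u)"])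
             (use int\<Theta> F1 CF in \<open>auto simp: norm_mult mult_right_mono\<close>)
      qed (use int\<Theta> F1 in \<open>auto simp: norm_mult mult_right_mono\<close>)
      then have "norm (G t) * norm (LINT u|lborel. F (t + e n *\<^sub>R u) * fourier \<Theta> u) \<le> (CG * decay ?s t) * (LINT u|lborel. CF * norm (fourier \<Theta> u))"
        using CG by (intro mult_mono) auto
      then show "norm (cnj (G t) * (LINT u|lborel. F (t + e n *\<^sub>R u) * fourier \<Theta> u)) \<le> (CG * (LINT u|lborel. CF * norm (fourier \<Theta> u))) * decay ?s t"
        by (simp add: norm_mult ac_simps)
    qed
  qed (use id Jm in \<open>auto intro!: borel_measurable_times cnjm meas\<close>)
  have "(LINT \<xi>|lborel. fourier F \<xi> * cnj (fourier G \<xi>) * \<Theta> 0) = (LINT t|lborel. cnj (G t) * (F t * ?I))"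
    by (rule LIMSEQ_unique[OF lhs]) (use rhs parseval_regularized[OF F G \<Theta> e] in simp)
  moreover have "(LINT t|lborel. cnj (G t) * (F t * ?I)) = (LINT t|lborel. ?I * (F t * cnj (G t)))"
    by (intro Bochner_Integration.integral_cong) (auto simp: ac_simps)
  ultimately show ?thesis by (simp add: mult.commute)
qed

text \<open>A zero integral would make f vanish almost everywhere, but the set where f is nonzero is
  open and contains x0.\<close>

lemma continuous_nonneg_integral_pos:
  fixes f :: "'a::euclidean_space \<Rightarrow> real"
  assumes "continuous_on UNIV f" "\<And>x. 0 \<le> f x" "integrable lborel f" "0 < f x0"
  shows "0 < integral\<^sup>L lborel f"
proof -
  have "integral\<^sup>L lborel f \<noteq> 0"
  proof
    assume "integral\<^sup>L lborel f = 0"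
    then have "AE x in lborel. f x = 0" using assms by (subst (asm) integral_nonneg_eq_0_iff_AE) auto
    then have "AE x in lebesgue. f x = 0" by (rule AE_completion)
    then have "negligible {x. f x \<noteq> 0}"
      by (simp add: eventually_ae_filter_negligible) (metis (mono_tags, lifting) mem_Collect_eq negligible_subset subsetI)
    moreover have "open {x. f x \<noteq> 0}"
      using open_Collect_neq[OF assms(1) continuous_on_const[of _ 0]] by simp
    ultimately show False using open_not_negligible assms(4) by (metis (mono_tags, lifting) empty_iff less_irrefl mem_Collect_eq)
  qed
  then show ?thesis using Bochner_Integration.integral_nonneg[of lborel f] assms(2) by (simp add: less_le)
qed

lemma schwartz_stft_kernel:
  fixes f \<phi> :: "'a::euclidean_space \<Rightarrow> complex"
  assumes "f \<in> schwartz" "\<phi> \<in> schwartz"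
  shows "(\<lambda>z. f (snd z) * cnj (\<phi> (snd z - fst z))) \<in> schwartz"
  using schwartz_tensor[OF assms, of 0 1 1 "- 1"] by simp

text \<open>The constant is 1, but only \<open>c \<noteq> 0\<close> is ever needed, so it is never computed.\<close>

theorem parseval:
  fixes \<phi> :: "'a::euclidean_space \<Rightarrow> complex"
  assumes \<phi>: "\<phi> \<in> schwartz" "\<phi> \<noteq> (\<lambda>_. 0)"
  obtains c where "c \<noteq> 0"
    "\<And>F G :: 'a \<Rightarrow> complex. fourier_nice F \<Longrightarrow> fourier_nice G \<Longrightarrow>
      (LINT \<xi>|lborel. fourier F \<xi> * cnj (fourier G \<xi>)) = c * (LINT t|lborel. F t * cnj (G t))"
proof -
  let ?s = "real (2 * DIM('a))"
  obtain x0 where x0: "\<phi> x0 \<noteq> 0" using \<phi> by auto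
  \<comment> \<open>A regularising function with \<open>\<Theta> 0\<close> nonzero: the window moved
    so that a point where it does not vanish sits at the origin. The constant conjugate factor lets
    it be a section of a Schwartz tensor, hence \<open>fourier_nice\<close>.\<close>
  define \<Theta> where "\<Theta> t = \<phi> (x0 + t) * cnj (\<phi> x0)" for t
  have "(\<lambda>z. \<phi> (fst z + snd z) * cnj (\<phi> (fst z))) \<in> schwartz"
    using schwartz_tensor[OF \<phi>(1) \<phi>(1), of 1 0 1 1] by simp
  from fourier_nice_section[OF this, of x0] have \<Theta>: "fourier_nice \<Theta>" by (simp add: \<Theta>_def[abs_def])
  have \<Theta>0: "\<Theta> 0 \<noteq> 0" using x0 by (simp add: \<Theta>_def)
  define c where "c = (LINT u|lborel. fourier \<Theta> u) / \<Theta> 0"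
  have main: "(LINT \<xi>|lborel. fourier F \<xi> * cnj (fourier G \<xi>)) = c * (LINT t|lborel. F t * cnj (G t))"
    if "fourier_nice F" "fourier_nice G" for F G :: "'a \<Rightarrow> complex"
    using parseval_limit[OF that \<Theta>] \<Theta>0 by (simp add: c_def field_simps)
  \<comment> \<open>For c = 0 the identity with F = G = |\<phi>|^2 would force the square integral
    of the transform of F to be zero; yet that transform is continuous and its value at 0 is the
    positive integral of |\<phi>|^2.\<close>
  have "c \<noteq> 0"
  proof
    assume c0: "c = 0"
    let ?H = "\<lambda>z. \<phi> (snd z) * cnj (\<phi> (snd z - fst z))"
    have H: "?H \<in> schwartz" by (rule schwartz_stft_kernel[OF \<phi>(1) \<phi>(1)])
    define F where "F t = \<phi> t * cnj (\<phi> t)" for t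
    have F: "fourier_nice F" using fourier_nice_section[OF H, of 0] by (simp add: F_def[abs_def])
    have Feq: "F = (\<lambda>t. complex_of_real ((norm (\<phi> t))\<^sup>2))" unfolding F_def using complex_norm_square by presburger
    have cF: "continuous_on UNIV F" and FD: "\<exists>C. (\<forall>t. norm (F t) \<le> C * decay ?s t) \<and> (\<forall>t. norm (fourier F t) \<le> C * decay ?s t)"
      using F unfolding fourier_nice_def by blast+
    then obtain C where C: "\<And>t. norm (F t) \<le> C * decay ?s t" "\<And>t. norm (fourier F t) \<le> C * decay ?s t" by blast
    have iF: "integrable lborel F"
      by (rule integrable_bounded_decay[OF borel_measurable_continuous_onI[OF cF] C(1)]) simp
    have cFF: "continuous_on UNIV (fourier F)"
    proof -
      have "continuous_on UNIV (\<lambda>\<xi>. partial_fourier ?H (0, \<xi>))"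
        by (intro continuous_on_compose2[OF schwartz_continuous[OF schwartz_partial_fourier[OF H]]] continuous_intros) auto
      then show ?thesis by (simp add: partial_fourier_eq F_def[abs_def])
    qed
    have pos: "0 < (LINT t|lborel. (norm (\<phi> t))\<^sup>2)"
    proof (rule continuous_nonneg_integral_pos[of _ x0])
      show "continuous_on UNIV (\<lambda>t. (norm (\<phi> t))\<^sup>2)" by (intro continuous_intros schwartz_continuous[OF \<phi>(1)])
      show "integrable lborel (\<lambda>t. (norm (\<phi> t))\<^sup>2)" using integrable_norm[OF iF] by (simp add: F_def norm_mult power2_eq_square)
    qed (use x0 in auto)
    have eq: "fourier F 0 = complex_of_real (LINT t|lborel. (norm (\<phi> t))\<^sup>2)"
      unfolding integral_complex_of_real[symmetric] by (simp add: fourier_def Feq)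
    have F0: "fourier F 0 \<noteq> 0"
      unfolding eq of_real_eq_0_iff by (rule less_imp_neq[OF pos, symmetric])
    have iFF: "integrable lborel (\<lambda>\<xi>. (norm (fourier F \<xi>))\<^sup>2)"
    proof (rule integrable_bounded_decay[where s = ?s and C = "C * C"])
      show "norm ((norm (fourier F \<xi>))\<^sup>2) \<le> C * C * decay ?s \<xi>" for \<xi>
      proof -
        have "0 \<le> C" using order_trans[OF norm_ge_zero C(1)[of 0]] by simp
        have "decay ?s \<xi> \<le> 1" by (rule decay_le_1) simp
        then have "norm (fourier F \<xi>) \<le> C" using C(2)[of \<xi>] \<open>0 \<le> C\<close> mult_left_mono[of "decay ?s \<xi>" 1 C] by simp
        then have "norm (fourier F \<xi>) * norm (fourier F \<xi>) \<le> C * (C * decay ?s \<xi>)"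
          using C(2)[of \<xi>] \<open>0 \<le> C\<close> by (intro mult_mono) auto
        then show ?thesis by (simp add: power2_eq_square)
      qed
    qed (use cFF in \<open>auto intro!: borel_measurable_continuous_onI continuous_intros\<close>)
    have pos': "0 < (LINT \<xi>|lborel. (norm (fourier F \<xi>))\<^sup>2)"
      by (rule continuous_nonneg_integral_pos[OF _ _ iFF, of 0]) (use F0 cFF in \<open>auto intro!: continuous_intros\<close>)
    have "complex_of_real (LINT \<xi>|lborel. (norm (fourier F \<xi>))\<^sup>2) = (LINT \<xi>|lborel. fourier F \<xi> * cnj (fourier F \<xi>))"
      unfolding integral_complex_of_real[symmetric] complex_norm_square by (rule refl)
    also have "\<dots> = 0" using main[OF F F] unfolding c0 by (simp only: mult_zero_left)
    finally show False unfolding of_real_eq_0_iff using less_imp_neq[OF pos'] by (simp only: not_True_eq_False)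
  qed
  then show ?thesis using main that by blast
qed


section \<open>Time-frequency analysis: reproducing formula, maximal functions,
  factorisation\<close>

section \<open>Short-time Fourier transforms of Schwartz functions\<close>

lemma integrable_decay_diff:
  assumes "real (2 * DIM('a)) \<le> s"
  shows "integrable lborel (\<lambda>w::'a::euclidean_space. decay s (z - w))"
  using integrable_decay[OF assms] integrable_distr_eq[of "\<lambda>w. z - w" lborel borel "decay s"]
  by (simp add: lborel_distr_reflect)

abbreviation stft :: "('a::euclidean_space \<Rightarrow> complex) \<Rightarrow> ('a \<Rightarrow> complex) \<Rightarrow> 'a \<times> 'a \<Rightarrow> complex" where
  "stft \<phi> f \<equiv> STFT \<phi> (distribution_of f)"

lemma stft_eq_inner: "stft \<psi> f (x, \<xi>) = (LINT t|lborel. f t * cnj (modulate \<xi> (translate x \<psi>) t))"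
  by (simp add: STFT_def distribution_of_def)

lemma stft_eq: "stft \<psi> f (x, \<xi>) = (LINT t|lborel. f t * cnj (\<psi> (t - x)) * cis (- (2 * pi * (\<xi> \<bullet> t))))"
  by (simp add: stft_eq_inner modulate_def translate_def cis_cnj inner_commute ac_simps)

lemma stft_eq_partial_fourier: "stft \<psi> f = partial_fourier (\<lambda>z. f (snd z) * cnj (\<psi> (snd z - fst z)))"
  by (auto simp: fun_eq_iff stft_eq partial_fourier_def)

lemma schwartz_stft: "f \<in> schwartz \<Longrightarrow> \<psi> \<in> schwartz \<Longrightarrow> stft \<psi> f \<in> schwartz"
  unfolding stft_eq_partial_fourier by (intro schwartz_partial_fourier schwartz_stft_kernel)

lemma schwartz_inner_integrable:
  fixes f g :: "'a::euclidean_space \<Rightarrow> complex"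
  assumes "f \<in> schwartz" "g \<in> schwartz"
  shows "integrable lborel (\<lambda>t. f t * cnj (g t))"
proof -
  obtain C where C: "0 < C" "\<And>x. norm (f x) \<le> C * decay (real (2 * DIM('a))) x" using schwartz_decay[OF assms(1)] by metis
  obtain C' where C': "0 < C'" "\<And>x. norm (g x) \<le> C' * decay 0 x" using schwartz_decay[OF assms(2)] by metis
  show ?thesis
  proof (rule integrable_bounded_decay[where C = "C * C'" and s = "real (2 * DIM('a))"])
    show "(\<lambda>t. f t * cnj (g t)) \<in> borel_measurable borel"
      by (intro borel_measurable_continuous_onI continuous_intros schwartz_continuous assms)
    have "norm (f t) * norm (g t) \<le> (C * decay (real (2 * DIM('a))) t) * C'" for t
      using C C'(1) C'(2)[of t] by (intro mult_mono) (auto simp: decay_def)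
    then show "norm (f t * cnj (g t)) \<le> C * C' * decay (real (2 * DIM('a))) t" for t
      by (simp add: norm_mult ac_simps)
  qed simp
qed

lemma inner_self_pos:
  assumes "\<phi> \<in> schwartz" "\<phi> \<noteq> (\<lambda>_. 0)"
  shows "0 < (LINT t|lborel. (norm (\<phi> t))\<^sup>2)"
    "(LINT t|lborel. \<phi> t * cnj (\<phi> t)) = complex_of_real (LINT t|lborel. (norm (\<phi> t))\<^sup>2)"
proof -
  obtain x0 where "\<phi> x0 \<noteq> 0" using assms by auto
  then show "0 < (LINT t|lborel. (norm (\<phi> t))\<^sup>2)"
    using integrable_norm[OF schwartz_inner_integrable[OF assms(1) assms(1)]]
    by (intro continuous_nonneg_integral_pos[of _ x0])
       (auto intro!: continuous_intros schwartz_continuous[OF assms(1)] simp: norm_mult power2_eq_square)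
  show "(LINT t|lborel. \<phi> t * cnj (\<phi> t)) = complex_of_real (LINT t|lborel. (norm (\<phi> t))\<^sup>2)"
    unfolding integral_complex_of_real[symmetric] complex_norm_square by (rule refl)
qed

text \<open>Moyal's identity. Parseval in the frequency for each fixed x leaves a double integral
  over x and t, whose x-integral sees the window only and yields its squared norm.\<close>

theorem stft_orthogonality:
  fixes \<phi> :: "'a::euclidean_space \<Rightarrow> complex"
  assumes \<phi>: "\<phi> \<in> schwartz" "\<phi> \<noteq> (\<lambda>_. 0)"
  obtains c where "c \<noteq> 0" "\<And>f g. f \<in> schwartz \<Longrightarrow> g \<in> schwartz \<Longrightarrow>
    (LINT w|lborel. stft \<phi> f w * cnj (stft \<phi> g w)) = c * (LINT t|lborel. f t * cnj (g t))"
proof -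
  let ?s = "real (2 * DIM('a))"
  obtain c where c: "c \<noteq> 0"
    "\<And>F G :: 'a \<Rightarrow> complex. fourier_nice F \<Longrightarrow> fourier_nice G \<Longrightarrow>
      (LINT \<xi>|lborel. fourier F \<xi> * cnj (fourier G \<xi>)) = c * (LINT t|lborel. F t * cnj (G t))"
    using parseval[OF \<phi>] by blast
  let ?N = "LINT t|lborel. \<phi> t * cnj (\<phi> t)"
  have N: "?N \<noteq> 0" using inner_self_pos[OF \<phi>] by simp
  show ?thesis
  proof (rule that[of "c * ?N"])
    show "c * ?N \<noteq> 0" using c N by simp
    fix f g :: "'a \<Rightarrow> complex" assume fg: "f \<in> schwartz" "g \<in> schwartz"
    let ?H = "\<lambda>f z. f (snd z) * cnj (\<phi> (snd z - fst z))"
    have H: "?H f \<in> schwartz" "?H g \<in> schwartz" using fg \<phi> by (auto intro: schwartz_stft_kernel)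
    have "(LINT w|lborel. stft \<phi> f w * cnj (stft \<phi> g w))
       = (LINT x|lborel. LINT \<xi>|lborel. stft \<phi> f (x, \<xi>) * cnj (stft \<phi> g (x, \<xi>)))"
      by (rule integral_lborel_prod) (intro schwartz_inner_integrable schwartz_stft fg \<phi>)
    also have "\<dots> = (LINT x|lborel. c * (LINT t|lborel. ?H f (x, t) * cnj (?H g (x, t))))"
      unfolding stft_eq_partial_fourier partial_fourier_eq
      by (subst c(2)[OF fourier_nice_section[OF H(1)] fourier_nice_section[OF H(2)]]) (rule refl)
    also have "\<dots> = c * (LINT x|lborel. LINT t|lborel. ?H f (x, t) * cnj (?H g (x, t)))"
      by simp
    also have "(LINT x|lborel. LINT t|lborel. ?H f (x, t) * cnj (?H g (x, t)))
       = (LINT t|lborel. LINT x|lborel. ?H f (x, t) * cnj (?H g (x, t)))"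
    proof -
      obtain C where C: "0 < C" "\<And>z. norm (?H f z) \<le> C * decay (2 * ?s) z" using schwartz_decay[OF H(1)] by metis
      obtain C' where C': "0 < C'" "\<And>z. norm (?H g z) \<le> C' * decay 0 z" using schwartz_decay[OF H(2)] by metis
      show ?thesis
      proof (rule fubini_swap[where g = "\<lambda>x. C * C' * decay ?s x" and h = "decay ?s"])
        show "(\<lambda>z. ?H f (fst z, snd z) * cnj (?H g (fst z, snd z))) \<in> borel_measurable borel"
          using schwartz_inner_integrable[OF H] by simp
        fix x t :: 'a
        have "norm (?H f (x, t)) * norm (?H g (x, t)) \<le> (C * (decay ?s x * decay ?s t)) * C'"
        proof (rule mult_mono)
          have "C * decay (2 * ?s) (x, t) \<le> C * (decay ?s x * decay ?s t)"
            using C(1) by (intro mult_left_mono decay_Pair_le_mult) auto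
          then show "norm (?H f (x, t)) \<le> C * (decay ?s x * decay ?s t)" using C(2) order_trans by blast
          show "norm (?H g (x, t)) \<le> C'" using C'(2)[of "(x, t)"] by (simp add: decay_def)
        qed (use C in auto)
        then show "norm (?H f (x, t) * cnj (?H g (x, t))) \<le> C * C' * decay ?s x * decay ?s t"
          by (simp add: norm_mult ac_simps)
      qed (use integrable_decay[where 'a = 'a, of ?s] in auto)
    qed
    also have "\<dots> = (LINT t|lborel. ?N * (f t * cnj (g t)))"
    proof (intro Bochner_Integration.integral_cong refl)
      fix t
      have "(LINT x|lborel. ?H f (x, t) * cnj (?H g (x, t))) = (LINT x|lborel. (f t * cnj (g t)) * (\<phi> (t - x) * cnj (\<phi> (t - x))))"
        by (intro Bochner_Integration.integral_cong) auto
      also have "\<dots> = (f t * cnj (g t)) * (LINT x|lborel. \<phi> (t - x) * cnj (\<phi> (t - x)))" by simp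
      also have "(LINT x|lborel. \<phi> (t - x) * cnj (\<phi> (t - x))) = ?N"
        using integral_reflect[of "\<lambda>t. \<phi> t * cnj (\<phi> t)" t] schwartz_inner_integrable[OF \<phi>(1) \<phi>(1)] by auto
      finally show "(LINT x|lborel. ?H f (x, t) * cnj (?H g (x, t))) = ?N * (f t * cnj (g t))" by simp
    qed
    finally show "(LINT w|lborel. stft \<phi> f w * cnj (stft \<phi> g w)) = c * ?N * (LINT t|lborel. f t * cnj (g t))"
      by simp
  qed
qed

text \<open>The substitution t + x turns the shift of the function into a shift of the argument, up
  to a constant phase that the modulus removes.\<close>

lemma stft_covariance:
  fixes \<psi> \<phi> :: "'a::euclidean_space \<Rightarrow> complex"
  assumes "\<psi> \<in> schwartz" "\<phi> \<in> schwartz"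
  shows "norm (stft \<phi> (modulate \<zeta> (translate x \<psi>)) w) = norm (stft \<phi> \<psi> (w - (x, \<zeta>)))"
proof -
  obtain y \<eta> where w: "w = (y, \<eta>)" by (cases w)
  let ?g = "\<lambda>t. modulate \<zeta> (translate x \<psi>) t * cnj (\<phi> (t - y)) * cis (- (2 * pi * (\<eta> \<bullet> t)))"
  have m: "?g \<in> borel_measurable borel"
  proof (intro borel_measurable_times borel_measurable_cis_inner)
    show "modulate \<zeta> (translate x \<psi>) \<in> borel_measurable borel"
      by (intro schwartz_borel_measurable schwartz_modulate schwartz_translate assms)
    have "continuous_on UNIV (\<lambda>t. cnj (\<phi> (t - y)))"
      by (intro continuous_intros continuous_on_compose2[OF schwartz_continuous[OF assms(2), of UNIV]]) auto
    then show "(\<lambda>t. cnj (\<phi> (t - y))) \<in> borel_measurable borel" by (rule borel_measurable_continuous_onI)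
  qed
  have "stft \<phi> (modulate \<zeta> (translate x \<psi>)) w = (LINT t|lborel. ?g (t + x))"
    unfolding w stft_eq by (rule integral_translate[OF m, symmetric])
  also have "\<dots> = (LINT t|lborel. cis (2 * pi * (x \<bullet> (\<zeta> - \<eta>))) * (\<psi> t * cnj (\<phi> (t - (y - x))) * cis (- (2 * pi * ((\<eta> - \<zeta>) \<bullet> t)))))"
  proof (intro Bochner_Integration.integral_cong refl)
    fix t
    have "cis (2 * pi * ((t + x) \<bullet> \<zeta>)) * cis (- (2 * pi * (\<eta> \<bullet> (t + x))))
      = cis (2 * pi * (x \<bullet> (\<zeta> - \<eta>))) * cis (- (2 * pi * ((\<eta> - \<zeta>) \<bullet> t)))"
      unfolding cis_mult by (rule arg_cong[where f = cis]) (simp add: algebra_simps inner_commute inner_diff_left)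
    then have "\<psi> t * cnj (\<phi> (t + x - y)) * (cis (2 * pi * ((t + x) \<bullet> \<zeta>)) * cis (- (2 * pi * (\<eta> \<bullet> (t + x)))))
      = \<psi> t * cnj (\<phi> (t + x - y)) * (cis (2 * pi * (x \<bullet> (\<zeta> - \<eta>))) * cis (- (2 * pi * ((\<eta> - \<zeta>) \<bullet> t))))"
      by (rule arg_cong)
    moreover have "t - (y - x) = t + x - y" by simp
    ultimately show "?g (t + x) = cis (2 * pi * (x \<bullet> (\<zeta> - \<eta>))) * (\<psi> t * cnj (\<phi> (t - (y - x))) * cis (- (2 * pi * ((\<eta> - \<zeta>) \<bullet> t))))"
      unfolding modulate_def translate_def add_diff_cancel_right' by (simp only: mult_ac)
  qed
  also have "\<dots> = cis (2 * pi * (x \<bullet> (\<zeta> - \<eta>))) * stft \<phi> \<psi> (w - (x, \<zeta>))"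
    by (simp add: w stft_eq)
  finally show ?thesis by simp
qed

text \<open>The value at z is the inner product of f with the shifted window \<open>\<psi>\<close>.
  Moyal's identity rewrites it as an integral of the transform of f against that of the shifted
  \<open>\<psi>\<close>, whose modulus is by covariance a translate of a rapidly decreasing
  function.\<close>

lemma stft_reproducing:
  fixes \<phi> \<psi> :: "'a::euclidean_space \<Rightarrow> complex"
  assumes \<phi>: "\<phi> \<in> schwartz" "\<phi> \<noteq> (\<lambda>_. 0)" and \<psi>: "\<psi> \<in> schwartz" and s: "real (2 * DIM('a \<times> 'a)) \<le> s"
  obtains C where "0 < C" "\<And>f z. f \<in> schwartz \<Longrightarrow>
    norm (stft \<psi> f z) \<le> C * (LINT w|lborel. norm (stft \<phi> f w) * decay s (z - w))"
proof -
  obtain c where c: "c \<noteq> 0" "\<And>f g. f \<in> schwartz \<Longrightarrow> g \<in> schwartz \<Longrightarrow>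
    (LINT w|lborel. stft \<phi> f w * cnj (stft \<phi> g w)) = c * (LINT t|lborel. f t * cnj (g t))"
    using stft_orthogonality[OF \<phi>] by blast
  obtain C where C: "0 < C" "\<And>w. norm (stft \<phi> \<psi> w) \<le> C * decay s w"
    using schwartz_decay[OF schwartz_stft[OF \<psi> \<phi>(1)]] by metis
  show ?thesis
  proof (rule that[of "C / norm c"])
    show "0 < C / norm c" using C c by simp
    fix f :: "'a \<Rightarrow> complex" and z :: "'a \<times> 'a" assume f: "f \<in> schwartz"
    obtain x \<zeta> where z: "z = (x, \<zeta>)" by (cases z)
    let ?g = "modulate \<zeta> (translate x \<psi>)"
    have g: "?g \<in> schwartz" by (intro schwartz_modulate schwartz_translate \<psi>)
    have k: "norm (stft \<phi> f w * cnj (stft \<phi> ?g w)) \<le> C * (norm (stft \<phi> f w) * decay s (z - w))" for w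
    proof -
      have "norm (stft \<phi> ?g w) \<le> C * decay s (z - w)"
        using C(2)[of "w - z"] unfolding stft_covariance[OF \<psi> \<phi>(1)] z[symmetric] decay_minus_commute[of s z] .
      from mult_left_mono[OF this norm_ge_zero[of "stft \<phi> f w"]] show ?thesis
        unfolding norm_mult complex_mod_cnj by (simp only: mult_ac)
    qed
    obtain B where B: "0 < B" "\<And>w. norm (stft \<phi> f w) \<le> B * decay 0 w"
      using schwartz_decay[OF schwartz_stft[OF f \<phi>(1)]] by metis
    have int: "integrable lborel (\<lambda>w. norm (stft \<phi> f w) * decay s (z - w))"
    proof (rule Bochner_Integration.integrable_bound)
      show "integrable lborel (\<lambda>w. B * decay s (z - w))" using integrable_decay_diff[OF s] by simp
      show "(\<lambda>w. norm (stft \<phi> f w) * decay s (z - w)) \<in> borel_measurable lborel"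
        using schwartz_borel_measurable[OF schwartz_stft[OF f \<phi>(1)]] by measurable
      show "AE w in lborel. norm (norm (stft \<phi> f w) * decay s (z - w)) \<le> norm (B * decay s (z - w))"
        using B by (intro AE_I2) (simp add: abs_mult decay_def[of 0] mult_right_mono)
    qed
    have "norm c * norm (stft \<psi> f z) = norm (LINT w|lborel. stft \<phi> f w * cnj (stft \<phi> ?g w))"
      unfolding c(2)[OF f g] by (simp add: z stft_eq_inner norm_mult)
    also have "\<dots> \<le> (LINT w|lborel. C * (norm (stft \<phi> f w) * decay s (z - w)))"
      by (rule norm_integral_le) (use k int schwartz_inner_integrable[OF schwartz_stft[OF f \<phi>(1)] schwartz_stft[OF g \<phi>(1)]] in auto)
    finally show "norm (stft \<psi> f z) \<le> C / norm c * (LINT w|lborel. norm (stft \<phi> f w) * decay s (z - w))"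
      using c by (simp add: field_simps)
  qed
qed


section \<open>Peetre maximal functions\<close>

text \<open>Peetre's maximal function: for bounded F, the least majorant that varies slowly at rate
  K in the sense of \<open>peetre_slow\<close>. The supremum is real, so boundedness is what gives
  it a meaning; transforms of Schwartz functions are bounded.\<close>

definition peetre :: "real \<Rightarrow> ('a::euclidean_space \<Rightarrow> real) \<Rightarrow> 'a \<Rightarrow> real" where
  "peetre K F z = (SUP w. F w * decay K (z - w))"

lemma
  assumes F: "\<And>w. 0 \<le> F w" "\<And>w. F w \<le> B" and K: "0 \<le> K"
  shows peetre_upper: "F w * decay K (z - w) \<le> peetre K F z"
    and peetre_ge: "F z \<le> peetre K F z"
    and peetre_nonneg: "0 \<le> peetre K F z"
    and peetre_slow: "peetre K F z * decay K (z - z') \<le> peetre K F z'"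
proof -
  have bdd: "bdd_above (range (\<lambda>w. F w * decay K (z - w)))" for z
  proof (rule bdd_aboveI2)
    fix w show "F w * decay K (z - w) \<le> B"
      using mult_mono[OF F(2)[of w] decay_le_1[OF K, of "z - w"]] F[of w] by simp
  qed
  show *: "F w * decay K (z - w) \<le> peetre K F z" for z w
    unfolding peetre_def by (rule cSUP_upper[OF UNIV_I bdd])
  show "F z \<le> peetre K F z" using *[of z z] by simp
  then show "0 \<le> peetre K F z" using F(1)[of z] by linarith
  have "peetre K F z \<le> peetre K F z' / decay K (z - z')"
    unfolding peetre_def[of K F z]
  proof (rule cSUP_least)
    fix w
    have "F w * decay K (z - w) * decay K (z - z') \<le> F w * decay K (z' - w)"
      using mult_left_mono[OF decay_triangle_diff[OF K, of z' z w] F(1)[of w]]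
      by (simp add: decay_minus_commute[of K z z'] ac_simps)
    also have "\<dots> \<le> peetre K F z'" by (rule *)
    finally show "F w * decay K (z - w) \<le> peetre K F z' / decay K (z - z')" by (simp add: field_simps)
  qed simp
  then show "peetre K F z * decay K (z - z') \<le> peetre K F z'" by (simp add: field_simps)
qed

lemma peetre_least: "(\<And>w. F w * decay K (z - w) \<le> c) \<Longrightarrow> peetre K F z \<le> c"
  unfolding peetre_def by (rule cSUP_least) auto

text \<open>
  A function dominated by its average at polynomial scale is dominated by its \<open>L\<^sup>r\<close> averages for
  every \<open>r \<le> 1\<close>: split \<open>F = F\<^sup>r F\<^bsup>1-r\<^esup>\<close> under the integral and absorb the second factor into the
  maximal function, which is finite.
\<close>

lemma peetre_powr_le:
  fixes F :: "'a::euclidean_space \<Rightarrow> real"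
  assumes F: "\<And>w. 0 \<le> F w" "\<And>w. F w \<le> B" and [measurable]: "F \<in> borel_measurable borel"
    and r: "0 < r" "r \<le> 1" and K: "real (2 * DIM('a)) \<le> r * K" "0 < C"
    and le: "\<And>z. F z \<le> C * (LINT w|lborel. F w * decay K (z - w))"
  shows "peetre K F z powr r \<le> C * (LINT w|lborel. F w powr r * decay (r * K) (z - w))"
proof -
  have K0: "0 \<le> K" using K r by (smt (verit) of_nat_0_le_iff zero_le_mult_iff)
  have "r * K \<le> 1 * K" using r K0 by (intro mult_right_mono) auto
  then have KK: "real (2 * DIM('a)) \<le> K" using K by simp
  note iT = integrable_decay_diff[where 'a = 'a]
  have B: "0 \<le> B" using F[of 0] by linarith
  have int: "integrable lborel (\<lambda>w. F w * decay K (z - w))" for z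
    by (rule Bochner_Integration.integrable_bound[of _ "\<lambda>w. B * decay K (z - w)"])
       (use iT[OF KK] F B in \<open>auto simp: abs_mult intro!: mult_right_mono\<close>)
  have intr: "integrable lborel (\<lambda>w. F w powr r * decay (r * K) (z - w))" for z
    by (rule Bochner_Integration.integrable_bound[of _ "\<lambda>w. B powr r * decay (r * K) (z - w)"])
       (use iT[OF K(1)] F B r in \<open>auto simp: abs_mult intro!: mult_right_mono powr_mono2\<close>)
  define M where "M = peetre K F z"
  let ?I = "LINT w|lborel. F w powr r * decay (r * K) (z - w)"
  have I0: "0 \<le> ?I" by (intro Bochner_Integration.integral_nonneg) auto
  have M0: "0 \<le> M" unfolding M_def by (rule peetre_nonneg[OF F K0])
  have split: "F w * decay K (z - w) \<le> M powr (1 - r) * (F w powr r * decay (r * K) (z - w))" for w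
  proof -
    let ?x = "F w * decay K (z - w)"
    have x: "0 \<le> ?x" "?x \<le> M" using F by (auto simp: M_def intro: peetre_upper[OF F K0])
    show ?thesis
    proof (cases "?x = 0")
      case False
      then have "?x = ?x powr (1 - r) * ?x powr r" using x by (simp flip: powr_add)
      also have "\<dots> \<le> M powr (1 - r) * ?x powr r"
        using x r by (intro mult_right_mono powr_mono2) auto
      also have "?x powr r = F w powr r * decay (r * K) (z - w)"
        using F by (simp add: powr_mult decay_powr mult.commute)
      finally show ?thesis .
    qed simp
  qed
  \<comment> \<open>The hypothesis at an arbitrary point y, damped by the kernel at z - y. The
    triangle inequality recentres everything at z, so the bound is uniform in y and survives the
    supremum.\<close>
  have "M \<le> C * (M powr (1 - r) * ?I)"
    unfolding M_def
  proof (rule peetre_least, fold M_def)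
    fix y
    have "F y * decay K (z - y) \<le> C * (LINT w|lborel. F w * decay K (y - w)) * decay K (z - y)"
      by (intro mult_right_mono le) auto
    also have "\<dots> = C * (LINT w|lborel. F w * decay K (y - w) * decay K (z - y))"
      by simp
    also have "\<dots> \<le> C * (LINT w|lborel. M powr (1 - r) * (F w powr r * decay (r * K) (z - w)))"
    proof (intro mult_left_mono integral_mono)
      fix w
      have "F w * decay K (y - w) * decay K (z - y) \<le> F w * decay K (z - w)"
        using mult_left_mono[OF decay_triangle_diff[OF K0, of z y w] F(1)[of w]] by (simp add: ac_simps)
      also note split
      finally show "F w * decay K (y - w) * decay K (z - y) \<le> M powr (1 - r) * (F w powr r * decay (r * K) (z - w))" .
    qed (use int intr K in auto)
    finally show "F y * decay K (z - y) \<le> C * (M powr (1 - r) * ?I)" by simp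
  qed
  then have *: "M \<le> M powr (1 - r) * (C * ?I)" by (simp add: ac_simps)
  \<comment> \<open>Cancelling the power 1 - r of M is possible because M is a finite
    number.\<close>
  have "M powr r \<le> C * ?I"
  proof (cases "M = 0")
    case False
    then have "M > 0" using M0 by simp
    then have "M powr (1 - r) * M powr r \<le> M powr (1 - r) * (C * ?I)"
      using * by (simp flip: powr_add)
    then show ?thesis using \<open>M > 0\<close> by simp
  qed (use I0 K in simp)
  then show ?thesis by (simp add: M_def)
qed

abbreviation stft_peetre :: "real \<Rightarrow> ('a::euclidean_space \<Rightarrow> complex) \<Rightarrow> ('a \<Rightarrow> complex) \<Rightarrow> 'a \<times> 'a \<Rightarrow> real" where
  "stft_peetre K \<phi> f \<equiv> peetre K (\<lambda>w. norm (stft \<phi> f w))"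

lemma stft_bounded:
  assumes "f \<in> schwartz" "\<phi> \<in> schwartz"
  obtains B where "\<And>w. norm (stft \<phi> f w) \<le> B"
proof -
  obtain B where B: "0 < B" "\<And>w. norm (stft \<phi> f w) \<le> B * decay 0 w"
    using schwartz_decay[OF schwartz_stft[OF assms]] by metis
  then show ?thesis using that[of B] by (simp add: decay_def)
qed

lemma
  assumes "f \<in> schwartz" "\<phi> \<in> schwartz" "0 \<le> K"
  shows stft_peetre_upper: "norm (stft \<phi> f w) * decay K (z - w) \<le> stft_peetre K \<phi> f z"
    and stft_peetre_ge: "norm (stft \<phi> f z) \<le> stft_peetre K \<phi> f z"
    and stft_peetre_nonneg: "0 \<le> stft_peetre K \<phi> f z"
    and stft_peetre_slow: "stft_peetre K \<phi> f z * decay K (z - z') \<le> stft_peetre K \<phi> f z'"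
proof -
  obtain B where B: "\<And>w. norm (stft \<phi> f w) \<le> B" using stft_bounded[OF assms(1,2)] by metis
  note F = norm_ge_zero B assms(3)
  show "norm (stft \<phi> f w) * decay K (z - w) \<le> stft_peetre K \<phi> f z"
    "norm (stft \<phi> f z) \<le> stft_peetre K \<phi> f z" "0 \<le> stft_peetre K \<phi> f z"
    "stft_peetre K \<phi> f z * decay K (z - z') \<le> stft_peetre K \<phi> f z'"
    by (rule peetre_upper[where F = "\<lambda>w. norm (stft \<phi> f w)", OF F]
        peetre_ge[where F = "\<lambda>w. norm (stft \<phi> f w)", OF F]
        peetre_nonneg[where F = "\<lambda>w. norm (stft \<phi> f w)", OF F]
        peetre_slow[where F = "\<lambda>w. norm (stft \<phi> f w)", OF F])+
qed

text \<open>In the reproducing formula the decay is split: K powers build the maximal function at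
  the same point, the other \<open>?s\<close> make the kernel integrable. A change of window thus
  acts pointwise on maximal functions, for all exponents and weights at once.\<close>

lemma stft_peetre_change_window:
  fixes \<phi> \<psi> :: "'a::euclidean_space \<Rightarrow> complex"
  assumes \<phi>: "\<phi> \<in> schwartz" "\<phi> \<noteq> (\<lambda>_. 0)" and \<psi>: "\<psi> \<in> schwartz" and K: "0 \<le> K"
  obtains C where "0 < C" "\<And>f z. f \<in> schwartz \<Longrightarrow> stft_peetre K \<psi> f z \<le> C * stft_peetre K \<phi> f z"
proof -
  let ?s = "real (2 * DIM('a \<times> 'a))"
  have Ks: "?s \<le> K + ?s" using K by simp
  obtain C where C: "0 < C" "\<And>f z. f \<in> schwartz \<Longrightarrow>
    norm (stft \<psi> f z) \<le> C * (LINT w|lborel. norm (stft \<phi> f w) * decay (K + ?s) (z - w))"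
    using stft_reproducing[OF \<phi> \<psi> Ks] by blast
  let ?I = "LINT w|lborel. decay ?s (w :: 'a \<times> 'a)"
  have I0: "0 \<le> ?I" by (intro Bochner_Integration.integral_nonneg) auto
  show ?thesis
  proof (rule that[of "C * (?I + 1)"])
    show "0 < C * (?I + 1)" by (intro mult_pos_pos C(1) add_nonneg_pos I0 zero_less_one)
    fix f :: "'a \<Rightarrow> complex" and z :: "'a \<times> 'a" assume f: "f \<in> schwartz"
    have ptw: "norm (stft \<psi> f y) \<le> C * (?I + 1) * stft_peetre K \<phi> f y" for y
    proof -
      have id: "integrable lborel (\<lambda>w. decay ?s (y - w))" by (rule integrable_decay_diff) simp
      have le: "norm (stft \<phi> f w) * decay (K + ?s) (y - w) \<le> stft_peetre K \<phi> f y * decay ?s (y - w)" for w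
        using mult_right_mono[OF stft_peetre_upper[OF f \<phi>(1) K, of w y], of "decay ?s (y - w)"]
        by (simp add: decay_add mult.assoc)
      have "(LINT w|lborel. norm (stft \<phi> f w) * decay (K + ?s) (y - w)) \<le> (LINT w|lborel. stft_peetre K \<phi> f y * decay ?s (y - w))"
      proof (rule integral_mono)
        show "integrable lborel (\<lambda>w. norm (stft \<phi> f w) * decay (K + ?s) (y - w))"
        proof (rule Bochner_Integration.integrable_bound[of _ "\<lambda>w. stft_peetre K \<phi> f y * decay ?s (y - w)"])
          show "(\<lambda>w. norm (stft \<phi> f w) * decay (K + ?s) (y - w)) \<in> borel_measurable lborel"
            using schwartz_borel_measurable[OF schwartz_stft[OF f \<phi>(1)]] by measurable
          show "AE w in lborel. norm (norm (stft \<phi> f w) * decay (K + ?s) (y - w)) \<le> norm (stft_peetre K \<phi> f y * decay ?s (y - w))"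
          proof (rule AE_I2)
            fix w
            show "norm (norm (stft \<phi> f w) * decay (K + ?s) (y - w)) \<le> norm (stft_peetre K \<phi> f y * decay ?s (y - w))"
              using order_trans[OF le[of w] abs_ge_self] by (simp only: real_norm_def abs_mult abs_norm_cancel abs_of_nonneg[OF decay_nonneg])
          qed
        qed (use id in simp)
      qed (use id le in auto)
      also have "\<dots> = stft_peetre K \<phi> f y * ?I"
        using integral_reflect[of "decay ?s" y] by simp
      also have "\<dots> \<le> stft_peetre K \<phi> f y * (?I + 1)"
        using stft_peetre_nonneg[OF f \<phi>(1) K] by (intro mult_left_mono) auto
      finally have "C * (LINT w|lborel. norm (stft \<phi> f w) * decay (K + ?s) (y - w)) \<le> C * (stft_peetre K \<phi> f y * (?I + 1))"
        using C by (intro mult_left_mono) auto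
      then show ?thesis using C(2)[OF f, of y] by (simp add: ac_simps)
    qed
    show "stft_peetre K \<psi> f z \<le> C * (?I + 1) * stft_peetre K \<phi> f z"
    proof (rule peetre_least)
      fix w
      have "norm (stft \<psi> f w) * decay K (z - w) \<le> C * (?I + 1) * (stft_peetre K \<phi> f w * decay K (w - z))"
        using mult_right_mono[OF ptw[of w], of "decay K (z - w)"] by (simp add: decay_minus_commute[of K z] mult.assoc)
      also have "\<dots> \<le> C * (?I + 1) * stft_peetre K \<phi> f z"
        using C I0 by (intro mult_left_mono stft_peetre_slow[OF f \<phi>(1) K]) auto
      finally show "norm (stft \<psi> f w) * decay K (z - w) \<le> C * (?I + 1) * stft_peetre K \<phi> f z" .
    qed
  qed
qed

text \<open>The reproducing formula with the window itself supplies the self-improvement hypothesis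
  of \<open>peetre_powr_le\<close>; the resulting L^r average is a convolution to which the weighted
  quasi-norm bound applies.\<close>

lemma stft_peetre_qnorm_le:
  fixes \<phi> :: "'a::euclidean_space \<Rightarrow> complex"
  assumes \<phi>: "\<phi> \<in> schwartz" "\<phi> \<noteq> (\<lambda>_. 0)" and pq: "0 < p" "0 < q"
    and m: "poly_moderate C0 s m" "borel_comparable m"
  obtains K0 where "0 \<le> K0" "\<And>K. K0 \<le> K \<Longrightarrow> \<exists>C>0. \<forall>f\<in>schwartz.
     mixed_qnorm p q lborel lborel (\<lambda>z. ennreal (stft_peetre K \<phi> f z * m z))
     \<le> ennreal C * mixed_qnorm p q lborel lborel (\<lambda>z. ennreal (norm (stft \<phi> f z) * m z))"
proof -
  obtain r where r: "0 < r" "r \<le> 1" "ennreal r \<le> p" "ennreal r \<le> q"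
    by (rule common_lower_exponent[OF pq])
  have s0: "0 \<le> s" using m(1) by (simp add: poly_moderate_def)
  let ?D = "real (2 * DIM('a \<times> 'a))"
  show ?thesis
  \<comment> \<open>The r-th power of the kernel must compensate the weight, r s powers, and remain
    integrable, \<open>?D\<close> powers; dividing the sum by r gives this threshold.\<close>
  proof (rule that[of "s + ?D / r"])
    show "0 \<le> s + ?D / r" using s0 r by simp
    fix K assume K: "s + ?D / r \<le> K"
    then have rK: "r * s + ?D \<le> r * K" using mult_left_mono[OF K, of r] r by (simp add: distrib_left)
    then have rK': "?D \<le> r * K" using s0 r mult_nonneg_nonneg[of r s] by linarith
    have K0: "0 \<le> K" using K s0 r by (smt (verit) divide_nonneg_pos of_nat_0_le_iff)
    have "r * K \<le> 1 * K" using r K0 by (intro mult_right_mono) auto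
    then have KD: "?D \<le> K" using rK' by simp
    obtain A where A: "0 < A" "\<And>f z. f \<in> schwartz \<Longrightarrow>
      norm (stft \<phi> f z) \<le> A * (LINT w|lborel. norm (stft \<phi> f w) * decay K (z - w))"
      using stft_reproducing[OF \<phi> \<phi>(1) KD] by blast
    obtain Q where Q: "0 < Q" "\<And>F H. F \<in> borel_measurable borel \<Longrightarrow> (\<And>z. 0 \<le> F z) \<Longrightarrow> (\<And>z. 0 \<le> H z) \<Longrightarrow>
      (\<And>z. ennreal (H z powr r) \<le> (\<integral>\<^sup>+w. ennreal (F w powr r * decay (r * K) (z - w)) \<partial>lborel)) \<Longrightarrow>
      mixed_qnorm p q lborel lborel (\<lambda>z. ennreal (H z * m z))
      \<le> ennreal Q * mixed_qnorm p q lborel lborel (\<lambda>z. ennreal (F z * m z))"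
      using mixed_qnorm_decay_bound_weight[OF m r(1,3,4) rK] by blast
    \<comment> \<open>Dividing the maximal function by a absorbs A, since the convolution bound is
      stated for constant 1.\<close>
    define a where "a = A powr (1 / r)"
    have a: "0 < a" "a powr r = A" using A(1) r by (simp_all add: a_def powr_powr)
    show "\<exists>C>0. \<forall>f\<in>schwartz.
     mixed_qnorm p q lborel lborel (\<lambda>z. ennreal (stft_peetre K \<phi> f z * m z))
     \<le> ennreal C * mixed_qnorm p q lborel lborel (\<lambda>z. ennreal (norm (stft \<phi> f z) * m z))"
    proof (intro exI[of _ "a * Q"] conjI ballI)
      show "0 < a * Q" using a Q by simp
      fix f :: "'a \<Rightarrow> complex" assume f: "f \<in> schwartz"
      let ?F = "\<lambda>w. norm (stft \<phi> f w)"
      obtain B where B: "\<And>w. ?F w \<le> B" using stft_bounded[OF f \<phi>(1)] by metis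
      have Fm[measurable]: "?F \<in> borel_measurable borel"
        using schwartz_borel_measurable[OF schwartz_stft[OF f \<phi>(1)]] by measurable
      define H where "H z = stft_peetre K \<phi> f z / a" for z
      have H0: "0 \<le> H z" for z using a stft_peetre_nonneg[OF f \<phi>(1) K0] by (simp add: H_def)
      have "ennreal (H z powr r) \<le> (\<integral>\<^sup>+w. ennreal (?F w powr r * decay (r * K) (z - w)) \<partial>lborel)" for z
      proof -
        have "stft_peetre K \<phi> f z powr r \<le> A * (LINT w|lborel. ?F w powr r * decay (r * K) (z - w))"
          by (rule peetre_powr_le[OF _ B Fm r(1,2) rK' A(1) A(2)[OF f]]) auto
        then have "H z powr r \<le> (LINT w|lborel. ?F w powr r * decay (r * K) (z - w))"
          using a A(1) stft_peetre_nonneg[OF f \<phi>(1) K0, of z] by (simp add: H_def powr_divide field_simps)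
        also have "ennreal \<dots> = (\<integral>\<^sup>+w. ennreal (?F w powr r * decay (r * K) (z - w)) \<partial>lborel)"
        proof (rule nn_integral_eq_integral[symmetric])
          have "integrable lborel (\<lambda>w. B powr r * decay (r * K) (z - w))"
            using integrable_decay_diff[OF rK'] by simp
          then show "integrable lborel (\<lambda>w. ?F w powr r * decay (r * K) (z - w))"
            by (rule Bochner_Integration.integrable_bound)
               (use B r in \<open>auto simp: abs_mult intro!: AE_I2 mult_right_mono powr_mono2\<close>)
        qed auto
        finally show ?thesis by (simp add: ennreal_leI)
      qed
      from Q(2)[OF Fm _ H0 this]
      have *: "mixed_qnorm p q lborel lborel (\<lambda>z. ennreal (H z * m z)) \<le> ennreal Q * mixed_qnorm p q lborel lborel (\<lambda>z. ennreal (?F z * m z))"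
        by simp
      have "mixed_qnorm p q lborel lborel (\<lambda>z. ennreal (stft_peetre K \<phi> f z * m z))
        = mixed_qnorm p q lborel lborel (\<lambda>z. ennreal a * ennreal (H z * m z))"
      proof -
        have "ennreal (stft_peetre K \<phi> f z * m z) = ennreal a * ennreal (H z * m z)" for z
          using a by (subst ennreal_mult'[symmetric]) (auto simp: H_def)
        then show ?thesis by (simp only:)
      qed
      also have "\<dots> \<le> ennreal a * (ennreal Q * mixed_qnorm p q lborel lborel (\<lambda>z. ennreal (?F z * m z)))"
        using a pq * by (simp add: mixed_qnorm_cmult mult_left_mono)
      finally show "mixed_qnorm p q lborel lborel (\<lambda>z. ennreal (stft_peetre K \<phi> f z * m z))
        \<le> ennreal (a * Q) * mixed_qnorm p q lborel lborel (\<lambda>z. ennreal (norm (stft \<phi> f z) * m z))"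
        using a Q by (simp add: ennreal_mult mult.assoc)
    qed
  qed
qed


section \<open>The Wigner distribution\<close>

lemma tau_wigner_eq_partial_fourier:
  "tau_wigner \<tau> f g = partial_fourier (\<lambda>z. f (fst z + \<tau> *\<^sub>R snd z) * cnj (g (fst z - (1 - \<tau>) *\<^sub>R snd z)))"
  by (auto simp: fun_eq_iff tau_wigner_def partial_fourier_def)

text \<open>The change of variables has determinant -1 for every \<open>\<tau>\<close>.\<close>

lemma schwartz_tau_wigner_kernel:
  fixes f g :: "'a::euclidean_space \<Rightarrow> complex"
  assumes "f \<in> schwartz" "g \<in> schwartz"
  shows "(\<lambda>z. f (fst z + \<tau> *\<^sub>R snd z) * cnj (g (fst z - (1 - \<tau>) *\<^sub>R snd z))) \<in> schwartz"
proof -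
  have "1 * (- (1 - \<tau>)) - \<tau> * 1 \<noteq> 0" by simp
  from schwartz_tensor[OF assms this] show ?thesis
    unfolding scaleR_one scaleR_minus_left add_uminus_conv_diff .
qed

lemma schwartz_tau_wigner: "f \<in> schwartz \<Longrightarrow> g \<in> schwartz \<Longrightarrow> tau_wigner \<tau> f g \<in> schwartz"
  unfolding tau_wigner_eq_partial_fourier by (intro schwartz_partial_fourier schwartz_tau_wigner_kernel)

lemma fourier_shift:
  fixes F :: "'a::euclidean_space \<Rightarrow> complex"
  assumes F: "F \<in> borel_measurable borel"
  shows "fourier (\<lambda>t. F (t - a)) \<xi> = cis (- (2 * pi * (\<xi> \<bullet> a))) * fourier F \<xi>"
proof -
  have "(\<lambda>t. F (t - a) * cis (- (2 * pi * (\<xi> \<bullet> t)))) \<in> borel_measurable borel"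
    by (intro borel_measurable_times borel_measurable_cis_inner measurable_compose[OF _ F]) auto
  from integral_translate[OF this, of a, symmetric]
  have "fourier (\<lambda>t. F (t - a)) \<xi> = (LINT t|lborel. F t * cis (- (2 * pi * (\<xi> \<bullet> (t + a)))))"
    by (simp add: fourier_def)
  also have "\<dots> = (LINT t|lborel. cis (- (2 * pi * (\<xi> \<bullet> a))) * (F t * cis (- (2 * pi * (\<xi> \<bullet> t)))))"
  proof (intro Bochner_Integration.integral_cong refl)
    fix t
    have "cis (- (2 * pi * (\<xi> \<bullet> (t + a)))) = cis (- (2 * pi * (\<xi> \<bullet> a))) * cis (- (2 * pi * (\<xi> \<bullet> t)))"
      unfolding cis_mult by (rule arg_cong[where f = cis]) (simp add: algebra_simps inner_add_right)
    then show "F t * cis (- (2 * pi * (\<xi> \<bullet> (t + a)))) = cis (- (2 * pi * (\<xi> \<bullet> a))) * (F t * cis (- (2 * pi * (\<xi> \<bullet> t))))"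
      by (simp only: mult_ac)
  qed
  finally show ?thesis by (simp add: fourier_def)
qed

lemma fourier_modulate:
  "fourier (\<lambda>t. cis (2 * pi * (\<omega> \<bullet> t)) * F t) \<xi> = fourier F (\<xi> - \<omega>)"
  unfolding fourier_def
proof (intro Bochner_Integration.integral_cong refl)
  fix t
  have "cis (2 * pi * (\<omega> \<bullet> t)) * cis (- (2 * pi * (\<xi> \<bullet> t))) = cis (- (2 * pi * ((\<xi> - \<omega>) \<bullet> t)))"
    unfolding cis_mult by (rule arg_cong[where f = cis]) (simp add: algebra_simps inner_diff_left)
  then show "cis (2 * pi * (\<omega> \<bullet> t)) * F t * cis (- (2 * pi * (\<xi> \<bullet> t))) = F t * cis (- (2 * pi * ((\<xi> - \<omega>) \<bullet> t)))"
    by (metis mult.assoc mult.commute)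
qed

text \<open>
  Parseval in the second variable removes the partial Fourier transforms; the substitution
  \<open>u = x + \<tau>(t - \<zeta>\<^sub>2)\<close>, \<open>v = x - (1 - \<tau>)(t - \<zeta>\<^sub>2)\<close> then separates the remaining double integral.
\<close>

theorem stft_tau_wigner:
  fixes \<phi> :: "'a::euclidean_space \<Rightarrow> complex"
  assumes \<phi>: "\<phi> \<in> schwartz" "\<phi> \<noteq> (\<lambda>_. 0)"
  obtains c where "0 < c" "\<And>f g z1 z2 \<zeta>1 \<zeta>2. f \<in> schwartz \<Longrightarrow> g \<in> schwartz \<Longrightarrow>
    norm (stft (tau_wigner \<tau> \<phi> \<phi>) (tau_wigner \<tau> f g) ((z1, z2), (\<zeta>1, \<zeta>2)))
    = c * norm (stft \<phi> f (z1 - \<tau> *\<^sub>R \<zeta>2, z2 + (1 - \<tau>) *\<^sub>R \<zeta>1)) *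
      norm (stft \<phi> g (z1 + (1 - \<tau>) *\<^sub>R \<zeta>2, z2 - \<tau> *\<^sub>R \<zeta>1))"
proof -
  let ?s = "real (2 * DIM('a))"
  obtain c where c: "c \<noteq> 0"
    "\<And>F G :: 'a \<Rightarrow> complex. fourier_nice F \<Longrightarrow> fourier_nice G \<Longrightarrow>
      (LINT \<xi>|lborel. fourier F \<xi> * cnj (fourier G \<xi>)) = c * (LINT t|lborel. F t * cnj (G t))"
    using parseval[OF \<phi>] by blast
  show ?thesis
  proof (rule that[of "norm c"])
    show "0 < norm c" using c by simp
    fix f g :: "'a \<Rightarrow> complex" and z1 z2 \<zeta>1 \<zeta>2 :: 'a assume fg: "f \<in> schwartz" "g \<in> schwartz"
    define T where "T = (\<lambda>z. f (fst z + \<tau> *\<^sub>R snd z) * cnj (g (fst z - (1 - \<tau>) *\<^sub>R snd z)))"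
    define T0 where "T0 = (\<lambda>z. \<phi> (fst z + \<tau> *\<^sub>R snd z) * cnj (\<phi> (fst z - (1 - \<tau>) *\<^sub>R snd z)))"
    have T: "T \<in> schwartz" "T0 \<in> schwartz" unfolding T_def T0_def using fg \<phi> by (auto intro!: schwartz_tau_wigner_kernel)
    \<comment> \<open>The operations on the frequency side are moved to the kernels: the phase with
      \<open>\<zeta>2\<close> becomes a shift in t, and the frequency shift by z2 becomes a
      modulation in t.\<close>
    define T' where "T' = translate (0, \<zeta>2) T"
    define T0' where "T0' = modulate (0, z2) (translate (z1, 0) T0)"
    have T': "T' \<in> schwartz" "T0' \<in> schwartz"
      unfolding T'_def T0'_def by (intro schwartz_modulate schwartz_translate T)+
    define h where "h x t = cis (- (2 * pi * (x \<bullet> \<zeta>1))) * (T' (x, t) * cnj (T0' (x, t)))" for x t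
    have W: "stft (tau_wigner \<tau> \<phi> \<phi>) (tau_wigner \<tau> f g) ((z1, z2), (\<zeta>1, \<zeta>2))
      = (LINT x|lborel. c * (LINT t|lborel. h x t))"
    proof -
      let ?g = "modulate (\<zeta>1, \<zeta>2) (translate (z1, z2) (partial_fourier T0))"
      have g: "?g \<in> schwartz" by (intro schwartz_modulate schwartz_translate schwartz_partial_fourier T)
      have "stft (tau_wigner \<tau> \<phi> \<phi>) (tau_wigner \<tau> f g) ((z1, z2), (\<zeta>1, \<zeta>2))
         = (LINT w|lborel. partial_fourier T w * cnj (?g w))"
        by (simp add: stft_eq_inner tau_wigner_eq_partial_fourier T_def T0_def)
      also have "\<dots> = (LINT x|lborel. LINT \<xi>|lborel. partial_fourier T (x, \<xi>) * cnj (?g (x, \<xi>)))"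
        by (rule integral_lborel_prod) (intro schwartz_inner_integrable schwartz_partial_fourier T g)
      also have "\<dots> = (LINT x|lborel. c * (LINT t|lborel. h x t))"
      proof (intro Bochner_Integration.integral_cong refl)
        fix x
        have F: "fourier (\<lambda>t. T' (x, t)) \<xi> = cis (- (2 * pi * (\<xi> \<bullet> \<zeta>2))) * partial_fourier T (x, \<xi>)" for \<xi>
          using fourier_shift[OF schwartz_section_measurable[OF T(1), of x], of \<zeta>2 \<xi>]
          by (simp add: T'_def translate_def partial_fourier_eq)
        have G: "fourier (\<lambda>t. T0' (x, t)) \<xi> = partial_fourier T0 (x - z1, \<xi> - z2)" for \<xi>
          using fourier_modulate[of z2 "\<lambda>t. T0 (x - z1, t)" \<xi>]
          by (simp add: T0'_def modulate_def translate_def partial_fourier_eq inner_commute)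
        have "(LINT \<xi>|lborel. partial_fourier T (x, \<xi>) * cnj (?g (x, \<xi>)))
          = (LINT \<xi>|lborel. cis (- (2 * pi * (x \<bullet> \<zeta>1))) * (fourier (\<lambda>t. T' (x, t)) \<xi> * cnj (fourier (\<lambda>t. T0' (x, t)) \<xi>)))"
        proof (intro Bochner_Integration.integral_cong refl)
          fix \<xi>
          have "cis (- (2 * pi * ((x, \<xi>) \<bullet> (\<zeta>1, \<zeta>2)))) = cis (- (2 * pi * (x \<bullet> \<zeta>1))) * cis (- (2 * pi * (\<xi> \<bullet> \<zeta>2)))"
            unfolding cis_mult by (rule arg_cong[where f = cis]) (simp add: algebra_simps)
          then have "cnj (?g (x, \<xi>)) = cis (- (2 * pi * (x \<bullet> \<zeta>1))) * cis (- (2 * pi * (\<xi> \<bullet> \<zeta>2))) * cnj (partial_fourier T0 (x - z1, \<xi> - z2))"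
            unfolding modulate_def translate_def complex_cnj_mult cis_cnj by simp
          then show "partial_fourier T (x, \<xi>) * cnj (?g (x, \<xi>))
            = cis (- (2 * pi * (x \<bullet> \<zeta>1))) * (fourier (\<lambda>t. T' (x, t)) \<xi> * cnj (fourier (\<lambda>t. T0' (x, t)) \<xi>))"
            unfolding F G by (simp only: mult_ac)
        qed
        also have "\<dots> = cis (- (2 * pi * (x \<bullet> \<zeta>1))) * (c * (LINT t|lborel. T' (x, t) * cnj (T0' (x, t))))"
          using c(2)[OF fourier_nice_section[OF T'(1), of x] fourier_nice_section[OF T'(2), of x]] by simp
        also have "\<dots> = c * (LINT t|lborel. h x t)" by (simp add: h_def)
        finally show "(LINT \<xi>|lborel. partial_fourier T (x, \<xi>) * cnj (?g (x, \<xi>))) = c * (LINT t|lborel. h x t)" .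
      qed
      finally show ?thesis .
    qed
    \<comment> \<open>(y1, a1) and (y2, a2) are the points of the time-frequency plane at which the
      transforms of f and g end up being evaluated.\<close>
    define y1 where "y1 = z1 - \<tau> *\<^sub>R \<zeta>2"
    define y2 where "y2 = z1 + (1 - \<tau>) *\<^sub>R \<zeta>2"
    define a1 where "a1 = z2 + (1 - \<tau>) *\<^sub>R \<zeta>1"
    define a2 where "a2 = z2 - \<tau> *\<^sub>R \<zeta>1"
    define A where "A u = f u * cnj (\<phi> (u - y1)) * cis (- (2 * pi * (a1 \<bullet> u)))" for u
    define B where "B v = g v * cnj (\<phi> (v - y2)) * cis (- (2 * pi * (a2 \<bullet> v)))" for v
    have key: "h (u - \<tau> *\<^sub>R (t - \<zeta>2)) t = cis (- (2 * pi * (z2 \<bullet> \<zeta>2))) * (A u * cnj (B (u - t + \<zeta>2)))" for u t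
    proof -
      define v where "v = u - t + \<zeta>2"
      have t: "t = u - v + \<zeta>2" by (simp add: v_def)
      define x where "x = u - \<tau> *\<^sub>R (t - \<zeta>2)"
      have x: "x = u - \<tau> *\<^sub>R (u - v)" by (simp add: x_def t)
      have e: "x + \<tau> *\<^sub>R (t - \<zeta>2) = u" "x - (1 - \<tau>) *\<^sub>R (t - \<zeta>2) = v"
        "x - z1 + \<tau> *\<^sub>R t = u - y1" "x - z1 - (1 - \<tau>) *\<^sub>R t = v - y2"
        unfolding x t y1_def y2_def by (simp_all add: algebra_simps)
      have "cis (- (2 * pi * (x \<bullet> \<zeta>1))) * cis (- (2 * pi * (t \<bullet> z2)))
          = cis (- (2 * pi * (z2 \<bullet> \<zeta>2))) * (cis (- (2 * pi * (a1 \<bullet> u))) * cis (2 * pi * (a2 \<bullet> v)))"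
        unfolding cis_mult x t a1_def a2_def
        by (rule arg_cong[where f = cis]) (simp add: algebra_simps inner_commute)
      then have ph: "(f u * cnj (g v) * (cnj (\<phi> (u - y1)) * \<phi> (v - y2))) * (cis (- (2 * pi * (x \<bullet> \<zeta>1))) * cis (- (2 * pi * (t \<bullet> z2))))
          = (f u * cnj (g v) * (cnj (\<phi> (u - y1)) * \<phi> (v - y2))) * (cis (- (2 * pi * (z2 \<bullet> \<zeta>2))) * (cis (- (2 * pi * (a1 \<bullet> u))) * cis (2 * pi * (a2 \<bullet> v))))"
        by (rule arg_cong)
      have T'x: "T' (x, t) = f u * cnj (g v)"
        unfolding T'_def translate_def T_def using e by simp
      have T0x: "T0' (x, t) = cis (2 * pi * (t \<bullet> z2)) * (\<phi> (u - y1) * cnj (\<phi> (v - y2)))"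
        unfolding T0'_def modulate_def translate_def T0_def using e by simp
      have "h x t = cis (- (2 * pi * (z2 \<bullet> \<zeta>2))) * (A u * cnj (B v))"
        unfolding h_def T'x T0x A_def B_def complex_cnj_mult cis_cnj complex_cnj_cnj minus_minus
        using ph by (simp only: mult_ac)
      then show ?thesis by (simp add: x_def v_def)
    qed
    have hm: "(\<lambda>z. h (fst z) (snd z)) \<in> borel_measurable borel"
    proof -
      have "continuous_on UNIV (\<lambda>z. h (fst z) (snd z))" unfolding h_def prod.collapse
        by (intro continuous_intros schwartz_continuous T')
      then show ?thesis by (rule borel_measurable_continuous_onI)
    qed
    obtain C1 where C1: "0 < C1" "\<And>z. norm (T' z) \<le> C1 * decay (2 * ?s) z" using schwartz_decay[OF T'(1)] by metis
    obtain C2 where C2: "0 < C2" "\<And>z. norm (T0' z) \<le> C2 * decay 0 z" using schwartz_decay[OF T'(2)] by metis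
    have id: "integrable lborel (\<lambda>x::'a. C * decay ?s x)" for C using integrable_decay[where 'a = 'a, of ?s] by simp
    have "(LINT x|lborel. LINT t|lborel. h x t) = (LINT t|lborel. LINT x|lborel. h x t)"
    proof (rule fubini_swap[OF hm id[of "C1 * C2"] id[of 1]])
      fix x t :: 'a
      have "norm (T' (x, t)) * norm (T0' (x, t)) \<le> (C1 * (decay ?s x * decay ?s t)) * C2"
      proof (rule mult_mono)
        have "C1 * decay (2 * ?s) (x, t) \<le> C1 * (decay ?s x * decay ?s t)"
          using C1(1) by (intro mult_left_mono decay_Pair_le_mult) auto
        then show "norm (T' (x, t)) \<le> C1 * (decay ?s x * decay ?s t)" using C1(2)[of "(x, t)"] by linarith
        show "norm (T0' (x, t)) \<le> C2" using C2(2)[of "(x, t)"] by (simp add: decay_def)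
      qed (use C1 in auto)
      then show "norm (h x t) \<le> C1 * C2 * decay ?s x * (1 * decay ?s t)"
        by (simp add: h_def norm_mult ac_simps)
    qed
    also have "\<dots> = (LINT t|lborel. LINT u|lborel. h (u - \<tau> *\<^sub>R (t - \<zeta>2)) t)"
    proof (rule Bochner_Integration.integral_cong[OF refl])
      fix t
      have "(\<lambda>x. h x t) \<in> borel_measurable borel"
        using measurable_compose[OF _ hm, of "\<lambda>x. (x, t)" borel]
        by (simp add: borel_measurable_continuous_onI continuous_intros)
      from integral_translate[OF this, of "- (\<tau> *\<^sub>R (t - \<zeta>2))"]
      show "(LINT x|lborel. h x t) = (LINT u|lborel. h (u - \<tau> *\<^sub>R (t - \<zeta>2)) t)" by simp
    qed
    also have "\<dots> = (LINT t|lborel. LINT u|lborel. cis (- (2 * pi * (z2 \<bullet> \<zeta>2))) * (A u * cnj (B (u - t + \<zeta>2))))"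
      unfolding key ..
    also have "\<dots> = cis (- (2 * pi * (z2 \<bullet> \<zeta>2))) * (LINT t|lborel. LINT u|lborel. A u * cnj (B (u - t + \<zeta>2)))"
      by simp
    \<comment> \<open>For this second exchange the product majorant comes from f(u) cnj(g(u - t +
      \<zeta>2)), which is Schwartz in (t, u); the window factors only need to be bounded.\<close>
    also have "(LINT t|lborel. LINT u|lborel. A u * cnj (B (u - t + \<zeta>2))) = (LINT u|lborel. LINT t|lborel. A u * cnj (B (u - t + \<zeta>2)))"
    proof -
      have cA: "continuous_on UNIV A" and cB: "continuous_on UNIV B"
        unfolding A_def[abs_def] B_def[abs_def]
        by (intro continuous_intros schwartz_continuous fg continuous_on_compose2[OF schwartz_continuous[OF \<phi>(1), of UNIV]]; simp)+
      obtain D where D: "0 < D" "\<And>x. norm (\<phi> x) \<le> D * decay 0 x" using schwartz_decay[OF \<phi>(1)] by metis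
      have D': "norm (\<phi> x) \<le> D" for x using D(2)[of x] by (simp add: decay_def)
      have g': "translate (- \<zeta>2) g \<in> schwartz" by (rule schwartz_translate[OF fg(2)])
      have "(1::real) * 1 - 0 * (- 1) \<noteq> 0" by simp
      have "(\<lambda>z. f (0 *\<^sub>R fst z + 1 *\<^sub>R snd z) * cnj (translate (- \<zeta>2) g ((- 1) *\<^sub>R fst z + 1 *\<^sub>R snd z))) \<in> schwartz"
        by (rule schwartz_tensor[OF fg(1) g']) simp
      then have fg': "(\<lambda>z. f (snd z) * cnj (g (snd z - fst z + \<zeta>2))) \<in> schwartz"
        by (simp add: translate_def)
      obtain E where E: "0 < E" "\<And>z. norm (f (snd z) * cnj (g (snd z - fst z + \<zeta>2))) \<le> E * decay (2 * ?s) z"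
        using schwartz_decay[OF fg', of "2 * ?s"] by blast
      show ?thesis
      proof (rule fubini_swap[OF _ id[of "E * D * D"] id[of 1]])
        have "continuous_on UNIV (\<lambda>z::'a \<times> 'a. A (snd z) * cnj (B (snd z - fst z + \<zeta>2)))"
          by (intro continuous_intros continuous_on_compose2[OF cA] continuous_on_compose2[OF cB]) auto
        then show "(\<lambda>z. A (snd z) * cnj (B (snd z - fst z + \<zeta>2))) \<in> borel_measurable borel"
          by (rule borel_measurable_continuous_onI)
        fix t u :: 'a
        have "norm (A u * cnj (B (u - t + \<zeta>2))) = (norm (f u * cnj (g (u - t + \<zeta>2)))) * norm (\<phi> (u - y1)) * norm (\<phi> (u - t + \<zeta>2 - y2))"
          by (simp add: A_def B_def norm_mult ac_simps)
        also have "\<dots> \<le> (E * (decay ?s t * decay ?s u)) * D * D"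
        proof (intro mult_mono D')
          have "E * decay (2 * ?s) (t, u) \<le> E * (decay ?s t * decay ?s u)"
            using E(1) by (intro mult_left_mono decay_Pair_le_mult) auto
          then show "norm (f u * cnj (g (u - t + \<zeta>2))) \<le> E * (decay ?s t * decay ?s u)"
            using E(2)[of "(t, u)"] by (simp only: fst_conv snd_conv)
        qed (use E D in auto)
        finally show "norm (A u * cnj (B (u - t + \<zeta>2))) \<le> E * D * D * decay ?s t * (1 * decay ?s u)"
          by (simp only: mult_ac mult_1_left)
      qed
    qed
    also have "\<dots> = (LINT u|lborel. A u * cnj (LINT v|lborel. B v))"
    proof (intro Bochner_Integration.integral_cong refl)
      fix u
      have Bm: "B \<in> borel_measurable borel"
        unfolding B_def[abs_def]
        by (intro borel_measurable_continuous_onI continuous_intros schwartz_continuous fg continuous_on_compose2[OF schwartz_continuous[OF \<phi>(1), of UNIV]]) auto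
      have "(LINT t|lborel. B (u - t + \<zeta>2)) = (LINT v|lborel. B v)"
        using integral_reflect[OF Bm, of "u + \<zeta>2"] by (simp add: algebra_simps)
      then show "(LINT t|lborel. A u * cnj (B (u - t + \<zeta>2))) = A u * cnj (LINT v|lborel. B v)" by simp
    qed
    also have "\<dots> = stft \<phi> f (y1, a1) * cnj (stft \<phi> g (y2, a2))"
      by (simp add: stft_eq A_def B_def)
    finally have "(LINT x|lborel. LINT t|lborel. h x t) = cis (- (2 * pi * (z2 \<bullet> \<zeta>2))) * (stft \<phi> f (y1, a1) * cnj (stft \<phi> g (y2, a2)))" .
    then show "norm (stft (tau_wigner \<tau> \<phi> \<phi>) (tau_wigner \<tau> f g) ((z1, z2), (\<zeta>1, \<zeta>2)))
      = norm c * norm (stft \<phi> f (z1 - \<tau> *\<^sub>R \<zeta>2, z2 + (1 - \<tau>) *\<^sub>R \<zeta>1)) *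
        norm (stft \<phi> g (z1 + (1 - \<tau>) *\<^sub>R \<zeta>2, z2 - \<tau> *\<^sub>R \<zeta>1))"
      unfolding W y1_def[symmetric] y2_def[symmetric] a1_def[symmetric] a2_def[symmetric] by (simp add: norm_mult)
  qed
qed


section \<open>Schwartz functions as distributions\<close>

text \<open>The L1 norm of W times the supremum of the test function bounds the pairing, so the
  order N = 0 is enough.\<close>

lemma distribution_of_schwartz:
  fixes W :: "'a::euclidean_space \<Rightarrow> complex"
  assumes W: "W \<in> schwartz"
  shows "distribution_of W \<in> tempered_distributions"
proof -
  have bdd: "bdd_above (range (\<lambda>x. norm x ^ 0 * norm (partial_derivs [] f x)))" if f: "f \<in> schwartz" for f :: "'a \<Rightarrow> complex"
    using schwartz_power_bound[OF f, of 0] by (auto simp: bdd_above_def)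
  have sup: "norm (f x) \<le> schwartz_seminorm 0 [] f" if "f \<in> schwartz" for f :: "'a \<Rightarrow> complex" and x
    using cSUP_upper[OF UNIV_I bdd[OF that], of x] by (simp add: schwartz_seminorm_def)
  have int: "integrable lborel (\<lambda>x. W x * f x)" if f: "f \<in> schwartz" for f :: "'a \<Rightarrow> complex"
  proof (rule Bochner_Integration.integrable_bound[of _ "\<lambda>x. schwartz_seminorm 0 [] f *\<^sub>R W x"])
    have "0 \<le> schwartz_seminorm 0 [] f" using sup[OF f, of 0] norm_ge_zero order_trans by blast
    then show "AE x in lborel. norm (W x * f x) \<le> norm (schwartz_seminorm 0 [] f *\<^sub>R W x)"
      using sup[OF f] by (intro AE_I2) (simp add: norm_mult mult.commute mult_left_mono)
  qed (use schwartz_integrable[OF W] schwartz_borel_measurable[OF W] schwartz_borel_measurable[OF f] in auto)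
  have bs: "{bs :: 'a list. set bs \<subseteq> Basis \<and> length bs \<le> 0} = {[]}" by auto
  show ?thesis
    unfolding tempered_distributions_def
  proof (intro CollectI conjI ballI allI exI)
    fix f g :: "'a \<Rightarrow> complex" assume "f \<in> schwartz" "g \<in> schwartz"
    then show "distribution_of W (\<lambda>x. f x + g x) = distribution_of W f + distribution_of W g"
      using int by (simp add: distribution_of_def distrib_left)
  next
    fix c and f :: "'a \<Rightarrow> complex" assume "f \<in> schwartz"
    then show "distribution_of W (\<lambda>x. c * f x) = c * distribution_of W f"
      by (simp add: distribution_of_def mult.left_commute)
  next
    fix f :: "'a \<Rightarrow> complex" assume f: "f \<in> schwartz"
    have "norm (distribution_of W f) \<le> (LINT x|lborel. norm (W x) * schwartz_seminorm 0 [] f)"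
      unfolding distribution_of_def
      by (rule norm_integral_le[OF int[OF f]]) (use sup[OF f] integrable_norm[OF schwartz_integrable[OF W]] in \<open>auto simp: norm_mult mult_left_mono\<close>)
    then show "norm (distribution_of W f) \<le> (LINT x|lborel. norm (W x)) *
      (\<Sum>k\<le>(0::nat). \<Sum>bs | set bs \<subseteq> Basis \<and> length bs \<le> 0. schwartz_seminorm k bs f)"
      by (simp only: bs) simp
  qed
qed

text \<open>The transform decays faster than the weight grows, and the surplus is split into
  separate decay in x and in frequency. For finite p the required rate is 2 d / p, with d the
  dimension of the domain of f; for p infinite no decay is called for.\<close>

lemma modulation_qnorm_schwartz_finite:
  fixes f \<phi> :: "'a::euclidean_space \<Rightarrow> complex"
  assumes f: "f \<in> schwartz" and \<phi>: "\<phi> \<in> schwartz" and m: "poly_moderate C0 s m" and pq: "0 < p" "0 < q"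
  shows "modulation_qnorm \<phi> p q m (distribution_of f) < \<infinity>"
proof -
  have Lp: "\<exists>t\<ge>0. \<forall>c::real. c \<ge> 0 \<longrightarrow> Lp_qnorm p (lborel :: 'a measure) (\<lambda>x. ennreal (c * decay t x)) < top" if p: "0 < p" for p
  proof (cases "p = top")
    case True
    have "Lp_qnorm p (lborel :: 'a measure) (\<lambda>x. ennreal (c * decay 0 x)) \<le> ennreal c" for c
      unfolding True by (subst Lp_qnorm_top_le_iff) (simp add: decay_def)
    then show ?thesis by (intro exI[of _ 0]) (auto intro: le_less_trans[OF _ ennreal_less_top])
  next
    case False
    note P = enn2real_pos[OF p False]
    let ?t = "real (2 * DIM('a)) / enn2real p"
    have "Lp_qnorm p (lborel :: 'a measure) (\<lambda>x. ennreal (c * decay ?t x)) < top" if c: "c \<ge> 0" for c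
    proof -
      have "(\<integral>\<^sup>+x. ennreal_powr (ennreal (c * decay ?t (x::'a))) (enn2real p) \<partial>lborel)
         = (\<integral>\<^sup>+x. ennreal (c powr enn2real p) * ennreal (decay (2 * DIM('a)) (x::'a)) \<partial>lborel)"
        using c P by (intro nn_integral_cong) (simp add: ennreal_powr_ennreal powr_mult decay_powr flip: ennreal_mult)
      also have "\<dots> = ennreal (c powr enn2real p) * (\<integral>\<^sup>+x. ennreal (decay (2 * DIM('a)) (x::'a)) \<partial>lborel)"
        by (rule nn_integral_cmult) measurable
      also have "\<dots> < top"
        using nn_integral_decay_finite[where 'a = 'a, of "real (2 * DIM('a))"] by (simp add: ennreal_mult_less_top)
      finally show ?thesis using False
        by (simp add: Lp_qnorm_def less_top[symmetric])
    qed
    then show ?thesis using P by (intro exI[of _ ?t]) auto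
  qed
  obtain tp where tp: "0 \<le> tp" "\<And>c::real. c \<ge> 0 \<Longrightarrow> Lp_qnorm p (lborel :: 'a measure) (\<lambda>x. ennreal (c * decay tp x)) < top"
    using Lp[OF pq(1)] by blast
  obtain tq where tq: "0 \<le> tq" "\<And>c::real. c \<ge> 0 \<Longrightarrow> Lp_qnorm q (lborel :: 'a measure) (\<lambda>x. ennreal (c * decay tq x)) < top"
    using Lp[OF pq(2)] by blast
  \<comment> \<open>The factor 2 is the price of splitting decay in a pair into a product.\<close>
  define t where "t = 2 * (tp + tq)"
  obtain C where C: "0 < C" "\<And>z. norm (stft \<phi> f z) \<le> C * decay (s + t) z"
    using schwartz_decay[OF schwartz_stft[OF f \<phi>]] by metis
  have C0: "0 < C0" using m by (simp add: poly_moderate_def)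
  have m0: "0 \<le> m z" for z by (rule poly_moderateD(2)[OF m])
  define D where "D = C * C0 * m 0"
  have D: "0 \<le> D" using C C0 m0 by (simp add: D_def)
  have le: "norm (stft \<phi> f (x, \<xi>)) * m (x, \<xi>) \<le> D * decay tq \<xi> * decay tp x" for x \<xi>
  proof -
    let ?z = "(x, \<xi>)"
    have "norm (stft \<phi> f ?z) * m ?z \<le> (C * decay (s + t) ?z) * (C0 * decay (- s) (?z - 0) * m 0)"
      using C C0 m0 poly_moderateD(1)[OF m, of ?z 0] by (intro mult_mono) auto
    also have "\<dots> = D * (decay (- s) ?z * decay s ?z) * decay t ?z"
      by (simp add: D_def decay_add ac_simps)
    also have "\<dots> = D * decay t ?z" by (simp only: decay_cancel mult_1_right)
    also have "\<dots> \<le> D * (decay (tp + tq) x * decay (tp + tq) \<xi>)"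
      unfolding t_def using tp tq D by (intro mult_left_mono decay_Pair_le_mult) auto
    also have "\<dots> \<le> D * (decay tp x * decay tq \<xi>)"
      using tp tq D by (intro mult_left_mono mult_mono decay_mono) auto
    finally show ?thesis by (simp add: ac_simps)
  qed
  define L where "L = enn2real (Lp_qnorm p (lborel :: 'a measure) (\<lambda>x. ennreal (D * decay tp x)))"
  have L: "Lp_qnorm p (lborel :: 'a measure) (\<lambda>x. ennreal (D * decay tp x)) = ennreal L"
    unfolding L_def using tp(2)[OF D] by simp
  have inner: "Lp_qnorm p lborel (\<lambda>x. ennreal (norm (stft \<phi> f (x, \<xi>)) * m (x, \<xi>))) \<le> ennreal (L * decay tq \<xi>)" for \<xi>
  proof -
    have "Lp_qnorm p lborel (\<lambda>x. ennreal (norm (stft \<phi> f (x, \<xi>)) * m (x, \<xi>)))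
      \<le> Lp_qnorm p lborel (\<lambda>x::'a. ennreal (decay tq \<xi>) * ennreal (D * decay tp x))"
    proof (rule Lp_qnorm_mono[OF _ pq(1)])
      fix x :: 'a
      have "norm (stft \<phi> f (x, \<xi>)) * m (x, \<xi>) \<le> decay tq \<xi> * (D * decay tp x)"
        using le[of x \<xi>] by (simp only: mult_ac)
      then show "ennreal (norm (stft \<phi> f (x, \<xi>)) * m (x, \<xi>)) \<le> ennreal (decay tq \<xi>) * ennreal (D * decay tp x)"
        by (subst ennreal_mult'[symmetric]) (simp_all add: ennreal_leI)
    qed
    also have "\<dots> = ennreal (L * decay tq \<xi>)"
      unfolding Lp_qnorm_cmult[OF decay_pos pq(1)] L
      by (subst ennreal_mult'[symmetric]) (simp_all add: mult.commute)
    finally show ?thesis .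
  qed
  have "modulation_qnorm \<phi> p q m (distribution_of f) \<le> Lp_qnorm q lborel (\<lambda>\<xi>::'a. ennreal (L * decay tq \<xi>))"
    unfolding modulation_qnorm_def mixed_qnorm_def by (intro Lp_qnorm_mono inner pq)
  also have "\<dots> < top" by (rule tq(2)) (simp add: L_def)
  finally show ?thesis by simp
qed


section \<open>Sampling, and sufficiency of the lattice estimate\<close>

section \<open>Sampling on the lattice\<close>

text \<open>The map called A in the overview; \<open>rot\<close>, the next definition, is J.\<close>

definition wshift :: "real \<Rightarrow> ('a::real_vector) \<times> 'a \<Rightarrow> 'a \<times> 'a" where
  "wshift \<tau> \<zeta> = (- (\<tau> *\<^sub>R snd \<zeta>), (1 - \<tau>) *\<^sub>R fst \<zeta>)"

definition rot :: "('a::real_vector) \<times> 'a \<Rightarrow> 'a \<times> 'a" where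
  "rot \<zeta> = (snd \<zeta>, - fst \<zeta>)"

lemma rot_rot [simp]: "rot (rot \<zeta>) = - \<zeta>"
  by (simp add: rot_def prod_eq_iff)

lemma rot_minus: "rot (- \<zeta>) = - rot \<zeta>" and rot_diff: "rot (\<zeta> - \<eta>) = rot \<zeta> - rot \<eta>"
  by (simp_all add: rot_def)

lemma norm_rot [simp]: "norm (rot \<zeta>) = norm (\<zeta> :: 'a::real_normed_vector \<times> 'a)"
  by (cases \<zeta>) (simp add: rot_def norm_Pair add.commute)

lemma wshift_diff: "wshift \<tau> (\<zeta> - \<eta>) = wshift \<tau> \<zeta> - wshift \<tau> \<eta>"
  by (simp add: wshift_def algebra_simps)

lemma norm_wshift:
  fixes \<zeta> :: "'a::real_normed_vector \<times> 'a"
  assumes "0 \<le> \<tau>" "\<tau> \<le> 1"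
  shows "norm (wshift \<tau> \<zeta>) \<le> 2 * norm \<zeta>"
proof -
  obtain x y where z: "\<zeta> = (x, y)" by (cases \<zeta>)
  have "norm (wshift \<tau> \<zeta>) \<le> norm (\<tau> *\<^sub>R y) + norm ((1 - \<tau>) *\<^sub>R x)"
    unfolding wshift_def z norm_Pair by (simp add: sqrt_sum_squares_le_sum)
  also have "\<dots> \<le> 1 * norm y + 1 * norm x"
    using assms by (intro add_mono) (auto intro!: mult_left_le_one_le)
  also have "\<dots> \<le> 2 * norm \<zeta>" using norm_fst_le[of x y] norm_snd_le[of y x] by (simp add: z)
  finally show ?thesis .
qed

lemma J_weight_eq_rot: "J_weight m z = m (rot z)"
  by (simp add: J_weight_def rot_def split_beta')

lemma stft_tau_wigner_rot:
  fixes \<phi> :: "'a::euclidean_space \<Rightarrow> complex"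
  assumes \<phi>: "\<phi> \<in> schwartz" "\<phi> \<noteq> (\<lambda>_. 0)"
  obtains c where "0 < c" "\<And>f g z \<zeta>. f \<in> schwartz \<Longrightarrow> g \<in> schwartz \<Longrightarrow>
    norm (stft (tau_wigner \<tau> \<phi> \<phi>) (tau_wigner \<tau> f g) (z, \<zeta>))
    = c * norm (stft \<phi> f (z + wshift \<tau> \<zeta>)) * norm (stft \<phi> g (z + wshift \<tau> \<zeta> + rot \<zeta>))"
proof -
  obtain c where c: "0 < c" "\<And>f g z1 z2 \<zeta>1 \<zeta>2. f \<in> schwartz \<Longrightarrow> g \<in> schwartz \<Longrightarrow>
    norm (stft (tau_wigner \<tau> \<phi> \<phi>) (tau_wigner \<tau> f g) ((z1, z2), (\<zeta>1, \<zeta>2)))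
    = c * norm (stft \<phi> f (z1 - \<tau> *\<^sub>R \<zeta>2, z2 + (1 - \<tau>) *\<^sub>R \<zeta>1)) *
      norm (stft \<phi> g (z1 + (1 - \<tau>) *\<^sub>R \<zeta>2, z2 - \<tau> *\<^sub>R \<zeta>1))"
    using stft_tau_wigner[OF \<phi>, of \<tau>] by blast
  show ?thesis
  proof (rule that[OF c(1)])
    fix f g :: "'a \<Rightarrow> complex" and z \<zeta> :: "'a \<times> 'a" assume fg: "f \<in> schwartz" "g \<in> schwartz"
    obtain z1 z2 \<zeta>1 \<zeta>2 where z: "z = (z1, z2)" "\<zeta> = (\<zeta>1, \<zeta>2)" by (cases z; cases \<zeta>)
    have e: "z + wshift \<tau> \<zeta> = (z1 - \<tau> *\<^sub>R \<zeta>2, z2 + (1 - \<tau>) *\<^sub>R \<zeta>1)"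
      "z + wshift \<tau> \<zeta> + rot \<zeta> = (z1 + (1 - \<tau>) *\<^sub>R \<zeta>2, z2 - \<tau> *\<^sub>R \<zeta>1)"
      unfolding z wshift_def rot_def by (simp_all add: algebra_simps)
    show "norm (stft (tau_wigner \<tau> \<phi> \<phi>) (tau_wigner \<tau> f g) (z, \<zeta>))
      = c * norm (stft \<phi> f (z + wshift \<tau> \<zeta>)) * norm (stft \<phi> g (z + wshift \<tau> \<zeta> + rot \<zeta>))"
      unfolding e(2) unfolding e(1) unfolding z by (rule c(2)[OF fg])
  qed
qed

text \<open>At the origin the factorisation gives c times the fourth power of the L2 norm of
  \<open>\<phi>\<close>, which is positive, whereas a zero window would give 0.\<close>

lemma tau_wigner_window_nonzero:
  assumes "\<phi> \<in> schwartz" "\<phi> \<noteq> (\<lambda>_. 0)"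
  shows "tau_wigner \<tau> \<phi> \<phi> \<noteq> (\<lambda>_. 0)"
proof
  assume 0: "tau_wigner \<tau> \<phi> \<phi> = (\<lambda>_. 0)"
  obtain c where c: "0 < c" "\<And>f g z \<zeta>. f \<in> schwartz \<Longrightarrow> g \<in> schwartz \<Longrightarrow>
    norm (stft (tau_wigner \<tau> \<phi> \<phi>) (tau_wigner \<tau> f g) (z, \<zeta>))
    = c * norm (stft \<phi> f (z + wshift \<tau> \<zeta>)) * norm (stft \<phi> g (z + wshift \<tau> \<zeta> + rot \<zeta>))"
    using stft_tau_wigner_rot[OF assms] by blast
  have e: "(0::'a \<times> 'a) + wshift \<tau> 0 = (0, 0)" "(0::'a \<times> 'a) + wshift \<tau> 0 + rot 0 = (0, 0)"
    by (simp_all add: wshift_def rot_def)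
  have "stft \<phi> \<phi> (0, 0) = (LINT t|lborel. \<phi> t * cnj (\<phi> t))"
    by (simp add: stft_eq)
  then have "stft \<phi> \<phi> (0, 0) \<noteq> 0" using inner_self_pos[OF assms] by simp
  moreover have "norm (stft (tau_wigner \<tau> \<phi> \<phi>) (tau_wigner \<tau> \<phi> \<phi>) (0, 0)) = 0"
    unfolding 0 by (simp add: STFT_def distribution_of_def zero_prod_def)
  ultimately show False using c(1) c(2)[OF assms(1) assms(1), of 0 0]
    unfolding e(2) unfolding e(1) by simp
qed

text \<open>For fixed \<open>\<zeta>\<close> the shear merely translates z, the inner variable, and
  so is invisible to the inner quasi-norm; the rotation acts on \<open>\<zeta>\<close> alone and
  preserves its measure. This is why \<open>\<tau>\<close> does not appear on the right.\<close>

lemma mixed_qnorm_sheared_lattice: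
  fixes G :: "((int ^ 'd) \<times> (int ^ 'd)) \<times> ((int ^ 'd) \<times> (int ^ 'd)) \<Rightarrow> ennreal"
  shows "mixed_qnorm p q lborel lborel (\<lambda>(z, \<zeta>). G (lattice_floor (z + wshift \<tau> \<zeta>), lattice_floor (- rot \<zeta>)))
    = mixed_qnorm p q (count_space UNIV) (count_space UNIV) G"
proof -
  have "Lp_qnorm p lborel (\<lambda>z. G (lattice_floor (z + w), n)) = Lp_qnorm p (count_space UNIV) (\<lambda>k. G (k, n))" for w n
    by (rule Lp_qnorm_lattice_floor_comp[of "\<lambda>z. z + w" p "\<lambda>k. G (k, n)"]) (auto simp: lborel_distr_translate)
  moreover have "Lp_qnorm q lborel (\<lambda>\<zeta>. h (lattice_floor (- rot \<zeta>))) = Lp_qnorm q (count_space UNIV) h"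
    for h :: "(int ^ 'd) \<times> (int ^ 'd) \<Rightarrow> ennreal"
  proof -
    have "- rot \<zeta> = (- snd \<zeta>, fst \<zeta>)" for \<zeta> :: "(real ^ 'd) \<times> (real ^ 'd)" by (simp add: rot_def)
    then show ?thesis
      using Lp_qnorm_lattice_floor_comp[of "\<lambda>z :: (real ^ 'd) \<times> (real ^ 'd). (- snd z, fst z)" q h]
      by (simp add: distr_rotate borel_measurable_continuous_onI continuous_intros)
  qed
  ultimately show ?thesis by (simp add: mixed_qnorm_def)
qed

lemma Lp_qnorm_count_uminus:
  fixes h :: "'k::ab_group_add \<Rightarrow> ennreal"
  shows "Lp_qnorm p (count_space UNIV) (\<lambda>k. h (- k)) = Lp_qnorm p (count_space UNIV) h"
  by (rule Lp_qnorm_distr) (auto intro!: distr_bij_count_space bij_uminus)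

lemma mixed_qnorm_count_uminus:
  fixes h :: "'k::ab_group_add \<times> 'n::ab_group_add \<Rightarrow> ennreal"
  shows "mixed_qnorm p q (count_space UNIV) (count_space UNIV) (\<lambda>j. h (- j))
    = mixed_qnorm p q (count_space UNIV) (count_space UNIV) h"
  using Lp_qnorm_count_uminus[of p "\<lambda>k. h (k, _)"]
    Lp_qnorm_count_uminus[of q "\<lambda>n. Lp_qnorm p (count_space UNIV) (\<lambda>k. h (k, n))"]
  by (simp add: mixed_qnorm_def)

lemma poly_moderate_close:
  assumes "poly_moderate C s m" "norm (z - w) \<le> r"
  shows "m z \<le> C * (1 + r) powr s * m w"
proof -
  have C: "0 < C" "0 \<le> s" using assms by (auto simp: poly_moderate_def)
  have "decay (- s) (z - w) \<le> (1 + r) powr s" using assms(2) C by (simp add: decay_def powr_mono2)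
  then have "C * decay (- s) (z - w) * m w \<le> C * (1 + r) powr s * m w"
    using C poly_moderateD(2)[OF assms(1)] by (intro mult_right_mono mult_left_mono) auto
  then show ?thesis using poly_moderateD(1)[OF assms(1), of z w] by linarith
qed

lemma stft_peetre_close:
  assumes "f \<in> schwartz" "\<phi> \<in> schwartz" "0 \<le> K" "norm (z - w) \<le> r"
  shows "stft_peetre K \<phi> f z \<le> (1 + r) powr K * stft_peetre K \<phi> f w"
proof -
  have r: "0 \<le> r" using assms(4) norm_ge_zero order_trans by blast
  have "(1 + r) powr - K \<le> decay K (z - w)"
    using assms(3,4) unfolding decay_def by (intro powr_mono2') auto
  then have "stft_peetre K \<phi> f z * (1 + r) powr - K \<le> stft_peetre K \<phi> f z * decay K (z - w)"
    by (intro mult_left_mono stft_peetre_nonneg[OF assms(1-3)])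
  also have "\<dots> \<le> stft_peetre K \<phi> f w" by (rule stft_peetre_slow[OF assms(1-3)])
  finally show ?thesis using r by (simp add: powr_minus field_simps)
qed

text \<open>Over a unit cell the maximal function and the weight both change by bounded factors
  only, so sampling at lattice points costs the constant D. The transform itself offers no such
  control.\<close>

lemma stft_peetre_lattice_qnorm:
  fixes \<phi> :: "real ^ 'd \<Rightarrow> complex"
  assumes \<phi>: "\<phi> \<in> schwartz" "\<phi> \<noteq> (\<lambda>_. 0)" and pq: "0 < p" "0 < q" and m: "poly_moderate C0 s m"
  obtains K0 where "0 \<le> K0" "\<And>K. K0 \<le> K \<Longrightarrow> \<exists>C>0. \<forall>f\<in>schwartz.
     mixed_qnorm p q (count_space UNIV) (count_space UNIV)
       (\<lambda>k. ennreal (stft_peetre K \<phi> f (lattice_point k) * m (lattice_point k)))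
     \<le> ennreal C * modulation_qnorm \<phi> p q m (distribution_of f)"
proof -
  let ?R = "2 * real CARD('d)"
  obtain K0 where K0: "0 \<le> K0" "\<And>K. K0 \<le> K \<Longrightarrow> \<exists>C>0. \<forall>f\<in>schwartz.
     mixed_qnorm p q lborel lborel (\<lambda>z. ennreal (stft_peetre K \<phi> f z * m z))
     \<le> ennreal C * mixed_qnorm p q lborel lborel (\<lambda>z. ennreal (norm (stft \<phi> f z) * m z))"
    using stft_peetre_qnorm_le[OF \<phi> pq m borel_comparable_moderate(1)[OF m]] by blast
  show ?thesis
  proof (rule that[OF K0(1)])
    fix K assume K: "K0 \<le> K"
    then have K': "0 \<le> K" using K0(1) by simp
    from K0(2)[OF K] obtain C where C: "0 < C" "\<And>f. f \<in> schwartz \<Longrightarrow>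
     mixed_qnorm p q lborel lborel (\<lambda>z. ennreal (stft_peetre K \<phi> f z * m z))
     \<le> ennreal C * mixed_qnorm p q lborel lborel (\<lambda>z. ennreal (norm (stft \<phi> f z) * m z))" by blast
    define D where "D = (1 + ?R) powr K * (C0 * (1 + ?R) powr s)"
    have C0: "0 < C0" using m by (simp add: poly_moderate_def)
    have D: "0 < D" using C0 by (simp add: D_def add_pos_nonneg)
    show "\<exists>C>0. \<forall>f\<in>schwartz.
     mixed_qnorm p q (count_space UNIV) (count_space UNIV)
       (\<lambda>k. ennreal (stft_peetre K \<phi> f (lattice_point k) * m (lattice_point k)))
     \<le> ennreal C * modulation_qnorm \<phi> p q m (distribution_of f)"
    proof (intro exI[of _ "D * C"] conjI ballI)
      show "0 < D * C" using D C by simp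
      fix f :: "real ^ 'd \<Rightarrow> complex" assume f: "f \<in> schwartz"
      have "mixed_qnorm p q (count_space UNIV) (count_space UNIV)
         (\<lambda>k. ennreal (stft_peetre K \<phi> f (lattice_point k) * m (lattice_point k)))
       = mixed_qnorm p q lborel lborel (\<lambda>z. ennreal (stft_peetre K \<phi> f (lattice_point (lattice_floor z)) * m (lattice_point (lattice_floor z))))"
        by (rule mixed_qnorm_lattice_floor[symmetric])
      also have "\<dots> \<le> ennreal D * mixed_qnorm p q lborel lborel (\<lambda>z. ennreal (stft_peetre K \<phi> f z * m z))"
      proof (rule mixed_qnorm_le_cmult[OF _ D pq])
        fix z :: "(real ^ 'd) \<times> (real ^ 'd)"
        have close: "norm (lattice_point (lattice_floor z) - z) \<le> ?R"
          using norm_minus_lattice_point[of z] by (simp add: norm_minus_commute)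
        have "stft_peetre K \<phi> f (lattice_point (lattice_floor z)) * m (lattice_point (lattice_floor z))
          \<le> ((1 + ?R) powr K * stft_peetre K \<phi> f z) * (C0 * (1 + ?R) powr s * m z)"
          by (intro mult_mono stft_peetre_close[OF f \<phi>(1) K' close] poly_moderate_close[OF m close]
              mult_nonneg_nonneg stft_peetre_nonneg[OF f \<phi>(1) K'] poly_moderateD(2)[OF m]) auto
        also have "\<dots> = D * (stft_peetre K \<phi> f z * m z)" by (simp add: D_def ac_simps)
        finally show "ennreal (stft_peetre K \<phi> f (lattice_point (lattice_floor z)) * m (lattice_point (lattice_floor z)))
          \<le> ennreal D * ennreal (stft_peetre K \<phi> f z * m z)"
          using D by (simp add: ennreal_leI flip: ennreal_mult')
      qed
      also have "\<dots> \<le> ennreal D * (ennreal C * modulation_qnorm \<phi> p q m (distribution_of f))"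
        unfolding modulation_qnorm_def by (intro mult_left_mono C f) auto
      finally show "mixed_qnorm p q (count_space UNIV) (count_space UNIV)
         (\<lambda>k. ennreal (stft_peetre K \<phi> f (lattice_point k) * m (lattice_point k)))
       \<le> ennreal (D * C) * modulation_qnorm \<phi> p q m (distribution_of f)"
        using D C by (simp add: ennreal_mult mult.assoc)
    qed
  qed
qed

abbreviation (input) lattice_estimate ::
  "ennreal \<Rightarrow> ennreal \<Rightarrow> ((real ^ 'd) \<times> (real ^ 'd) \<Rightarrow> real) \<Rightarrow> ennreal \<Rightarrow> ennreal \<Rightarrow> ((real ^ 'd) \<times> (real ^ 'd) \<Rightarrow> real) \<Rightarrow>
   ennreal \<Rightarrow> ennreal \<Rightarrow> ((real ^ 'd) \<times> (real ^ 'd) \<Rightarrow> real) \<Rightarrow> bool" where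
  "lattice_estimate p1 q1 m1 p2 q2 m2 p q m \<equiv> \<exists>C::real. 0 < C \<and> (\<forall>a b :: (int ^ 'd) \<times> (int ^ 'd) \<Rightarrow> complex.
     seq_qnorm p q (one_tensor (J_weight m \<circ> lattice_point)) (\<lambda>(k, n). a k * b (n - k))
       \<le> ennreal C * seq_qnorm p1 q1 (m1 \<circ> lattice_point) a
                   * seq_qnorm p2 q2 (reflect_weight m2 \<circ> lattice_point) b)"

theorem lattice_estimate_imp_bounded:
  fixes \<phi> :: "real ^ 'd \<Rightarrow> complex"
  assumes pos: "0 < p1" "0 < p2" "0 < q1" "0 < q2" "0 < p" "0 < q"
    and \<tau>: "0 \<le> \<tau>" "\<tau> \<le> 1"
    and m: "poly_moderate C0 s0 m" "poly_moderate C1 s1 m1" "poly_moderate C2 s2 m2"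
    and \<phi>: "\<phi> \<in> schwartz" "\<phi> \<noteq> (\<lambda>_. 0)"
    and \<Phi>: "\<Phi> \<in> schwartz" "\<Phi> \<noteq> (\<lambda>_. 0)"
    and est: "lattice_estimate p1 q1 m1 p2 q2 m2 p q m"
  shows "tau_wigner_bounded \<phi> \<Phi> \<tau> p1 q1 m1 p2 q2 m2 p q (one_tensor m)"
proof -
  let ?R = "2 * real CARD('d)"
  let ?W = "tau_wigner \<tau>"
  define \<Phi>1 where "\<Phi>1 = ?W \<phi> \<phi>"
  have \<Phi>1: "\<Phi>1 \<in> schwartz" "\<Phi>1 \<noteq> (\<lambda>_. 0)"
    unfolding \<Phi>1_def by (intro schwartz_tau_wigner \<phi>(1)) (rule tau_wigner_window_nonzero[OF \<phi>])
  let ?M = "one_tensor m :: ((real ^ 'd) \<times> (real ^ 'd)) \<times> ((real ^ 'd) \<times> (real ^ 'd)) \<Rightarrow> real"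
  have M: "poly_moderate C0 s0 ?M" "borel_comparable ?M"
    by (rule poly_moderate_one_tensor[OF m(1)], rule borel_comparable_moderate(2)[OF m(1)])
  obtain K0 where "0 \<le> K0" and K0: "\<And>K. K0 \<le> K \<Longrightarrow> \<exists>C>0. \<forall>F\<in>schwartz.
     mixed_qnorm p q lborel lborel (\<lambda>z. ennreal (stft_peetre K \<Phi>1 F z * ?M z))
     \<le> ennreal C * mixed_qnorm p q lborel lborel (\<lambda>z. ennreal (norm (stft \<Phi>1 F z) * ?M z))"
    by (rule stft_peetre_qnorm_le[OF \<Phi>1 pos(5,6) M]) (rule that)
  obtain K1 where "0 \<le> K1" and K1: "\<And>K. K1 \<le> K \<Longrightarrow> \<exists>C>0. \<forall>f\<in>schwartz.
     mixed_qnorm p1 q1 (count_space UNIV) (count_space UNIV)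
       (\<lambda>k. ennreal (stft_peetre K \<phi> f (lattice_point k) * m1 (lattice_point k)))
     \<le> ennreal C * modulation_qnorm \<phi> p1 q1 m1 (distribution_of f)"
    by (rule stft_peetre_lattice_qnorm[OF \<phi> pos(1,3) m(2)]) (rule that)
  obtain K2 where "0 \<le> K2" and K2: "\<And>K. K2 \<le> K \<Longrightarrow> \<exists>C>0. \<forall>f\<in>schwartz.
     mixed_qnorm p2 q2 (count_space UNIV) (count_space UNIV)
       (\<lambda>k. ennreal (stft_peetre K \<phi> f (lattice_point k) * m2 (lattice_point k)))
     \<le> ennreal C * modulation_qnorm \<phi> p2 q2 m2 (distribution_of f)"
    by (rule stft_peetre_lattice_qnorm[OF \<phi> pos(2,4) m(3)]) (rule that)
  define K where "K = max 0 (max K0 (max K1 K2))"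
  have K: "0 \<le> K" "K0 \<le> K" "K1 \<le> K" "K2 \<le> K" by (auto simp: K_def)
  obtain A0 where A0: "0 < A0" "\<And>F. F \<in> schwartz \<Longrightarrow>
     mixed_qnorm p q lborel lborel (\<lambda>z. ennreal (stft_peetre K \<Phi>1 F z * ?M z))
     \<le> ennreal A0 * mixed_qnorm p q lborel lborel (\<lambda>z. ennreal (norm (stft \<Phi>1 F z) * ?M z))"
    using K0[OF K(2)] by blast
  obtain A1 where A1: "0 < A1" "\<And>f. f \<in> schwartz \<Longrightarrow>
     mixed_qnorm p1 q1 (count_space UNIV) (count_space UNIV)
       (\<lambda>k. ennreal (stft_peetre K \<phi> f (lattice_point k) * m1 (lattice_point k)))
     \<le> ennreal A1 * modulation_qnorm \<phi> p1 q1 m1 (distribution_of f)"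
    using K1[OF K(3)] by blast
  obtain A2 where A2: "0 < A2" "\<And>f. f \<in> schwartz \<Longrightarrow>
     mixed_qnorm p2 q2 (count_space UNIV) (count_space UNIV)
       (\<lambda>k. ennreal (stft_peetre K \<phi> f (lattice_point k) * m2 (lattice_point k)))
     \<le> ennreal A2 * modulation_qnorm \<phi> p2 q2 m2 (distribution_of f)"
    using K2[OF K(4)] by blast
  obtain B where B: "0 < B" "\<And>F z. F \<in> schwartz \<Longrightarrow> stft_peetre K \<Phi> F z \<le> B * stft_peetre K \<Phi>1 F z"
    using stft_peetre_change_window[OF \<Phi>1 \<Phi>(1) K(1)] by blast
  obtain c where c: "0 < c" "\<And>f g z \<zeta>. f \<in> schwartz \<Longrightarrow> g \<in> schwartz \<Longrightarrow>
    norm (stft \<Phi>1 (?W f g) (z, \<zeta>))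
    = c * norm (stft \<phi> f (z + wshift \<tau> \<zeta>)) * norm (stft \<phi> g (z + wshift \<tau> \<zeta> + rot \<zeta>))"
    unfolding \<Phi>1_def using stft_tau_wigner_rot[OF \<phi>] by blast
  obtain E where E: "0 < E" "\<And>a b :: (int ^ 'd) \<times> (int ^ 'd) \<Rightarrow> complex.
     seq_qnorm p q (one_tensor (J_weight m \<circ> lattice_point)) (\<lambda>(k, n). a k * b (n - k))
       \<le> ennreal E * seq_qnorm p1 q1 (m1 \<circ> lattice_point) a * seq_qnorm p2 q2 (reflect_weight m2 \<circ> lattice_point) b"
    using est by blast
  have C0: "0 < C0" using m(1) by (simp add: poly_moderate_def)
  \<comment> \<open>Cost of rounding: one radius for the transform of f and for the weight, two for
    the transform of g, whose argument involves both k and n.\<close>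
  define D where "D = c * (1 + ?R) powr K * (1 + 2 * ?R) powr K * (C0 * (1 + ?R) powr s0)"
  have D: "0 < D" using c C0 by (simp add: D_def add_pos_nonneg)
  have main: "modulation_qnorm \<Phi> p q ?M (distribution_of (?W f g))
     \<le> ennreal (B * A0 * D * E * A1 * A2) * modulation_qnorm \<phi> p1 q1 m1 (distribution_of f)
        * modulation_qnorm \<phi> p2 q2 m2 (distribution_of g)"
    if fg: "f \<in> schwartz" "g \<in> schwartz" for f g
  proof -
    have W: "?W f g \<in> schwartz" by (rule schwartz_tau_wigner[OF fg])
    let ?a = "\<lambda>k. complex_of_real (stft_peetre K \<phi> f (lattice_point k))"
    \<comment> \<open>The transform of g is evaluated near k - n = -(n - k); taking b at reflected
      points produces b_{n-k}, and with it the reflected weight.\<close>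
    let ?b = "\<lambda>k. complex_of_real (stft_peetre K \<phi> g (lattice_point (- k)))"
    note Pf = stft_peetre_nonneg[OF fg(1) \<phi>(1) K(1)] and Pg = stft_peetre_nonneg[OF fg(2) \<phi>(1) K(1)]
    have m0: "0 \<le> m z" for z by (rule poly_moderateD(2)[OF m(1)])
    have s1: "modulation_qnorm \<Phi> p q ?M (distribution_of (?W f g))
       \<le> ennreal B * mixed_qnorm p q lborel lborel (\<lambda>z. ennreal (stft_peetre K \<Phi>1 (?W f g) z * ?M z))"
      unfolding modulation_qnorm_def
    proof (rule mixed_qnorm_le_cmult[OF _ B(1) pos(5,6)])
      fix z
      have "norm (stft \<Phi> (?W f g) z) * ?M z \<le> (B * stft_peetre K \<Phi>1 (?W f g) z) * ?M z"
        using order_trans[OF stft_peetre_ge[OF W \<Phi>(1) K(1)] B(2)[OF W]] poly_moderateD(2)[OF M(1)]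
        by (intro mult_right_mono)
      then show "ennreal (norm (stft \<Phi> (?W f g) z) * ?M z) \<le> ennreal B * ennreal (stft_peetre K \<Phi>1 (?W f g) z * ?M z)"
        using B(1) by (simp add: ennreal_leI mult.assoc flip: ennreal_mult')
    qed
    note s2 = A0(2)[OF W]
    have s3: "mixed_qnorm p q lborel lborel (\<lambda>z. ennreal (norm (stft \<Phi>1 (?W f g) z) * ?M z))
       \<le> ennreal D * seq_qnorm p q (one_tensor (J_weight m \<circ> lattice_point)) (\<lambda>(k, n). ?a k * ?b (n - k))"
      unfolding seq_qnorm_def mixed_qnorm_sheared_lattice[where \<tau> = \<tau>, symmetric]
    proof (rule mixed_qnorm_le_cmult[OF _ D pos(5,6)])
      fix x :: "((real ^ 'd) \<times> (real ^ 'd)) \<times> ((real ^ 'd) \<times> (real ^ 'd))"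
      obtain z \<zeta> where x: "x = (z, \<zeta>)" by (cases x)
      define w where "w = z + wshift \<tau> \<zeta>"
      define k where "k = lattice_floor w"
      define n where "n = lattice_floor (- rot \<zeta>)"
      have dk: "norm (w - lattice_point k) \<le> ?R" unfolding k_def by (rule norm_minus_lattice_point)
      have dn: "norm (- rot \<zeta> - lattice_point n) \<le> ?R" unfolding n_def by (rule norm_minus_lattice_point)
      have e: "w + rot \<zeta> - lattice_point (- (n - k)) = (w - lattice_point k) - (- rot \<zeta> - lattice_point n)"
        by (simp add: lattice_point_diff)
      have dkn: "norm (w + rot \<zeta> - lattice_point (- (n - k))) \<le> 2 * ?R"
        unfolding e using norm_triangle_ineq4[of "w - lattice_point k" "- rot \<zeta> - lattice_point n"] dk dn by linarith
      have "norm (\<zeta> - rot (lattice_point n)) = norm (rot (- rot \<zeta> - lattice_point n))"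
        by (simp add: rot_diff rot_minus del: norm_rot)
      then have dm: "norm (\<zeta> - rot (lattice_point n)) \<le> ?R" using dn by simp
      have "norm (stft \<Phi>1 (?W f g) (z, \<zeta>)) = c * norm (stft \<phi> f w) * norm (stft \<phi> g (w + rot \<zeta>))"
        unfolding w_def by (rule c(2)[OF fg])
      also have "\<dots> \<le> c * ((1 + ?R) powr K * stft_peetre K \<phi> f (lattice_point k)) * ((1 + 2 * ?R) powr K * stft_peetre K \<phi> g (lattice_point (- (n - k))))"
        using c(1) Pf
        by (intro mult_mono order_trans[OF stft_peetre_ge[OF fg(1) \<phi>(1) K(1)] stft_peetre_close[OF fg(1) \<phi>(1) K(1) dk]]
          order_trans[OF stft_peetre_ge[OF fg(2) \<phi>(1) K(1)] stft_peetre_close[OF fg(2) \<phi>(1) K(1) dkn]]) auto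
      finally have "norm (stft \<Phi>1 (?W f g) (z, \<zeta>)) * m \<zeta>
        \<le> (c * ((1 + ?R) powr K * stft_peetre K \<phi> f (lattice_point k)) * ((1 + 2 * ?R) powr K * stft_peetre K \<phi> g (lattice_point (- (n - k)))))
          * (C0 * (1 + ?R) powr s0 * m (rot (lattice_point n)))"
        using c(1) Pf Pg m0 by (intro mult_mono poly_moderate_close[OF m(1) dm]) auto
      also have "\<dots> = D * (norm (?a k * ?b (n - k)) * J_weight m (lattice_point n))"
        using Pf Pg by (simp add: D_def norm_mult J_weight_eq_rot ac_simps)
      finally show "ennreal (norm (stft \<Phi>1 (?W f g) x) * ?M x)
        \<le> ennreal D * (case x of (z, \<zeta>) \<Rightarrow> ennreal (norm ((\<lambda>(k, n). ?a k * ?b (n - k)) (lattice_floor (z + wshift \<tau> \<zeta>), lattice_floor (- rot \<zeta>)))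
           * one_tensor (J_weight m \<circ> lattice_point) (lattice_floor (z + wshift \<tau> \<zeta>), lattice_floor (- rot \<zeta>))))"
        using D by (simp add: x one_tensor_def k_def n_def w_def ennreal_leI flip: ennreal_mult')
    qed
    note s4 = E(2)[of ?a ?b]
    have s5: "seq_qnorm p1 q1 (m1 \<circ> lattice_point) ?a \<le> ennreal A1 * modulation_qnorm \<phi> p1 q1 m1 (distribution_of f)"
      using A1(2)[OF fg(1)] Pf by (simp add: seq_qnorm_def)
    have s6: "seq_qnorm p2 q2 (reflect_weight m2 \<circ> lattice_point) ?b \<le> ennreal A2 * modulation_qnorm \<phi> p2 q2 m2 (distribution_of g)"
      using A2(2)[OF fg(2)] Pg
        mixed_qnorm_count_uminus[of p2 q2 "\<lambda>k. ennreal (stft_peetre K \<phi> g (lattice_point k) * m2 (lattice_point k))"]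
      by (simp add: seq_qnorm_def reflect_weight_def lattice_point_minus)
    note s1
    also note mult_left_mono[OF s2, of "ennreal B"]
    also note mult_left_mono[OF mult_left_mono[OF s3, of "ennreal A0"], of "ennreal B"]
    also note mult_left_mono[OF mult_left_mono[OF mult_left_mono[OF s4, of "ennreal D"], of "ennreal A0"], of "ennreal B"]
    also have "ennreal B * (ennreal A0 * (ennreal D * (ennreal E * seq_qnorm p1 q1 (m1 \<circ> lattice_point) ?a * seq_qnorm p2 q2 (reflect_weight m2 \<circ> lattice_point) ?b)))
      \<le> ennreal B * (ennreal A0 * (ennreal D * (ennreal E * (ennreal A1 * modulation_qnorm \<phi> p1 q1 m1 (distribution_of f)) * (ennreal A2 * modulation_qnorm \<phi> p2 q2 m2 (distribution_of g)))))"
      by (intro mult_left_mono mult_mono s5 s6) auto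
    also have "\<dots> = ennreal (B * A0 * D * E * A1 * A2) * modulation_qnorm \<phi> p1 q1 m1 (distribution_of f) * modulation_qnorm \<phi> p2 q2 m2 (distribution_of g)"
      using B(1) A0(1) D E(1) A1(1) A2(1) by (simp add: ennreal_mult ac_simps)
    finally show ?thesis by simp
  qed
  show ?thesis
    unfolding tau_wigner_bounded_def
  proof (intro exI[of _ "B * A0 * D * E * A1 * A2"] conjI ballI)
    show "0 < B * A0 * D * E * A1 * A2" using B(1) A0(1) D E(1) A1(1) A2(1) by simp
    fix f g :: "real ^ 'd \<Rightarrow> complex" assume fg: "f \<in> schwartz" "g \<in> schwartz"
    show "modulation_qnorm \<Phi> p q ?M (distribution_of (?W f g))
      \<le> ennreal (B * A0 * D * E * A1 * A2) * modulation_qnorm \<phi> p1 q1 m1 (distribution_of f) * modulation_qnorm \<phi> p2 q2 m2 (distribution_of g)"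
      by (rule main[OF fg])
    show "distribution_of (?W f g) \<in> modulation_space \<Phi> p q ?M"
      unfolding modulation_space_def
      by (intro CollectI conjI distribution_of_schwartz schwartz_tau_wigner fg
          modulation_qnorm_schwartz_finite[OF schwartz_tau_wigner[OF fg] \<Phi>(1) M(1) pos(5,6)])
  qed
qed

section \<open>Interpolation, and necessity of the lattice estimate\<close>

section \<open>Interpolation on separated subsets of the lattice\<close>

text \<open>The row sums of E against A are at most A/2, so iterating -E halves a bound of the form
  A each time and the Neumann series for (I + E) c = a converges. Measuring against A, rather than
  in one fixed norm, lets the solution keep the pointwise profile of the data; the factor 2 is the
  geometric series.\<close>

lemma neumann_series_finite:
  fixes E :: "'k \<Rightarrow> 'k \<Rightarrow> complex"
  assumes S: "finite S" and a: "\<And>k. k \<in> S \<Longrightarrow> norm (a k) \<le> A k"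
    and E: "\<And>k. k \<in> S \<Longrightarrow> (\<Sum>j\<in>S. norm (E k j) * A j) \<le> A k / 2"
  obtains c where "\<And>k. k \<in> S \<Longrightarrow> c k + (\<Sum>j\<in>S. E k j * c j) = a k"
    "\<And>k. k \<in> S \<Longrightarrow> norm (c k) \<le> 2 * A k"
proof -
  \<comment> \<open>The n-th term is (-E)^n applied to a.\<close>
  define d where "d = rec_nat a (\<lambda>_ d k. - (\<Sum>j\<in>S. E k j * d j))"
  have d: "d 0 = a" "d (Suc n) k = - (\<Sum>j\<in>S. E k j * d n j)" for n k
    by (simp_all add: d_def)
  have bound: "norm (d n k) \<le> A k * (1 / 2) ^ n" if "k \<in> S" for n k
    using that
  proof (induction n arbitrary: k)
    case (Suc n)
    have "norm (d (Suc n) k) \<le> (\<Sum>j\<in>S. norm (E k j) * norm (d n j))"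
      unfolding d norm_minus_cancel by (rule order_trans[OF norm_sum]) (simp add: norm_mult)
    also have "\<dots> \<le> (\<Sum>j\<in>S. norm (E k j) * (A j * (1 / 2) ^ n))"
      by (intro sum_mono mult_left_mono Suc.IH) auto
    also have "\<dots> = (\<Sum>j\<in>S. norm (E k j) * A j) * (1 / 2) ^ n"
      by (simp add: sum_distrib_right mult.assoc)
    also have "\<dots> \<le> A k / 2 * (1 / 2) ^ n" by (intro mult_right_mono E Suc.prems) auto
    finally show ?case by simp
  qed (use a in \<open>simp add: d\<close>)
  have geo: "summable (\<lambda>n. A k * (1 / 2) ^ n)" for k
    by (intro summable_mult summable_geometric) auto
  have sum: "summable (\<lambda>n. d n k)" if "k \<in> S" for k
    using bound[OF that] by (intro summable_comparison_test[OF _ geo[of k]]) auto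
  show ?thesis
  proof (rule that[of "\<lambda>k. \<Sum>n. d n k"])
    fix k assume k: "k \<in> S"
    have "(\<Sum>j\<in>S. E k j * (\<Sum>n. d n j)) = (\<Sum>n. \<Sum>j\<in>S. E k j * d n j)"
      using sum by (subst suminf_sum) (auto simp: suminf_mult intro: summable_mult)
    also have "\<dots> = - (\<Sum>n. d (Suc n) k)"
      unfolding d(2) using sum by (subst suminf_minus) (auto intro!: summable_minus summable_sum summable_mult)
    finally show "(\<Sum>n. d n k) + (\<Sum>j\<in>S. E k j * (\<Sum>n. d n j)) = a k"
      using suminf_split_head[OF sum[OF k]] by (simp add: d(1))
    have "norm (\<Sum>n. d n k) \<le> (\<Sum>n. A k * (1 / 2) ^ n)"
      using bound[OF k] geo sum by (intro norm_suminf_le)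
    also have "\<dots> = A k * (\<Sum>n. (1 / 2) ^ n)" by (rule suminf_mult) (auto intro: summable_geometric)
    also have "\<dots> = 2 * A k" by (subst suminf_geometric) auto
    finally show "norm (\<Sum>n. d n k) \<le> 2 * A k" .
  qed
qed

text \<open>Each summand is an integral over a cell of volume 1, on which the kernel changes by at
  most the displayed factor.\<close>

lemma lattice_sum_le_nn_integral:
  fixes z :: "(real ^ 'd) \<times> (real ^ 'd)"
  assumes S: "finite S" and h: "\<And>k. 0 \<le> h k" and t: "0 \<le> t"
  shows "ennreal (\<Sum>k\<in>S. h k * decay t (z - lattice_point k))
    \<le> ennreal ((1 + 2 * real CARD('d)) powr t) * (\<integral>\<^sup>+w. ennreal (h (lattice_floor w) * decay t (z - w)) \<partial>lborel)"
proof -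
  let ?R = "2 * real CARD('d)"
  let ?g = "\<lambda>k. ennreal (h k * decay t (z - lattice_point k))"
  have "ennreal (\<Sum>k\<in>S. h k * decay t (z - lattice_point k)) = (\<Sum>k\<in>S. ?g k)"
    using h by (subst sum_ennreal) auto
  also have "\<dots> = (\<integral>\<^sup>+k. (if k \<in> S then ?g k else 0) \<partial>count_space UNIV)"
    by (subst nn_integral_count_space'[OF S]) auto
  also have "\<dots> \<le> (\<integral>\<^sup>+k. ?g k \<partial>count_space UNIV)"
    by (intro nn_integral_mono) auto
  also have "\<dots> = (\<integral>\<^sup>+w. ?g (lattice_floor w) \<partial>lborel)"
    by (subst distr_lattice_floor[symmetric], subst nn_integral_distr) auto
  also have "\<dots> \<le> (\<integral>\<^sup>+w. ennreal ((1 + ?R) powr t) * ennreal (h (lattice_floor w) * decay t (z - w)) \<partial>lborel)"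
  proof (rule nn_integral_mono)
    fix w :: "(real ^ 'd) \<times> (real ^ 'd)"
    let ?l = "lattice_point (lattice_floor w)"
    have "(1 + ?R) powr - t \<le> decay t (?l - w)"
      using norm_minus_lattice_point[of w] t unfolding decay_def
      by (intro powr_mono2') (auto simp: norm_minus_commute)
    then have "decay t (z - ?l) * (1 + ?R) powr - t \<le> decay t (z - ?l) * decay t (?l - w)"
      by (intro mult_left_mono) auto
    also have "\<dots> \<le> decay t (z - w)" by (rule decay_triangle_diff[OF t])
    finally have "decay t (z - ?l) \<le> (1 + ?R) powr t * decay t (z - w)"
      by (simp add: powr_minus field_simps add_pos_nonneg)
    from mult_left_mono[OF this h[of "lattice_floor w"]]
    show "?g (lattice_floor w) \<le> ennreal ((1 + ?R) powr t) * ennreal (h (lattice_floor w) * decay t (z - w))"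
      by (subst ennreal_mult[symmetric]) (auto intro!: ennreal_leI mult_nonneg_nonneg h simp: ac_simps)
  qed
  also have "\<dots> = ennreal ((1 + ?R) powr t) * (\<integral>\<^sup>+w. ennreal (h (lattice_floor w) * decay t (z - w)) \<partial>lborel)"
  proof (rule nn_integral_cmult)
    have [measurable]: "(\<lambda>w. h (lattice_floor w)) \<in> borel_measurable (borel :: ((real ^ 'd) \<times> (real ^ 'd)) measure)"
      by (rule measurable_compose[OF measurable_lattice_floor]) simp
    show "(\<lambda>w. ennreal (h (lattice_floor w) * decay t (z - w))) \<in> borel_measurable lborel" by measurable
  qed
  finally show ?thesis .
qed

lemma lattice_decay_sum_bounded:
  assumes t: "real (2 * DIM((real ^ 'd) \<times> (real ^ 'd))) \<le> t"
  obtains L where "0 < L" "\<And>(S :: ((int ^ 'd) \<times> (int ^ 'd)) set) (z :: (real ^ 'd) \<times> (real ^ 'd)). finite S \<Longrightarrow>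
    (\<Sum>k\<in>S. decay t (z - lattice_point k)) \<le> L"
proof -
  let ?c = "(1 + 2 * real CARD('d)) powr t"
  let ?I = "\<integral>\<^sup>+(w :: (real ^ 'd) \<times> (real ^ 'd)). ennreal (decay t w) \<partial>lborel"
  have t0: "0 \<le> t" using t by (smt (verit) of_nat_0_le_iff)
  have I: "?I < \<infinity>" by (rule nn_integral_decay_finite[OF t])
  show ?thesis
  proof (rule that[of "?c * enn2real ?I + 1"])
    show "0 < ?c * enn2real ?I + 1" by (intro add_nonneg_pos) auto
    fix S :: "((int ^ 'd) \<times> (int ^ 'd)) set" and z :: "(real ^ 'd) \<times> (real ^ 'd)" assume S: "finite S"
    have "ennreal (\<Sum>k\<in>S. 1 * decay t (z - lattice_point k))
      \<le> ennreal ?c * (\<integral>\<^sup>+w. ennreal (1 * decay t (z - w)) \<partial>lborel)"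
      by (rule lattice_sum_le_nn_integral[OF S _ t0]) auto
    also have "\<dots> = ennreal ?c * ?I"
      using nn_integral_reflect[of "\<lambda>w. ennreal (decay t w)" z] by simp
    also have "\<dots> = ennreal (?c * enn2real ?I)"
      using I by (simp add: ennreal_mult)
    finally have "(\<Sum>k\<in>S. decay t (z - lattice_point k)) \<le> ?c * enn2real ?I"
      by (simp add: ennreal_le_iff)
    then show "(\<Sum>k\<in>S. decay t (z - lattice_point k)) \<le> ?c * enn2real ?I + 1" by simp
  qed
qed

lemma stft_sum:
  assumes c: "finite S" "\<And>j. j \<in> S \<Longrightarrow> f j \<in> schwartz" "\<phi> \<in> schwartz"
  shows "stft \<phi> (\<lambda>t. \<Sum>j\<in>S. c j * f j t) z = (\<Sum>j\<in>S. c j * stft \<phi> (f j) z)"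
proof -
  obtain x \<xi> where z: "z = (x, \<xi>)" by (cases z)
  let ?g = "modulate \<xi> (translate x \<phi>)"
  have g: "?g \<in> schwartz" by (intro schwartz_modulate schwartz_translate assms)
  have "stft \<phi> (\<lambda>t. \<Sum>j\<in>S. c j * f j t) z = (LINT t|lborel. (\<Sum>j\<in>S. c j * (f j t * cnj (?g t))))"
    unfolding z stft_eq_inner by (simp add: sum_distrib_right mult.assoc)
  also have "\<dots> = (\<Sum>j\<in>S. LINT t|lborel. c j * (f j t * cnj (?g t)))"
    by (rule Bochner_Integration.integral_sum) (auto intro!: schwartz_inner_integrable c g)
  finally show ?thesis by (simp add: z stft_eq_inner)
qed

abbreviation separated :: "real \<Rightarrow> ((int ^ 'd) \<times> (int ^ 'd)) set \<Rightarrow> bool" where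
  "separated N \<equiv> pairwise (\<lambda>j k. N \<le> norm (lattice_point j - lattice_point k))"

text \<open>The solution must be controlled in a mixed quasi-norm with exponents possibly below 1,
  so a bound on an operator norm of the Gram matrix is not enough. Instead the data are replaced by
  the envelope \<open>A\<close>, which dominates them on S, varies slowly at rate K and has a
  quasi-norm controlled by that of the data. The Neumann series keeps the coefficients below 2 A,
  and the transform of the solution is below a multiple of A everywhere.\<close>

theorem stft_interpolation:
  fixes \<phi> :: "real ^ 'd \<Rightarrow> complex"
  assumes \<phi>: "\<phi> \<in> schwartz" "\<phi> \<noteq> (\<lambda>_. 0)" and pq: "0 < p" "0 < q" and m: "poly_moderate C0 s m"
  obtains N C :: real where "0 < C" "\<And>S (a :: (int ^ 'd) \<times> (int ^ 'd) \<Rightarrow> complex). finite S \<Longrightarrow>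
    separated N S \<Longrightarrow>
    \<exists>f\<in>schwartz. (\<forall>k\<in>S. stft \<phi> f (lattice_point k) = a k) \<and>
      modulation_qnorm \<phi> p q m (distribution_of f)
      \<le> ennreal C * seq_qnorm p q (m \<circ> lattice_point) (\<lambda>k. if k \<in> S then a k else 0)"
proof -
  let ?R = "2 * real CARD('d)"
  let ?T = "real (2 * DIM((real ^ 'd) \<times> (real ^ 'd)))"
  obtain r where "r \<le> 1" and r: "0 < r" "ennreal r \<le> p" "ennreal r \<le> q"
    by (rule common_lower_exponent[OF pq])
  have C0: "0 < C0" "0 \<le> s" using m by (simp_all add: poly_moderate_def)
  \<comment> \<open>K is chosen below so that the r-th power of \<open>decay K\<close> is
    \<open>decay \<sigma>\<close>, with \<open>\<sigma>\<close> the rate that the weighted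
    convolution bound asks for.\<close>
  define \<sigma> where "\<sigma> = r * s + ?T"
  have \<sigma>0: "0 \<le> \<sigma>" using r C0 by (simp add: \<sigma>_def)
  define K where "K = \<sigma> / r"
  have K: "0 \<le> K" "r * K = \<sigma>" using \<sigma>0 r by (simp_all add: K_def)
  \<comment> \<open>The exponent \<open>K + ?T + 1\<close> has three tasks: K exchanges the envelope
    at j for the envelope at another point, \<open>?T\<close> makes lattice sums converge, and the
    last power yields the small factor 1/N on separated points.\<close>
  obtain B where B: "0 < B" "\<And>w. norm (stft \<phi> \<phi> w) \<le> B * decay (K + ?T + 1) w"
    using schwartz_decay[OF schwartz_stft[OF \<phi>(1) \<phi>(1)]] by metis
  obtain L where L: "0 < L" "\<And>S (z :: (real ^ 'd) \<times> (real ^ 'd)). finite S \<Longrightarrow> (\<Sum>k\<in>S. decay ?T (z - lattice_point k)) \<le> L"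
    using lattice_decay_sum_bounded[where 'd = 'd, of ?T] by auto
  obtain Q where Q: "0 < Q" "\<And>F H. F \<in> borel_measurable borel \<Longrightarrow> (\<And>z. 0 \<le> F z) \<Longrightarrow> (\<And>z. 0 \<le> H z) \<Longrightarrow>
      (\<And>z. ennreal (H z powr r) \<le> (\<integral>\<^sup>+w. ennreal (F w powr r * decay \<sigma> (z - w)) \<partial>lborel)) \<Longrightarrow>
      mixed_qnorm p q lborel lborel (\<lambda>z. ennreal (H z * m z))
      \<le> ennreal Q * mixed_qnorm p q lborel lborel (\<lambda>z. ennreal (F z * m z))"
    using mixed_qnorm_decay_bound_weight[OF m borel_comparable_moderate(1)[OF m] r, of \<sigma>] unfolding \<sigma>_def by blast
  define \<gamma> where "\<gamma> = (LINT t|lborel. (norm (\<phi> t))\<^sup>2)"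
  have \<gamma>: "0 < \<gamma>" "(LINT t|lborel. \<phi> t * cnj (\<phi> t)) = complex_of_real \<gamma>"
    using inner_self_pos[OF \<phi>] by (simp_all add: \<gamma>_def)
  \<comment> \<open>With this separation the off-diagonal row sums are at most (B L / \<gamma>) / N
    = 1/2 of the envelope. The same number reappears as the constant in the pointwise bound
    \<open>ptw\<close>.\<close>
  define N where "N = 2 * B * L / \<gamma>"
  have N: "0 < N" using B L \<gamma> by (simp add: N_def)
  \<comment> \<open>Its r-th power is the constant of \<open>lattice_sum_le_nn_integral\<close>;
    dividing the envelope by c1 cancels that constant.\<close>
  define c1 where "c1 = (1 + ?R) powr (\<sigma> / r)"
  have c1: "0 < c1" "c1 powr r = (1 + ?R) powr \<sigma>"
    using r by (simp_all add: c1_def powr_powr add_pos_nonneg)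
  define D where "D = C0 * (1 + ?R) powr s"
  have D: "0 < D" using C0 by (simp add: D_def add_pos_nonneg)
  define \<pi> where "\<pi> j = modulate (snd (lattice_point j)) (translate (fst (lattice_point j)) \<phi>)" for j
  have \<pi>S: "\<pi> j \<in> schwartz" for j unfolding \<pi>_def by (intro schwartz_modulate schwartz_translate \<phi>)
  have \<pi>bound: "norm (stft \<phi> (\<pi> j) z) \<le> B * decay (K + ?T + 1) (z - lattice_point j)" for j z
    unfolding \<pi>_def stft_covariance[OF \<phi>(1) \<phi>(1)] using B(2)[of "z - lattice_point j"] by simp
  have \<pi>diag: "stft \<phi> (\<pi> j) (lattice_point j) = complex_of_real \<gamma>" for j
  proof -
    obtain x \<xi> where xx: "lattice_point j = (x, \<xi>)" by (cases "lattice_point j")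
    have "stft \<phi> (\<pi> j) (lattice_point j) = (LINT t|lborel. \<phi> (t - x) * cnj (\<phi> (t - x)))"
      unfolding xx stft_eq_inner
      by (intro Bochner_Integration.integral_cong refl)
         (simp add: \<pi>_def xx modulate_def translate_def cis_cnj mult.left_commute cis_mult flip: mult.assoc)
    also have "\<dots> = (LINT t|lborel. \<phi> t * cnj (\<phi> t))"
      using integral_translate[of "\<lambda>t. \<phi> t * cnj (\<phi> t)" "- x"] schwartz_inner_integrable[OF \<phi>(1) \<phi>(1)] by auto
    finally show ?thesis using \<gamma> by simp
  qed
  show ?thesis
  proof (rule that[of "N * (c1 * (Q * D))" N])
    show "0 < N * (c1 * (Q * D))" using N c1 Q D by simp
    fix S :: "((int ^ 'd) \<times> (int ^ 'd)) set" and a :: "(int ^ 'd) \<times> (int ^ 'd) \<Rightarrow> complex"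
    assume S: "finite S"
      and sep: "separated N S"
    \<comment> \<open>The discrete L^r maximal average of the data. Slow variation follows from the
      triangle inequality for the kernel applied to each summand.\<close>
    define A where "A z = (\<Sum>j\<in>S. norm (a j) powr r * decay \<sigma> (z - lattice_point j)) powr (1 / r)" for z
    have A0: "0 \<le> A z" for z by (simp add: A_def)
    have Ar: "A z powr r = (\<Sum>j\<in>S. norm (a j) powr r * decay \<sigma> (z - lattice_point j))" for z
      unfolding A_def using r by (simp add: powr_powr sum_nonneg)
    have Aa: "norm (a k) \<le> A (lattice_point k)" if "k \<in> S" for k
    proof -
      have "norm (a k) powr r * decay \<sigma> (lattice_point k - lattice_point k) \<le> A (lattice_point k) powr r"
        unfolding Ar using that S by (intro member_le_sum) auto
      then show ?thesis using r A0 powr_mono2[of "1 / r" "norm (a k) powr r" "A (lattice_point k) powr r"]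
        by (simp add: powr_powr)
    qed
    have Aslow: "A z * decay K (z' - z) \<le> A z'" for z z'
    proof -
      have "(A z * decay K (z' - z)) powr r = (\<Sum>j\<in>S. norm (a j) powr r * decay \<sigma> (z - lattice_point j)) * decay \<sigma> (z' - z)"
        using A0 K by (simp add: powr_mult Ar decay_powr mult.commute[of K])
      also have "\<dots> = (\<Sum>j\<in>S. norm (a j) powr r * (decay \<sigma> (z' - z) * decay \<sigma> (z - lattice_point j)))"
        unfolding sum_distrib_right by (simp only: mult_ac)
      also have "\<dots> \<le> A z' powr r" unfolding Ar
        by (intro sum_mono mult_left_mono decay_triangle_diff \<sigma>0) auto
      finally show ?thesis using r A0 powr_mono2[of "1 / r" "(A z * decay K (z' - z)) powr r" "A z' powr r"]
        by (simp add: powr_powr)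
    qed
    have AT: "A (lattice_point j) * decay (K + ?T) (z - lattice_point j) \<le> A z * decay ?T (z - lattice_point j)" for j z
      using mult_right_mono[OF Aslow[of "lattice_point j" z] decay_nonneg[of ?T "z - lattice_point j"]]
      by (simp add: decay_add mult.assoc)
    \<comment> \<open>The Gram matrix of the shifted windows, divided by its diagonal value
      \<open>\<gamma>\<close>, minus the identity.\<close>
    define E where "E k j = (if j = k then 0 else stft \<phi> (\<pi> j) (lattice_point k) / complex_of_real \<gamma>)" for k j
    have Esum: "(\<Sum>j\<in>S. norm (E k j) * A (lattice_point j)) \<le> A (lattice_point k) / 2" if k: "k \<in> S" for k
    proof -
      have "(\<Sum>j\<in>S. norm (E k j) * A (lattice_point j))
        \<le> (\<Sum>j\<in>S. B / \<gamma> / N * (A (lattice_point k) * decay ?T (lattice_point k - lattice_point j)))"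
      proof (rule sum_mono)
        fix j assume j: "j \<in> S"
        let ?d = "lattice_point k - lattice_point j"
        show "norm (E k j) * A (lattice_point j) \<le> B / \<gamma> / N * (A (lattice_point k) * decay ?T ?d)"
        proof (cases "j = k")
          case True then show ?thesis using B \<gamma> N A0 by (simp add: E_def)
        next
          case False
          have "norm (E k j) \<le> B * decay (K + ?T + 1) ?d / \<gamma>"
            using False \<gamma> divide_right_mono[OF \<pi>bound[of j "lattice_point k"], of \<gamma>] by (simp add: E_def norm_divide)
          also have "\<dots> = B / \<gamma> * decay (K + ?T) ?d * decay 1 ?d" by (simp add: decay_add)
          also have "\<dots> \<le> B / \<gamma> * decay (K + ?T) ?d * (1 / N)"
          proof (rule mult_left_mono)
            have "N \<le> norm ?d" using pairwiseD[OF sep k j] False by auto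
            then show "decay 1 ?d \<le> 1 / N" using N
              by (simp add: decay_def powr_minus_divide) (intro divide_left_mono; simp add: add_pos_nonneg)
          qed (use B \<gamma> in simp)
          finally have "norm (E k j) * A (lattice_point j) \<le> B / \<gamma> * decay (K + ?T) ?d * (1 / N) * A (lattice_point j)"
            using A0 by (rule mult_right_mono)
          also have "\<dots> = B / \<gamma> / N * (A (lattice_point j) * decay (K + ?T) ?d)" by simp
          also have "\<dots> \<le> B / \<gamma> / N * (A (lattice_point k) * decay ?T ?d)"
            using B \<gamma> N by (intro mult_left_mono AT) auto
          finally show ?thesis .
        qed
      qed
      also have "\<dots> = B / \<gamma> / N * A (lattice_point k) * (\<Sum>j\<in>S. decay ?T (lattice_point k - lattice_point j))"
        by (simp add: sum_distrib_left mult.assoc)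
      also have "\<dots> \<le> B / \<gamma> / N * A (lattice_point k) * L"
        using B \<gamma> N A0 by (intro mult_left_mono L(2)[OF S]) auto
      also have "\<dots> = A (lattice_point k) / 2" using B L \<gamma> by (simp add: N_def)
      finally show ?thesis .
    qed
    obtain c where c: "\<And>k. k \<in> S \<Longrightarrow> c k + (\<Sum>j\<in>S. E k j * c j) = a k"
      "\<And>k. k \<in> S \<Longrightarrow> norm (c k) \<le> 2 * A (lattice_point k)"
      by (rule neumann_series_finite[OF S Aa Esum]) auto
    define f where "f t = (\<Sum>j\<in>S. (c j / complex_of_real \<gamma>) * \<pi> j t)" for t
    have fS: "f \<in> schwartz" unfolding f_def by (intro schwartz_sum schwartz_scale \<pi>S)
    have stf: "stft \<phi> f z = (\<Sum>j\<in>S. (c j / complex_of_real \<gamma>) * stft \<phi> (\<pi> j) z)" for z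
      unfolding f_def[abs_def] by (rule stft_sum[OF S \<pi>S \<phi>(1)])
    have val: "stft \<phi> f (lattice_point k) = a k" if k: "k \<in> S" for k
    proof -
      have "stft \<phi> f (lattice_point k) = (\<Sum>j\<in>S. (if j = k then c j else 0) + E k j * c j)"
        unfolding stf using \<gamma> by (intro sum.cong refl) (simp add: E_def \<pi>diag)
      also have "\<dots> = c k + (\<Sum>j\<in>S. E k j * c j)" using k S by (simp add: sum.distrib)
      finally show ?thesis using c(1)[OF k] by simp
    qed
    have ptw: "norm (stft \<phi> f z) \<le> N * A z" for z
    proof -
      have "norm (stft \<phi> f z) \<le> (\<Sum>j\<in>S. 2 * B / \<gamma> * (A z * decay ?T (z - lattice_point j)))"
        unfolding stf
      proof (rule sum_norm_le)
        fix j assume j: "j \<in> S"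
        have "norm (c j / complex_of_real \<gamma> * stft \<phi> (\<pi> j) z)
          \<le> (2 * A (lattice_point j) / \<gamma>) * (B * decay (K + ?T + 1) (z - lattice_point j))"
          unfolding norm_mult norm_divide using \<gamma> A0 by (intro mult_mono \<pi>bound divide_mono c j) auto
        also have "\<dots> \<le> (2 * A (lattice_point j) / \<gamma>) * (B * decay (K + ?T) (z - lattice_point j))"
          using \<gamma> A0 B by (intro mult_left_mono decay_mono) auto
        also have "\<dots> = 2 * B / \<gamma> * (A (lattice_point j) * decay (K + ?T) (z - lattice_point j))" by simp
        also have "\<dots> \<le> 2 * B / \<gamma> * (A z * decay ?T (z - lattice_point j))"
          using B \<gamma> by (intro mult_left_mono AT) auto
        finally show "norm (c j / complex_of_real \<gamma> * stft \<phi> (\<pi> j) z) \<le> 2 * B / \<gamma> * (A z * decay ?T (z - lattice_point j))" .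
      qed
      also have "\<dots> = 2 * B / \<gamma> * A z * (\<Sum>j\<in>S. decay ?T (z - lattice_point j))"
        by (simp add: sum_distrib_left mult.assoc)
      also have "\<dots> \<le> 2 * B / \<gamma> * A z * L"
        using B \<gamma> A0 by (intro mult_left_mono L(2)[OF S]) auto
      finally show ?thesis by (simp add: N_def ac_simps)
    qed
    define h where "h k = (if k \<in> S then norm (a k) else 0)" for k
    have h0: "0 \<le> h k" for k by (simp add: h_def)
    let ?F = "\<lambda>w :: (real ^ 'd) \<times> (real ^ 'd). h (lattice_floor w)"
    have Fm: "?F \<in> borel_measurable borel"
      by (rule measurable_compose[OF measurable_lattice_floor]) simp
    have step: "mixed_qnorm p q lborel lborel (\<lambda>z. ennreal (A z / c1 * m z)) \<le> ennreal Q * mixed_qnorm p q lborel lborel (\<lambda>z. ennreal (?F z * m z))"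
    proof (rule Q(2)[OF Fm])
      show "0 \<le> A z / c1" for z using A0 c1 by simp
      fix z
      have hS: "A z powr r = (\<Sum>j\<in>S. h j powr r * decay \<sigma> (z - lattice_point j))"
        unfolding Ar by (intro sum.cong) (auto simp: h_def)
      let ?I = "\<integral>\<^sup>+w. ennreal (?F w powr r * decay \<sigma> (z - w)) \<partial>lborel"
      have le: "ennreal (A z powr r) \<le> ennreal ((1 + ?R) powr \<sigma>) * ?I"
        unfolding hS by (rule lattice_sum_le_nn_integral[OF S _ \<sigma>0, where h = "\<lambda>k. h k powr r"]) simp
      have "ennreal ((A z / c1) powr r) = ennreal (1 / (1 + ?R) powr \<sigma>) * ennreal (A z powr r)"
        using A0 c1 by (simp add: powr_divide flip: ennreal_mult)
      also have "\<dots> \<le> ennreal (1 / (1 + ?R) powr \<sigma>) * (ennreal ((1 + ?R) powr \<sigma>) * ?I)"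
        by (rule mult_left_mono[OF le]) simp
      also have "\<dots> = ?I"
        unfolding mult.assoc[symmetric] by (subst ennreal_mult[symmetric]) (simp_all add: add_pos_nonneg)
      finally show "ennreal ((A z / c1) powr r) \<le> ?I" .
    qed (use h0 in auto)
    have step1: "modulation_qnorm \<phi> p q m (distribution_of f)
      \<le> ennreal (N * c1) * mixed_qnorm p q lborel lborel (\<lambda>z. ennreal (A z / c1 * m z))"
      unfolding modulation_qnorm_def
    proof (rule mixed_qnorm_le_cmult[OF _ _ pq])
      fix z
      have "norm (stft \<phi> f z) * m z \<le> N * c1 * (A z / c1 * m z)"
        using mult_right_mono[OF ptw[of z] poly_moderateD(2)[OF m, of z]] c1 by simp
      then show "ennreal (norm (stft \<phi> f z) * m z) \<le> ennreal (N * c1) * ennreal (A z / c1 * m z)"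
        using N c1 by (simp add: ennreal_leI flip: ennreal_mult')
    qed (use N c1 in simp)
    have step2: "mixed_qnorm p q lborel lborel (\<lambda>z. ennreal (?F z * m z))
       \<le> ennreal D * seq_qnorm p q (m \<circ> lattice_point) (\<lambda>k. if k \<in> S then a k else 0)"
      unfolding seq_qnorm_def mixed_qnorm_lattice_floor[symmetric]
    proof (rule mixed_qnorm_le_cmult[OF _ D pq])
      fix z :: "(real ^ 'd) \<times> (real ^ 'd)"
      have "?F z * m z \<le> ?F z * (D * m (lattice_point (lattice_floor z)))"
        unfolding D_def by (intro mult_left_mono h0 poly_moderate_close[OF m norm_minus_lattice_point])
      also have "\<dots> = D * (norm (if lattice_floor z \<in> S then a (lattice_floor z) else 0) * (m \<circ> lattice_point) (lattice_floor z))"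
        by (simp add: h_def)
      finally show "ennreal (?F z * m z) \<le> ennreal D *
         ennreal (norm (if lattice_floor z \<in> S then a (lattice_floor z) else 0) * (m \<circ> lattice_point) (lattice_floor z))"
        unfolding ennreal_mult'[OF less_imp_le[OF D], symmetric] by (rule ennreal_leI)
    qed
    note step1
    also have "ennreal (N * c1) * mixed_qnorm p q lborel lborel (\<lambda>z. ennreal (A z / c1 * m z))
      \<le> ennreal (N * c1) * (ennreal Q * (ennreal D * seq_qnorm p q (m \<circ> lattice_point) (\<lambda>k. if k \<in> S then a k else 0)))"
      by (intro mult_left_mono order_trans[OF step] step2) auto
    also have "\<dots> = ennreal (N * (c1 * (Q * D))) * seq_qnorm p q (m \<circ> lattice_point) (\<lambda>k. if k \<in> S then a k else 0)"
      using N c1 Q D by (simp add: ennreal_mult mult.assoc)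
    finally have bound: "modulation_qnorm \<phi> p q m (distribution_of f)
      \<le> ennreal (N * (c1 * (Q * D))) * seq_qnorm p q (m \<circ> lattice_point) (\<lambda>k. if k \<in> S then a k else 0)" .
    show "\<exists>f\<in>schwartz. (\<forall>k\<in>S. stft \<phi> f (lattice_point k) = a k) \<and>
      modulation_qnorm \<phi> p q m (distribution_of f)
      \<le> ennreal (N * (c1 * (Q * D))) * seq_qnorm p q (m \<circ> lattice_point) (\<lambda>k. if k \<in> S then a k else 0)"
      by (rule bexI[OF _ fS], intro conjI ballI val bound)
  qed
qed

section \<open>Sequence spaces\<close>

lemma Lp_qnorm_count_SUP:
  fixes F :: "nat \<Rightarrow> 'k \<Rightarrow> ennreal"
  assumes F: "incseq F" and p: "0 < p"
  shows "Lp_qnorm p (count_space UNIV) (\<lambda>k. SUP i. F i k) = (SUP i. Lp_qnorm p (count_space UNIV) (F i))"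
proof (rule antisym)
  show "(SUP i. Lp_qnorm p (count_space UNIV) (F i)) \<le> Lp_qnorm p (count_space UNIV) (\<lambda>k. SUP i. F i k)"
    by (intro SUP_least Lp_qnorm_mono SUP_upper p) auto
  show "Lp_qnorm p (count_space UNIV) (\<lambda>k. SUP i. F i k) \<le> (SUP i. Lp_qnorm p (count_space UNIV) (F i))"
  proof (cases "p = top")
    case True
    have "F i k \<le> Lp_qnorm top (count_space UNIV) (F i)" for i k
      using AE_le_Lp_qnorm_top[of "F i" "count_space UNIV"] by (simp add: AE_count_space)
    then show ?thesis unfolding True Lp_qnorm_top_le_iff AE_count_space
      by (auto intro!: SUP_least intro: SUP_upper2)
  next
    case False
    note P = enn2real_pos[OF p False]
    have "(\<integral>\<^sup>+k. ennreal_powr (SUP i. F i k) (enn2real p) \<partial>count_space UNIV)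
      = (SUP i. \<integral>\<^sup>+k. ennreal_powr (F i k) (enn2real p) \<partial>count_space UNIV)"
      unfolding ennreal_powr_SUP[OF P]
      by (rule nn_integral_monotone_convergence_SUP)
         (use F P in \<open>auto simp: incseq_def le_fun_def intro!: ennreal_powr_mono\<close>)
    then show ?thesis using False P by (simp add: Lp_qnorm_def ennreal_powr_SUP)
  qed
qed

lemma mixed_qnorm_count_SUP:
  fixes F :: "nat \<Rightarrow> 'k \<times> 'n \<Rightarrow> ennreal"
  assumes F: "incseq F" and pq: "0 < p" "0 < q"
  shows "mixed_qnorm p q (count_space UNIV) (count_space UNIV) (\<lambda>z. SUP i. F i z)
    = (SUP i. mixed_qnorm p q (count_space UNIV) (count_space UNIV) (F i))"
proof -
  have "Lp_qnorm p (count_space UNIV) (\<lambda>k. SUP i. F i (k, n)) = (SUP i. Lp_qnorm p (count_space UNIV) (\<lambda>k. F i (k, n)))" for n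
    by (rule Lp_qnorm_count_SUP[OF _ pq(1)]) (use F in \<open>auto simp: incseq_def le_fun_def\<close>)
  then show ?thesis unfolding mixed_qnorm_def
    by (simp, intro Lp_qnorm_count_SUP pq(2))
       (use F pq(1) in \<open>auto simp: incseq_def le_fun_def intro!: Lp_qnorm_mono\<close>)
qed

lemma ennreal_powr_add_le:
  assumes "0 < r"
  shows "ennreal_powr (x + y) r \<le> ennreal (2 powr r) * (ennreal_powr x r + ennreal_powr y r)"
proof -
  have "ennreal_powr (x + y) r \<le> ennreal_powr (ennreal 2 * max x y) r"
  proof (rule ennreal_powr_mono[OF _ assms])
    have "x + y \<le> max x y + max x y" by (intro add_mono) auto
    then show "x + y \<le> ennreal 2 * max x y" by (simp add: mult_2)
  qed
  also have "\<dots> = ennreal (2 powr r) * ennreal_powr (max x y) r"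
    using assms by (subst ennreal_powr_mult) (simp_all add: ennreal_powr_ennreal del: ennreal_numeral)
  also have "\<dots> \<le> ennreal (2 powr r) * (ennreal_powr x r + ennreal_powr y r)"
    by (intro mult_left_mono) (auto simp: max_def)
  finally show ?thesis .
qed

text \<open>The inequality x + y \<le> 2 max(x, y) serves powers below and above 1 alike. It is used
  once under the sum and once for the outer root, whence the constant 2 * 2^(1/p).\<close>

lemma Lp_qnorm_count_add:
  assumes p: "0 < p"
  obtains K :: real where "0 < K" "\<And>F G :: 'k \<Rightarrow> ennreal. Lp_qnorm p (count_space UNIV) (\<lambda>k. F k + G k)
    \<le> ennreal K * (Lp_qnorm p (count_space UNIV) F + Lp_qnorm p (count_space UNIV) G)"
proof (cases "p = top")
  case True
  have le: "F k \<le> Lp_qnorm top (count_space UNIV) F" for F :: "'k \<Rightarrow> ennreal" and k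
    using AE_le_Lp_qnorm_top[of F "count_space UNIV"] by (simp add: AE_count_space)
  show ?thesis
    by (rule that[of 1]) (auto simp: True Lp_qnorm_top_le_iff AE_count_space intro: add_mono le)
next
  case False
  note P = enn2real_pos[OF p False]
  let ?P = "enn2real p"
  let ?K = "2 * 2 powr (1 / ?P)"
  show ?thesis
  proof (rule that[of ?K])
    fix F G :: "'k \<Rightarrow> ennreal"
    let ?I = "\<lambda>F. \<integral>\<^sup>+k. ennreal_powr (F k) ?P \<partial>count_space UNIV"
    have "?I (\<lambda>k. F k + G k) \<le> (\<integral>\<^sup>+k. ennreal (2 powr ?P) * (ennreal_powr (F k) ?P + ennreal_powr (G k) ?P) \<partial>count_space UNIV)"
      by (intro nn_integral_mono ennreal_powr_add_le P)
    also have "\<dots> = ennreal (2 powr ?P) * (?I F + ?I G)"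
      by (simp add: nn_integral_cmult nn_integral_add)
    finally have "Lp_qnorm p (count_space UNIV) (\<lambda>k. F k + G k) \<le> ennreal_powr (ennreal (2 powr ?P) * (?I F + ?I G)) (1 / ?P)"
      using False P by (auto simp: Lp_qnorm_def intro!: ennreal_powr_mono)
    also have "\<dots> = ennreal 2 * ennreal_powr (?I F + ?I G) (1 / ?P)"
      using P by (subst ennreal_powr_mult) (simp_all add: ennreal_powr_ennreal powr_powr)
    also have "\<dots> \<le> ennreal 2 * (ennreal (2 powr (1 / ?P)) * (ennreal_powr (?I F) (1 / ?P) + ennreal_powr (?I G) (1 / ?P)))"
      using P by (intro mult_left_mono ennreal_powr_add_le) auto
    finally show "Lp_qnorm p (count_space UNIV) (\<lambda>k. F k + G k) \<le> ennreal ?K * (Lp_qnorm p (count_space UNIV) F + Lp_qnorm p (count_space UNIV) G)"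
      using False by (simp add: Lp_qnorm_def ennreal_mult mult.assoc)
  qed simp
qed

lemma mixed_qnorm_count_sum:
  assumes pq: "0 < p" "0 < q" and I: "finite I"
  obtains K :: real where "0 < K" "\<And>F :: 'i \<Rightarrow> 'k \<times> 'n \<Rightarrow> ennreal.
    mixed_qnorm p q (count_space UNIV) (count_space UNIV) (\<lambda>z. \<Sum>i\<in>I. F i z)
    \<le> ennreal K * (\<Sum>i\<in>I. mixed_qnorm p q (count_space UNIV) (count_space UNIV) (F i))"
proof -
  obtain A :: real where A: "0 < A" "\<And>F G :: 'k \<Rightarrow> ennreal. Lp_qnorm p (count_space UNIV) (\<lambda>k. F k + G k)
    \<le> ennreal A * (Lp_qnorm p (count_space UNIV) F + Lp_qnorm p (count_space UNIV) G)"
    using Lp_qnorm_count_add[OF pq(1)] by blast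
  obtain B :: real where B: "0 < B" "\<And>F G :: 'n \<Rightarrow> ennreal. Lp_qnorm q (count_space UNIV) (\<lambda>k. F k + G k)
    \<le> ennreal B * (Lp_qnorm q (count_space UNIV) F + Lp_qnorm q (count_space UNIV) G)"
    using Lp_qnorm_count_add[OF pq(2)] by blast
  let ?N = "mixed_qnorm p q (count_space UNIV) (count_space UNIV) :: ('k \<times> 'n \<Rightarrow> ennreal) \<Rightarrow> ennreal"
  have add: "?N (\<lambda>z. F z + G z) \<le> ennreal (A * B) * (?N F + ?N G)" for F G
  proof -
    have "?N (\<lambda>z. F z + G z) \<le> Lp_qnorm q (count_space UNIV) (\<lambda>n. ennreal A *
        (Lp_qnorm p (count_space UNIV) (\<lambda>k. F (k, n)) + Lp_qnorm p (count_space UNIV) (\<lambda>k. G (k, n))))"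
      unfolding mixed_qnorm_def by (intro Lp_qnorm_mono A pq)
    also have "\<dots> \<le> ennreal A * (ennreal B * (?N F + ?N G))"
      unfolding Lp_qnorm_cmult[OF A(1) pq(2)] mixed_qnorm_def by (intro mult_left_mono B) auto
    finally show ?thesis using A B by (simp add: ennreal_mult mult.assoc)
  qed
  have "\<exists>K>0. \<forall>F :: 'i \<Rightarrow> 'k \<times> 'n \<Rightarrow> ennreal. ?N (\<lambda>z. \<Sum>i\<in>I. F i z) \<le> ennreal K * (\<Sum>i\<in>I. ?N (F i))"
    using I
  proof induction
    case empty
    have "?N (\<lambda>_. 0) = 0" unfolding mixed_qnorm_def using pq by simp
    then show ?case by (intro exI[of _ 1]) auto
  next
    case (insert i I)
    then obtain K where K: "0 < K" "\<And>F :: 'i \<Rightarrow> 'k \<times> 'n \<Rightarrow> ennreal. ?N (\<lambda>z. \<Sum>i\<in>I. F i z) \<le> ennreal K * (\<Sum>i\<in>I. ?N (F i))"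
      by blast
    show ?case
    proof (intro exI[of _ "A * B * max 1 K"] conjI allI)
      show "0 < A * B * max 1 K" using A B by simp
      fix F :: "'i \<Rightarrow> 'k \<times> 'n \<Rightarrow> ennreal"
      have "?N (\<lambda>z. \<Sum>i\<in>insert i I. F i z) \<le> ennreal (A * B) * (?N (F i) + ?N (\<lambda>z. \<Sum>i\<in>I. F i z))"
        using add[of "F i"] insert by simp
      also have "\<dots> \<le> ennreal (A * B) * (ennreal (max 1 K) * ?N (F i) + ennreal (max 1 K) * (\<Sum>i\<in>I. ?N (F i)))"
      proof (intro mult_left_mono add_mono)
        show "?N (F i) \<le> ennreal (max 1 K) * ?N (F i)"
          using mult_right_mono[OF ennreal_leI[of 1 "max 1 K"], of "?N (F i)"] by simp
        show "?N (\<lambda>z. \<Sum>i\<in>I. F i z) \<le> ennreal (max 1 K) * (\<Sum>i\<in>I. ?N (F i))"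
          by (rule order_trans[OF K(2)], intro mult_right_mono ennreal_leI) auto
      qed auto
      also have "\<dots> = ennreal (A * B * max 1 K) * (\<Sum>i\<in>insert i I. ?N (F i))"
        using A B insert by (simp add: ennreal_mult distrib_left mult.assoc)
      finally show "?N (\<lambda>z. \<Sum>i\<in>insert i I. F i z) \<le> ennreal (A * B * max 1 K) * (\<Sum>i\<in>insert i I. ?N (F i))" .
    qed
  qed
  then show ?thesis using that by blast
qed

lemma finite_exhaustion:
  obtains S :: "nat \<Rightarrow> 'k::countable set" where "incseq S" "\<And>i. finite (S i)" "\<And>k. \<exists>i. k \<in> S i"
proof (rule that[of "\<lambda>i. to_nat -` {..i}"])
  show "incseq (\<lambda>i. to_nat -` {..i} :: 'k set)" by (auto simp: incseq_def)
  show "finite (to_nat -` {..i} :: 'k set)" for i by (intro finite_vimageI) auto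
qed auto

lemma seq_qnorm_mono:
  "(\<And>k. norm (a k) \<le> norm (b k)) \<Longrightarrow> (\<And>k. 0 \<le> w k) \<Longrightarrow> 0 < p \<Longrightarrow> 0 < q \<Longrightarrow> seq_qnorm p q w a \<le> seq_qnorm p q w b"
  unfolding seq_qnorm_def by (intro mixed_qnorm_mono ennreal_leI mult_right_mono)

text \<open>Truncate both sequences to an increasing exhaustion by finite sets. Each entry of the
  truncated product increases to the full one, as k and n - k both lie in a late enough set;
  monotone convergence passes to the limit with the same constant.\<close>

lemma bilinear_estimate_finite_support:
  fixes w :: "('k::{countable, ab_group_add} \<times> 'n::{countable, ab_group_add}) \<times> ('k \<times> 'n) \<Rightarrow> real" and w1 w2 :: "'k \<times> 'n \<Rightarrow> real"
  assumes pos: "0 < p1" "0 < p2" "0 < q1" "0 < q2" "0 < p" "0 < q"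
    and w: "\<And>k. 0 \<le> w1 k" "\<And>k. 0 \<le> w2 k"
    and fin: "\<And>a b. finite {k. a k \<noteq> 0} \<Longrightarrow> finite {k. b k \<noteq> 0} \<Longrightarrow>
      seq_qnorm p q w (\<lambda>(k, n). a k * b (n - k)) \<le> C * seq_qnorm p1 q1 w1 a * seq_qnorm p2 q2 w2 b"
  shows "seq_qnorm p q w (\<lambda>(k, n). a k * b (n - k)) \<le> C * seq_qnorm p1 q1 w1 a * seq_qnorm p2 q2 w2 b"
proof -
  obtain S :: "nat \<Rightarrow> ('k \<times> 'n) set" where S: "incseq S" "\<And>i. finite (S i)" "\<And>k. \<exists>i. k \<in> S i"
    using finite_exhaustion by blast
  define r where "r i c k = (if k \<in> S i then c k else 0 :: complex)" for i c k
  define F where "F i z = ennreal (norm (case z of (k, n) \<Rightarrow> r i a k * r i b (n - k)) * w z)" for i z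
  have sup: "(SUP i. F i z) = ennreal (norm (case z of (k, n) \<Rightarrow> a k * b (n - k)) * w z)" for z
  proof -
    obtain k n where z: "z = (k, n)" by (cases z)
    obtain i where "k \<in> S i" using S(3) by blast
    moreover obtain j where "n - k \<in> S j" using S(3) by blast
    ultimately have "k \<in> S (max i j)" "n - k \<in> S (max i j)"
      using monoD[OF S(1), of i "max i j"] monoD[OF S(1), of j "max i j"] by auto
    then have *: "F (max i j) z = ennreal (norm (case z of (k, n) \<Rightarrow> a k * b (n - k)) * w z)"
      by (simp add: F_def r_def z)
    have "F i z \<le> ennreal (norm (case z of (k, n) \<Rightarrow> a k * b (n - k)) * w z)" for i
      by (auto simp: F_def r_def z)
    then show ?thesis using SUP_upper[of "max i j" UNIV "\<lambda>i. F i z"] by (intro antisym SUP_least) (simp_all add: *)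
  qed
  have inc: "incseq F"
  proof (intro incseq_SucI le_funI)
    fix i and z :: "('k \<times> 'n) \<times> ('k \<times> 'n)"
    have "S i \<subseteq> S (Suc i)" using S(1) by (simp add: incseq_SucD)
    then show "F i z \<le> F (Suc i) z" by (cases z) (auto simp: F_def r_def)
  qed
  have "seq_qnorm p q w (\<lambda>(k, n). a k * b (n - k)) = (SUP i. mixed_qnorm p q (count_space UNIV) (count_space UNIV) (F i))"
    unfolding seq_qnorm_def sup[symmetric] by (rule mixed_qnorm_count_SUP[OF inc pos(5,6)])
  also have "\<dots> \<le> C * seq_qnorm p1 q1 w1 a * seq_qnorm p2 q2 w2 b"
  proof (rule SUP_least)
    fix i
    have "finite {k. r i c k \<noteq> 0}" for c by (rule finite_subset[OF _ S(2)[of i]]) (auto simp: r_def)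
    then have "mixed_qnorm p q (count_space UNIV) (count_space UNIV) (F i)
      \<le> C * seq_qnorm p1 q1 w1 (r i a) * seq_qnorm p2 q2 w2 (r i b)"
      using fin[of "r i a" "r i b"] by (simp add: seq_qnorm_def F_def[abs_def])
    also have "\<dots> \<le> C * seq_qnorm p1 q1 w1 a * seq_qnorm p2 q2 w2 b"
      by (intro mult_mono seq_qnorm_mono w pos) (auto simp: r_def)
    finally show "mixed_qnorm p q (count_space UNIV) (count_space UNIV) (F i) \<le> C * seq_qnorm p1 q1 w1 a * seq_qnorm p2 q2 w2 b" .
  qed
  finally show ?thesis .
qed

lemma seq_qnorm_finite_support:
  assumes a: "finite {k. a k \<noteq> 0}" and pq: "0 < p" "0 < q"
  shows "seq_qnorm p q w a < \<infinity>"
proof -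
  have Lp: "Lp_qnorm p (count_space UNIV) F < top"
    if "finite {k. F k \<noteq> 0}" "\<And>k. F k < top" "0 < p" for p and F :: "'z \<Rightarrow> ennreal"
  proof (cases "p = top")
    case True
    have "F k \<le> (\<Sum>k\<in>{k. F k \<noteq> 0}. F k)" for k
      using that(1) by (cases "F k = 0") (auto intro: member_le_sum)
    then have "Lp_qnorm top (count_space UNIV) F \<le> (\<Sum>k\<in>{k. F k \<noteq> 0}. F k)"
      by (simp add: Lp_qnorm_top_le_iff AE_count_space)
    also have "\<dots> < top" using that by simp
    finally show ?thesis using True by simp
  next
    case False
    have "(\<integral>\<^sup>+k. ennreal_powr (F k) (enn2real p) \<partial>count_space UNIV) = (\<Sum>k\<in>{k. F k \<noteq> 0}. ennreal_powr (F k) (enn2real p))"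
      by (rule nn_integral_count_space'[OF that(1)]) auto
    also have "\<dots> < top"
    proof -
      have "ennreal_powr (F k) (enn2real p) < top" for k
        using that(2)[of k] by (simp add: less_top[symmetric])
      then show ?thesis using that(1) by simp
    qed
    finally show ?thesis using False by (simp add: Lp_qnorm_def less_top[symmetric])
  qed
  have fst: "finite {k. a (k, n) \<noteq> 0}" for n
    by (rule finite_subset[OF _ finite_imageI[OF a, of fst]]) (auto simp: image_iff)
  have snd: "finite {n. Lp_qnorm p (count_space UNIV) (\<lambda>k. ennreal (norm (a (k, n)) * w (k, n))) \<noteq> 0}"
  proof (rule finite_subset[OF _ finite_imageI[OF a, of snd]], rule subsetI, rule ccontr)
    fix n assume n: "n \<in> {n. Lp_qnorm p (count_space UNIV) (\<lambda>k. ennreal (norm (a (k, n)) * w (k, n))) \<noteq> 0}"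
      and "n \<notin> snd ` {k. a k \<noteq> 0}"
    then have "a (k, n) = 0" for k by (force simp: image_iff)
    then show False using n pq by simp
  qed
  show ?thesis
    unfolding seq_qnorm_def mixed_qnorm_def infinity_ennreal_def
  proof (intro Lp snd pq)
    show "finite {k. ennreal (norm (a (k, n)) * w (k, n)) \<noteq> 0}" for n
      by (rule finite_subset[OF _ fst[of n]]) auto
  qed auto
qed

section \<open>From boundedness to the lattice estimate\<close>

text \<open>The colour is the residue of every coordinate modulo an integer M \<ge> N. Distinct
  points of one colour differ in some coordinate by a nonzero multiple of M.\<close>

lemma lattice_colouring:
  obtains I and col :: "(int ^ 'd) \<times> (int ^ 'd) \<Rightarrow> (int ^ 'd) \<times> (int ^ 'd)"
  where "finite I" "\<And>k. col k \<in> I"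
    "\<And>j k. col j = col k \<Longrightarrow> j \<noteq> k \<Longrightarrow> N \<le> norm (lattice_point j - lattice_point k)"
proof -
  define M where "M = max 1 \<lceil>N\<rceil>"
  have M: "0 < M" "N \<le> real_of_int M" unfolding M_def by linarith+
  define R where "R k = (\<chi> i. (k $ i) mod M)" for k :: "int ^ 'd"
  define V where "V = vec_lambda ` (UNIV \<rightarrow>\<^sub>E {0..<M} :: ('d \<Rightarrow> int) set)"
  have "finite (UNIV \<rightarrow>\<^sub>E {0..<M} :: ('d \<Rightarrow> int) set)" by (intro finite_PiE) auto
  then have V: "finite V" by (simp add: V_def)
  have RV: "R k \<in> V" for k
    unfolding R_def V_def using M by (intro imageI) (auto simp: PiE_UNIV_domain)
  have far: "N \<le> norm ((\<chi> i. of_int (j $ i)) - (\<chi> i. of_int (k $ i)) :: real ^ 'd)"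
    if eq: "R j = R k" and neq: "j \<noteq> k" for j k :: "int ^ 'd"
  proof -
    obtain i where i: "j $ i \<noteq> k $ i" using neq by (auto simp: vec_eq_iff)
    have "(j $ i) mod M = (k $ i) mod M" using eq by (simp add: R_def vec_eq_iff)
    then have "M dvd j $ i - k $ i" by (simp add: mod_eq_dvd_iff)
    then have "M \<le> \<bar>j $ i - k $ i\<bar>" using i M by (intro zdvd_imp_le) auto
    then have "real_of_int M \<le> \<bar>of_int (j $ i) - of_int (k $ i)\<bar>"
      by (metis of_int_abs of_int_diff of_int_le_iff)
    also have "\<dots> \<le> norm ((\<chi> i. of_int (j $ i)) - (\<chi> i. of_int (k $ i)) :: real ^ 'd)"
      using component_le_norm_cart[of "(\<chi> i. of_int (j $ i)) - (\<chi> i. of_int (k $ i)) :: real ^ 'd" i] by simp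
    finally show ?thesis using M by linarith
  qed
  show ?thesis
  proof (rule that[of "V \<times> V" "map_prod R R"])
    show "finite (V \<times> V)" using V by simp
    show "map_prod R R k \<in> V \<times> V" for k using RV by (cases k) auto
    fix j k :: "(int ^ 'd) \<times> (int ^ 'd)" assume jk: "map_prod R R j = map_prod R R k" "j \<noteq> k"
    obtain j1 j2 k1 k2 where e: "j = (j1, j2)" "k = (k1, k2)" by (cases j; cases k)
    let ?l = "\<lambda>k :: int ^ 'd. (\<chi> i. of_int (k $ i)) :: real ^ 'd"
    have "norm (?l j1 - ?l k1) \<le> norm (lattice_point j - lattice_point k)"
      "norm (?l j2 - ?l k2) \<le> norm (lattice_point j - lattice_point k)"
      unfolding e lattice_point_def by (simp_all add: norm_fst_le norm_snd_le)
    moreover have "N \<le> norm (?l j1 - ?l k1) \<or> N \<le> norm (?l j2 - ?l k2)"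
      using jk far unfolding e by auto
    ultimately show "N \<le> norm (lattice_point j - lattice_point k)" by linarith
  qed
qed

text \<open>Interpolating a and b gives f and g for which the transform of their Wigner distribution
  has modulus c |a_k b_{n-k}| at one point for each relevant pair (k, n). The maximal function
  spreads this value over the cell belonging to (k, n), so the discrete quasi-norm is bounded by
  that of the maximal function.\<close>

lemma bounded_imp_separated_lattice_estimate:
  fixes \<phi> :: "real ^ 'd \<Rightarrow> complex"
  assumes pos: "0 < p1" "0 < p2" "0 < q1" "0 < q2" "0 < p" "0 < q"
    and \<tau>: "0 \<le> \<tau>" "\<tau> \<le> 1"
    and m: "poly_moderate C0 s0 m" "poly_moderate C1 s1 m1" "poly_moderate C2 s2 m2"
    and \<phi>: "\<phi> \<in> schwartz" "\<phi> \<noteq> (\<lambda>_. 0)"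
    and \<Phi>: "\<Phi> \<in> schwartz" "\<Phi> \<noteq> (\<lambda>_. 0)"
    and bdd: "tau_wigner_bounded \<phi> \<Phi> \<tau> p1 q1 m1 p2 q2 m2 p q (one_tensor m)"
  obtains N C :: real where "0 < C" "\<And>S T (a :: (int ^ 'd) \<times> (int ^ 'd) \<Rightarrow> complex) b. finite S \<Longrightarrow> finite T \<Longrightarrow>
    separated N S \<Longrightarrow>
    separated N T \<Longrightarrow>
    \<forall>k. k \<notin> S \<longrightarrow> a k = 0 \<Longrightarrow> \<forall>k. k \<notin> T \<longrightarrow> b k = 0 \<Longrightarrow>
    seq_qnorm p q (one_tensor (J_weight m \<circ> lattice_point)) (\<lambda>(k, n). a k * b (n - k))
       \<le> ennreal C * seq_qnorm p1 q1 (m1 \<circ> lattice_point) a * seq_qnorm p2 q2 (reflect_weight m2 \<circ> lattice_point) b"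
proof -
  let ?R = "2 * real CARD('d)"
  let ?W = "tau_wigner \<tau>"
  define \<Phi>1 where "\<Phi>1 = ?W \<phi> \<phi>"
  have \<Phi>1: "\<Phi>1 \<in> schwartz" unfolding \<Phi>1_def by (intro schwartz_tau_wigner \<phi>(1))
  let ?M = "one_tensor m :: ((real ^ 'd) \<times> (real ^ 'd)) \<times> ((real ^ 'd) \<times> (real ^ 'd)) \<Rightarrow> real"
  have M: "poly_moderate C0 s0 ?M" "borel_comparable ?M"
    by (rule poly_moderate_one_tensor[OF m(1)], rule borel_comparable_moderate(2)[OF m(1)])
  obtain K where K: "0 \<le> K" and "\<And>K'. K \<le> K' \<Longrightarrow> \<exists>C>0. \<forall>F\<in>schwartz.
     mixed_qnorm p q lborel lborel (\<lambda>z. ennreal (stft_peetre K' \<Phi> F z * ?M z))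
     \<le> ennreal C * mixed_qnorm p q lborel lborel (\<lambda>z. ennreal (norm (stft \<Phi> F z) * ?M z))"
    by (rule stft_peetre_qnorm_le[OF \<Phi> pos(5,6) M]) (rule that)
  from this(2)[of K] obtain A where A: "0 < A" "\<And>F. F \<in> schwartz \<Longrightarrow>
     mixed_qnorm p q lborel lborel (\<lambda>z. ennreal (stft_peetre K \<Phi> F z * ?M z))
     \<le> ennreal A * modulation_qnorm \<Phi> p q ?M (distribution_of F)"
    unfolding modulation_qnorm_def by blast
  obtain B where B: "0 < B" "\<And>F z. F \<in> schwartz \<Longrightarrow> stft_peetre K \<Phi>1 F z \<le> B * stft_peetre K \<Phi> F z"
    using stft_peetre_change_window[OF \<Phi> \<Phi>1 K] by blast
  obtain c where c: "0 < c" "\<And>f g z \<zeta>. f \<in> schwartz \<Longrightarrow> g \<in> schwartz \<Longrightarrow>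
    norm (stft \<Phi>1 (?W f g) (z, \<zeta>))
    = c * norm (stft \<phi> f (z + wshift \<tau> \<zeta>)) * norm (stft \<phi> g (z + wshift \<tau> \<zeta> + rot \<zeta>))"
    unfolding \<Phi>1_def using stft_tau_wigner_rot[OF \<phi>] by blast
  obtain N1 D1 :: real where D1: "0 < D1" "\<And>S (a :: (int ^ 'd) \<times> (int ^ 'd) \<Rightarrow> complex). finite S \<Longrightarrow>
    separated N1 S \<Longrightarrow>
    \<exists>f\<in>schwartz. (\<forall>k\<in>S. stft \<phi> f (lattice_point k) = a k) \<and>
      modulation_qnorm \<phi> p1 q1 m1 (distribution_of f)
      \<le> ennreal D1 * seq_qnorm p1 q1 (m1 \<circ> lattice_point) (\<lambda>k. if k \<in> S then a k else 0)"
    by (rule stft_interpolation[OF \<phi> pos(1,3) m(2)]) (rule that)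
  obtain N2 D2 :: real where D2: "0 < D2" "\<And>S (a :: (int ^ 'd) \<times> (int ^ 'd) \<Rightarrow> complex). finite S \<Longrightarrow>
    separated N2 S \<Longrightarrow>
    \<exists>f\<in>schwartz. (\<forall>k\<in>S. stft \<phi> f (lattice_point k) = a k) \<and>
      modulation_qnorm \<phi> p2 q2 m2 (distribution_of f)
      \<le> ennreal D2 * seq_qnorm p2 q2 (m2 \<circ> lattice_point) (\<lambda>k. if k \<in> S then a k else 0)"
    by (rule stft_interpolation[OF \<phi> pos(2,4) m(3)]) (rule that)
  obtain E :: real where E: "0 < E" "\<And>f g. f \<in> schwartz \<Longrightarrow> g \<in> schwartz \<Longrightarrow>
    modulation_qnorm \<Phi> p q ?M (distribution_of (?W f g))
      \<le> ennreal E * modulation_qnorm \<phi> p1 q1 m1 (distribution_of f) * modulation_qnorm \<phi> p2 q2 m2 (distribution_of g)"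
    using bdd unfolding tau_wigner_bounded_def by blast
  have C0: "0 < C0" using m(1) by (simp add: poly_moderate_def)
  \<comment> \<open>The chosen point differs from a point of its cell by at most \<open>?R\<close>
    in \<open>\<zeta>\<close> and 3 \<open>?R\<close> in z: one from rounding and two from the
    shear, which at most doubles norms. Hence the factor with 4 \<open>?R\<close>.\<close>
  define D where "D = B / c * (1 + 4 * ?R) powr K * (C0 * (1 + ?R) powr s0)"
  have D: "0 < D" using B c C0 by (simp add: D_def add_pos_nonneg)
  have m0: "0 \<le> m z" for z by (rule poly_moderateD(2)[OF m(1)])
  show ?thesis
  proof (rule that[of "D * A * E * D1 * D2" "max N1 N2"])
    show "0 < D * A * E * D1 * D2" using D A(1) E(1) D1(1) D2(1) by simp
    fix S T and a b :: "(int ^ 'd) \<times> (int ^ 'd) \<Rightarrow> complex"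
    assume fin: "finite S" "finite T"
      and sepS: "separated (max N1 N2) S"
      and sepT: "separated (max N1 N2) T"
      and supp: "\<forall>k. k \<notin> S \<longrightarrow> a k = 0" "\<forall>k. k \<notin> T \<longrightarrow> b k = 0"
    have a0: "a k = 0" if "k \<notin> S" for k using supp(1) that by blast
    have b0: "b k = 0" if "k \<notin> T" for k using supp(2) that by blast
    have "\<exists>f\<in>schwartz. (\<forall>k\<in>S. stft \<phi> f (lattice_point k) = a k) \<and>
      modulation_qnorm \<phi> p1 q1 m1 (distribution_of f)
      \<le> ennreal D1 * seq_qnorm p1 q1 (m1 \<circ> lattice_point) (\<lambda>k. if k \<in> S then a k else 0)"
      using sepS by (intro D1(2)[OF fin(1)]) (auto simp: pairwise_def)
    moreover have "(\<lambda>k. if k \<in> S then a k else 0) = a" using a0 by auto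
    ultimately obtain f where f: "f \<in> schwartz" "\<And>k. k \<in> S \<Longrightarrow> stft \<phi> f (lattice_point k) = a k"
      "modulation_qnorm \<phi> p1 q1 m1 (distribution_of f) \<le> ennreal D1 * seq_qnorm p1 q1 (m1 \<circ> lattice_point) a"
      by auto
    \<comment> \<open>The transform of g is met at -(n - k), so the values of b are prescribed at
      the reflected points.\<close>
    have "\<exists>g\<in>schwartz. (\<forall>k\<in>uminus ` T. stft \<phi> g (lattice_point k) = b (- k)) \<and>
      modulation_qnorm \<phi> p2 q2 m2 (distribution_of g)
      \<le> ennreal D2 * seq_qnorm p2 q2 (m2 \<circ> lattice_point) (\<lambda>k. if k \<in> uminus ` T then b (- k) else 0)"
    proof (rule D2(2)[of "uminus ` T" "\<lambda>k. b (- k)"])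
      show "separated N2 (uminus ` T)"
        using sepT by (auto simp: pairwise_def lattice_point_minus norm_minus_commute)
    qed (use fin in auto)
    moreover have "(\<lambda>k. if k \<in> uminus ` T then b (- k) else 0) = (\<lambda>k. b (- k))"
    proof (rule ext)
      fix k show "(if k \<in> uminus ` T then b (- k) else 0) = b (- k)"
        using image_eqI[of k uminus "- k" T] b0[of "- k"] by auto
    qed
    moreover have "seq_qnorm p2 q2 (m2 \<circ> lattice_point) (\<lambda>k. b (- k)) = seq_qnorm p2 q2 (reflect_weight m2 \<circ> lattice_point) b"
      using mixed_qnorm_count_uminus[of p2 q2 "\<lambda>k. ennreal (norm (b k) * m2 (lattice_point (- k)))"]
      by (simp add: seq_qnorm_def reflect_weight_def lattice_point_minus)
    ultimately obtain g where g: "g \<in> schwartz" "\<And>k. k \<in> T \<Longrightarrow> stft \<phi> g (lattice_point (- k)) = b k"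
      "modulation_qnorm \<phi> p2 q2 m2 (distribution_of g) \<le> ennreal D2 * seq_qnorm p2 q2 (reflect_weight m2 \<circ> lattice_point) b"
      by auto
    have W: "?W f g \<in> schwartz" by (rule schwartz_tau_wigner[OF f(1) g(1)])
    note P0 = stft_peetre_nonneg[OF W \<Phi>(1) K]
    have s1: "seq_qnorm p q (one_tensor (J_weight m \<circ> lattice_point)) (\<lambda>(k, n). a k * b (n - k))
      \<le> ennreal D * mixed_qnorm p q lborel lborel (\<lambda>z. ennreal (stft_peetre K \<Phi> (?W f g) z * ?M z))"
      unfolding seq_qnorm_def mixed_qnorm_sheared_lattice[where \<tau> = \<tau>, symmetric]
    proof (rule mixed_qnorm_le_cmult[OF _ D pos(5,6)])
      fix x :: "((real ^ 'd) \<times> (real ^ 'd)) \<times> ((real ^ 'd) \<times> (real ^ 'd))"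
      obtain z \<zeta> where x: "x = (z, \<zeta>)" by (cases x)
      define k where "k = lattice_floor (z + wshift \<tau> \<zeta>)"
      define n where "n = lattice_floor (- rot \<zeta>)"
      \<comment> \<open>The pair (z', \<zeta>') is the exact preimage of the lattice data: the
        arguments of the two transforms there are k and k - n.\<close>
      define \<zeta>' where "\<zeta>' = rot (lattice_point n)"
      define z' where "z' = lattice_point k - wshift \<tau> \<zeta>'"
      have r: "rot \<zeta>' = - lattice_point n" by (simp add: \<zeta>'_def)
      have d1: "norm (\<zeta>' - \<zeta>) \<le> ?R"
      proof -
        have "norm (\<zeta>' - \<zeta>) = norm (rot (- rot \<zeta> - lattice_point n))"
          unfolding rot_diff rot_minus by (simp add: \<zeta>'_def norm_minus_commute del: norm_rot)
        then show ?thesis using norm_minus_lattice_point[of "- rot \<zeta>"] by (simp add: n_def)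
      qed
      have d2: "norm (z' - z) \<le> 3 * ?R"
      proof -
        have "z' - z = - ((z + wshift \<tau> \<zeta>) - lattice_point k) - wshift \<tau> (\<zeta>' - \<zeta>)"
          unfolding z'_def wshift_diff by simp
        also have "norm \<dots> \<le> ?R + 2 * norm (\<zeta>' - \<zeta>)"
          using norm_triangle_ineq4[of "- ((z + wshift \<tau> \<zeta>) - lattice_point k)" "wshift \<tau> (\<zeta>' - \<zeta>)"]
            norm_minus_lattice_point[of "z + wshift \<tau> \<zeta>"] norm_wshift[OF \<tau>, of "\<zeta>' - \<zeta>"]
          unfolding k_def norm_minus_cancel by linarith
        also have "\<dots> \<le> 3 * ?R" using d1 by simp
        finally show ?thesis .
      qed
      have d: "norm ((z', \<zeta>') - (z, \<zeta>)) \<le> 4 * ?R"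
        using norm_Pair_le[of "z' - z" "\<zeta>' - \<zeta>"] d1 d2 by simp
      \<comment> \<open>Values are prescribed only on S and on the reflection of T; off these sets
        the product on the left is zero.\<close>
      have "norm (a k * b (n - k)) \<le> norm (stft \<Phi>1 (?W f g) (z', \<zeta>')) / c"
      proof (cases "k \<in> S \<and> n - k \<in> T")
        case True
        have e: "z' + wshift \<tau> \<zeta>' = lattice_point k" "z' + wshift \<tau> \<zeta>' + rot \<zeta>' = lattice_point (- (n - k))"
          by (simp_all add: z'_def r lattice_point_diff)
        show ?thesis using c(1) True unfolding c(2)[OF f(1) g(1)] e(2) unfolding e(1)
          by (simp add: f(2) g(2)[of "n - k", simplified] norm_mult)
      next
        case False
        then have "norm (a k * b (n - k)) = 0" using a0[of k] b0[of "n - k"] by auto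
        then show ?thesis using divide_nonneg_pos[OF norm_ge_zero c(1)] by (simp only:)
      qed
      also have "\<dots> \<le> (B * ((1 + 4 * ?R) powr K * stft_peetre K \<Phi> (?W f g) (z, \<zeta>))) / c"
      proof (rule divide_right_mono)
        have "norm (stft \<Phi>1 (?W f g) (z', \<zeta>')) \<le> stft_peetre K \<Phi>1 (?W f g) (z', \<zeta>')"
          by (rule stft_peetre_ge[OF W \<Phi>1 K])
        also have "\<dots> \<le> B * stft_peetre K \<Phi> (?W f g) (z', \<zeta>')" by (rule B(2)[OF W])
        also have "\<dots> \<le> B * ((1 + 4 * ?R) powr K * stft_peetre K \<Phi> (?W f g) (z, \<zeta>))"
          using B(1) by (intro mult_left_mono stft_peetre_close[OF W \<Phi>(1) K d]) auto
        finally show "norm (stft \<Phi>1 (?W f g) (z', \<zeta>')) \<le> B * ((1 + 4 * ?R) powr K * stft_peetre K \<Phi> (?W f g) (z, \<zeta>))" .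
      qed (use c in simp)
      finally have "norm (a k * b (n - k)) * m \<zeta>'
        \<le> (B * ((1 + 4 * ?R) powr K * stft_peetre K \<Phi> (?W f g) (z, \<zeta>))) / c * (C0 * (1 + ?R) powr s0 * m \<zeta>)"
        using B c P0 m0 by (intro mult_mono poly_moderate_close[OF m(1) d1]) auto
      also have "\<dots> = D * (stft_peetre K \<Phi> (?W f g) (z, \<zeta>) * m \<zeta>)"
        by (simp add: D_def)
      finally have "norm (a k * b (n - k)) * m \<zeta>' \<le> D * (stft_peetre K \<Phi> (?W f g) (z, \<zeta>) * m \<zeta>)" .
      then show "(case x of (z, \<zeta>) \<Rightarrow> ennreal (norm ((\<lambda>(k, n). a k * b (n - k)) (lattice_floor (z + wshift \<tau> \<zeta>), lattice_floor (- rot \<zeta>)))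
           * one_tensor (J_weight m \<circ> lattice_point) (lattice_floor (z + wshift \<tau> \<zeta>), lattice_floor (- rot \<zeta>))))
        \<le> ennreal D * ennreal (stft_peetre K \<Phi> (?W f g) x * ?M x)"
        using D by (simp add: x one_tensor_def k_def[symmetric] n_def[symmetric] J_weight_eq_rot \<zeta>'_def ennreal_leI flip: ennreal_mult')
    qed
    note s1
    also have "ennreal D * mixed_qnorm p q lborel lborel (\<lambda>z. ennreal (stft_peetre K \<Phi> (?W f g) z * ?M z))
      \<le> ennreal D * (ennreal A * (ennreal E * (ennreal D1 * seq_qnorm p1 q1 (m1 \<circ> lattice_point) a)
          * (ennreal D2 * seq_qnorm p2 q2 (reflect_weight m2 \<circ> lattice_point) b)))"
      by (intro mult_left_mono order_trans[OF A(2)[OF W]] order_trans[OF E(2)[OF f(1) g(1)]] mult_mono f(3) g(3)) auto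
    also have "\<dots> = ennreal (D * A * E * D1 * D2) * seq_qnorm p1 q1 (m1 \<circ> lattice_point) a
          * seq_qnorm p2 q2 (reflect_weight m2 \<circ> lattice_point) b"
      using D A(1) E(1) D1(1) D2(1) by (simp add: ennreal_mult ac_simps)
    finally show "seq_qnorm p q (one_tensor (J_weight m \<circ> lattice_point)) (\<lambda>(k, n). a k * b (n - k))
       \<le> ennreal (D * A * E * D1 * D2) * seq_qnorm p1 q1 (m1 \<circ> lattice_point) a * seq_qnorm p2 q2 (reflect_weight m2 \<circ> lattice_point) b" .
  qed
qed

theorem bounded_imp_lattice_estimate:
  fixes \<phi> :: "real ^ 'd \<Rightarrow> complex"
  assumes pos: "0 < p1" "0 < p2" "0 < q1" "0 < q2" "0 < p" "0 < q"
    and \<tau>: "0 \<le> \<tau>" "\<tau> \<le> 1"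
    and m: "poly_moderate C0 s0 m" "poly_moderate C1 s1 m1" "poly_moderate C2 s2 m2"
    and \<phi>: "\<phi> \<in> schwartz" "\<phi> \<noteq> (\<lambda>_. 0)"
    and \<Phi>: "\<Phi> \<in> schwartz" "\<Phi> \<noteq> (\<lambda>_. 0)"
    and bdd: "tau_wigner_bounded \<phi> \<Phi> \<tau> p1 q1 m1 p2 q2 m2 p q (one_tensor m)"
  shows "lattice_estimate p1 q1 m1 p2 q2 m2 p q m"
proof -
  let ?w = "one_tensor (J_weight m \<circ> lattice_point) :: ((int ^ 'd) \<times> (int ^ 'd)) \<times> ((int ^ 'd) \<times> (int ^ 'd)) \<Rightarrow> real"
  let ?w1 = "m1 \<circ> lattice_point" and ?w2 = "reflect_weight m2 \<circ> lattice_point"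
  obtain N C :: real where C: "0 < C" "\<And>S T (a :: (int ^ 'd) \<times> (int ^ 'd) \<Rightarrow> complex) b. finite S \<Longrightarrow> finite T \<Longrightarrow>
    separated N S \<Longrightarrow>
    separated N T \<Longrightarrow>
    \<forall>k. k \<notin> S \<longrightarrow> a k = 0 \<Longrightarrow> \<forall>k. k \<notin> T \<longrightarrow> b k = 0 \<Longrightarrow>
    seq_qnorm p q ?w (\<lambda>(k, n). a k * b (n - k)) \<le> ennreal C * seq_qnorm p1 q1 ?w1 a * seq_qnorm p2 q2 ?w2 b"
    by (rule bounded_imp_separated_lattice_estimate[OF pos \<tau> m \<phi> \<Phi> bdd]) (rule that)
  obtain I and col :: "(int ^ 'd) \<times> (int ^ 'd) \<Rightarrow> (int ^ 'd) \<times> (int ^ 'd)" where I: "finite I" "\<And>k. col k \<in> I"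
    "\<And>j k. col j = col k \<Longrightarrow> j \<noteq> k \<Longrightarrow> N \<le> norm (lattice_point j - lattice_point k)"
    using lattice_colouring[of N] by blast
  have "finite (I \<times> I)" using I(1) by simp
  from mixed_qnorm_count_sum[OF pos(5,6) this] obtain Q :: real where Q: "0 < Q"
    "\<And>F :: _ \<Rightarrow> ((int ^ 'd) \<times> (int ^ 'd)) \<times> ((int ^ 'd) \<times> (int ^ 'd)) \<Rightarrow> ennreal.
    mixed_qnorm p q (count_space UNIV) (count_space UNIV) (\<lambda>z. \<Sum>i\<in>I \<times> I. F i z)
    \<le> ennreal Q * (\<Sum>i\<in>I \<times> I. mixed_qnorm p q (count_space UNIV) (count_space UNIV) (F i))"
    by blast
  have w0: "0 \<le> ?w1 k" "0 \<le> ?w2 k" for k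
    using poly_moderateD(2)[OF m(2)] poly_moderateD(2)[OF m(3)] by (simp_all add: reflect_weight_def)
  \<comment> \<open>The number of pairs of colours; the + 1 makes positivity of the final constant
    immediate.\<close>
  define n where "n = card (I \<times> I) + 1"
  have main: "seq_qnorm p q ?w (\<lambda>(k, n). a k * b (n - k)) \<le> ennreal (Q * n * C) * seq_qnorm p1 q1 ?w1 a * seq_qnorm p2 q2 ?w2 b"
    if fin: "finite {k. a k \<noteq> 0}" "finite {k. b k \<noteq> 0}" for a b
  proof -
    define r where "r u c k = (if col k = u then c k else 0 :: complex)" for u c k
    let ?X = "ennreal C * seq_qnorm p1 q1 ?w1 a * seq_qnorm p2 q2 ?w2 b"
    let ?F = "\<lambda>i z. ennreal (norm (case z of (k, n) \<Rightarrow> r (fst i) a k * r (snd i) b (n - k)) * ?w z)"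
    have F: "mixed_qnorm p q (count_space UNIV) (count_space UNIV) (?F i) \<le> ?X" for i
    proof -
      let ?u = "fst i" and ?v = "snd i"
      have "seq_qnorm p q ?w (\<lambda>(k, n). r ?u a k * r ?v b (n - k)) \<le> ennreal C * seq_qnorm p1 q1 ?w1 (r ?u a) * seq_qnorm p2 q2 ?w2 (r ?v b)"
        by (rule C(2)[of "{k. a k \<noteq> 0 \<and> col k = ?u}" "{k. b k \<noteq> 0 \<and> col k = ?v}"])
           (use fin I(3) in \<open>auto simp: r_def pairwise_def\<close>)
      also have "\<dots> \<le> ?X"
        by (intro mult_mono seq_qnorm_mono w0 pos) (auto simp: r_def)
      finally show ?thesis by (simp add: seq_qnorm_def)
    qed
    have "seq_qnorm p q ?w (\<lambda>(k, n). a k * b (n - k)) \<le> mixed_qnorm p q (count_space UNIV) (count_space UNIV) (\<lambda>z. \<Sum>i\<in>I \<times> I. ?F i z)"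
      unfolding seq_qnorm_def
    proof (rule mixed_qnorm_mono[OF _ pos(5,6)])
      fix z :: "((int ^ 'd) \<times> (int ^ 'd)) \<times> ((int ^ 'd) \<times> (int ^ 'd))"
      obtain k n where z: "z = (k, n)" by (cases z)
      have "ennreal (norm (case z of (k, n) \<Rightarrow> a k * b (n - k)) * ?w z) = ?F (col k, col (n - k)) z"
        by (simp add: z r_def)
      also have "\<dots> \<le> (\<Sum>i\<in>I \<times> I. ?F i z)"
        using I by (intro member_le_sum) auto
      finally show "ennreal (norm (case z of (k, n) \<Rightarrow> a k * b (n - k)) * ?w z) \<le> (\<Sum>i\<in>I \<times> I. ?F i z)" .
    qed
    also have "\<dots> \<le> ennreal Q * (\<Sum>i\<in>I \<times> I. ?X)"
      by (rule order_trans[OF Q(2)], intro mult_left_mono sum_mono F) auto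
    also have "\<dots> \<le> ennreal Q * (ennreal (real n) * ?X)"
      unfolding sum_constant n_def by (intro mult_left_mono mult_right_mono) (auto simp: ennreal_of_nat_eq_real_of_nat intro!: ennreal_leI)
    also have "\<dots> = ennreal (Q * n * C) * seq_qnorm p1 q1 ?w1 a * seq_qnorm p2 q2 ?w2 b"
      using Q(1) C(1) by (simp add: ennreal_mult mult.assoc)
    finally show ?thesis .
  qed
  have "0 < Q * n * C" using Q C by (simp add: n_def)
  then show ?thesis using bilinear_estimate_finite_support[OF pos w0 main] by blast
qed

section \<open>Passage to the convolution inclusion\<close>

section \<open>The convolution inclusion\<close>

text \<open>At exponent infinity a positive power is an order isomorphism of [0, \<infinity>], so it
  commutes with the essential supremum; there the division gives infinity over p, again
  infinity.\<close>

lemma Lp_qnorm_powr: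
  assumes p: "0 < p" "p < top" and p1: "0 < p1"
  shows "Lp_qnorm (p1 / p) M (\<lambda>x. ennreal_powr (F x) (enn2real p)) = ennreal_powr (Lp_qnorm p1 M F) (enn2real p)"
proof -
  have P: "0 < enn2real p" using p by (intro enn2real_pos) auto
  show ?thesis
  proof (cases "p1 = top")
    case True
    have swap: "ennreal_powr x (enn2real p) \<le> y \<longleftrightarrow> x \<le> ennreal_powr y (1 / enn2real p)" for x y
      using P ennreal_powr_le_swap[of "1 / enn2real p" x y] by simp
    have "Lp_qnorm top M (\<lambda>x. ennreal_powr (F x) (enn2real p)) \<le> c \<longleftrightarrow> ennreal_powr (Lp_qnorm top M F) (enn2real p) \<le> c" for c
      by (simp add: Lp_qnorm_top_le_iff swap)
    then have "Lp_qnorm top M (\<lambda>x. ennreal_powr (F x) (enn2real p)) = ennreal_powr (Lp_qnorm top M F) (enn2real p)"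
      by (meson antisym order_refl)
    then show ?thesis using p by (auto simp: True ennreal_top_divide)
  next
    case False
    have P1: "0 < enn2real p1" using p1 False by (intro enn2real_pos)
    have e: "p1 / p = ennreal (enn2real p1 / enn2real p)"
      using P P1 p False by (simp add: less_top flip: divide_ennreal)
    have "p1 / p \<noteq> top" "enn2real (p1 / p) = enn2real p1 / enn2real p" using P P1 by (simp_all add: e)
    then show ?thesis using False P P1 by (simp add: Lp_qnorm_def ennreal_powr_powr)
  qed
qed

lemma mixed_qnorm_powr:
  assumes "0 < p" "p < top" "0 < p1" "0 < q1"
  shows "mixed_qnorm (p1 / p) (q1 / p) M N (\<lambda>z. ennreal_powr (F z) (enn2real p))
    = ennreal_powr (mixed_qnorm p1 q1 M N F) (enn2real p)"
  using assms by (simp add: mixed_qnorm_def Lp_qnorm_powr)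

text \<open>The outer quasi-norm of the lattice estimate runs over n as a single index, whereas the
  target of the convolution is a mixed space; with equal exponents the two agree.\<close>

lemma Lp_qnorm_count_Pair:
  fixes H :: "'k \<times> 'n \<Rightarrow> ennreal"
  assumes q: "0 < q"
  shows "Lp_qnorm q (count_space UNIV) H = mixed_qnorm q q (count_space UNIV) (count_space UNIV) H"
proof (cases "q = top")
  case True
  have "Lp_qnorm top (count_space UNIV) H \<le> c \<longleftrightarrow> mixed_qnorm top top (count_space UNIV) (count_space UNIV) H \<le> c" for c
    by (auto simp: mixed_qnorm_def Lp_qnorm_top_le_iff AE_count_space)
  then show ?thesis unfolding True by (meson antisym order_refl)
next
  case False
  have "enn2real q \<noteq> 0" using enn2real_pos[OF q False] by simp
  then show ?thesis using False
    by (simp add: Lp_qnorm_def mixed_qnorm_def ennreal_powr_inverse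
        nn_integral_snd_count_space[of "\<lambda>z. ennreal_powr (H z) (enn2real q)"])
qed

lemma le_mixed_qnorm_count:
  fixes H :: "'k \<times> 'n \<Rightarrow> ennreal"
  assumes "0 < p" "0 < q"
  shows "H z \<le> mixed_qnorm p q (count_space UNIV) (count_space UNIV) H"
proof -
  have Lp: "F k \<le> Lp_qnorm p (count_space UNIV) F" if p: "0 < p" for p k and F :: "'z \<Rightarrow> ennreal"
  proof (cases "p = top")
    case True
    then show ?thesis using AE_le_Lp_qnorm_top[of F "count_space UNIV"] by (simp add: AE_count_space)
  next
    case False
    note P = enn2real_pos[OF p False]
    have "ennreal_powr (F k) (enn2real p) \<le> (\<integral>\<^sup>+k. ennreal_powr (F k) (enn2real p) \<partial>count_space UNIV)"
      by (rule nn_integral_ge_point) simp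
    from ennreal_powr_mono[OF this, of "1 / enn2real p"] show ?thesis
      using False P by (simp add: Lp_qnorm_def ennreal_powr_inverse)
  qed
  obtain k n where z: "z = (k, n)" by (cases z)
  show ?thesis
    unfolding z mixed_qnorm_def
    using order_trans[OF Lp[OF assms(1), of "\<lambda>k. H (k, n)" k] Lp[OF assms(2), of "\<lambda>n. Lp_qnorm p (count_space UNIV) (\<lambda>k. H (k, n))" n]] .
qed

text \<open>Convolution of moduli with values in [0, \<infinity>]: always defined, so absolute
  convergence becomes finiteness, and identities can precede any convergence question.\<close>

definition abs_conv :: "('k::ab_group_add \<Rightarrow> complex) \<Rightarrow> ('k \<Rightarrow> complex) \<Rightarrow> 'k \<Rightarrow> ennreal" where
  "abs_conv a b n = (\<integral>\<^sup>+k. ennreal (norm (a k * b (n - k))) \<partial>count_space UNIV)"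

lemma abs_conv_finite_imp_summable:
  assumes fin: "abs_conv a b n < \<infinity>"
  shows "(\<lambda>k. norm (a k * b (n - k))) summable_on UNIV"
    "ennreal (norm (\<Sum>\<^sub>\<infinity>k. a k * b (n - k))) \<le> abs_conv a b n"
proof -
  let ?f = "\<lambda>k. norm (a k * b (n - k))"
  have bound: "sum ?f X \<le> enn2real (abs_conv a b n)" if X: "finite X" for X
  proof -
    have "ennreal (sum ?f X) = (\<Sum>k\<in>X. ennreal (?f k))" by (rule sum_ennreal[symmetric]) simp
    also have "\<dots> = (\<integral>\<^sup>+k. (if k \<in> X then ennreal (?f k) else 0) \<partial>count_space UNIV)"
      by (subst nn_integral_count_space'[OF X]) auto
    also have "\<dots> \<le> abs_conv a b n" unfolding abs_conv_def by (intro nn_integral_mono) auto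
    finally have "enn2real (ennreal (sum ?f X)) \<le> enn2real (abs_conv a b n)"
      using fin by (intro enn2real_mono) auto
    then show ?thesis by (simp add: sum_nonneg)
  qed
  show s: "?f summable_on UNIV"
    by (rule nonneg_bounded_partial_sums_imp_summable_on[where C = "enn2real (abs_conv a b n)"])
       (auto simp: bound intro!: eventually_finite_subsets_at_top_weakI)
  have "norm (\<Sum>\<^sub>\<infinity>k. a k * b (n - k)) \<le> infsum ?f UNIV" using s by (rule norm_infsum_bound)
  also have "\<dots> \<le> enn2real (abs_conv a b n)" by (rule infsum_le_finite_sums[OF s bound])
  finally have "ennreal (norm (\<Sum>\<^sub>\<infinity>k. a k * b (n - k))) \<le> ennreal (enn2real (abs_conv a b n))" by (rule ennreal_leI)
  then show "ennreal (norm (\<Sum>\<^sub>\<infinity>k. a k * b (n - k))) \<le> abs_conv a b n"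
    unfolding ennreal_enn2real[OF fin[unfolded infinity_ennreal_def]] .
qed

text \<open>The two conditions on values express that a and b are nonnegative, so that no
  cancellation occurs in the sum.\<close>

lemma abs_conv_finite_support:
  assumes fin: "finite {k. a k \<noteq> 0}" and a: "\<And>k. a k = of_real (norm (a k))" and b: "\<And>k. b k = of_real (norm (b k))"
  shows "abs_conv a b n = ennreal (norm (\<Sum>\<^sub>\<infinity>k. a k * b (n - k)))"
proof -
  let ?S = "{k. a k \<noteq> 0}"
  have "abs_conv a b n = (\<Sum>k\<in>?S. ennreal (norm (a k * b (n - k))))"
    unfolding abs_conv_def by (rule nn_integral_count_space'[OF fin]) auto
  also have "\<dots> = ennreal (\<Sum>k\<in>?S. norm (a k * b (n - k)))" by (rule sum_ennreal) simp
  also have "(\<Sum>k\<in>?S. norm (a k * b (n - k))) = norm (\<Sum>k\<in>?S. a k * b (n - k))"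
  proof -
    have ab: "a k * b (n - k) = of_real (norm (a k * b (n - k)))" for k
      using a[of k] b[of "n - k"] by (metis norm_mult of_real_mult)
    have eq: "(\<Sum>k\<in>?S. a k * b (n - k)) = of_real (\<Sum>k\<in>?S. norm (a k * b (n - k)))"
      unfolding of_real_sum by (rule sum.cong[OF refl ab])
    show ?thesis unfolding eq norm_of_real by (simp add: sum_nonneg)
  qed
  also have "(\<Sum>k\<in>?S. a k * b (n - k)) = (\<Sum>\<^sub>\<infinity>k. a k * b (n - k))"
    unfolding infsum_finite[OF fin, symmetric] by (rule infsum_cong_neutral) auto
  finally show ?thesis .
qed

abbreviation norm_powr :: "real \<Rightarrow> ('k \<Rightarrow> complex) \<Rightarrow> 'k \<Rightarrow> complex" where
  "norm_powr P a \<equiv> \<lambda>k. complex_of_real (norm (a k) powr P)"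

lemma seq_qnorm_powr:
  assumes p: "0 < p" "p < top" "0 < p1" "0 < q1" and w: "\<And>k. 0 \<le> w k"
  shows "seq_qnorm (p1 / p) (q1 / p) (\<lambda>k. w k powr enn2real p) (norm_powr (enn2real p) a)
    = ennreal_powr (seq_qnorm p1 q1 w a) (enn2real p)"
proof -
  have "ennreal (norm (norm_powr (enn2real p) a k) * w k powr enn2real p) = ennreal_powr (ennreal (norm (a k) * w k)) (enn2real p)" for k
    using w by (simp add: ennreal_powr_ennreal powr_mult)
  then show ?thesis unfolding seq_qnorm_def using mixed_qnorm_powr[OF p] by simp
qed

text \<open>The p-th power of the inner quasi-norm over k is a plain sum of products |a_k|^p
  |b_{n-k}|^p, that is, the convolution of the p-th powers at n.\<close>

lemma bilinear_qnorm_powr: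
  fixes a b :: "'k::ab_group_add \<times> 'n::ab_group_add \<Rightarrow> complex"
  assumes p: "0 < p" "p < top" and q: "0 < q" and w: "\<And>k. 0 \<le> w k"
  shows "ennreal_powr (seq_qnorm p q (one_tensor w) (\<lambda>(k, n). a k * b (n - k))) (enn2real p)
    = mixed_qnorm (q / p) (q / p) (count_space UNIV) (count_space UNIV)
        (\<lambda>n. abs_conv (norm_powr (enn2real p) a) (norm_powr (enn2real p) b) n * ennreal (w n powr enn2real p))"
proof -
  let ?P = "enn2real p"
  have P: "0 < ?P" using p by (intro enn2real_pos) auto
  have inner: "ennreal_powr (Lp_qnorm p (count_space UNIV) (\<lambda>k. ennreal (norm (a k * b (n - k)) * w n))) ?P
     = abs_conv (norm_powr ?P a) (norm_powr ?P b) n * ennreal (w n powr ?P)" for n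
  proof -
    have "ennreal_powr (Lp_qnorm p (count_space UNIV) (\<lambda>k. ennreal (norm (a k * b (n - k)) * w n))) ?P
      = (\<integral>\<^sup>+k. ennreal_powr (ennreal (norm (a k * b (n - k)) * w n)) ?P \<partial>count_space UNIV)"
      using p(2)[THEN less_imp_neq] P by (simp add: Lp_qnorm_def ennreal_powr_inverse)
    also have "\<dots> = (\<integral>\<^sup>+k. ennreal (norm (norm_powr ?P a k * norm_powr ?P b (n - k))) * ennreal (w n powr ?P) \<partial>count_space UNIV)"
      using w by (intro nn_integral_cong) (simp add: ennreal_powr_ennreal powr_mult norm_mult flip: ennreal_mult)
    finally show ?thesis by (simp add: abs_conv_def nn_integral_multc)
  qed
  have qp: "0 < q / p" using p q by (simp add: ennreal_zero_less_divide)
  have "ennreal_powr (seq_qnorm p q (one_tensor w) (\<lambda>(k, n). a k * b (n - k))) ?P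
    = Lp_qnorm (q / p) (count_space UNIV) (\<lambda>n. ennreal_powr (Lp_qnorm p (count_space UNIV) (\<lambda>k. ennreal (norm (a k * b (n - k)) * w n))) ?P)"
    by (simp add: Lp_qnorm_powr[OF p q] seq_qnorm_def mixed_qnorm_def one_tensor_def)
  then show ?thesis unfolding inner using Lp_qnorm_count_Pair[OF qp] by simp
qed

text \<open>Towards the inclusion, the estimate is applied to 1/p-th powers of the moduli.
  Conversely the inclusion speaks only of members of the spaces, so it is applied to p-th powers of
  finitely supported sequences, which always belong, and exhaustion does the rest.\<close>

theorem bilinear_estimate_iff_convolution_inclusion:
  fixes w w1 w2 :: "'k::{countable, ab_group_add} \<times> 'n::{countable, ab_group_add} \<Rightarrow> real"
  assumes pos: "0 < p1" "0 < p2" "0 < q1" "0 < q2" "0 < p" "0 < q" and p: "p < top"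
    and w: "\<And>k. 0 < w k" "\<And>k. 0 \<le> w1 k" "\<And>k. 0 \<le> w2 k"
  shows "(\<exists>C::real. 0 < C \<and> (\<forall>a b. seq_qnorm p q (one_tensor w) (\<lambda>(k, n). a k * b (n - k))
            \<le> ennreal C * seq_qnorm p1 q1 w1 a * seq_qnorm p2 q2 w2 b)) \<longleftrightarrow>
         convolution_inclusion (p1 / p) (q1 / p) (\<lambda>k. w1 k powr enn2real p)
            (p2 / p) (q2 / p) (\<lambda>k. w2 k powr enn2real p) (q / p) (q / p) (\<lambda>k. w k powr enn2real p)"
    (is "?L \<longleftrightarrow> ?R")
proof
  let ?P = "enn2real p"
  have P: "0 < ?P" using p pos by (intro enn2real_pos) auto
  have qp: "0 < q / p" using p pos by (simp add: ennreal_zero_less_divide)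
  let ?N = "mixed_qnorm (q / p) (q / p) (count_space UNIV) (count_space UNIV) :: ('k \<times> 'n \<Rightarrow> ennreal) \<Rightarrow> ennreal"
  let ?N1 = "seq_qnorm (p1 / p) (q1 / p) (\<lambda>k. w1 k powr ?P)"
  let ?N2 = "seq_qnorm (p2 / p) (q2 / p) (\<lambda>k. w2 k powr ?P)"
  {
    assume ?L
    then obtain C :: real where C: "0 < C" "\<And>a b. seq_qnorm p q (one_tensor w) (\<lambda>(k, n). a k * b (n - k))
        \<le> ennreal C * seq_qnorm p1 q1 w1 a * seq_qnorm p2 q2 w2 b" by blast
    have est: "?N (\<lambda>n. abs_conv \<alpha> \<beta> n * ennreal (w n powr ?P)) \<le> ennreal (C powr ?P) * ?N1 \<alpha> * ?N2 \<beta>" for \<alpha> \<beta>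
    proof -
      let ?a = "norm_powr (1 / ?P) \<alpha>" and ?b = "norm_powr (1 / ?P) \<beta>"
      \<comment> \<open>The two powers cancel except for the phases, and both the quasi-norms and
        \<open>abs_conv\<close> see moduli only.\<close>
      have e: "norm_powr ?P (norm_powr (1 / ?P) c) = (\<lambda>k. of_real (norm (c k)))" for c :: "'k \<times> 'n \<Rightarrow> complex"
        using P by (simp add: powr_powr)
      have n: "seq_qnorm u v w' (\<lambda>k. of_real (norm (c k))) = seq_qnorm u v w' c" for u v w' and c :: "'k \<times> 'n \<Rightarrow> complex"
        by (simp add: seq_qnorm_def)
      have c: "abs_conv (\<lambda>k. of_real (norm (\<alpha> k))) (\<lambda>k. of_real (norm (\<beta> k))) = abs_conv \<alpha> \<beta>"
        by (simp add: abs_conv_def fun_eq_iff norm_mult)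
      have "?N (\<lambda>n. abs_conv \<alpha> \<beta> n * ennreal (w n powr ?P))
        = ennreal_powr (seq_qnorm p q (one_tensor w) (\<lambda>(k, n). ?a k * ?b (n - k))) ?P"
        using bilinear_qnorm_powr[OF pos(5) p pos(6) less_imp_le[OF w(1)], where a = ?a and b = ?b] unfolding e c by (rule sym)
      also have "\<dots> \<le> ennreal_powr (ennreal C * seq_qnorm p1 q1 w1 ?a * seq_qnorm p2 q2 w2 ?b) ?P"
        by (rule ennreal_powr_mono[OF C(2) P])
      also have "\<dots> = ennreal (C powr ?P) * ennreal_powr (seq_qnorm p1 q1 w1 ?a) ?P * ennreal_powr (seq_qnorm p2 q2 w2 ?b) ?P"
        using P C(1) by (simp add: ennreal_powr_mult ennreal_powr_ennreal)
      also have "\<dots> = ennreal (C powr ?P) * ?N1 \<alpha> * ?N2 \<beta>"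
        unfolding seq_qnorm_powr[OF pos(5) p pos(1,3) w(2), symmetric] seq_qnorm_powr[OF pos(5) p pos(2,4) w(3), symmetric] e n ..
      finally show ?thesis .
    qed
    show ?R
      unfolding convolution_inclusion_def
    proof (intro exI[of _ "C powr ?P"] conjI ballI allI)
      show "0 < C powr ?P" using C by simp
      fix \<alpha> \<beta> assume \<alpha>: "\<alpha> \<in> seq_space (p1 / p) (q1 / p) (\<lambda>k. w1 k powr ?P)" and \<beta>: "\<beta> \<in> seq_space (p2 / p) (q2 / p) (\<lambda>k. w2 k powr ?P)"
      \<comment> \<open>A single entry is at most the whole quasi-norm, and positivity of w at n
        then makes the unweighted entry finite.\<close>
      have fin: "abs_conv \<alpha> \<beta> n < \<infinity>" for n
      proof -
        have "abs_conv \<alpha> \<beta> n * ennreal (w n powr ?P) \<le> ?N (\<lambda>n. abs_conv \<alpha> \<beta> n * ennreal (w n powr ?P))"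
          using qp by (intro le_mixed_qnorm_count)
        also note est
        also have "ennreal (C powr ?P) * ?N1 \<alpha> * ?N2 \<beta> < top"
          using \<alpha> \<beta> by (simp add: seq_space_def ennreal_mult_less_top)
        finally show ?thesis using w(1)[of n] by (auto simp: ennreal_mult_less_top less_top[symmetric])
      qed
      show "(\<lambda>k. norm (\<alpha> k * \<beta> (n - k))) summable_on UNIV" for n
        by (rule abs_conv_finite_imp_summable(1)[OF fin])
      have "seq_qnorm (q / p) (q / p) (\<lambda>k. w k powr ?P) (\<lambda>n. \<Sum>\<^sub>\<infinity>k. \<alpha> k * \<beta> (n - k)) \<le> ?N (\<lambda>n. abs_conv \<alpha> \<beta> n * ennreal (w n powr ?P))"
        unfolding seq_qnorm_def
        by (rule mixed_qnorm_mono[OF _ qp qp])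
           (simp add: ennreal_mult mult_right_mono abs_conv_finite_imp_summable(2)[OF fin])
      also note est
      finally show "seq_qnorm (q / p) (q / p) (\<lambda>k. w k powr ?P) (\<lambda>n. \<Sum>\<^sub>\<infinity>k. \<alpha> k * \<beta> (n - k))
        \<le> ennreal (C powr ?P) * ?N1 \<alpha> * ?N2 \<beta>" .
    qed
  }
  {
    assume ?R
    then obtain C :: real where C: "0 < C" "\<And>\<alpha> \<beta>. \<alpha> \<in> seq_space (p1 / p) (q1 / p) (\<lambda>k. w1 k powr ?P) \<Longrightarrow>
        \<beta> \<in> seq_space (p2 / p) (q2 / p) (\<lambda>k. w2 k powr ?P) \<Longrightarrow>
        seq_qnorm (q / p) (q / p) (\<lambda>k. w k powr ?P) (\<lambda>n. \<Sum>\<^sub>\<infinity>k. \<alpha> k * \<beta> (n - k)) \<le> ennreal C * ?N1 \<alpha> * ?N2 \<beta>"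
      unfolding convolution_inclusion_def by blast
    have "seq_qnorm p q (one_tensor w) (\<lambda>(k, n). a k * b (n - k))
        \<le> ennreal (C powr (1 / ?P)) * seq_qnorm p1 q1 w1 a * seq_qnorm p2 q2 w2 b" for a b
    proof (rule bilinear_estimate_finite_support[OF pos w(2,3)])
      fix a b :: "'k \<times> 'n \<Rightarrow> complex"
      assume fin: "finite {k. a k \<noteq> 0}" "finite {k. b k \<noteq> 0}"
      let ?\<alpha> = "norm_powr ?P a" and ?\<beta> = "norm_powr ?P b"
      have fin': "finite {k. ?\<alpha> k \<noteq> 0}" "finite {k. ?\<beta> k \<noteq> 0}" using fin by simp_all
      have mem: "?\<alpha> \<in> seq_space (p1 / p) (q1 / p) (\<lambda>k. w1 k powr ?P)" "?\<beta> \<in> seq_space (p2 / p) (q2 / p) (\<lambda>k. w2 k powr ?P)"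
        unfolding seq_space_def using pos p
        by (intro CollectI seq_qnorm_finite_support fin'; simp add: ennreal_zero_less_divide)+
      have "ennreal_powr (seq_qnorm p q (one_tensor w) (\<lambda>(k, n). a k * b (n - k))) ?P
        = seq_qnorm (q / p) (q / p) (\<lambda>k. w k powr ?P) (\<lambda>n. \<Sum>\<^sub>\<infinity>k. ?\<alpha> k * ?\<beta> (n - k))"
      proof -
        have "abs_conv ?\<alpha> ?\<beta> n = ennreal (norm (\<Sum>\<^sub>\<infinity>k. ?\<alpha> k * ?\<beta> (n - k)))" for n
          by (rule abs_conv_finite_support[OF fin'(1)]) simp_all
        then show ?thesis
          using bilinear_qnorm_powr[OF pos(5) p pos(6) less_imp_le[OF w(1)], where a = a and b = b]
          unfolding seq_qnorm_def[of "q / p"] by (simp add: ennreal_mult)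
      qed
      also have "\<dots> \<le> ennreal C * ?N1 ?\<alpha> * ?N2 ?\<beta>" by (rule C(2)[OF mem])
      also have "\<dots> = ennreal_powr (ennreal (C powr (1 / ?P)) * seq_qnorm p1 q1 w1 a * seq_qnorm p2 q2 w2 b) ?P"
        unfolding seq_qnorm_powr[OF pos(5) p pos(1,3) w(2)] seq_qnorm_powr[OF pos(5) p pos(2,4) w(3)]
        using P C(1) by (simp add: ennreal_powr_mult ennreal_powr_ennreal powr_powr)
      finally show "seq_qnorm p q (one_tensor w) (\<lambda>(k, n). a k * b (n - k))
        \<le> ennreal (C powr (1 / ?P)) * seq_qnorm p1 q1 w1 a * seq_qnorm p2 q2 w2 b"
        using P by (simp add: ennreal_powr_le_iff)
    qed
    then show ?L using C(1) by (intro exI[of _ "C powr (1 / ?P)"]) auto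
  }
qed

theorem theorem1p1:
  fixes p1 p2 q1 q2 p q :: ennreal
    and \<tau> :: real
    and m m1 m2 :: "(real ^ 'd) \<times> (real ^ 'd) \<Rightarrow> real"
    and \<phi> :: "real ^ 'd \<Rightarrow> complex"
    and \<Phi> :: "(real ^ 'd) \<times> (real ^ 'd) \<Rightarrow> complex"
  assumes "0 < p1" "0 < p2" "0 < q1" "0 < q2" "0 < p" "0 < q"
    and "0 \<le> \<tau>" "\<tau> \<le> 1"
    and "m \<in> weights" "m1 \<in> weights" "m2 \<in> weights"
    and "\<phi> \<in> schwartz" "\<phi> \<noteq> (\<lambda>_. 0)"
    and "\<Phi> \<in> schwartz" "\<Phi> \<noteq> (\<lambda>_. 0)"
  shows "(tau_wigner_bounded \<phi> \<Phi> \<tau> p1 q1 m1 p2 q2 m2 p q (one_tensor m) \<longleftrightarrow>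
           (\<exists>C::real. 0 < C \<and> (\<forall>a b :: (int ^ 'd) \<times> (int ^ 'd) \<Rightarrow> complex.
              seq_qnorm p q (one_tensor (J_weight m \<circ> lattice_point)) (\<lambda>(k, n). a k * b (n - k))
              \<le> ennreal C * seq_qnorm p1 q1 (m1 \<circ> lattice_point) a
                          * seq_qnorm p2 q2 (reflect_weight m2 \<circ> lattice_point) b)))
       \<and> (p < \<infinity> \<and> (\<exists>z. m z \<noteq> 0) \<longrightarrow>
           (tau_wigner_bounded \<phi> \<Phi> \<tau> p1 q1 m1 p2 q2 m2 p q (one_tensor m) \<longleftrightarrow>
            convolution_inclusion
              (p1 / p) (q1 / p) ((\<lambda>z. m1 z powr enn2real p) \<circ> lattice_point)
              (p2 / p) (q2 / p) ((\<lambda>z. reflect_weight m2 z powr enn2real p) \<circ> lattice_point)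
              (q / p) (q / p) ((\<lambda>z. J_weight m z powr enn2real p) \<circ> lattice_point)))"
proof -
  note pos = assms(1-6) and \<tau> = assms(7,8) and \<phi> = assms(12,13) and \<Phi> = assms(14,15)
  obtain C0 s0 where m: "poly_moderate C0 s0 m" using weights_poly_moderate[OF assms(9)] .
  obtain C1 s1 where m1: "poly_moderate C1 s1 m1" using weights_poly_moderate[OF assms(10)] .
  obtain C2 s2 where m2: "poly_moderate C2 s2 m2" using weights_poly_moderate[OF assms(11)] .
  have first: "tau_wigner_bounded \<phi> \<Phi> \<tau> p1 q1 m1 p2 q2 m2 p q (one_tensor m) \<longleftrightarrow> lattice_estimate p1 q1 m1 p2 q2 m2 p q m"
    using lattice_estimate_imp_bounded[OF pos \<tau> m m1 m2 \<phi> \<Phi>] bounded_imp_lattice_estimate[OF pos \<tau> m m1 m2 \<phi> \<Phi>] by blast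
  have second: "lattice_estimate p1 q1 m1 p2 q2 m2 p q m \<longleftrightarrow>
       convolution_inclusion
         (p1 / p) (q1 / p) ((\<lambda>z. m1 z powr enn2real p) \<circ> lattice_point)
         (p2 / p) (q2 / p) ((\<lambda>z. reflect_weight m2 z powr enn2real p) \<circ> lattice_point)
         (q / p) (q / p) ((\<lambda>z. J_weight m z powr enn2real p) \<circ> lattice_point)"
    if p: "p < \<infinity>" and nz: "\<exists>z. m z \<noteq> 0"
  proof -
    obtain z0 where z0: "m z0 \<noteq> 0" using nz by blast
    \<comment> \<open>A moderate weight that vanishes at one point vanishes everywhere.\<close>
    have mpos: "0 < m z" for z
    proof (rule ccontr)
      assume "\<not> 0 < m z"
      then have "m z = 0" using poly_moderateD(2)[OF m, of z] by simp
      then have "m z0 \<le> 0" using poly_moderateD(1)[OF m, of z0 z] by simp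
      then show False using poly_moderateD(2)[OF m, of z0] z0 by simp
    qed
    show ?thesis unfolding comp_def
    proof (rule bilinear_estimate_iff_convolution_inclusion[OF pos])
      show "0 < J_weight m (lattice_point k)" for k using mpos by (simp add: J_weight_eq_rot)
      show "0 \<le> m1 (lattice_point k)" "0 \<le> reflect_weight m2 (lattice_point k)" for k
        using poly_moderateD(2)[OF m1] poly_moderateD(2)[OF m2] by (simp_all add: reflect_weight_def)
    qed (use p in simp)
  qed
  show ?thesis using first second by blast
qed

end
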